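(* Let $m,n$ be integers such that either $n\geq 3$ and $m\geq 2$, or $n\geq 2$ and $m\geq 3$. Let $a,b\in\mathbb{C}$ with $b\neq 0$ and $a\neq b$, and let $$Q(z)=\sum_{i=0}^{m}\sum_{j=0}^{n}\binom{m}{i}\binom{n}{j}\frac{(-1)^{i+j}}{n+m+1-i-j}\,z^{n+m+1-i-j}a^{j}b^{i},\qquad P(z)=Q(z)+c,$$ where $c\in\mathbb{C}$ satisfies $c\notin\left\{0,-Q(a),-Q(b),-\frac{Q(a)+Q(b)}{2}\right\}$. Let $S_1=\{a,b\}$ and $S_2=\{z\in\mathbb{C}: P(z)=0\}$. If two nonconstant meromorphic functions $f$ and $g$ on $\mathbb{C}$ share $S_1$ IM and share $S_2$ CM, then $f\equiv g$.
   Context: Meromorphic means meromorphic in the whole complex plane $\mathbb{C}$. For a non-empty set $S\subset\mathbb{C}\cup\{\infty\}$ and a meromorphic function $f$, put $E_f(S)=\bigcup_{\alpha\in S}\{z: f(z)-\alpha=0\}$, where a zero of $f-\alpha$ of multiplicity $k$ is counted $k$ times (so $E_f(S)$ is a set of points with multiplicities), and let $\overline{E}_f(S)$ denote the set of distinct elements of $E_f(S)$. Two meromorphic functions $f,g$ share the set $S$ CM (counting multiplicities) if $E_f(S)=E_g(S)$, and share $S$ IM (ignoring multiplicities) if $\overline{E}_f(S)=\overline{E}_g(S)$. In the formula for $Q$, the convention $0^0=1$ is used if $a=0$. *)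

theory Defs
  imports "HOL-Complex_Analysis.Complex_Analysis"
begin

text \<open>
  A meromorphic function on the plane is rendered as a total function
  \<^term>\<open>f :: complex \<Rightarrow> complex\<close> with \<^term>\<open>f nicely_meromorphic_on UNIV\<close>: it is
  holomorphic off its poles, and at a pole it carries the dummy value \<open>0\<close>.  Thus equality
  of meromorphic functions is equality of HOL functions, but poles have to be excluded when
  solving \<open>f z = \<alpha>\<close>, because the dummy value is not a value of the meromorphic function.
\<close>

definition zeros_minus :: "(complex \<Rightarrow> complex) \<Rightarrow> complex \<Rightarrow> complex set" where
  "zeros_minus f \<alpha> = {z. \<not> is_pole f z \<and> f z - \<alpha> = 0}"

text \<open>
  \<open>E_set f S\<close> is a set of points with multiplicities, encoded as the set of pairs of a point
  and its multiplicity; a point is a zero of \<open>f - \<alpha>\<close> for at most one \<open>\<alpha>\<close>, so it occurs in at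
  most one pair.  Only sets of finite values \<open>\<alpha>\<close> are covered.  The multiplicity
  \<^const>\<open>zorder\<close> is meaningful only if \<open>f\<close> is not identically \<open>\<alpha>\<close>.
\<close>

definition E_set :: "(complex \<Rightarrow> complex) \<Rightarrow> complex set \<Rightarrow> (complex \<times> int) set" where
  "E_set f S = (\<Union>\<alpha>\<in>S. {(z, zorder (\<lambda>w. f w - \<alpha>) z) | z. z \<in> zeros_minus f \<alpha>})"

definition E_bar :: "(complex \<Rightarrow> complex) \<Rightarrow> complex set \<Rightarrow> complex set" where
  "E_bar f S = fst ` E_set f S"

definition share_CM :: "(complex \<Rightarrow> complex) \<Rightarrow> (complex \<Rightarrow> complex) \<Rightarrow> complex set \<Rightarrow> bool" where
  "share_CM f g S \<longleftrightarrow> E_set f S = E_set g S"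

definition share_IM :: "(complex \<Rightarrow> complex) \<Rightarrow> (complex \<Rightarrow> complex) \<Rightarrow> complex set \<Rightarrow> bool" where
  "share_IM f g S \<longleftrightarrow> E_bar f S = E_bar g S"

definition Q_poly :: "nat \<Rightarrow> nat \<Rightarrow> complex \<Rightarrow> complex \<Rightarrow> complex \<Rightarrow> complex" where
  "Q_poly m n a b z =
     (\<Sum>i=0..m. \<Sum>j=0..n.
        of_nat (m choose i) * of_nat (n choose j) *
        ((-1) ^ (i + j) / of_nat (n + m + 1 - i - j)) *
        z ^ (n + m + 1 - i - j) * a ^ j * b ^ i)"

end

theory Submission
  imports Defs "HOL-Computational_Algebra.Fundamental_Theorem_Algebra"
begin

text \<open>
  Let \<open>p\<close> be the polynomial with values \<open>P\<close>.  Its derivative is \<open>(z - a)\<^sup>n (z - b)\<^sup>m\<close>, so \<open>a\<close>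
  and \<open>b\<close> are its only critical points, its degree is \<open>N = n + m + 1 \<ge> 6\<close>, and the hypotheses on
  \<open>c\<close> say that \<open>p a\<close>, \<open>p b\<close> and \<open>p a + p b\<close> do not vanish; in particular \<open>p\<close> has \<open>N\<close> simple
  zeros.  Moreover \<open>p a \<noteq> p b\<close>, because the difference is a nonzero multiple of a Beta integral.

  The proof is a piece of Nevanlinna theory, arranged so that neither counting functions nor
  exceptional sets of finite measure occur.  Write \<open>f = f1 / f2\<close> and \<open>g = g1 / g2\<close> with entire
  functions without common zeros, and \<open>\<mu> = max |f1| |f2| * max |g1| |g2|\<close>.  The mean of \<open>ln \<mu>\<close> over
  the circle of radius \<open>r\<close> plays the role of the sum of the two Nevanlinna characteristics; a
  function \<open>\<phi>\<close> is called small if the circle means of \<open>ln (1 + |\<phi>|)\<close> are logarithmic in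
  this quantity.  Three tools carry everything.
  \<^item> Logarithmic derivatives are small (\<open>small_log_deriv\<close>, and for quotients \<open>small_value\<close> and
    \<open>small_second\<close>).
  \<^item> For \<open>q\<close> distinct values \<open>x\<close>, the number \<open>max 1 |f| ^ (q - 1) * |f'|\<close> is at most a small
    function times the product of the \<open>|f - x|\<close> (\<open>second_main\<close>).  This is the second main
    theorem in pointwise form.
  \<^item> An entire \<open>\<Omega>\<close> that is not identically zero cannot satisfy \<open>|\<Omega>| * \<mu> ^ k \<le> |\<psi>|\<close> with
    \<open>\<psi>\<close> small and \<open>k \<ge> 1\<close> (\<open>key_contradiction\<close>), since the circle means of \<open>ln |\<Omega>|\<close> are
    bounded below and those of \<open>ln \<mu>\<close> tend to infinity.

  Most cases are excluded by writing down a product \<open>\<Omega>\<close> of logarithmic derivatives,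
  \<open>f'\<close>, and factors \<open>f - x\<close>, checking that its order is nonnegative at each point of the plane,
  and estimating it by the pointwise second main theorem.

  Let \<open>L\<^sub>f\<close> be the logarithmic derivative of \<open>p \<circ> f\<close> and \<open>H\<^sub>f\<close> that of the derivative of
  \<open>1 / (p \<circ> f)\<close>.  Sharing \<open>S2\<close> with multiplicities makes \<open>L\<^sub>f - L\<^sub>g\<close> regular at the zeros of \<open>p \<circ> f\<close>, and
  makes \<open>H\<^sub>f - H\<^sub>g\<close> vanish at the simple ones; sharing \<open>S1\<close> makes \<open>L\<^sub>f - L\<^sub>g\<close> vanish at least
  doubly at the points where \<open>f\<close> takes a value in \<open>{a, b}\<close>.  If neither difference vanished identically,
  \<open>\<Omega> = (H\<^sub>f - H\<^sub>g)\<^sup>2 (L\<^sub>f - L\<^sub>g)\<^sup>3 W\<^sub>f W\<^sub>g\<close> with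
  \<open>W\<^sub>f = f'\<^sup>2 / ((f - a)\<^sup>2 (f - b)\<^sup>2 (p \<circ> f) f2 ^ (N - 5))\<close> would be pole free and
  contradict the estimates with \<open>k = N - 5\<close> (\<open>auxiliary_alternative\<close>).  Integrating the remaining possibilities gives
  \<open>1 / p f = A / p g + B\<close> with constants \<open>A \<noteq> 0\<close> and \<open>B\<close>.

  If \<open>B \<noteq> 0\<close>, then \<open>f\<close> takes three different roots of \<open>p = 1 / B\<close> only at poles of \<open>g\<close>, where its
  multiplicity is a multiple of \<open>N\<close>; a nonconstant meromorphic function cannot do so
  (\<open>totally_ramified_values\<close>).  So \<open>p f = K * p g\<close>.  If \<open>K \<noteq> 1\<close>, then \<open>f\<close> and \<open>g\<close> cannot take the
  same value in \<open>{a, b}\<close> at a point, and since \<open>p a + p b \<noteq> 0\<close> the function \<open>g\<close> omits \<open>a\<close> or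
  \<open>b\<close>; this is refuted by \<open>no_relation_omitting\<close>.  If \<open>K = 1\<close>, then \<open>f\<close> and \<open>g\<close> share \<open>a\<close> and \<open>b\<close>
  separately, and \<open>(f - a) / (g - a)\<close> and \<open>(f - b) / (g - b)\<close> are entire without zeros; an
  analysis of their logarithmic derivatives (\<open>equal_relation\<close>) leaves only \<open>f = g\<close>.
\<close>

section \<open>Circle means\<close>

definition circle_mean :: "real \<Rightarrow> (complex \<Rightarrow> 'b::banach) \<Rightarrow> 'b" where
  "circle_mean r \<phi> = integral {0..1} (\<lambda>t. \<phi> (circlepath 0 r t))"

lemma circlepath_in_sphere: "0 \<le> r \<Longrightarrow> circlepath 0 r t \<in> sphere 0 r"
  by (simp add: circlepath norm_mult norm_exp_eq_Re)

lemma circle_mean_integrable: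
  fixes \<phi> :: "complex \<Rightarrow> 'b::banach"
  assumes "continuous_on (sphere 0 r) \<phi>" "0 \<le> r"
  shows "(\<lambda>t. \<phi> (circlepath 0 r t)) integrable_on {0..1::real}"
proof -
  have "continuous_on {0..1} (circlepath 0 r)"
    using path_circlepath[of 0 r] by (simp only: path_def)
  then have "continuous_on {0..1} (\<lambda>t. \<phi> (circlepath 0 r t))"
    by (rule continuous_on_compose2[OF assms(1)]) (use circlepath_in_sphere assms in blast)
  then show ?thesis by (rule integrable_continuous_real)
qed

lemma circle_mean_has_integral:
  assumes "continuous_on (sphere 0 r) \<phi>" "0 \<le> r"
  shows "((\<lambda>t. \<phi> (circlepath 0 r t)) has_integral circle_mean r \<phi>) {0..1::real}"
  using circle_mean_integrable[OF assms] unfolding circle_mean_def by (rule integrable_integral)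

lemma circle_mean_const [simp]: "circle_mean r (\<lambda>z. c) = c"
  by (simp add: circle_mean_def)

lemma circle_mean_add:
  assumes "continuous_on (sphere 0 r) \<phi>" "continuous_on (sphere 0 r) \<psi>" "0 \<le> r"
  shows "circle_mean r (\<lambda>z. \<phi> z + \<psi> z) = circle_mean r \<phi> + circle_mean r \<psi>"
  unfolding circle_mean_def using circle_mean_integrable assms by (intro integral_add) auto

lemma circle_mean_diff:
  assumes "continuous_on (sphere 0 r) \<phi>" "continuous_on (sphere 0 r) \<psi>" "0 \<le> r"
  shows "circle_mean r (\<lambda>z. \<phi> z - \<psi> z) = circle_mean r \<phi> - circle_mean r \<psi>"
  unfolding circle_mean_def using circle_mean_integrable assms by (intro integral_diff) auto

lemma circle_mean_cmult: "circle_mean r (\<lambda>z. c * \<phi> z) = c * circle_mean r (\<phi> :: complex \<Rightarrow> real)"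
  by (simp add: circle_mean_def)

lemma circle_mean_sum_list:
  fixes \<phi> :: "'a \<Rightarrow> complex \<Rightarrow> real"
  assumes "\<And>a. a \<in> set as \<Longrightarrow> continuous_on (sphere 0 r) (\<phi> a)" "0 \<le> r"
  shows "circle_mean r (\<lambda>z. \<Sum>a\<leftarrow>as. \<phi> a z) = (\<Sum>a\<leftarrow>as. circle_mean r (\<phi> a))
    \<and> continuous_on (sphere 0 r) (\<lambda>z. \<Sum>a\<leftarrow>as. \<phi> a z)"
  using assms by (induction as) (auto simp: circle_mean_add intro!: continuous_intros)

lemma circle_mean_mono:
  fixes \<phi> \<psi> :: "complex \<Rightarrow> real"
  assumes "continuous_on (sphere 0 r) \<phi>" "continuous_on (sphere 0 r) \<psi>" "0 \<le> r"
    and "\<And>z. norm z = r \<Longrightarrow> \<phi> z \<le> \<psi> z"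
  shows "circle_mean r \<phi> \<le> circle_mean r \<psi>"
  unfolding circle_mean_def
  using circle_mean_integrable assms circlepath_in_sphere[of r] by (intro integral_le) auto

lemma circle_mean_cong:
  assumes "0 \<le> r" "\<And>z. norm z = r \<Longrightarrow> \<phi> z = \<psi> z"
  shows "circle_mean r \<phi> = circle_mean r \<psi>"
  unfolding circle_mean_def
  using assms circlepath_in_sphere[of r] by (intro integral_cong) auto

lemma circle_mean_Re:
  assumes "continuous_on (sphere 0 r) \<phi>" "0 \<le> r"
  shows "circle_mean r (\<lambda>z. Re (\<phi> z)) = Re (circle_mean r \<phi>)"
  using has_integral_linear[OF circle_mean_has_integral[OF assms] bounded_linear_Re]
  by (simp add: circle_mean_def integral_unique o_def)

lemma circle_mean_cnj:
  assumes "continuous_on (sphere 0 r) \<phi>" "0 \<le> r"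
  shows "circle_mean r (\<lambda>z. cnj (\<phi> z)) = cnj (circle_mean r \<phi>)"
  using has_integral_linear[OF circle_mean_has_integral[OF assms] bounded_linear_cnj]
  by (simp add: circle_mean_def integral_unique o_def)

lemma circle_mean_contour:
  assumes "((\<lambda>u. \<phi> u / u) has_contour_integral (2 * of_real pi * \<i> * I)) (circlepath 0 r)" "0 < r"
  shows "circle_mean r \<phi> = I"
proof -
  have "((\<lambda>t. \<phi> (circlepath 0 r t) / circlepath 0 r t *
      vector_derivative (circlepath 0 r) (at t within {0..1})) has_integral (2 * of_real pi * \<i> * I)) {0..1}"
    using assms(1) unfolding has_contour_integral_def .
  then have "((\<lambda>t. (2 * of_real pi * \<i>) * \<phi> (circlepath 0 r t)) has_integral (2 * of_real pi * \<i> * I)) {0..1}"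
  proof (rule has_integral_eq[rotated])
    fix t :: real assume "t \<in> {0..1}"
    then show "\<phi> (circlepath 0 r t) / circlepath 0 r t *
      vector_derivative (circlepath 0 r) (at t within {0..1}) = (2 * of_real pi * \<i>) * \<phi> (circlepath 0 r t)"
      using assms(2) by (subst vector_derivative_circlepath01) (auto simp: circlepath)
  qed
  from has_integral_mult_right[OF this, of "1/(2 * of_real pi * \<i>)"]
  have "((\<lambda>t. \<phi> (circlepath 0 r t)) has_integral I) {0..1}"
    by simp
  then show ?thesis by (simp add: circle_mean_def integral_unique)
qed

lemma circle_mean_holomorphic:
  assumes "u holomorphic_on cball 0 r" "0 < r"
  shows "circle_mean r u = u 0"
  using Cauchy_integral_circlepath_simple[OF assms(1), of 0] assms(2)
  by (intro circle_mean_contour) auto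

text \<open>
  Differentiating the Poisson-Schwarz formula bounds the derivative by the real part alone.
  Applied to \<open>k = ln W\<close> with \<open>W\<close> zero free it bounds a logarithmic derivative by the mean of
  \<open>|ln |W||\<close>.
\<close>

lemma deriv_bound_Re_mean:
  assumes k: "k holomorphic_on cball 0 r" and z: "norm z < r"
  shows "norm (deriv k z) \<le> 2 * r / (r - norm z)\<^sup>2 * circle_mean r (\<lambda>w. \<bar>Re (k w)\<bar>)"
proof -
  have r: "0 < r" using z norm_ge_zero le_less_trans by blast
  have kc: "continuous_on (cball 0 r) k" using k holomorphic_on_imp_continuous_on by blast
  then have kcs: "continuous_on (sphere 0 r) k" by (rule continuous_on_subset) auto
  have kb: "k holomorphic_on ball 0 r" using k by (rule holomorphic_on_subset) auto
  have nez: "w - z \<noteq> 0" if "norm w = r" for w using that z by auto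
  have nez': "r\<^sup>2 - cnj z * w \<noteq> 0" if "norm w \<le> r" for w
  proof
    assume "r\<^sup>2 - cnj z * w = 0"
    then have "cnj z * w = complex_of_real (r\<^sup>2)" by simp
    then have "norm (cnj z * w) = r\<^sup>2" by (simp only: norm_of_real) simp
    moreover have "norm (cnj z * w) \<le> norm z * r" using that by (simp add: norm_mult mult_left_mono)
    moreover have "norm z * r < r\<^sup>2" using z r by (simp add: power2_eq_square)
    ultimately show False by simp
  qed
  have c1: "continuous_on (sphere 0 r) (\<lambda>w. k w * (w / (w - z)\<^sup>2))"
    using nez by (intro continuous_intros kcs) auto
  have c2: "continuous_on (sphere 0 r) (\<lambda>w. k w * r\<^sup>2 * w / (r\<^sup>2 - cnj z * w)\<^sup>2)"
    using nez' by (intro continuous_intros kcs) auto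
  have "((\<lambda>u. k u / (u - z) ^ Suc 1) has_contour_integral
          ((2 * pi * \<i>) / (fact 1) * (deriv ^^ 1) k z)) (circlepath 0 r)"
    by (rule Cauchy_has_contour_integral_higher_derivative_circlepath[OF kc kb]) (use z in auto)
  moreover have "k x / (x - z) ^ Suc 1 = (k x * (x / (x - z)\<^sup>2)) / x"
    if "x \<in> path_image (circlepath 0 r)" for x
    using r that by (auto simp: path_image_circlepath power2_eq_square)
  ultimately have "((\<lambda>u. (k u * (u / (u - z)\<^sup>2)) / u) has_contour_integral
          ((2 * pi * \<i>) / (fact 1) * (deriv ^^ 1) k z)) (circlepath 0 r)"
    by (rule has_contour_integral_eq)
  then have A: "circle_mean r (\<lambda>w. k w * (w / (w - z)\<^sup>2)) = deriv k z"
    using r by (intro circle_mean_contour) (auto simp: mult_ac)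
  \<comment> \<open>The reflected kernel is holomorphic in the disc and vanishes at \<open>0\<close>, so adding the conjugate
    of its mean changes nothing; on the circle it turns \<open>k\<close> in Cauchy's formula into \<open>2 * Re k\<close>.\<close>
  have "circle_mean r (\<lambda>w. k w * r\<^sup>2 * w / (r\<^sup>2 - cnj z * w)\<^sup>2) = 0"
    using nez' r by (subst circle_mean_holomorphic) (auto intro!: holomorphic_intros k)
  then have "circle_mean r (\<lambda>w. cnj (k w * r\<^sup>2 * w / (r\<^sup>2 - cnj z * w)\<^sup>2)) = 0"
    by (subst circle_mean_cnj[OF c2]) (use r in auto)
  moreover have "circle_mean r (\<lambda>w. cnj (k w * r\<^sup>2 * w / (r\<^sup>2 - cnj z * w)\<^sup>2))
     = circle_mean r (\<lambda>w. cnj (k w) * (w / (w - z)\<^sup>2))"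
  proof (rule circle_mean_cong)
    fix w :: complex assume w: "norm w = r"
    have w0: "w \<noteq> 0" using w r by auto
    have e: "cnj w = r\<^sup>2 / w" using w w0 complex_norm_square[of w] by (simp add: field_simps)
    have "cnj (r\<^sup>2 * w / (r\<^sup>2 - cnj z * w)\<^sup>2) = r\<^sup>2 * (r\<^sup>2/w) / (r\<^sup>2 - z * (r\<^sup>2/w))\<^sup>2"
      by (simp add: e)
    also have "r\<^sup>2 - z * (r\<^sup>2/w) = r\<^sup>2 * (w - z) / w" using w0 by (simp add: field_simps)
    also have "r\<^sup>2 * (r\<^sup>2/w) / (r\<^sup>2 * (w - z) / w)\<^sup>2 = w / (w - z)\<^sup>2"
    proof -
      have "R * (R / w) / (R * q / w)\<^sup>2 = w / q\<^sup>2" if "R \<noteq> 0" "q \<noteq> 0" for R q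
        using that w0 by (simp add: field_simps power2_eq_square)
      from this[of "r\<^sup>2" "w - z"] show ?thesis using r nez[OF w] by simp
    qed
    finally show "cnj (k w * r\<^sup>2 * w / (r\<^sup>2 - cnj z * w)\<^sup>2) = cnj (k w) * (w / (w - z)\<^sup>2)"
      by (metis (no_types, lifting) complex_cnj_mult mult.assoc times_divide_eq_right)
  qed (use r in auto)
  ultimately have B: "circle_mean r (\<lambda>w. cnj (k w) * (w / (w - z)\<^sup>2)) = 0" by simp
  have c3: "continuous_on (sphere 0 r) (\<lambda>w. cnj (k w) * (w / (w - z)\<^sup>2))"
    using nez by (intro continuous_intros kcs) auto
  have D: "deriv k z = circle_mean r (\<lambda>w. 2 * Re (k w) * (w / (w - z)\<^sup>2))"
  proof -
    have "deriv k z = circle_mean r (\<lambda>w. k w * (w / (w - z)\<^sup>2) + cnj (k w) * (w / (w - z)\<^sup>2))"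
      using A B by (subst circle_mean_add[OF c1 c3]) (use r in auto)
    also have "\<dots> = circle_mean r (\<lambda>w. 2 * Re (k w) * (w / (w - z)\<^sup>2))"
      by (rule circle_mean_cong) (use r in \<open>simp_all only: complex_add_cnj distrib_right[symmetric] less_imp_le\<close>)
    finally show ?thesis .
  qed
  have "norm (circle_mean r (\<lambda>w. 2 * Re (k w) * (w / (w - z)\<^sup>2)))
     \<le> circle_mean r (\<lambda>w. (2 * r / (r - norm z)\<^sup>2) * \<bar>Re (k w)\<bar>)"
    unfolding circle_mean_def
  proof (rule integral_norm_bound_integral)
    show "(\<lambda>t. 2 * Re (k (circlepath 0 r t)) * (circlepath 0 r t / (circlepath 0 r t - z)\<^sup>2))
        integrable_on {0..1}"
      by (rule circle_mean_integrable) (use nez r in \<open>auto intro!: continuous_intros kcs\<close>)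
    show "(\<lambda>t. 2 * r / (r - norm z)\<^sup>2 * \<bar>Re (k (circlepath 0 r t))\<bar>) integrable_on {0..1}"
      by (rule circle_mean_integrable) (use r z in \<open>auto intro!: continuous_intros kcs\<close>)
    fix t :: real assume "t \<in> {0..1}"
    define w where "w = circlepath 0 r t"
    have w: "norm w = r" using circlepath_in_sphere[of r t] r by (simp add: w_def)
    have "(r - norm z)\<^sup>2 \<le> (norm (w - z))\<^sup>2"
      using w z norm_triangle_ineq2[of w z] by (intro power_mono) auto
    then have "r / (norm (w - z))\<^sup>2 \<le> r / (r - norm z)\<^sup>2"
      using r z by (intro divide_left_mono) (auto intro!: mult_pos_pos simp: nez[OF w])
    then have "2 * \<bar>Re (k w)\<bar> * (r / (norm (w - z))\<^sup>2) \<le> 2 * \<bar>Re (k w)\<bar> * (r / (r - norm z)\<^sup>2)"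
      by (intro mult_left_mono) auto
    then have "norm (2 * Re (k w) * (w / (w - z)\<^sup>2)) \<le> 2 * r / (r - norm z)\<^sup>2 * \<bar>Re (k w)\<bar>"
      using w by (simp add: norm_mult norm_divide norm_power mult_ac)
    then show "norm (2 * Re (k (circlepath 0 r t)) * (circlepath 0 r t / (circlepath 0 r t - z)\<^sup>2))
      \<le> 2 * r / (r - norm z)\<^sup>2 * \<bar>Re (k (circlepath 0 r t))\<bar>" by (simp add: w_def)
  qed
  then show ?thesis unfolding D circle_mean_cmult .
qed

lemma zero_free_on_larger_ball:
  fixes w :: "complex \<Rightarrow> complex"
  assumes w: "continuous_on UNIV w" and nz: "\<And>z. norm z \<le> r \<Longrightarrow> w z \<noteq> 0" and r: "0 < r"
  obtains r' where "r < r'" "\<And>z. norm z < r' \<Longrightarrow> w z \<noteq> 0"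
proof -
  have "open {z. w z \<noteq> 0}" using w by (intro open_Collect_neq) auto
  moreover have "cball 0 r \<subseteq> {z. w z \<noteq> 0}" using nz by auto
  ultimately obtain e where e: "0 < e" "(\<Union>x\<in>cball 0 r. ball x e) \<subseteq> {z. w z \<noteq> 0}"
    using compact_subset_open_imp_ball_epsilon_subset[of "cball 0 r" "{z. w z \<noteq> 0}"] compact_cball by blast
  have "w z \<noteq> 0" if z: "norm z < r + e" for z
  proof (cases "norm z \<le> r")
    case False
    define x where "x = of_real (r / norm z) * z"
    have nz0: "norm z > 0" using False r by linarith
    have nx: "norm x = r" using nz0 r by (simp add: x_def norm_mult norm_divide)
    have "x - z = of_real (r / norm z - 1) * z" by (simp add: x_def algebra_simps)
    then have "norm (x - z) = \<bar>r / norm z - 1\<bar> * norm z" by (simp only: norm_mult norm_of_real)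
    moreover have "\<bar>r / norm z - 1\<bar> = 1 - r / norm z" using False nz0 by (simp add: abs_if)
    moreover have "(1 - r / norm z) * norm z = norm z - r" using nz0 by (simp add: left_diff_distrib)
    ultimately have "norm (x - z) = norm z - r" by simp
    then have "z \<in> ball x e" using z by (simp add: dist_norm)
    moreover have "x \<in> cball 0 r" using nx by simp
    ultimately have "z \<in> (\<Union>x\<in>cball 0 r. ball x e)" by blast
    then show ?thesis using e by blast
  qed (use nz in auto)
  then show ?thesis using that[of "r + e"] e by auto
qed

lemma circle_mean_ln_zero_free:
  assumes w: "w holomorphic_on UNIV" and nz: "\<And>z. norm z \<le> r \<Longrightarrow> w z \<noteq> 0" and r: "0 < r"
  shows "circle_mean r (\<lambda>z. ln (norm (w z))) = ln (norm (w 0))"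
proof -
  obtain r' where r': "r < r'" "\<And>z. norm z < r' \<Longrightarrow> w z \<noteq> 0"
    using zero_free_on_larger_ball[of w r] w nz r holomorphic_on_imp_continuous_on by blast
  obtain k where k: "k holomorphic_on ball 0 r'" "\<And>z. z \<in> ball 0 r' \<Longrightarrow> w z = exp (k z)"
    using contractible_imp_holomorphic_log[of w "ball 0 r'"] r' holomorphic_on_subset[OF w]
    by (auto simp: convex_imp_contractible)
  have kc: "k holomorphic_on cball 0 r" using k(1) by (rule holomorphic_on_subset) (use r' in auto)
  have eq: "ln (norm (w z)) = Re (k z)" if "norm z \<le> r" for z
    using k(2)[of z] that r' by simp
  have "circle_mean r (\<lambda>z. ln (norm (w z))) = circle_mean r (\<lambda>z. Re (k z))"
    using r eq by (intro circle_mean_cong) auto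
  also have "\<dots> = Re (circle_mean r k)"
  proof (rule circle_mean_Re)
    show "continuous_on (sphere 0 r) k"
      using holomorphic_on_imp_continuous_on[OF kc] by (rule continuous_on_subset) auto
  qed (use r in auto)
  also have "\<dots> = ln (norm (w 0))"
    using circle_mean_holomorphic[OF kc r] eq[of 0] r by simp
  finally show ?thesis .
qed

text \<open>
  On the circle \<open>|z - a| = r * |1 - cnj a * z / r\<^sup>2|\<close>, and the second factor is zero free on
  the disc with value \<open>1\<close> at \<open>0\<close>.
\<close>

lemma circle_mean_ln_linear:
  fixes a :: complex
  assumes a: "norm a < r"
  shows "circle_mean r (\<lambda>z. ln (norm (z - a))) = ln r"
proof -
  have r: "0 < r" using a norm_ge_zero le_less_trans by blast
  define w where "w = (\<lambda>z. 1 - cnj a * z / r\<^sup>2)"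
  have nz: "w z \<noteq> 0" if "norm z \<le> r" for z
  proof
    assume "w z = 0"
    then have "norm (cnj a * z / r\<^sup>2) = 1" by (simp add: w_def)
    then have "norm a * norm z = r\<^sup>2" using r by (simp add: norm_mult norm_divide norm_power)
    moreover have "norm a * norm z \<le> norm a * r" using that by (simp add: mult_left_mono)
    moreover have "norm a * r < r\<^sup>2" using a r by (simp add: power2_eq_square)
    ultimately show False by simp
  qed
  have cw: "continuous_on (sphere 0 r) (\<lambda>z. ln (norm (w z)))"
    using nz unfolding w_def by (intro continuous_intros) (use r in auto)
  have "circle_mean r (\<lambda>z. ln (norm (z - a))) = circle_mean r (\<lambda>z. ln r + ln (norm (w z)))"
  proof (rule circle_mean_cong)
    fix z :: complex assume z: "norm z = r"
    have "z * cnj z = r\<^sup>2" using z complex_norm_square[of z] by simp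
    then have "cnj z * (z - a) = r\<^sup>2 * cnj (w z)"
      using r by (simp add: w_def field_simps)
    then have "norm (cnj z * (z - a)) = norm (r\<^sup>2 * cnj (w z))" by simp
    then have "norm (z - a) = r * norm (w z)"
      using z r by (simp add: norm_mult norm_power power2_eq_square)
    then show "ln (norm (z - a)) = ln r + ln (norm (w z))"
      using r nz[of z] z by (simp add: ln_mult)
  qed (use r in auto)
  also have "\<dots> = ln r + circle_mean r (\<lambda>z. ln (norm (w z)))"
    using cw r by (subst circle_mean_add) auto
  also have "circle_mean r (\<lambda>z. ln (norm (w z))) = 0"
    by (subst circle_mean_ln_zero_free) (use nz r in \<open>auto simp: w_def intro!: holomorphic_intros\<close>)
  finally show ?thesis by simp
qed

lemma norm_le_sqrt2_Re_csqrt: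
  assumes "0 < Re x"
  shows "norm (csqrt x) \<le> sqrt 2 * Re (csqrt x)"
proof -
  define y where "y = csqrt x"
  have y2: "x = y\<^sup>2" by (simp add: y_def)
  have "Re y \<ge> 0" using csqrt_principal[of x] by (auto simp: y_def)
  moreover have "(Re y)\<^sup>2 - (Im y)\<^sup>2 > 0" using assms by (simp add: y2 Re_power2)
  then have "(norm y)\<^sup>2 \<le> (sqrt 2 * Re y)\<^sup>2" by (simp add: cmod_power2 power_mult_distrib)
  ultimately show ?thesis unfolding y_def[symmetric] using power2_le_imp_le[of "norm y" "sqrt 2 * Re y"] by simp
qed

text \<open>
  The function \<open>1 / (1 - w * z)\<close> has positive real part, so the argument of its square root is
  less than \<open>pi / 4\<close> in absolute value. The modulus of the root is then at most \<open>sqrt 2\<close> times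
  its real part, and the real part is harmonic.
\<close>

lemma circle_mean_inverse_sqrt_unit:
  assumes w: "norm w * r < 1" and r: "0 < r"
  shows "circle_mean r (\<lambda>z. 1 / sqrt (norm (1 - w * z))) \<le> sqrt 2"
proof -
  have pos: "0 < Re (1 - w * z)" if "norm z \<le> r" for z
  proof -
    have "Re (w * z) \<le> norm (w * z)" by (rule complex_Re_le_cmod)
    also have "\<dots> \<le> norm w * r" using that by (simp add: norm_mult mult_left_mono)
    finally show ?thesis using w by simp
  qed
  define x where "x = (\<lambda>z. inverse (1 - w * z))"
  have posx: "0 < Re (x z)" if "norm z \<le> r" for z
  proof -
    have "(Re (1 - w * z))\<^sup>2 + (Im (1 - w * z))\<^sup>2 > 0"
      using pos[OF that] by (intro add_pos_nonneg zero_less_power) simp_all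
    then show ?thesis
      unfolding x_def inverse_complex.sel using pos[OF that] by (intro divide_pos_pos)
  qed
  have nz: "1 - w * z \<noteq> 0" if "norm z \<le> r" for z
  proof
    assume "1 - w * z = 0"
    with pos[OF that] have "0 < Re 0" by (simp only:)
    then show False by simp
  qed
  have holx: "x holomorphic_on cball 0 r" unfolding x_def using nz by (intro holomorphic_intros) auto
  have hol: "(\<lambda>z. csqrt (x z)) holomorphic_on cball 0 r"
  proof (rule holomorphic_on_csqrt'[OF holx])
    fix z :: complex assume "z \<in> cball 0 r"
    then have "0 < Re (x z)" using posx[of z] by simp
    then show "x z \<notin> \<real>\<^sub>\<le>\<^sub>0" by (metis complex_nonpos_Reals_iff not_le)
  qed
  have cont: "continuous_on (sphere 0 r) (\<lambda>z. csqrt (x z))"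
    using holomorphic_on_imp_continuous_on[OF hol] by (rule continuous_on_subset) auto
  have "circle_mean r (\<lambda>z. 1 / sqrt (norm (1 - w * z))) \<le> circle_mean r (\<lambda>z. sqrt 2 * Re (csqrt (x z)))"
  proof (rule circle_mean_mono)
    show "continuous_on (sphere 0 r) (\<lambda>z. 1 / sqrt (norm (1 - w * z)))"
      using nz by (intro continuous_intros) auto
    show "continuous_on (sphere 0 r) (\<lambda>z. sqrt 2 * Re (csqrt (x z)))"
      by (intro continuous_intros cont)
    fix z :: complex assume z: "norm z = r"
    have "(norm (csqrt (x z)))\<^sup>2 = norm (x z)" unfolding norm_power[symmetric] by simp
    then have "norm (csqrt (x z)) = sqrt (norm (x z))" using real_sqrt_unique norm_ge_zero by metis
    also have "\<dots> = 1 / sqrt (norm (1 - w * z))"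
      unfolding x_def norm_inverse real_sqrt_inverse by (simp only: inverse_eq_divide)
    finally show "1 / sqrt (norm (1 - w * z)) \<le> sqrt 2 * Re (csqrt (x z))"
      using norm_le_sqrt2_Re_csqrt[OF posx[of z]] z by simp
  qed (use r in auto)
  also have "\<dots> = sqrt 2 * Re (csqrt (x 0))"
    by (simp only: circle_mean_cmult circle_mean_Re[OF cont less_imp_le[OF r]] circle_mean_holomorphic[OF hol r])
  finally show ?thesis by (simp add: x_def)
qed

text \<open>
  The bound does not depend on the distance of \<open>a\<close> from the circle. The exponent \<open>1 / 2\<close> is
  what makes the singularity integrable uniformly; this is why logarithmic derivatives are
  averaged below through their square roots.
\<close>

lemma circle_mean_inverse_sqrt:
  fixes a :: complex
  assumes a: "norm a \<noteq> r" and r: "0 < r"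
  shows "circle_mean r (\<lambda>z. 1 / sqrt (norm (z - a))) \<le> sqrt 2 / sqrt r"
proof -
  obtain w b where w: "norm w * r < 1" "r \<le> b"
    "\<And>z. norm z = r \<Longrightarrow> norm (z - a) = b * norm (1 - w * z)"
  proof (cases "norm a < r")
    case True
    define w where "w = cnj a / r\<^sup>2"
    have "norm (z - a) = r * norm (1 - w * z)" if z: "norm z = r" for z
    proof -
      have "z * cnj z = r\<^sup>2" using z complex_norm_square[of z] by simp
      then have "cnj z * (z - a) = r\<^sup>2 * cnj (1 - w * z)"
        using r by (simp add: w_def field_simps)
      then have "norm (cnj z * (z - a)) = norm (r\<^sup>2 * cnj (1 - w * z))" by simp
      then show ?thesis
        using z r by (simp only: norm_mult complex_mod_cnj norm_power norm_of_real power2_eq_square) simp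
    qed
    moreover have "norm w * r < 1"
      using True r by (simp add: w_def norm_divide norm_mult power2_eq_square)
    ultimately show ?thesis using that[of w r] by simp
  next
    case False
    then have ra: "r < norm a" using a by simp
    then have a0: "a \<noteq> 0" using r by auto
    have "norm (z - a) = norm a * norm (1 - inverse a * z)" for z
    proof -
      have "z - a = - (a * (1 - inverse a * z))" using a0 by (simp add: field_simps)
      then show ?thesis by (simp only: norm_minus_cancel norm_mult)
    qed
    moreover have "norm (inverse a) * r < 1" using ra a0 r
      by (simp add: norm_inverse inverse_eq_divide norm_divide)
    ultimately show ?thesis using that[of "inverse a" "norm a"] ra by simp
  qed
  have b: "0 < b" using w r by simp
  have nz: "1 - w * z \<noteq> 0" if "norm z = r" for z
  proof
    assume "1 - w * z = 0"
    then have "norm (w * z) = 1" by simp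
    then show False using that w(1) by (simp add: norm_mult)
  qed
  have "circle_mean r (\<lambda>z. 1 / sqrt (norm (z - a)))
      = circle_mean r (\<lambda>z. (1 / sqrt b) * (1 / sqrt (norm (1 - w * z))))"
    using w(3) r by (intro circle_mean_cong) (auto simp: real_sqrt_mult)
  also have "\<dots> \<le> (1 / sqrt b) * sqrt 2"
    unfolding circle_mean_cmult using circle_mean_inverse_sqrt_unit[OF w(1) r] b
    by (intro mult_left_mono) auto
  also have "\<dots> \<le> (1 / sqrt r) * sqrt 2"
    using w(2) r by (intro mult_right_mono divide_left_mono) auto
  finally show ?thesis by simp
qed

section \<open>Zeros of entire functions and Jensen's inequality\<close>

lemma entire_split_zero:
  assumes F: "F holomorphic_on UNIV" and nz: "F z0 \<noteq> 0"
  shows "\<exists>k W. W holomorphic_on UNIV \<and> W a \<noteq> 0 \<and> (\<forall>z. F z = (z - a) ^ k * W z)"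
proof -
  define n where "n = nat (zorder F a)"
  define g where "g = zor_poly F a"
  from zorder_exist_zero[OF F open_UNIV connected_UNIV UNIV_I, of a] nz
  obtain r where r: "r > 0" "g holomorphic_on cball a r"
    "\<And>w. w \<in> cball a r \<Longrightarrow> F w = g w * (w - a) ^ n \<and> g w \<noteq> 0"
    unfolding g_def n_def by blast
  define W where "W = (\<lambda>z. if z = a then g a else F z / (z - a) ^ n)"
  have eq: "F z = (z - a) ^ n * W z" for z
    using r(3)[of a] r(1) by (cases "z = a") (auto simp: W_def)
  have "W holomorphic_on UNIV"
  proof -
    have "W holomorphic_on (- {a})"
    proof (rule holomorphic_transform)
      show "(\<lambda>z. F z / (z - a) ^ n) holomorphic_on (- {a})"
        by (intro holomorphic_intros holomorphic_on_subset[OF F]) auto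
    qed (auto simp: W_def)
    moreover have "W holomorphic_on (ball a r)"
    proof (rule holomorphic_transform)
      show "g holomorphic_on ball a r" by (rule holomorphic_on_subset[OF r(2)]) auto
      show "g z = W z" if "z \<in> ball a r" for z
        using r(3)[of z] that by (auto simp: W_def)
    qed
    ultimately have "W holomorphic_on (- {a} \<union> ball a r)"
      by (intro holomorphic_on_Un) auto
    moreover have "- {a} \<union> ball a r = UNIV" using r(1) by auto
    ultimately show ?thesis by simp
  qed
  moreover have "W a \<noteq> 0" using r(3)[of a] r(1) by (auto simp: W_def)
  ultimately show ?thesis using eq by blast
qed

lemma entire_factor_zeros:
  assumes F: "F holomorphic_on UNIV" and nz: "F z0 \<noteq> 0"
  shows "\<exists>zs W. W holomorphic_on UNIV \<and> (\<forall>z. norm z \<le> r \<longrightarrow> W z \<noteq> 0) \<and>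
    (\<forall>z. F z = (\<Prod>a\<leftarrow>zs. z - a) * W z) \<and> (\<forall>a\<in>set zs. norm a \<le> r \<and> F a = 0)"
  using F nz
proof (induction "card {z \<in> cball 0 r. F z = 0}" arbitrary: F z0 rule: less_induct)
    case less
    show ?case
    proof (cases "{z \<in> cball 0 r. F z = 0} = {}")
      case True
      then show ?thesis using less.prems(1) by (intro exI[of _ "[]"] exI[of _ F]) auto
    next
      case False
      then obtain a where a: "norm a \<le> r" "F a = 0" by auto
      obtain k W where W: "W holomorphic_on UNIV" "W a \<noteq> 0" "\<And>z. F z = (z - a) ^ k * W z"
        using entire_split_zero[OF less.prems, of a] by blast
      have "k \<noteq> 0" using W(2) W(3)[of a] a by (cases k) auto
      have fin: "finite {z \<in> cball 0 r. F z = 0}"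
      proof -
        have "\<not> F constant_on UNIV" using less.prems(2) a(2) by (metis UNIV_I constant_on_def)
        then show ?thesis
          using holomorphic_compact_finite_zeros[OF less.prems(1) open_UNIV connected_UNIV, of "cball 0 r"]
          by auto
      qed
      have "{z \<in> cball 0 r. W z = 0} \<subset> {z \<in> cball 0 r. F z = 0}"
        using a W by auto
      then have "card {z \<in> cball 0 r. W z = 0} < card {z \<in> cball 0 r. F z = 0}"
        using fin by (rule psubset_card_mono[rotated])
      from less.hyps[OF this W(1) W(2)] obtain zs V where V: "V holomorphic_on UNIV"
        "\<And>z. norm z \<le> r \<Longrightarrow> V z \<noteq> 0" "\<And>z. W z = (\<Prod>a\<leftarrow>zs. z - a) * V z"
        "\<And>a. a \<in> set zs \<Longrightarrow> norm a \<le> r \<and> W a = 0" by blast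
      show ?thesis
      proof (intro exI conjI allI ballI impI)
        show "V holomorphic_on UNIV" by (fact V)
        show "V z \<noteq> 0" if "norm z \<le> r" for z using V(2)[OF that] .
        show "F z = (\<Prod>a\<leftarrow>replicate k a @ zs. z - a) * V z" for z
          using W(3) V(3) by (simp add: prod_list_replicate mult.assoc)
        show "norm b \<le> r" "F b = 0" if "b \<in> set (replicate k a @ zs)" for b
          using that a V(4)[of b] W(3)[of b] \<open>k \<noteq> 0\<close> by auto
      qed
    qed
qed

lemma continuous_on_ln_norm:
  assumes "continuous_on S F" "\<And>z. z \<in> S \<Longrightarrow> F z \<noteq> 0"
  shows "continuous_on S (\<lambda>z. ln (norm (F z)))"
  using assms by (intro continuous_on_ln continuous_on_norm) auto

lemma ln_norm_prod_list:
  fixes z :: complex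
  assumes "\<And>a. a \<in> set zs \<Longrightarrow> z \<noteq> a"
  shows "ln (norm (\<Prod>a\<leftarrow>zs. z - a)) = (\<Sum>a\<leftarrow>zs. ln (norm (z - a)))"
proof -
  have "(\<Prod>a\<leftarrow>zs. z - a) \<noteq> 0 \<and> ln (norm (\<Prod>a\<leftarrow>zs. z - a)) = (\<Sum>a\<leftarrow>zs. ln (norm (z - a)))"
    using assms by (induction zs) (auto simp: norm_mult ln_mult)
  then show ?thesis by simp
qed

lemma circle_mean_ln_factored:
  assumes W: "W holomorphic_on UNIV" and F: "\<And>z. F z = (\<Prod>a\<leftarrow>zs. z - a) * W z"
    and zs: "\<And>a. a \<in> set zs \<Longrightarrow> norm a < r" and r: "0 < r"
    and nz: "\<And>z. norm z = r \<Longrightarrow> F z \<noteq> 0"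
  shows "circle_mean r (\<lambda>z. ln (norm (F z))) = length zs * ln r + circle_mean r (\<lambda>z. ln (norm (W z)))"
proof -
  have nW: "W z \<noteq> 0" if "norm z = r" for z using nz[OF that] F[of z] by auto
  have nza: "z \<noteq> a" if "norm z = r" "a \<in> set zs" for z a using zs that by force
  have ca: "continuous_on (sphere 0 r) (\<lambda>z. ln (norm (z - a)))" if "a \<in> set zs" for a
    using nza that by (intro continuous_on_ln_norm continuous_intros) auto
  have cW: "continuous_on (sphere 0 r) (\<lambda>z. ln (norm (W z)))"
    using nW holomorphic_on_imp_continuous_on[OF W]
    by (intro continuous_on_ln_norm) (auto intro: continuous_on_subset)
  have "circle_mean r (\<lambda>z. ln (norm (F z)))
      = circle_mean r (\<lambda>z. (\<Sum>a\<leftarrow>zs. ln (norm (z - a))) + ln (norm (W z)))"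
  proof (rule circle_mean_cong)
    fix z :: complex assume z: "norm z = r"
    have "ln (norm (F z)) = ln (norm (\<Prod>a\<leftarrow>zs. z - a)) + ln (norm (W z))"
      using nz[OF z] unfolding F by (auto simp: norm_mult ln_mult)
    also have "ln (norm (\<Prod>a\<leftarrow>zs. z - a)) = (\<Sum>a\<leftarrow>zs. ln (norm (z - a)))"
      using nza z by (intro ln_norm_prod_list) auto
    finally show "ln (norm (F z)) = (\<Sum>a\<leftarrow>zs. ln (norm (z - a))) + ln (norm (W z))" .
  qed (use r in auto)
  also have "\<dots> = circle_mean r (\<lambda>z. \<Sum>a\<leftarrow>zs. ln (norm (z - a))) + circle_mean r (\<lambda>z. ln (norm (W z)))"
    using circle_mean_sum_list[of zs r "\<lambda>a z. ln (norm (z - a))"] ca cW r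
    by (intro circle_mean_add) auto
  also have "circle_mean r (\<lambda>z. \<Sum>a\<leftarrow>zs. ln (norm (z - a)))
      = (\<Sum>a\<leftarrow>zs. circle_mean r (\<lambda>z. ln (norm (z - a))))"
    using circle_mean_sum_list[of zs r "\<lambda>a z. ln (norm (z - a))"] ca r by auto
  also have "\<dots> = (\<Sum>a\<leftarrow>zs. ln r)"
    using zs by (intro arg_cong[where f = sum_list] map_cong circle_mean_ln_linear) auto
  finally show ?thesis by (simp add: sum_list_triv)
qed

text \<open>
  Jensen's inequality: each zero \<open>a\<close> in the disc raises the mean above the value at the centre
  by \<open>ln r - ln |a|\<close>.
\<close>

lemma circle_mean_ln_ge_at_0:
  assumes F: "F holomorphic_on UNIV" and F0: "F 0 \<noteq> 0" and r: "0 < r"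
    and nz: "\<And>z. norm z = r \<Longrightarrow> F z \<noteq> 0"
  shows "ln (norm (F 0)) \<le> circle_mean r (\<lambda>z. ln (norm (F z)))"
proof -
  obtain zs W where W: "W holomorphic_on UNIV" "\<And>z. norm z \<le> r \<Longrightarrow> W z \<noteq> 0"
    "\<And>z. F z = (\<Prod>a\<leftarrow>zs. z - a) * W z" "\<And>a. a \<in> set zs \<Longrightarrow> norm a \<le> r \<and> F a = 0"
    using entire_factor_zeros[OF F F0, of r] by blast
  have lt: "norm a < r" if "a \<in> set zs" for a using W(4)[OF that] nz[of a] by force
  have "circle_mean r (\<lambda>z. ln (norm (F z))) = length zs * ln r + ln (norm (W 0))"
    using circle_mean_ln_factored[OF W(1,3) lt r nz] circle_mean_ln_zero_free[OF W(1,2) r] by simp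
  moreover have "ln (norm (F 0)) = (\<Sum>a\<leftarrow>zs. ln (norm a)) + ln (norm (W 0))"
  proof -
    have ne: "0 \<noteq> a" if "a \<in> set zs" for a using W(4)[OF that] F0 by auto
    have "ln (norm (F 0)) = ln (norm (\<Prod>a\<leftarrow>zs. 0 - a)) + ln (norm (W 0))"
      using F0 unfolding W(3)[of 0] norm_mult by (subst ln_mult) auto
    then show ?thesis using ln_norm_prod_list[of zs 0, OF ne] by simp
  qed
  moreover have "(\<Sum>a\<leftarrow>zs. ln (norm a)) \<le> (\<Sum>a\<leftarrow>zs. ln r)"
  proof (rule sum_list_mono)
    fix a assume a: "a \<in> set zs"
    then have "a \<noteq> 0" using W(4) F0 by auto
    then show "ln (norm a) \<le> ln r" using lt[OF a] r by auto
  qed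
  ultimately show ?thesis by (simp add: sum_list_triv)
qed

text \<open>
  With the zeros in the disc of radius \<open>\<rho>\<close> split off as \<open>zs\<close>, every zero contributes at least
  \<open>ln (R / \<rho>)\<close> to the mean over the circle of radius \<open>R\<close>. So means over larger circles control
  the number of zeros. A zero at the origin is divided out first, because Jensen's inequality
  needs a nonzero value there.
\<close>

lemma jensen_zero_count:
  assumes F: "F holomorphic_on UNIV" and nz0: "F z0 \<noteq> 0"
  shows "\<exists>C\<ge>0. \<forall>\<rho>\<ge>1. (\<forall>z. norm z = \<rho> \<longrightarrow> F z \<noteq> 0) \<longrightarrow>
       (\<exists>zs W. W holomorphic_on UNIV \<and> (\<forall>z. norm z \<le> \<rho> \<longrightarrow> W z \<noteq> 0) \<and>
         (\<forall>z. F z = (\<Prod>a\<leftarrow>zs. z - a) * W z) \<and> (\<forall>a\<in>set zs. norm a < \<rho> \<and> F a = 0) \<and>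
         (\<forall>R\<ge>\<rho>. (\<forall>z. norm z = R \<longrightarrow> F z \<noteq> 0) \<longrightarrow>
            length zs * ln (R / \<rho>) \<le> circle_mean R (\<lambda>z. ln (norm (F z))) + C))"
proof -
  obtain k F0 where F0: "F0 holomorphic_on UNIV" "F0 0 \<noteq> 0" "\<And>z. F z = (z - 0) ^ k * F0 z"
    using entire_split_zero[OF F nz0, of 0] by blast
  show ?thesis
  proof (intro exI[of _ "\<bar>ln (norm (F0 0))\<bar>"] conjI allI impI)
    fix \<rho> :: real assume \<rho>: "1 \<le> \<rho>" and nz: "\<forall>z. norm z = \<rho> \<longrightarrow> F z \<noteq> 0"
    obtain zs W where W: "W holomorphic_on UNIV" "\<And>z. norm z \<le> \<rho> \<Longrightarrow> W z \<noteq> 0"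
      "\<And>z. F0 z = (\<Prod>a\<leftarrow>zs. z - a) * W z" "\<And>a. a \<in> set zs \<Longrightarrow> norm a \<le> \<rho> \<and> F0 a = 0"
      using entire_factor_zeros[OF F0(1,2), of \<rho>] by blast
    define ys where "ys = replicate k 0 @ zs"
    have FW: "F z = (\<Prod>a\<leftarrow>ys. z - a) * W z" for z
      using F0(3) W(3) by (simp add: ys_def prod_list_replicate mult.assoc)
    have ys: "norm a < \<rho> \<and> F a = 0" if a: "a \<in> set ys" for a
    proof -
      have "norm a \<le> \<rho> \<and> F a = 0"
        using a W(4)[of a] F0(3)[of a] \<rho> by (auto simp: ys_def)
      then show ?thesis using nz by force
    qed
    have "length ys * ln (R / \<rho>) \<le> circle_mean R (\<lambda>z. ln (norm (F z))) + \<bar>ln (norm (F0 0))\<bar>"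
      if R: "\<rho> \<le> R" and nzR: "\<forall>z. norm z = R \<longrightarrow> F z \<noteq> 0" for R
    proof -
      have R0: "0 < R" using \<rho> R by simp
      have nW: "W z \<noteq> 0" if "norm z = R" for z using nzR that FW[of z] by auto
      have "circle_mean R (\<lambda>z. ln (norm (F z))) = length ys * ln R + circle_mean R (\<lambda>z. ln (norm (W z)))"
        using circle_mean_ln_factored[OF W(1) FW _ R0] ys R nzR by force
      moreover have "ln (norm (W 0)) \<le> circle_mean R (\<lambda>z. ln (norm (W z)))"
        using W(2)[of 0] \<rho> by (intro circle_mean_ln_ge_at_0[OF W(1) _ R0 nW]) auto
      moreover have "ln (norm (F0 0)) \<le> length zs * ln \<rho> + ln (norm (W 0))"
      proof -
        have ne: "0 \<noteq> a" if "a \<in> set zs" for a using W(4)[OF that] F0(2) by auto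
        have "ln (norm (F0 0)) = ln (norm (\<Prod>a\<leftarrow>zs. 0 - a)) + ln (norm (W 0))"
          using F0(2) unfolding W(3)[of 0] norm_mult by (subst ln_mult) auto
        also have "ln (norm (\<Prod>a\<leftarrow>zs. 0 - a)) = (\<Sum>a\<leftarrow>zs. ln (norm a))"
          using ln_norm_prod_list[of zs 0, OF ne] by simp
        also have "\<dots> \<le> (\<Sum>a\<leftarrow>zs. ln \<rho>)"
        proof (rule sum_list_mono)
          fix a assume a: "a \<in> set zs"
          then have "0 < norm a" using ne by auto
          then show "ln (norm a) \<le> ln \<rho>" using W(4)[OF a] by (intro ln_mono) auto
        qed
        finally show ?thesis by (simp add: sum_list_triv)
      qed
      moreover have "length zs * ln \<rho> \<le> length ys * ln \<rho>"
        using \<rho> by (intro mult_right_mono) (auto simp: ys_def)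
      ultimately show ?thesis
        using \<rho> R0 by (simp add: ln_div algebra_simps)
    qed
    then show "\<exists>zs W. W holomorphic_on UNIV \<and> (\<forall>z. norm z \<le> \<rho> \<longrightarrow> W z \<noteq> 0) \<and>
         (\<forall>z. F z = (\<Prod>a\<leftarrow>zs. z - a) * W z) \<and> (\<forall>a\<in>set zs. norm a < \<rho> \<and> F a = 0) \<and>
         (\<forall>R\<ge>\<rho>. (\<forall>z. norm z = R \<longrightarrow> F z \<noteq> 0) \<longrightarrow>
            length zs * ln (R / \<rho>) \<le> circle_mean R (\<lambda>z. ln (norm (F z))) + \<bar>ln (norm (F0 0))\<bar>)"
      using W(1,2) FW ys by blast
  qed auto
qed

lemma circle_mean_ln_lower_bound:
  assumes F: "F holomorphic_on UNIV" and nz0: "F z0 \<noteq> 0"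
  shows "\<exists>C\<ge>0. \<forall>r\<ge>1. (\<forall>z. norm z = r \<longrightarrow> F z \<noteq> 0) \<longrightarrow> - C \<le> circle_mean r (\<lambda>z. ln (norm (F z)))"
proof -
  obtain C where C: "0 \<le> C"
    "\<And>\<rho>. 1 \<le> \<rho> \<Longrightarrow> (\<forall>z. norm z = \<rho> \<longrightarrow> F z \<noteq> 0) \<Longrightarrow>
       \<exists>zs W. W holomorphic_on UNIV \<and> (\<forall>z. norm z \<le> \<rho> \<longrightarrow> W z \<noteq> 0) \<and>
         (\<forall>z. F z = (\<Prod>a\<leftarrow>zs. z - a) * W z) \<and> (\<forall>a\<in>set zs. norm a < \<rho> \<and> F a = 0) \<and>
         (\<forall>R\<ge>\<rho>. (\<forall>z. norm z = R \<longrightarrow> F z \<noteq> 0) \<longrightarrow>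
            length zs * ln (R / \<rho>) \<le> circle_mean R (\<lambda>z. ln (norm (F z))) + C)"
    using jensen_zero_count[OF F nz0] by blast
  have "- C \<le> circle_mean r (\<lambda>z. ln (norm (F z)))" if r: "1 \<le> r" "\<forall>z. norm z = r \<longrightarrow> F z \<noteq> 0" for r
  proof -
    from C(2)[OF r] obtain zs :: "complex list" where
      "\<forall>R\<ge>r. (\<forall>z. norm z = R \<longrightarrow> F z \<noteq> 0) \<longrightarrow>
        length zs * ln (R / r) \<le> circle_mean R (\<lambda>z. ln (norm (F z))) + C" by blast
    from this[rule_format, of r] show ?thesis using r by simp
  qed
  then show ?thesis using C(1) by blast
qed

section \<open>The mean of a logarithmic derivative\<close>

lemma continuous_on_ln_1_plus:
  fixes \<phi> :: "'a::topological_space \<Rightarrow> real"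
  assumes c: "continuous_on S \<phi>" and nn: "\<And>z. z \<in> S \<Longrightarrow> 0 \<le> \<phi> z"
  shows "continuous_on S (\<lambda>z. ln (1 + \<phi> z))"
proof -
  have "\<forall>z\<in>S. 1 + \<phi> z \<noteq> 0" using nn by force
  then show ?thesis by (intro continuous_on_ln continuous_on_add continuous_on_const c)
qed

text \<open>
  Jensen's inequality for the concave function \<open>ln (1 + x)\<close>, by comparison with its tangent at
  \<open>M\<close>.
\<close>

lemma circle_mean_ln_1_plus_le:
  fixes \<phi> :: "complex \<Rightarrow> real"
  assumes c: "continuous_on (sphere 0 r) \<phi>" and r: "0 \<le> r"
    and nn: "\<And>z. norm z = r \<Longrightarrow> 0 \<le> \<phi> z" and M: "circle_mean r \<phi> \<le> M" and M0: "0 \<le> M"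
  shows "circle_mean r (\<lambda>z. ln (1 + \<phi> z)) \<le> ln (1 + M)"
proof -
  have c1: "continuous_on (sphere 0 r) (\<lambda>z. ln (1 + \<phi> z))"
    by (intro continuous_on_ln_1_plus c nn) auto
  have c2: "continuous_on (sphere 0 r) (\<lambda>z. (1 / (1 + M)) * \<phi> z)"
    by (intro continuous_intros c)
  have "circle_mean r (\<lambda>z. ln (1 + \<phi> z)) \<le>
      circle_mean r (\<lambda>z. (ln (1 + M) - M / (1 + M)) + (1 / (1 + M)) * \<phi> z)"
  proof (rule circle_mean_mono[OF c1 _ r])
    show "continuous_on (sphere 0 r) (\<lambda>z. (ln (1 + M) - M / (1 + M)) + (1 / (1 + M)) * \<phi> z)"
      by (intro continuous_intros c)
    fix z :: complex assume "norm z = r"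
    then have p: "0 \<le> \<phi> z" by (rule nn)
    have "ln ((1 + \<phi> z) / (1 + M)) \<le> (1 + \<phi> z) / (1 + M) - 1"
      using p M0 by (intro ln_le_minus_one divide_pos_pos) auto
    moreover have "ln ((1 + \<phi> z) / (1 + M)) = ln (1 + \<phi> z) - ln (1 + M)"
      using p M0 by (simp add: ln_div)
    moreover have "(1 + \<phi> z) / (1 + M) - 1 = (1 / (1 + M)) * \<phi> z - M / (1 + M)"
    proof -
      have q: "(a + x) / d - 1 = x / d - (d - a) / d" if "d \<noteq> 0" for a x d :: real
        using that by (simp add: field_simps)
      show ?thesis using q[of "1 + M" 1 "\<phi> z"] M0 by simp
    qed
    ultimately show "ln (1 + \<phi> z) \<le> (ln (1 + M) - M / (1 + M)) + (1 / (1 + M)) * \<phi> z"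
      by linarith
  qed
  also have "\<dots> = (ln (1 + M) - M / (1 + M)) + (1 / (1 + M)) * circle_mean r \<phi>"
    unfolding circle_mean_add[OF continuous_on_const c2 r] circle_mean_const circle_mean_cmult ..
  also have "\<dots> \<le> (ln (1 + M) - M / (1 + M)) + (1 / (1 + M)) * M"
    using M M0 by (intro add_left_mono mult_left_mono) auto
  finally show ?thesis by simp
qed

lemma sqrt_sum_list_le:
  assumes "\<And>x. x \<in> set xs \<Longrightarrow> 0 \<le> x"
  shows "sqrt (sum_list xs) \<le> (\<Sum>x\<leftarrow>xs. sqrt x)"
  using assms
proof (induction xs)
  case (Cons x xs)
  have "sqrt (x + sum_list xs) \<le> sqrt x + sqrt (sum_list xs)"
    using Cons.prems by (intro sqrt_add_le_add_sqrt sum_list_nonneg) auto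
  then show ?case using Cons by fastforce
qed auto

lemma norm_sum_list_le: "norm (sum_list (xs :: complex list)) \<le> (\<Sum>x\<leftarrow>xs. norm x)"
  by (induction xs) (auto intro: norm_triangle_le)

lemma deriv_prod_list_linear:
  assumes W: "W holomorphic_on UNIV" and F: "\<And>z. F z = (\<Prod>a\<leftarrow>zs. z - a) * W z" and z: "F z \<noteq> 0"
  shows "deriv F z / F z = (\<Sum>a\<leftarrow>zs. 1 / (z - a)) + deriv W z / W z"
proof -
  have P: "((\<lambda>z. \<Prod>a\<leftarrow>zs. z - a) has_field_derivative
      (\<Prod>a\<leftarrow>zs. z - a) * (\<Sum>a\<leftarrow>zs. 1 / (z - a))) (at z)" if "(\<Prod>a\<leftarrow>zs. z - a) \<noteq> 0"
    using that
  proof (induction zs)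
    case (Cons b zs)
    have "((\<lambda>z. (z - b) * (\<Prod>a\<leftarrow>zs. z - a)) has_field_derivative
      (1 - 0) * (\<Prod>a\<leftarrow>zs. z - a) + ((\<Prod>a\<leftarrow>zs. z - a) * (\<Sum>a\<leftarrow>zs. 1 / (z - a))) * (z - b)) (at z)"
      using Cons by (intro DERIV_mult DERIV_diff DERIV_ident DERIV_const) auto
    moreover have "(1 - 0) * (\<Prod>a\<leftarrow>zs. z - a) + ((\<Prod>a\<leftarrow>zs. z - a) * (\<Sum>a\<leftarrow>zs. 1 / (z - a))) * (z - b)
      = (\<Prod>a\<leftarrow>b#zs. z - a) * (\<Sum>a\<leftarrow>b#zs. 1 / (z - a))"
      using Cons.prems by (auto simp: field_simps)
    ultimately show ?case by simp
  qed auto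
  have nz: "(\<Prod>a\<leftarrow>zs. z - a) \<noteq> 0" "W z \<noteq> 0" using z F[of z] by auto
  have "(W has_field_derivative deriv W z) (at z)"
    using W by (rule holomorphic_derivI) auto
  from DERIV_mult[OF P[OF nz(1)] this]
  have "((\<lambda>z. (\<Prod>a\<leftarrow>zs. z - a) * W z) has_field_derivative
      (\<Prod>a\<leftarrow>zs. z - a) * (\<Sum>a\<leftarrow>zs. 1 / (z - a)) * W z + deriv W z * (\<Prod>a\<leftarrow>zs. z - a)) (at z)" .
  moreover have "(\<lambda>z. (\<Prod>a\<leftarrow>zs. z - a) * W z) = F" using F by auto
  ultimately have "deriv F z = (\<Prod>a\<leftarrow>zs. z - a) * (\<Sum>a\<leftarrow>zs. 1 / (z - a)) * W z + deriv W z * (\<Prod>a\<leftarrow>zs. z - a)"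
    by (simp add: DERIV_imp_deriv)
  then show ?thesis using nz unfolding F[of z] by (simp add: field_simps)
qed

lemma abs_le_of_upper_bound: "(x::real) \<le> b \<Longrightarrow> 0 \<le> b \<Longrightarrow> \<bar>x\<bar> \<le> 2 * b - x"
  by (auto simp: abs_if)

text \<open>
  Since \<open>|z - a| \<le> 2 * r\<close> on the circle, the positive part of \<open>ln (|z - a| / r)\<close> is at most
  \<open>ln 2\<close>, and the mean of the function itself vanishes.
\<close>

lemma circle_mean_abs_ln_linear:
  fixes a :: complex
  assumes a: "norm a < r"
  shows "circle_mean r (\<lambda>z. \<bar>ln (norm (z - a)) - ln r\<bar>) \<le> 2 * ln 2"
proof -
  have r: "0 < r" using a norm_ge_zero le_less_trans by blast
  have ne: "z \<noteq> a" if "norm z = r" for z using that a by auto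
  have c: "continuous_on (sphere 0 r) (\<lambda>z. ln (norm (z - a)))"
    using ne by (intro continuous_on_ln_norm continuous_intros) auto
  have "circle_mean r (\<lambda>z. \<bar>ln (norm (z - a)) - ln r\<bar>) \<le> circle_mean r (\<lambda>z. (2 * ln 2 + ln r) - ln (norm (z - a)))"
  proof (rule circle_mean_mono)
    fix z :: complex assume z: "norm z = r"
    have "norm (z - a) \<le> 2 * r" using norm_triangle_ineq4[of z a] z a by simp
    then have "ln (norm (z - a)) \<le> ln (2 * r)" using ne[OF z] by (intro ln_mono) auto
    then have "ln (norm (z - a)) - ln r \<le> ln 2" using r by (simp add: ln_mult)
    then show "\<bar>ln (norm (z - a)) - ln r\<bar> \<le> (2 * ln 2 + ln r) - ln (norm (z - a))"
      using abs_le_of_upper_bound[of "ln (norm (z - a)) - ln r" "ln 2"] by simp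
  qed (use r in \<open>auto intro!: continuous_intros c\<close>)
  also have "\<dots> = 2 * ln 2"
    using circle_mean_diff[OF continuous_on_const c, of "2 * ln 2 + ln r"] circle_mean_ln_linear[OF a] r by simp
  finally show ?thesis .
qed

lemma zero_free_entire_log:
  fixes W :: "complex \<Rightarrow> complex"
  assumes W: "W holomorphic_on UNIV" and nz: "\<forall>z. norm z \<le> r \<longrightarrow> W z \<noteq> 0" and r: "0 < r"
  shows "\<exists>r'>r. \<exists>k. k holomorphic_on ball 0 r' \<and> (\<forall>z\<in>ball 0 r'. W z = exp (k z) \<and> deriv k z = deriv W z / W z)"
proof -
  have Wc: "continuous_on UNIV W" using W by (rule holomorphic_on_imp_continuous_on)
  obtain r' where r': "r < r'" "\<And>z. norm z < r' \<Longrightarrow> W z \<noteq> 0"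
    using zero_free_on_larger_ball[OF Wc _ r] nz by blast
  obtain k where k: "k holomorphic_on ball 0 r'" "\<And>z. z \<in> ball 0 r' \<Longrightarrow> W z = exp (k z)"
    using contractible_imp_holomorphic_log[of W "ball 0 r'"] r' holomorphic_on_subset[OF W]
    by (auto simp: convex_imp_contractible)
  have "deriv k z = deriv W z / W z" if z: "z \<in> ball 0 r'" for z
  proof -
    have "(k has_field_derivative deriv k z) (at z)"
      using k(1) z by (intro holomorphic_derivI) auto
    then have "((\<lambda>z. exp (k z)) has_field_derivative exp (k z) * deriv k z) (at z)"
      by (rule DERIV_chain2[OF DERIV_exp])
    then have "(W has_field_derivative exp (k z) * deriv k z) (at z)"
      by (rule has_field_derivative_transform_within_open[where S = "ball 0 r'"]) (use z k in auto)
    then show ?thesis using k(2)[OF z] by (simp add: DERIV_imp_deriv)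
  qed
  then show ?thesis using k r' by blast
qed

text \<open>
  Split off the \<open>n\<close> zeros of \<open>u1\<close> and \<open>u2\<close> in the disc of radius \<open>\<rho>\<close>. The logarithmic
  derivative of \<open>u1 / u2\<close> is the sum of \<open>\<plusminus> 1 / (z - a)\<close> over these zeros and of \<open>k'\<close>, where
  \<open>k\<close> is a logarithm of the zero-free remainder. On the circle of radius \<open>r\<close> the derivative
  \<open>k'\<close> is bounded by the mean of \<open>|Re k|\<close> over the circle of radius \<open>\<rho>\<close>, the square roots of
  the terms \<open>1 / |z - a|\<close> have bounded means, and \<open>n\<close> is bounded by means over the circle of
  radius \<open>R\<close>.
\<close>

lemma log_deriv_mean_estimate:
  assumes u: "u1 holomorphic_on UNIV" "u2 holomorphic_on UNIV" and nz: "u1 z1 \<noteq> 0" "u2 z2 \<noteq> 0"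
  shows "\<exists>C\<ge>0. \<forall>r \<rho> R. 1 \<le> r \<and> r < \<rho> \<and> \<rho> < R \<and>
      (\<forall>z. norm z \<in> {r, \<rho>, R} \<longrightarrow> u1 z \<noteq> 0 \<and> u2 z \<noteq> 0) \<longrightarrow>
      (\<exists>n\<ge>0. n * ln (R / \<rho>) \<le> 2 * circle_mean R (\<lambda>z. ln (max (norm (u1 z)) (norm (u2 z)))) + C \<and>
        0 \<le> 2 * circle_mean \<rho> (\<lambda>z. ln (max (norm (u1 z)) (norm (u2 z)))) + C + 2 * ln 2 * n \<and>
        circle_mean r (\<lambda>z. ln (1 + norm (deriv u1 z / u1 z - deriv u2 z / u2 z))) \<le>
        2 * ln (1 + (sqrt (2 * \<rho> / (\<rho> - r)\<^sup>2 *
            (2 * circle_mean \<rho> (\<lambda>z. ln (max (norm (u1 z)) (norm (u2 z)))) + C + 2 * ln 2 * n)) + sqrt 2 * n)))"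
proof -
  obtain C1 where C1: "0 \<le> C1"
    "\<And>\<rho>. 1 \<le> \<rho> \<Longrightarrow> (\<forall>z. norm z = \<rho> \<longrightarrow> u1 z \<noteq> 0) \<Longrightarrow>
       \<exists>zs W. W holomorphic_on UNIV \<and> (\<forall>z. norm z \<le> \<rho> \<longrightarrow> W z \<noteq> 0) \<and>
         (\<forall>z. u1 z = (\<Prod>a\<leftarrow>zs. z - a) * W z) \<and> (\<forall>a\<in>set zs. norm a < \<rho> \<and> u1 a = 0) \<and>
         (\<forall>R\<ge>\<rho>. (\<forall>z. norm z = R \<longrightarrow> u1 z \<noteq> 0) \<longrightarrow>
            length zs * ln (R / \<rho>) \<le> circle_mean R (\<lambda>z. ln (norm (u1 z))) + C1)"
    using jensen_zero_count[OF u(1) nz(1)] by blast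
  obtain C2 where C2: "0 \<le> C2"
    "\<And>\<rho>. 1 \<le> \<rho> \<Longrightarrow> (\<forall>z. norm z = \<rho> \<longrightarrow> u2 z \<noteq> 0) \<Longrightarrow>
       \<exists>zs W. W holomorphic_on UNIV \<and> (\<forall>z. norm z \<le> \<rho> \<longrightarrow> W z \<noteq> 0) \<and>
         (\<forall>z. u2 z = (\<Prod>a\<leftarrow>zs. z - a) * W z) \<and> (\<forall>a\<in>set zs. norm a < \<rho> \<and> u2 a = 0) \<and>
         (\<forall>R\<ge>\<rho>. (\<forall>z. norm z = R \<longrightarrow> u2 z \<noteq> 0) \<longrightarrow>
            length zs * ln (R / \<rho>) \<le> circle_mean R (\<lambda>z. ln (norm (u2 z))) + C2)"
    using jensen_zero_count[OF u(2) nz(2)] by blast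
  obtain C3 where C3: "0 \<le> C3" "\<And>r. 1 \<le> r \<Longrightarrow> (\<forall>z. norm z = r \<longrightarrow> u1 z \<noteq> 0) \<Longrightarrow>
      - C3 \<le> circle_mean r (\<lambda>z. ln (norm (u1 z)))"
    using circle_mean_ln_lower_bound[OF u(1) nz(1)] by blast
  obtain C4 where C4: "0 \<le> C4" "\<And>r. 1 \<le> r \<Longrightarrow> (\<forall>z. norm z = r \<longrightarrow> u2 z \<noteq> 0) \<Longrightarrow>
      - C4 \<le> circle_mean r (\<lambda>z. ln (norm (u2 z)))"
    using circle_mean_ln_lower_bound[OF u(2) nz(2)] by blast
  define C where "C = C1 + C2 + C3 + C4"
  define X where "X = (\<lambda>t. circle_mean t (\<lambda>z. ln (max (norm (u1 z)) (norm (u2 z)))))"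
  have uc: "continuous_on S u1" "continuous_on S u2" for S
    using u by (auto intro: holomorphic_on_imp_continuous_on continuous_on_subset)
  have main: "\<exists>n\<ge>0. n * ln (R / \<rho>) \<le> 2 * X R + C \<and> 0 \<le> 2 * X \<rho> + C + 2 * ln 2 * n \<and>
        circle_mean r (\<lambda>z. ln (1 + norm (deriv u1 z / u1 z - deriv u2 z / u2 z))) \<le>
        2 * ln (1 + (sqrt (2 * \<rho> / (\<rho> - r)\<^sup>2 * (2 * X \<rho> + C + 2 * ln 2 * n)) + sqrt 2 * n))"
    if rR: "1 \<le> r" "r < \<rho>" "\<rho> < R" and un: "\<And>z. norm z \<in> {r, \<rho>, R} \<Longrightarrow> u1 z \<noteq> 0 \<and> u2 z \<noteq> 0" for r \<rho> R
  proof -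
    have \<rho>: "1 \<le> \<rho>" "0 < \<rho>" "0 < r" "0 < R" "1 \<le> R" using rR by auto
    have un1: "\<forall>z. norm z = t \<longrightarrow> u1 z \<noteq> 0" and un2: "\<forall>z. norm z = t \<longrightarrow> u2 z \<noteq> 0"
      if "t \<in> {r, \<rho>, R}" for t using un that by auto
    obtain zs1 W1 where W1: "W1 holomorphic_on UNIV" "\<forall>z. norm z \<le> \<rho> \<longrightarrow> W1 z \<noteq> 0"
      "\<And>z. u1 z = (\<Prod>a\<leftarrow>zs1. z - a) * W1 z" "\<And>a. a \<in> set zs1 \<Longrightarrow> norm a < \<rho> \<and> u1 a = 0"
      "\<forall>R\<ge>\<rho>. (\<forall>z. norm z = R \<longrightarrow> u1 z \<noteq> 0) \<longrightarrow>
            length zs1 * ln (R / \<rho>) \<le> circle_mean R (\<lambda>z. ln (norm (u1 z))) + C1"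
      using C1(2)[OF \<rho>(1) un1[of \<rho>]] by blast
    obtain zs2 W2 where W2: "W2 holomorphic_on UNIV" "\<forall>z. norm z \<le> \<rho> \<longrightarrow> W2 z \<noteq> 0"
      "\<And>z. u2 z = (\<Prod>a\<leftarrow>zs2. z - a) * W2 z" "\<And>a. a \<in> set zs2 \<Longrightarrow> norm a < \<rho> \<and> u2 a = 0"
      "\<forall>R\<ge>\<rho>. (\<forall>z. norm z = R \<longrightarrow> u2 z \<noteq> 0) \<longrightarrow>
            length zs2 * ln (R / \<rho>) \<le> circle_mean R (\<lambda>z. ln (norm (u2 z))) + C2"
      using C2(2)[OF \<rho>(1) un2[of \<rho>]] by blast
    define zs where "zs = zs1 @ zs2"
    define n where "n = real (length zs)"
    have cl: "continuous_on (sphere 0 t) (\<lambda>z. ln (norm (u1 z)))"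
             "continuous_on (sphere 0 t) (\<lambda>z. ln (norm (u2 z)))"
             "continuous_on (sphere 0 t) (\<lambda>z. ln (max (norm (u1 z)) (norm (u2 z))))" if "t \<in> {r, \<rho>, R}" for t
    proof -
      have n1: "u1 z \<noteq> 0" and n2: "u2 z \<noteq> 0" if "z \<in> sphere 0 t" for z
        using un[of z] that \<open>t \<in> {r, \<rho>, R}\<close> by auto
      show "continuous_on (sphere 0 t) (\<lambda>z. ln (norm (u1 z)))"
           "continuous_on (sphere 0 t) (\<lambda>z. ln (norm (u2 z)))"
        using n1 n2 by (auto intro!: continuous_on_ln_norm uc)
      have "max (norm (u1 z)) (norm (u2 z)) \<noteq> 0" if "z \<in> sphere 0 t" for z
        using n1[OF that] by (auto simp: max_def)
      then show "continuous_on (sphere 0 t) (\<lambda>z. ln (max (norm (u1 z)) (norm (u2 z))))"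
        by (intro continuous_on_ln continuous_on_max continuous_on_norm uc) auto
    qed
    have le_max: "circle_mean t (\<lambda>z. ln (norm (u1 z))) \<le> X t" "circle_mean t (\<lambda>z. ln (norm (u2 z))) \<le> X t"
      if t: "t \<in> {r, \<rho>, R}" for t
    proof -
      have t0: "0 \<le> t" using t \<rho> by auto
      have "0 < norm (u1 z)" "0 < norm (u2 z)" if "norm z = t" for z using un[of z] t that by auto
      then have "ln (norm (u1 z)) \<le> ln (max (norm (u1 z)) (norm (u2 z)))"
        "ln (norm (u2 z)) \<le> ln (max (norm (u1 z)) (norm (u2 z)))" if "norm z = t" for z
        using that by (auto intro!: ln_mono)
      then show "circle_mean t (\<lambda>z. ln (norm (u1 z))) \<le> X t" "circle_mean t (\<lambda>z. ln (norm (u2 z))) \<le> X t"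
        unfolding X_def
        by (auto intro: circle_mean_mono[OF cl(1)[OF t] cl(3)[OF t] t0] circle_mean_mono[OF cl(2)[OF t] cl(3)[OF t] t0])
    qed
    have "length zs1 * ln (R / \<rho>) \<le> X R + C1"
      using W1(5)[rule_format, of R] un1[of R] le_max(1)[of R] rR by fastforce
    moreover have "length zs2 * ln (R / \<rho>) \<le> X R + C2"
      using W2(5)[rule_format, of R] un2[of R] le_max(2)[of R] rR by fastforce
    ultimately have nbound: "n * ln (R / \<rho>) \<le> 2 * X R + C"
      using C3(1) C4(1) by (simp add: n_def zs_def C_def algebra_simps)
    obtain r1 k1 where k1: "\<rho> < r1" "k1 holomorphic_on ball 0 r1"
      "\<And>z. z \<in> ball 0 r1 \<Longrightarrow> W1 z = exp (k1 z) \<and> deriv k1 z = deriv W1 z / W1 z"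
      using zero_free_entire_log[OF W1(1,2) \<rho>(2)] by blast
    obtain r2 k2 where k2: "\<rho> < r2" "k2 holomorphic_on ball 0 r2"
      "\<And>z. z \<in> ball 0 r2 \<Longrightarrow> W2 z = exp (k2 z) \<and> deriv k2 z = deriv W2 z / W2 z"
      using zero_free_entire_log[OF W2(1,2) \<rho>(2)] by blast
    \<comment> \<open>The constant normalises each factor \<open>z - a\<close> to \<open>(z - a) / \<rho>\<close>, whose logarithm has bounded
      mean modulus.\<close>
    define c where "c = (real (length zs1) - real (length zs2)) * ln \<rho>"
    define k where "k = (\<lambda>z. k1 z - k2 z + of_real c)"
    have kh: "k holomorphic_on cball 0 \<rho>"
      unfolding k_def using k1(1) k2(1)
      by (intro holomorphic_intros holomorphic_on_subset[OF k1(2)] holomorphic_on_subset[OF k2(2)]) auto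
    have dk: "deriv k z = deriv W1 z / W1 z - deriv W2 z / W2 z" if "norm z \<le> \<rho>" for z
    proof -
      have "(k1 has_field_derivative deriv k1 z) (at z)" "(k2 has_field_derivative deriv k2 z) (at z)"
        using that k1(1) k2(1) by (auto intro!: holomorphic_derivI[OF k1(2)] holomorphic_derivI[OF k2(2)])
      then have "(k has_field_derivative deriv k1 z - deriv k2 z + 0) (at z)"
        unfolding k_def by (intro DERIV_add DERIV_diff DERIV_const)
      then show ?thesis using k1(3)[of z] k2(3)[of z] that k1(1) k2(1) by (simp add: DERIV_imp_deriv)
    qed
    define e where "e = (\<lambda>a z :: complex. \<bar>ln (norm (z - a)) - ln \<rho>\<bar>)"
    have zsn: "norm a < \<rho>" if "a \<in> set zs" for a using that W1(4) W2(4) by (auto simp: zs_def)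
    have ce: "continuous_on (sphere 0 \<rho>) (e a)" if "a \<in> set zs" for a
      unfolding e_def using zsn[OF that]
      by (intro continuous_intros continuous_on_ln_norm) auto
    have csum: "circle_mean \<rho> (\<lambda>z. \<Sum>a\<leftarrow>zs. e a z) = (\<Sum>a\<leftarrow>zs. circle_mean \<rho> (e a))"
      "continuous_on (sphere 0 \<rho>) (\<lambda>z. \<Sum>a\<leftarrow>zs. e a z)"
      using circle_mean_sum_list[of zs \<rho> e] ce \<rho> by auto
    \<comment> \<open>An upper bound for \<open>|ln |u1| - ln |u2||\<close> whose mean is computable: the means of \<open>ln |u1|\<close>
      and \<open>ln |u2|\<close> are bounded below.\<close>
    define B where "B = (\<lambda>z. (2 * ln (max (norm (u1 z)) (norm (u2 z))) - ln (norm (u1 z))) - ln (norm (u2 z)))"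
    have cB: "continuous_on (sphere 0 \<rho>) B"
      unfolding B_def by (intro continuous_on_diff continuous_on_mult continuous_on_const cl) auto
    have Rek: "\<bar>Re (k z)\<bar> \<le> B z + (\<Sum>a\<leftarrow>zs. e a z)" if z: "norm z = \<rho>" for z
    proof -
      have z1: "u1 z \<noteq> 0" "u2 z \<noteq> 0" using un z by auto
      have ne1: "z \<noteq> a" if "a \<in> set zs1" for a using that W1(4)[OF that] z by auto
      have ne2: "z \<noteq> a" if "a \<in> set zs2" for a using that W2(4)[OF that] z by auto
      have "ln (norm (u1 z)) = ln (norm (\<Prod>a\<leftarrow>zs1. z - a)) + ln (norm (W1 z))"
        using z1 unfolding W1(3)[of z] norm_mult by (subst ln_mult) auto
      also have "ln (norm (\<Prod>a\<leftarrow>zs1. z - a)) = (\<Sum>a\<leftarrow>zs1. ln (norm (z - a)))"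
        by (rule ln_norm_prod_list[OF ne1])
      also have "ln (norm (W1 z)) = Re (k1 z)" using k1(3)[of z] k1(1) z by simp
      finally have e1: "Re (k1 z) = ln (norm (u1 z)) - (\<Sum>a\<leftarrow>zs1. ln (norm (z - a)))" by simp
      have "ln (norm (u2 z)) = ln (norm (\<Prod>a\<leftarrow>zs2. z - a)) + ln (norm (W2 z))"
        using z1 unfolding W2(3)[of z] norm_mult by (subst ln_mult) auto
      also have "ln (norm (\<Prod>a\<leftarrow>zs2. z - a)) = (\<Sum>a\<leftarrow>zs2. ln (norm (z - a)))"
        by (rule ln_norm_prod_list[OF ne2])
      also have "ln (norm (W2 z)) = Re (k2 z)" using k2(3)[of z] k2(1) z by simp
      finally have e2: "Re (k2 z) = ln (norm (u2 z)) - (\<Sum>a\<leftarrow>zs2. ln (norm (z - a)))" by simp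
      have s1: "(\<Sum>a\<leftarrow>xs. ln (norm (z - a)) - ln \<rho>) = (\<Sum>a\<leftarrow>xs. ln (norm (z - a))) - length xs * ln \<rho>" for xs
        by (induction xs) (auto simp: algebra_simps)
      have "Re (k z) = (ln (norm (u1 z)) - ln (norm (u2 z)))
          - (\<Sum>a\<leftarrow>zs1. ln (norm (z - a)) - ln \<rho>) + (\<Sum>a\<leftarrow>zs2. ln (norm (z - a)) - ln \<rho>)"
        unfolding s1 by (simp add: k_def e1 e2 c_def algebra_simps)
      moreover have "\<bar>\<Sum>a\<leftarrow>xs. ln (norm (z - a)) - ln \<rho>\<bar> \<le> (\<Sum>a\<leftarrow>xs. e a z)" for xs
        by (induction xs) (auto simp: e_def)
      then have "\<bar>\<Sum>a\<leftarrow>zs1. ln (norm (z - a)) - ln \<rho>\<bar> \<le> (\<Sum>a\<leftarrow>zs1. e a z)"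
        "\<bar>\<Sum>a\<leftarrow>zs2. ln (norm (z - a)) - ln \<rho>\<bar> \<le> (\<Sum>a\<leftarrow>zs2. e a z)" by blast+
      moreover have "\<bar>ln (norm (u1 z)) - ln (norm (u2 z))\<bar> \<le> B z"
        using z1 by (auto simp: B_def max_def)
      ultimately show ?thesis by (simp add: zs_def)
    qed
    have ck: "continuous_on (sphere 0 \<rho>) k"
      using holomorphic_on_imp_continuous_on[OF kh] by (rule continuous_on_subset) auto
    have "circle_mean \<rho> (\<lambda>z. \<bar>Re (k z)\<bar>) \<le> circle_mean \<rho> (\<lambda>z. B z + (\<Sum>a\<leftarrow>zs. e a z))"
      using Rek \<rho> by (intro circle_mean_mono) (auto intro!: continuous_intros ck cB csum)
    also have "\<dots> = circle_mean \<rho> B + (\<Sum>a\<leftarrow>zs. circle_mean \<rho> (e a))"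
      using circle_mean_add[OF cB csum(2)] csum(1) \<rho> by simp
    also have "(\<Sum>a\<leftarrow>zs. circle_mean \<rho> (e a)) \<le> (\<Sum>a\<leftarrow>zs. 2 * ln 2)"
      unfolding e_def by (intro sum_list_mono circle_mean_abs_ln_linear zsn)
    also have "\<dots> = 2 * ln 2 * n" by (simp add: sum_list_triv n_def)
    also have "circle_mean \<rho> B = 2 * X \<rho> - circle_mean \<rho> (\<lambda>z. ln (norm (u1 z))) - circle_mean \<rho> (\<lambda>z. ln (norm (u2 z)))"
    proof -
      have c2: "continuous_on (sphere 0 \<rho>) (\<lambda>z. 2 * ln (max (norm (u1 z)) (norm (u2 z))))"
        by (intro continuous_on_mult continuous_on_const cl) auto
      have c3: "continuous_on (sphere 0 \<rho>) (\<lambda>z. 2 * ln (max (norm (u1 z)) (norm (u2 z))) - ln (norm (u1 z)))"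
        by (intro continuous_on_diff c2 cl) auto
      have in\<rho>: "\<rho> \<in> {r, \<rho>, R}" by simp
      have \<rho>0: "0 \<le> \<rho>" using \<rho> by simp
      show ?thesis unfolding B_def X_def circle_mean_diff[OF c3 cl(2)[OF in\<rho>] \<rho>0]
        circle_mean_diff[OF c2 cl(1)[OF in\<rho>] \<rho>0] circle_mean_cmult ..
    qed
    also have "2 * X \<rho> - circle_mean \<rho> (\<lambda>z. ln (norm (u1 z))) - circle_mean \<rho> (\<lambda>z. ln (norm (u2 z))) \<le> 2 * X \<rho> + C"
      using C3(2)[OF \<rho>(1) un1[of \<rho>]] C4(2)[OF \<rho>(1) un2[of \<rho>]] C1(1) C2(1) by (simp add: C_def)
    finally have meank: "circle_mean \<rho> (\<lambda>z. \<bar>Re (k z)\<bar>) \<le> 2 * X \<rho> + C + 2 * ln 2 * n" by simp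
    have "circle_mean \<rho> (\<lambda>z. 0) \<le> circle_mean \<rho> (\<lambda>z. \<bar>Re (k z)\<bar>)"
      using \<rho> by (intro circle_mean_mono) (auto intro!: continuous_intros ck)
    then have nnK: "0 \<le> 2 * X \<rho> + C + 2 * ln 2 * n" using meank by simp
    define K where "K = 2 * \<rho> / (\<rho> - r)\<^sup>2 * (2 * X \<rho> + C + 2 * ln 2 * n)"
    have dkb: "norm (deriv k z) \<le> K" if z: "norm z = r" for z
    proof -
      have "norm (deriv k z) \<le> 2 * \<rho> / (\<rho> - r)\<^sup>2 * circle_mean \<rho> (\<lambda>w. \<bar>Re (k w)\<bar>)"
        using deriv_bound_Re_mean[OF kh, of z] z rR by simp
      also have "\<dots> \<le> K" unfolding K_def using meank \<rho> by (intro mult_left_mono) auto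
      finally show ?thesis .
    qed
    have K0: "0 \<le> K" using dkb[of "of_real r"] \<rho> by (metis norm_ge_zero norm_of_real abs_of_pos order_trans)
    define L where "L = (\<lambda>z. deriv u1 z / u1 z - deriv u2 z / u2 z)"
    have cL: "continuous_on (sphere 0 r) L"
    proof -
      have "deriv u1 holomorphic_on UNIV" "deriv u2 holomorphic_on UNIV"
        using u by (auto intro!: holomorphic_intros)
      then have "continuous_on (sphere 0 r) (deriv u1)" "continuous_on (sphere 0 r) (deriv u2)"
        by (auto intro: holomorphic_on_imp_continuous_on continuous_on_subset)
      then show ?thesis unfolding L_def using un uc by (intro continuous_on_diff continuous_on_divide) auto
    qed
    have zsr: "norm a \<noteq> r" if "a \<in> set zs" for a
      using that W1(4) W2(4) un[of a] by (auto simp: zs_def)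
    have sq: "sqrt (norm (L z)) \<le> sqrt K + (\<Sum>a\<leftarrow>zs. 1 / sqrt (norm (z - a)))" if z: "norm z = r" for z
    proof -
      have z1: "u1 z \<noteq> 0" "u2 z \<noteq> 0" using un z by auto
      have "L z = (\<Sum>a\<leftarrow>zs1. 1 / (z - a)) - (\<Sum>a\<leftarrow>zs2. 1 / (z - a)) + deriv k z"
        unfolding L_def deriv_prod_list_linear[OF W1(1,3) z1(1)] deriv_prod_list_linear[OF W2(1,3) z1(2)]
        using dk[of z] z rR by simp
      then have "norm (L z) \<le> norm (\<Sum>a\<leftarrow>zs1. 1 / (z - a)) + norm (\<Sum>a\<leftarrow>zs2. 1 / (z - a)) + norm (deriv k z)"
        by (simp add: norm_triangle_le norm_triangle_ineq4)
      also have "\<dots> \<le> (\<Sum>a\<leftarrow>zs1. norm (1 / (z - a))) + (\<Sum>a\<leftarrow>zs2. norm (1 / (z - a))) + K"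
        using norm_sum_list_le[of "map (\<lambda>a. 1 / (z - a)) zs1"] norm_sum_list_le[of "map (\<lambda>a. 1 / (z - a)) zs2"] dkb[OF z]
        by (intro add_mono) (auto simp: o_def)
      also have "\<dots> = sum_list (K # map (\<lambda>a. norm (1 / (z - a))) zs)" by (simp add: zs_def)
      finally have "sqrt (norm (L z)) \<le> sqrt (sum_list (K # map (\<lambda>a. norm (1 / (z - a))) zs))" by simp
      also have "\<dots> \<le> (\<Sum>x\<leftarrow>K # map (\<lambda>a. norm (1 / (z - a))) zs. sqrt x)"
        by (rule sqrt_sum_list_le) (use K0 in auto)
      also have "\<dots> = sqrt K + (\<Sum>a\<leftarrow>zs. 1 / sqrt (norm (z - a)))"
        by (simp add: o_def norm_divide real_sqrt_divide)
      finally show ?thesis .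
    qed
    have ci: "continuous_on (sphere 0 r) (\<lambda>z. 1 / sqrt (norm (z - a)))" if "a \<in> set zs" for a
      using zsr[OF that] by (intro continuous_intros) auto
    have csum2: "circle_mean r (\<lambda>z. \<Sum>a\<leftarrow>zs. 1 / sqrt (norm (z - a))) = (\<Sum>a\<leftarrow>zs. circle_mean r (\<lambda>z. 1 / sqrt (norm (z - a))))"
      "continuous_on (sphere 0 r) (\<lambda>z. \<Sum>a\<leftarrow>zs. 1 / sqrt (norm (z - a)))"
      using circle_mean_sum_list[of zs r "\<lambda>a z. 1 / sqrt (norm (z - a))"] ci \<rho> by auto
    have csL: "continuous_on (sphere 0 r) (\<lambda>z. sqrt (norm (L z)))"
      by (intro continuous_on_real_sqrt continuous_on_norm cL)
    have "circle_mean r (\<lambda>z. sqrt (norm (L z))) \<le> circle_mean r (\<lambda>z. sqrt K + (\<Sum>a\<leftarrow>zs. 1 / sqrt (norm (z - a))))"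
      using sq \<rho> by (intro circle_mean_mono csL continuous_on_add continuous_on_const csum2) auto
    also have "\<dots> = sqrt K + (\<Sum>a\<leftarrow>zs. circle_mean r (\<lambda>z. 1 / sqrt (norm (z - a))))"
      using circle_mean_add[OF continuous_on_const csum2(2)] csum2(1) \<rho> by simp
    also have "(\<Sum>a\<leftarrow>zs. circle_mean r (\<lambda>z. 1 / sqrt (norm (z - a)))) \<le> (\<Sum>a\<leftarrow>zs. sqrt 2)"
    proof (rule sum_list_mono)
      fix a assume "a \<in> set zs"
      from circle_mean_inverse_sqrt[OF zsr[OF this] \<rho>(3)]
      have "circle_mean r (\<lambda>z. 1 / sqrt (norm (z - a))) \<le> sqrt 2 / sqrt r" .
      also have "\<dots> \<le> sqrt 2 / 1" using rR by (intro divide_left_mono) auto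
      finally show "circle_mean r (\<lambda>z. 1 / sqrt (norm (z - a))) \<le> sqrt 2" by simp
    qed
    also have "\<dots> = sqrt 2 * n" by (simp add: sum_list_triv n_def)
    finally have msq: "circle_mean r (\<lambda>z. sqrt (norm (L z))) \<le> sqrt K + sqrt 2 * n" by simp
    have cl1: "continuous_on (sphere 0 r) (\<lambda>z. ln (1 + norm (L z)))"
      by (intro continuous_on_ln_1_plus continuous_on_norm cL) auto
    have cl2: "continuous_on (sphere 0 r) (\<lambda>z. 2 * ln (1 + sqrt (norm (L z))))"
      by (intro continuous_on_mult continuous_on_const continuous_on_ln_1_plus csL) auto
    have "circle_mean r (\<lambda>z. ln (1 + norm (L z))) \<le> circle_mean r (\<lambda>z. 2 * ln (1 + sqrt (norm (L z))))"
    proof (rule circle_mean_mono[OF cl1 cl2])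
      fix z :: complex
      define x where "x = sqrt (norm (L z))"
      have x: "0 \<le> x" "norm (L z) = x\<^sup>2" by (auto simp: x_def)
      have "ln (1 + x\<^sup>2) \<le> ln ((1 + x)\<^sup>2)" using x(1)
        by (intro ln_mono) (auto simp: power2_eq_square algebra_simps intro: add_pos_nonneg)
      also have "\<dots> = 2 * ln (1 + x)" using x(1) by (simp add: ln_realpow)
      finally show "ln (1 + norm (L z)) \<le> 2 * ln (1 + sqrt (norm (L z)))" using x by simp
    qed (use \<rho> in auto)
    also have "\<dots> = 2 * circle_mean r (\<lambda>z. ln (1 + sqrt (norm (L z))))" by (rule circle_mean_cmult)
    also have "circle_mean r (\<lambda>z. ln (1 + sqrt (norm (L z)))) \<le> ln (1 + (sqrt K + sqrt 2 * n))"
      using K0 by (intro circle_mean_ln_1_plus_le csL msq) (use \<rho> in \<open>auto simp: n_def\<close>)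
    finally have "circle_mean r (\<lambda>z. ln (1 + norm (L z))) \<le> 2 * ln (1 + (sqrt K + sqrt 2 * n))" by simp
    then show ?thesis using nbound nnK unfolding L_def K_def by (intro exI[of _ n]) (auto simp: n_def)
  qed
  have "0 \<le> C" using C1(1) C2(1) C3(1) C4(1) by (simp add: C_def)
  then show ?thesis using main unfolding X_def by blast
qed

section \<open>Small functions\<close>

definition growth :: "(real \<Rightarrow> real) \<Rightarrow> bool" where
  "growth \<Lambda> \<longleftrightarrow> (\<forall>S\<ge>1. 1 \<le> \<Lambda> S) \<and> (\<forall>r\<ge>1. \<forall>S\<ge>r. \<Lambda> r \<le> \<Lambda> S)"

text \<open>
  The error term of Nevanlinna theory. A second radius \<open>S > r\<close> is carried along instead of an
  exceptional set of radii: \<open>\<Lambda> S\<close> is compared with \<open>\<Lambda> r\<close> only at the very end, in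
  \<open>no_slow_growth\<close>.
\<close>

definition err :: "(real \<Rightarrow> real) \<Rightarrow> real \<Rightarrow> real \<Rightarrow> real" where
  "err \<Lambda> r S = 1 + ln (\<Lambda> S * (S / (S - r)))"

text \<open>
  The countable set \<open>D\<close> consists of radii whose circles meet zeros or poles of the functions
  concerned; it lets values at a discrete set of points be ignored.
\<close>

definition small :: "(real \<Rightarrow> real) \<Rightarrow> (complex \<Rightarrow> complex) \<Rightarrow> bool" where
  "small \<Lambda> \<phi> \<longleftrightarrow> (\<exists>C D. 0 \<le> C \<and> countable D \<and> (\<forall>r\<ge>1. r \<notin> D \<longrightarrow> continuous_on (sphere 0 r) \<phi> \<and>
     (\<forall>S>r. circle_mean r (\<lambda>z. ln (1 + norm (\<phi> z))) \<le> C * err \<Lambda> r S)))"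

lemma err_arg_ge_1:
  assumes "growth \<Lambda>" "1 \<le> r" "r < S"
  shows "1 \<le> S / (S - r)" "1 \<le> \<Lambda> S" "1 \<le> \<Lambda> S * (S / (S - r))"
proof -
  show 1: "1 \<le> S / (S - r)" using assms by (simp add: field_simps)
  show 2: "1 \<le> \<Lambda> S" using assms unfolding growth_def by auto
  have "1 * 1 \<le> \<Lambda> S * (S / (S - r))" using 1 2 by (intro mult_mono) auto
  then show "1 \<le> \<Lambda> S * (S / (S - r))" by simp
qed

lemma err_ge_1: "growth \<Lambda> \<Longrightarrow> 1 \<le> r \<Longrightarrow> r < S \<Longrightarrow> 1 \<le> err \<Lambda> r S"
  using err_arg_ge_1(3)[of \<Lambda> r S] by (simp add: err_def)

lemma cosparse_generic_radius:
  assumes "\<forall>\<^sub>\<approx>z. P (z::complex)"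
  shows "\<exists>D. countable D \<and> (\<forall>r. r \<notin> D \<longrightarrow> (\<forall>z. norm z = r \<longrightarrow> P z))"
proof -
  have "countable (UNIV \<inter> {z. \<not> P z})"
    using assms by (intro sparse_imp_countable) (auto simp: eventually_cosparse)
  then have "countable (norm ` {z. \<not> P z})" by simp
  then show ?thesis by (intro exI[of _ "norm ` {z. \<not> P z}"]) auto
qed

lemma continuous_on_ln_1_plus_norm:
  fixes \<phi> :: "'a::topological_space \<Rightarrow> complex"
  shows "continuous_on S \<phi> \<Longrightarrow> continuous_on S (\<lambda>z. ln (1 + norm (\<phi> z)))"
  by (intro continuous_on_ln_1_plus continuous_on_norm) auto

lemma small_cong:
  assumes \<phi>: "small \<Lambda> \<phi>" and eq: "\<forall>\<^sub>\<approx>z. \<phi> z = \<psi> z"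
  shows "small \<Lambda> \<psi>"
proof -
  obtain C D where C: "0 \<le> C" "countable D"
    "\<And>r. 1 \<le> r \<Longrightarrow> r \<notin> D \<Longrightarrow> continuous_on (sphere 0 r) \<phi> \<and>
     (\<forall>S>r. circle_mean r (\<lambda>z. ln (1 + norm (\<phi> z))) \<le> C * err \<Lambda> r S)"
    using \<phi> unfolding small_def by blast
  obtain D' where D': "countable D'" "\<And>r z. r \<notin> D' \<Longrightarrow> norm z = r \<Longrightarrow> \<phi> z = \<psi> z"
    using cosparse_generic_radius[OF eq] by blast
  have "continuous_on (sphere 0 r) \<psi> \<and>
     (\<forall>S>r. circle_mean r (\<lambda>z. ln (1 + norm (\<psi> z))) \<le> C * err \<Lambda> r S)"
    if r: "1 \<le> r" "r \<notin> D \<union> D'" for r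
  proof -
    have e: "\<phi> z = \<psi> z" if "norm z = r" for z using D'(2)[of r z] r that by auto
    have "continuous_on (sphere 0 r) \<psi> = continuous_on (sphere 0 r) \<phi>"
      by (intro continuous_on_cong) (auto simp: e)
    moreover have "circle_mean r (\<lambda>z. ln (1 + norm (\<psi> z))) = circle_mean r (\<lambda>z. ln (1 + norm (\<phi> z)))"
      using r by (intro circle_mean_cong) (auto simp: e)
    ultimately show ?thesis using C(3)[of r] r by auto
  qed
  then show ?thesis unfolding small_def using C(1,2) D'(1)
    by (intro exI[of _ C] exI[of _ "D \<union> D'"]) auto
qed

text \<open>
  All closure properties follow from the subadditivity of \<open>\<phi> \<mapsto> ln (1 + |\<phi>|)\<close> in the sense of
  the last assumption.
\<close>

lemma small_combine:
  assumes g: "growth \<Lambda>" and \<phi>: "small \<Lambda> \<phi>" and \<psi>: "small \<Lambda> \<psi>"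
    and c: "\<And>S. continuous_on S \<phi> \<Longrightarrow> continuous_on S \<psi> \<Longrightarrow> continuous_on S \<omega>"
    and b: "\<And>z. 1 + norm (\<omega> z) \<le> (1 + norm (\<phi> z)) * (1 + norm (\<psi> z))"
  shows "small \<Lambda> \<omega>"
proof -
  obtain C D where C: "0 \<le> C" "countable D"
    "\<And>r. 1 \<le> r \<Longrightarrow> r \<notin> D \<Longrightarrow> continuous_on (sphere 0 r) \<phi> \<and>
     (\<forall>S>r. circle_mean r (\<lambda>z. ln (1 + norm (\<phi> z))) \<le> C * err \<Lambda> r S)"
    using \<phi> unfolding small_def by blast
  obtain C' D' where C': "0 \<le> C'" "countable D'"
    "\<And>r. 1 \<le> r \<Longrightarrow> r \<notin> D' \<Longrightarrow> continuous_on (sphere 0 r) \<psi> \<and>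
     (\<forall>S>r. circle_mean r (\<lambda>z. ln (1 + norm (\<psi> z))) \<le> C' * err \<Lambda> r S)"
    using \<psi> unfolding small_def by blast
  have "continuous_on (sphere 0 r) \<omega> \<and>
     (\<forall>S>r. circle_mean r (\<lambda>z. ln (1 + norm (\<omega> z))) \<le> (C + C') * err \<Lambda> r S)"
    if r: "1 \<le> r" "r \<notin> D \<union> D'" for r
  proof (intro conjI allI impI)
    have c1: "continuous_on (sphere 0 r) \<phi>" and c2: "continuous_on (sphere 0 r) \<psi>"
      using C(3)[of r] C'(3)[of r] r by auto
    show c3: "continuous_on (sphere 0 r) \<omega>" using c[OF c1 c2] .
    fix S assume S: "r < S"
    have "circle_mean r (\<lambda>z. ln (1 + norm (\<omega> z))) \<le>
        circle_mean r (\<lambda>z. ln (1 + norm (\<phi> z)) + ln (1 + norm (\<psi> z)))"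
    proof (rule circle_mean_mono)
      fix z :: complex
      have p: "0 < 1 + norm (\<omega> z)" "0 < 1 + norm (\<phi> z)" "0 < 1 + norm (\<psi> z)"
        by (simp_all add: add_pos_nonneg)
      have "ln (1 + norm (\<omega> z)) \<le> ln ((1 + norm (\<phi> z)) * (1 + norm (\<psi> z)))"
        using b[of z] p by (intro ln_mono) auto
      then show "ln (1 + norm (\<omega> z)) \<le> ln (1 + norm (\<phi> z)) + ln (1 + norm (\<psi> z))"
        using p by (simp add: ln_mult_pos)
    qed (use r in \<open>auto intro!: continuous_on_add continuous_on_ln_1_plus_norm c1 c2 c3\<close>)
    also have "\<dots> = circle_mean r (\<lambda>z. ln (1 + norm (\<phi> z))) + circle_mean r (\<lambda>z. ln (1 + norm (\<psi> z)))"
      using r by (intro circle_mean_add continuous_on_ln_1_plus_norm c1 c2) auto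
    also have "\<dots> \<le> C * err \<Lambda> r S + C' * err \<Lambda> r S"
      using C(3)[of r] C'(3)[of r] r S by (intro add_mono) auto
    finally show "circle_mean r (\<lambda>z. ln (1 + norm (\<omega> z))) \<le> (C + C') * err \<Lambda> r S"
      by (simp add: algebra_simps)
  qed
  then show ?thesis unfolding small_def using C(1,2) C'(1,2)
    by (intro exI[of _ "C + C'"] exI[of _ "D \<union> D'"]) auto
qed

lemma small_const:
  assumes g: "growth \<Lambda>"
  shows "small \<Lambda> (\<lambda>z. c)"
  unfolding small_def
proof (intro exI[of _ "ln (1 + norm c)"] exI[of _ "{}"] conjI allI impI)
  show "0 \<le> ln (1 + norm c)" by simp
  fix r S :: real assume "1 \<le> r" "r < S"
  then have "1 \<le> err \<Lambda> r S" using g err_ge_1 by blast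
  then have "ln (1 + norm c) * 1 \<le> ln (1 + norm c) * err \<Lambda> r S" by (intro mult_left_mono) auto
  then show "circle_mean r (\<lambda>z. ln (1 + norm c)) \<le> ln (1 + norm c) * err \<Lambda> r S" by simp
qed auto

lemma small_add: "growth \<Lambda> \<Longrightarrow> small \<Lambda> \<phi> \<Longrightarrow> small \<Lambda> \<psi> \<Longrightarrow> small \<Lambda> (\<lambda>z. \<phi> z + \<psi> z)"
proof (rule small_combine)
  fix z :: complex
  have "norm (\<phi> z + \<psi> z) \<le> norm (\<phi> z) + norm (\<psi> z)" by (rule norm_triangle_ineq)
  then show "1 + norm (\<phi> z + \<psi> z) \<le> (1 + norm (\<phi> z)) * (1 + norm (\<psi> z))"
    using mult_nonneg_nonneg[OF norm_ge_zero[of "\<phi> z"] norm_ge_zero[of "\<psi> z"]]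
    unfolding distrib_left distrib_right mult_1_left mult_1_right by linarith
qed (auto intro!: continuous_intros)

lemma small_mult: "growth \<Lambda> \<Longrightarrow> small \<Lambda> \<phi> \<Longrightarrow> small \<Lambda> \<psi> \<Longrightarrow> small \<Lambda> (\<lambda>z. \<phi> z * \<psi> z)"
  by (rule small_combine[of \<Lambda> \<phi> \<psi>]) (auto intro!: continuous_intros simp: norm_mult algebra_simps)

lemma small_cmult: "growth \<Lambda> \<Longrightarrow> small \<Lambda> \<phi> \<Longrightarrow> small \<Lambda> (\<lambda>z. c * \<phi> z)"
  by (rule small_mult[OF _ small_const])

lemma small_diff: "growth \<Lambda> \<Longrightarrow> small \<Lambda> \<phi> \<Longrightarrow> small \<Lambda> \<psi> \<Longrightarrow> small \<Lambda> (\<lambda>z. \<phi> z - \<psi> z)"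
  using small_add[of \<Lambda> \<phi> "\<lambda>z. (-1) * \<psi> z"] small_cmult[of \<Lambda> \<psi> "-1"] by simp

lemma small_power: "growth \<Lambda> \<Longrightarrow> small \<Lambda> \<phi> \<Longrightarrow> small \<Lambda> (\<lambda>z. \<phi> z ^ k)"
  by (induction k) (auto intro: small_const small_mult)

lemma small_sum:
  "growth \<Lambda> \<Longrightarrow> (\<And>i. i \<in> I \<Longrightarrow> small \<Lambda> (\<phi> i)) \<Longrightarrow> small \<Lambda> (\<lambda>z. \<Sum>i\<in>I. \<phi> i z)"
  by (induction I rule: infinite_finite_induct) (auto intro: small_const small_add)

lemma small_norm:
  assumes "growth \<Lambda>" "small \<Lambda> \<phi>" shows "small \<Lambda> (\<lambda>z. of_real (norm (\<phi> z)))"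
  by (rule small_combine[OF assms small_const[OF assms(1), of 0]]) (auto intro!: continuous_intros)

text \<open>
  The lemma on the logarithmic derivative. The three radii of \<open>log_deriv_mean_estimate\<close> are
  chosen between \<open>r\<close> and \<open>S\<close> at distances comparable to \<open>S - r\<close>, so that all quantities in the
  estimate are bounded by powers of \<open>\<Lambda> S * (S / (S - r))\<close>; the outer logarithm turns this into
  \<open>err\<close>.
\<close>

lemma small_log_deriv:
  assumes g: "growth \<Lambda>" and u: "u1 holomorphic_on UNIV" "u2 holomorphic_on UNIV"
    and nz: "u1 z1 \<noteq> 0" "u2 z2 \<noteq> 0"
    and adm: "\<exists>C D. countable D \<and> (\<forall>t\<ge>1. t \<notin> D \<longrightarrow> (\<forall>S>t.
      circle_mean t (\<lambda>z. ln (max (norm (u1 z)) (norm (u2 z)))) \<le> C * (\<Lambda> S * (S / (S - t)))))"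
  shows "small \<Lambda> (\<lambda>z. deriv u1 z / u1 z - deriv u2 z / u2 z)"
proof -
  define X where "X = (\<lambda>t. circle_mean t (\<lambda>z. ln (max (norm (u1 z)) (norm (u2 z)))))"
  obtain C0' D0 where C0': "countable D0" "\<And>t S. 1 \<le> t \<Longrightarrow> t \<notin> D0 \<Longrightarrow> t < S \<Longrightarrow>
      X t \<le> C0' * (\<Lambda> S * (S / (S - t)))"
    using adm unfolding X_def by blast
  define C0 where "C0 = max 0 C0'"
  have C0: "0 \<le> C0" and X: "X t \<le> C0 * (\<Lambda> S * (S / (S - t)))" if "1 \<le> t" "t \<notin> D0" "t < S" for t S
  proof -
    have "1 \<le> \<Lambda> S * (S / (S - t))" using err_arg_ge_1(3)[OF g] that by blast
    then have "C0' * (\<Lambda> S * (S / (S - t))) \<le> C0 * (\<Lambda> S * (S / (S - t)))"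
      unfolding C0_def by (intro mult_right_mono) auto
    then show "X t \<le> C0 * (\<Lambda> S * (S / (S - t)))" using C0'(2)[OF that] by simp
  qed (simp add: C0_def)
  have C0: "0 \<le> C0" by (simp add: C0_def)
  have ev: "\<forall>\<^sub>\<approx>z. u1 z \<noteq> 0 \<and> u2 z \<noteq> 0"
  proof (rule eventually_conj)
    show "\<forall>\<^sub>\<approx>z. u1 z \<noteq> 0" "\<forall>\<^sub>\<approx>z. u2 z \<noteq> 0"
      using nicely_meromorphic_imp_constant_or_avoid[of u1 UNIV 0] nicely_meromorphic_imp_constant_or_avoid[of u2 UNIV 0]
        nz u analytic_on_imp_nicely_meromorphic_on[of _ UNIV] analytic_on_open[of UNIV]
      by (auto simp: connected_UNIV)
  qed
  obtain D1 where D1: "countable D1" "\<And>r z. r \<notin> D1 \<Longrightarrow> norm z = r \<Longrightarrow> u1 z \<noteq> 0 \<and> u2 z \<noteq> 0"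
    using cosparse_generic_radius[OF ev] by blast
  define D where "D = D0 \<union> D1"
  have D: "countable D" using D1(1) C0'(1) by (simp add: D_def)
  obtain C where C: "0 \<le> C" "\<And>r \<rho> R. 1 \<le> r \<and> r < \<rho> \<and> \<rho> < R \<and>
      (\<forall>z. norm z \<in> {r, \<rho>, R} \<longrightarrow> u1 z \<noteq> 0 \<and> u2 z \<noteq> 0) \<Longrightarrow>
      (\<exists>n\<ge>0. n * ln (R / \<rho>) \<le> 2 * X R + C \<and> 0 \<le> 2 * X \<rho> + C + 2 * ln 2 * n \<and>
        circle_mean r (\<lambda>z. ln (1 + norm (deriv u1 z / u1 z - deriv u2 z / u2 z))) \<le>
        2 * ln (1 + (sqrt (2 * \<rho> / (\<rho> - r)\<^sup>2 * (2 * X \<rho> + C + 2 * ln 2 * n)) + sqrt 2 * n)))"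
    using log_deriv_mean_estimate[OF u nz] unfolding X_def by blast
  define c1 where "c1 = 5 * (10 * C0 + C)"
  define c2 where "c2 = 50 * (10 * C0 + C + 2 * c1)"
  define c3 where "c3 = 1 + sqrt c2 + 2 * c1"
  have c: "0 \<le> c1" "0 \<le> c2" "1 \<le> c3" using C0 C(1) by (auto simp: c1_def c2_def c3_def)
  have main: "circle_mean r (\<lambda>z. ln (1 + norm (deriv u1 z / u1 z - deriv u2 z / u2 z)))
      \<le> (2 * ln c3 + 4) * err \<Lambda> r S" if r: "1 \<le> r" "r \<notin> D" and S: "r < S" for r S
  proof -
    define d where "d = (S - r) / 5"
    have d: "0 < d" using S by (simp add: d_def)
    obtain \<rho> where \<rho>: "r + d < \<rho>" "\<rho> < r + 2 * d" "\<rho> \<notin> D"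
      using real_interval_avoid_countable_set[of "r + d" "r + 2 * d" D] D d by auto
    obtain R where R: "r + 3 * d < R" "R < r + 4 * d" "R \<notin> D"
      using real_interval_avoid_countable_set[of "r + 3 * d" "r + 4 * d" D] D d by auto
    define Q where "Q = S / (S - r)"
    define Y where "Y = \<Lambda> S * Q"
    have Q: "1 \<le> Q" and L: "1 \<le> \<Lambda> S" and Y: "1 \<le> Y"
      using err_arg_ge_1[OF g r(1) S] by (auto simp: Q_def Y_def)
    have QY: "Q \<le> Y" using L Q by (simp add: Y_def mult_le_cancel_right1)
    have Sd: "S = r + 5 * d" by (simp add: d_def field_simps)
    have S1: "1 \<le> S" using r S by simp
    have Qd: "Q = S / (5 * d)" using Sd by (simp add: Q_def)
    have near: "X t \<le> 5 * C0 * Y" if t: "1 \<le> t" "t \<notin> D" "t < r + 4 * d" for t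
    proof -
      have "S / (S - t) \<le> S / d" using t d S1 Sd by (intro divide_left_mono mult_pos_pos) auto
      also have "\<dots> = 5 * Q" using d by (simp add: Qd)
      finally have "\<Lambda> S * (S / (S - t)) \<le> \<Lambda> S * (5 * Q)" using L by (intro mult_left_mono) auto
      then have "C0 * (\<Lambda> S * (S / (S - t))) \<le> C0 * (\<Lambda> S * (5 * Q))" using C0 by (rule mult_left_mono)
      then show ?thesis using X[of t S] t d Sd by (simp add: D_def Y_def mult_ac)
    qed
    have X\<rho>: "X \<rho> \<le> 5 * C0 * Y" by (rule near) (use r \<rho> d in auto)
    have XR: "X R \<le> 5 * C0 * Y" by (rule near) (use r R d in auto)
    have "1 \<le> r \<and> r < \<rho> \<and> \<rho> < R \<and> (\<forall>z. norm z \<in> {r, \<rho>, R} \<longrightarrow> u1 z \<noteq> 0 \<and> u2 z \<noteq> 0)"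
      using r \<rho> R d D1(2) by (auto simp: D_def)
    from C(2)[OF this] obtain n where n: "0 \<le> n" "n * ln (R / \<rho>) \<le> 2 * X R + C"
      "0 \<le> 2 * X \<rho> + C + 2 * ln 2 * n"
      "circle_mean r (\<lambda>z. ln (1 + norm (deriv u1 z / u1 z - deriv u2 z / u2 z))) \<le>
        2 * ln (1 + (sqrt (2 * \<rho> / (\<rho> - r)\<^sup>2 * (2 * X \<rho> + C + 2 * ln 2 * n)) + sqrt 2 * n))" by blast
    have \<rho>R: "1 \<le> \<rho>" "\<rho> < R" "d \<le> R - \<rho>" "R \<le> S" "d \<le> \<rho> - r" "\<rho> \<le> S"
      using r \<rho> R d Sd by auto
    have lnb: "1 / (5 * Q) \<le> ln (R / \<rho>)"
    proof -
      have "1 / (5 * Q) = d / S" using d S1 by (simp add: Qd)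
      also have "\<dots> \<le> d / R" using \<rho>R d by (intro divide_left_mono) auto
      also have "\<dots> \<le> (R - \<rho>) / R" using \<rho>R by (intro divide_right_mono) auto
      also have "\<dots> = 1 - \<rho> / R" using \<rho>R by (simp add: field_simps)
      also have "\<dots> \<le> - ln (\<rho> / R)" using ln_le_minus_one[of "\<rho> / R"] \<rho>R by simp
      also have "\<dots> = ln (R / \<rho>)" using \<rho>R by (simp add: ln_divide_pos)
      finally show ?thesis .
    qed
    have "n * (1 / (5 * Q)) \<le> n * ln (R / \<rho>)" using n(1) lnb by (intro mult_left_mono)
    also have "\<dots> \<le> 10 * C0 * Y + C * Y"
    proof -
      have "C * 1 \<le> C * Y" using C(1) Y by (intro mult_left_mono)
      then show ?thesis using n(2) XR by simp
    qed
    finally have "n \<le> (10 * C0 * Y + C * Y) * (5 * Q)" using Q by (simp add: field_simps)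
    also have "\<dots> \<le> (10 * C0 * Y + C * Y) * (5 * Y)"
      using QY C0 C(1) Y by (intro mult_left_mono) auto
    also have "\<dots> = c1 * Y\<^sup>2" by (simp add: c1_def power2_eq_square algebra_simps)
    finally have nb: "n \<le> c1 * Y\<^sup>2" .
    have YY: "Y \<le> Y\<^sup>2" "1 \<le> Y\<^sup>2"
      using Y self_le_power[of Y 2] one_le_power[of Y 2] by auto
    define K where "K = 2 * \<rho> / (\<rho> - r)\<^sup>2 * (2 * X \<rho> + C + 2 * ln 2 * n)"
    have Kb: "K \<le> c2 * (Y\<^sup>2)\<^sup>2"
    proof -
      have a: "2 * \<rho> / (\<rho> - r)\<^sup>2 \<le> 50 * Y\<^sup>2"
      proof -
        have "d\<^sup>2 \<le> (\<rho> - r)\<^sup>2" using \<rho>R d by (intro power_mono) auto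
        then have "2 * \<rho> / (\<rho> - r)\<^sup>2 \<le> 2 * S / d\<^sup>2"
          using \<rho>R d by (intro frac_le) auto
        also have "\<dots> \<le> 2 * (S * S) / d\<^sup>2"
          using S1 d mult_left_mono[OF S1, of S] by (intro divide_right_mono) auto
        also have "\<dots> = 50 * Q\<^sup>2" using d by (simp add: Qd power2_eq_square)
        also have "\<dots> \<le> 50 * Y\<^sup>2" using QY Q by (intro mult_left_mono power_mono) auto
        finally show ?thesis .
      qed
      have "2 * X \<rho> + C + 2 * ln 2 * n \<le> (10 * C0 + C + 2 * c1) * Y\<^sup>2"
      proof -
        have "10 * C0 * Y \<le> 10 * C0 * Y\<^sup>2" "C * 1 \<le> C * Y\<^sup>2"
          using mult_left_mono[OF YY(2) C(1)] mult_left_mono[OF YY(1), of "10 * C0"] C0 by auto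
        moreover have "2 * ln 2 * n \<le> 2 * (c1 * Y\<^sup>2)"
        proof -
          have "ln 2 * n \<le> 1 * n" using n(1) ln_2_less_1 by (intro mult_right_mono) auto
          then show ?thesis using nb by simp
        qed
        ultimately show ?thesis using X\<rho> by (simp add: algebra_simps)
      qed
      moreover have "0 \<le> 2 * \<rho> / (\<rho> - r)\<^sup>2" using \<rho>R by simp
      ultimately have "K \<le> 2 * \<rho> / (\<rho> - r)\<^sup>2 * ((10 * C0 + C + 2 * c1) * Y\<^sup>2)"
        unfolding K_def by (intro mult_left_mono)
      also have "\<dots> \<le> 50 * Y\<^sup>2 * ((10 * C0 + C + 2 * c1) * Y\<^sup>2)"
        using a C0 C(1) c by (intro mult_right_mono) auto
      finally show ?thesis by (simp add: c2_def power2_eq_square algebra_simps)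
    qed
    have "sqrt K \<le> sqrt (c2 * (Y\<^sup>2)\<^sup>2)" using Kb by simp
    also have "\<dots> = sqrt c2 * Y\<^sup>2" unfolding real_sqrt_mult real_sqrt_abs by simp
    finally have sK: "sqrt K \<le> sqrt c2 * Y\<^sup>2" .
    have "sqrt 2 * n \<le> 2 * (c1 * Y\<^sup>2)"
      using nb n(1) sqrt2_less_2 by (intro mult_mono) auto
    then have arg: "1 + (sqrt K + sqrt 2 * n) \<le> c3 * Y\<^sup>2"
      using sK YY by (simp add: c3_def algebra_simps)
    have "0 \<le> K" unfolding K_def using n(3) \<rho>R by (intro mult_nonneg_nonneg) auto
    then have pos: "0 < 1 + (sqrt K + sqrt 2 * n)" using n(1) by (intro add_pos_nonneg) auto
    have "2 * ln (1 + (sqrt K + sqrt 2 * n)) \<le> 2 * ln (c3 * Y\<^sup>2)"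
      using arg pos by (intro mult_left_mono ln_mono) auto
    also have "\<dots> = 2 * ln c3 + 4 * ln Y" using c Y by (simp add: ln_mult_pos ln_realpow)
    also have "\<dots> \<le> (2 * ln c3 + 4) * (1 + ln Y)"
    proof -
      have "0 \<le> ln c3 * ln Y" using c Y by simp
      then show ?thesis by (simp add: algebra_simps)
    qed
    also have "1 + ln Y = err \<Lambda> r S" by (simp add: err_def Y_def Q_def)
    finally show ?thesis using n(4) unfolding K_def by linarith
  qed
  have "continuous_on (sphere 0 r) (\<lambda>z. deriv u1 z / u1 z - deriv u2 z / u2 z)"
    if "r \<notin> D" for r
  proof -
    have "deriv u1 holomorphic_on UNIV" "deriv u2 holomorphic_on UNIV"
      using u by (auto intro!: holomorphic_intros)
    then have "continuous_on (sphere 0 r) (deriv u1)" "continuous_on (sphere 0 r) (deriv u2)"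
      "continuous_on (sphere 0 r) u1" "continuous_on (sphere 0 r) u2"
      using u by (auto intro: holomorphic_on_imp_continuous_on continuous_on_subset)
    then show ?thesis using D1(2)[of r] that
      by (intro continuous_on_diff continuous_on_divide) (auto simp: D_def)
  qed
  then show ?thesis unfolding small_def using main c D
    by (intro exI[of _ "2 * ln c3 + 4"] exI[of _ D]) (auto intro: add_nonneg_nonneg)
qed

section \<open>Characteristic functions and the basic contradiction\<close>

text \<open>
  A Borel-type growth argument. Along radii \<open>R k\<close> that increase to \<open>2 * r0\<close> the gaps shrink
  geometrically, so the inequality gives \<open>\<Lambda> (R (k + 1)) \<ge> exp (\<Lambda> (R k) / C - k - 3)\<close>. If the
  starting value is large, this forces \<open>\<Lambda>\<close> to be unbounded on the interval from \<open>r0\<close> to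
  \<open>2 * r0\<close>, against monotonicity.
\<close>

lemma no_slow_growth:
  assumes g: "growth \<Lambda>" and unb: "\<And>B. \<exists>r\<ge>1. B \<le> \<Lambda> r"
    and le: "\<And>r S. 1 \<le> r \<Longrightarrow> r < S \<Longrightarrow> \<Lambda> r \<le> C * err \<Lambda> r S"
  shows False
proof -
  define C' where "C' = max C 1"
  have C': "1 \<le> C'" by (simp add: C'_def)
  have le': "\<Lambda> r \<le> C' * err \<Lambda> r S" if "1 \<le> r" "r < S" for r S
  proof -
    have "C * err \<Lambda> r S \<le> C' * err \<Lambda> r S"
      using err_ge_1[OF g that] by (intro mult_right_mono) (auto simp: C'_def)
    then show ?thesis using le[OF that] by simp
  qed
  have "filterlim (\<lambda>y. exp y / (C' * (2 * y + 8))) at_top at_top" using C' by real_asymp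
  then have "\<forall>\<^sub>F y in at_top. 1 \<le> exp y / (C' * (2 * y + 8))" by (simp add: filterlim_at_top)
  then obtain y0 where y0: "\<And>y. y0 \<le> y \<Longrightarrow> 1 \<le> exp y / (C' * (2 * y + 8))"
    by (auto simp: eventually_at_top_linorder)
  define a where "a = max y0 0 + 3"
  have big: "C' * (a + 2 * (real k + 1)) \<le> exp (a - 3 + real k)" for k
  proof -
    define y where "y = a - 3 + real k"
    have y: "y0 \<le> y" "0 \<le> y" by (auto simp: y_def a_def)
    have "C' * (a + 2 * (real k + 1)) \<le> C' * (2 * y + 8)"
      using C' by (intro mult_left_mono) (auto simp: y_def a_def)
    also have "\<dots> \<le> exp y" using y0[OF y(1)] C' y(2) by (simp add: le_divide_eq)
    finally show ?thesis by (simp add: y_def)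
  qed
  obtain r0 where r0: "1 \<le> r0" "C' * a \<le> \<Lambda> r0" using unb by blast
  \<comment> \<open>The quotient \<open>R (k + 1) / (R (k + 1) - R k)\<close> is at most \<open>2 ^ (k + 2)\<close>, so it costs only
    \<open>k + 2\<close> in the exponent.\<close>
  define R where "R = (\<lambda>k. r0 * (2 - (1/2) ^ k) :: real)"
  have R: "r0 \<le> R k" "R k \<le> 2 * r0" "R k < R (Suc k)" for k
  proof -
    have "(1/2::real) ^ k \<le> 1" by (simp add: power_le_one)
    then have "r0 * 1 \<le> r0 * (2 - (1/2) ^ k)" using r0 by (intro mult_left_mono) auto
    then show "r0 \<le> R k" by (simp add: R_def)
    have "r0 * (2 - (1/2) ^ k) \<le> r0 * 2" using r0 by (intro mult_left_mono) auto
    then show "R k \<le> 2 * r0" by (simp add: R_def)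
    have "r0 * (2 - (1/2) ^ k) < r0 * (2 - (1/2) ^ Suc k)"
      using r0 by (intro mult_strict_left_mono) auto
    then show "R k < R (Suc k)" by (simp add: R_def)
  qed
  have "C' * (a + 2 * real k) \<le> \<Lambda> (R k)" for k
  proof (induction k)
    case 0 then show ?case using r0 by (simp add: R_def)
  next
    case (Suc k)
    have L: "1 \<le> \<Lambda> (R (Suc k))" using g R(1)[of "Suc k"] r0 unfolding growth_def by auto
    have q: "R (Suc k) / (R (Suc k) - R k) \<le> 2 ^ (k + 2)"
    proof -
      have e: "R (Suc k) - R k = r0 * (1/2) ^ Suc k" by (simp add: R_def algebra_simps)
      have "R (Suc k) / (R (Suc k) - R k) \<le> (2 * r0) / (r0 * (1/2) ^ Suc k)"
        unfolding e using R(2)[of "Suc k"] r0 by (intro divide_right_mono) auto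
      also have "\<dots> = 2 ^ (k + 2)" using r0 by (simp add: power_one_over field_simps)
      finally show ?thesis .
    qed
    have qpos: "0 < R (Suc k) / (R (Suc k) - R k)"
      using R(1)[of "Suc k"] R(3)[of k] r0 by (intro divide_pos_pos) auto
    have "err \<Lambda> (R k) (R (Suc k)) \<le> 1 + ln (\<Lambda> (R (Suc k))) + (real k + 2)"
    proof -
      have "ln (R (Suc k) / (R (Suc k) - R k)) \<le> ln (2 ^ (k + 2))"
        using q qpos by (intro ln_mono) auto
      also have "\<dots> = (real k + 2) * ln 2" by (subst ln_realpow) auto
      also have "\<dots> \<le> (real k + 2) * 1" using ln_2_less_1 by (intro mult_left_mono) auto
      finally show ?thesis unfolding err_def using L qpos by (subst ln_mult_pos) auto
    qed
    then have "C' * err \<Lambda> (R k) (R (Suc k)) \<le> C' * (1 + ln (\<Lambda> (R (Suc k))) + (real k + 2))"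
      using C' by (intro mult_left_mono) auto
    moreover have "C' * (a + 2 * real k) \<le> C' * err \<Lambda> (R k) (R (Suc k))"
      using Suc.IH le'[OF _ R(3)[of k]] R(1)[of k] r0 by simp
    ultimately have "C' * (a + 2 * real k) \<le> C' * (1 + ln (\<Lambda> (R (Suc k))) + (real k + 2))" by simp
    then have "a + 2 * real k \<le> 1 + ln (\<Lambda> (R (Suc k))) + (real k + 2)" using C' by simp
    then have "a - 3 + real k \<le> ln (\<Lambda> (R (Suc k)))" by simp
    then have "exp (a - 3 + real k) \<le> \<Lambda> (R (Suc k))" using L by (subst (asm) ln_ge_iff) auto
    then show ?case using big[of k] by (simp add: algebra_simps)
  qed
  moreover have "\<Lambda> (R k) \<le> \<Lambda> (2 * r0)" for k
    using g R(1,2)[of k] r0 unfolding growth_def by auto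
  ultimately have b: "C' * (a + 2 * real k) \<le> \<Lambda> (2 * r0)" for k using order_trans by blast
  obtain k :: nat where k: "\<Lambda> (2 * r0) < real k" using reals_Archimedean2 by blast
  have "1 * (a + 2 * real k) \<le> C' * (a + 2 * real k)" using C' by (intro mult_right_mono) (auto simp: a_def)
  then show False using b[of k] k by (simp add: a_def)
qed

text \<open>
  The circle mean of \<open>ln \<mu>\<close>, made positive and monotone in the radius.
\<close>

definition char_fun :: "(complex \<Rightarrow> real) \<Rightarrow> real \<Rightarrow> real" where
  "char_fun \<mu> R = 1 + (SUP t\<in>{1..R}. \<bar>circle_mean t (\<lambda>z. ln (\<mu> z))\<bar>)"

lemma circle_mean_ln_continuous:
  fixes \<mu> :: "complex \<Rightarrow> real"
  assumes c: "continuous_on UNIV \<mu>" and pos: "\<And>z. 0 < \<mu> z"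
  shows "continuous_on UNIV (\<lambda>t. circle_mean t (\<lambda>z. ln (\<mu> z)))"
proof -
  have cl: "continuous_on UNIV (\<lambda>z. ln (\<mu> z))"
    using pos by (intro continuous_on_ln c) (metis less_irrefl)
  have "continuous_on (UNIV \<times> cbox 0 (1::real)) (\<lambda>(t::real, x). ln (\<mu> (circlepath 0 t x)))"
    unfolding case_prod_unfold circlepath
    by (rule continuous_on_compose2[OF cl]) (auto intro!: continuous_intros)
  from integral_continuous_on_param[OF this]
  show ?thesis by (simp add: circle_mean_def)
qed

lemma char_fun_properties:
  fixes \<mu> :: "complex \<Rightarrow> real"
  assumes c: "continuous_on UNIV \<mu>" and pos: "\<And>z. 0 < \<mu> z"
  shows growth_char_fun: "growth (char_fun \<mu>)"
    and le_char_fun: "1 \<le> t \<Longrightarrow> t \<le> R \<Longrightarrow> \<bar>circle_mean t (\<lambda>z. ln (\<mu> z))\<bar> \<le> char_fun \<mu> R"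
    and char_fun_le: "1 \<le> R \<Longrightarrow> (\<And>t. 1 \<le> t \<Longrightarrow> t \<le> R \<Longrightarrow> \<bar>circle_mean t (\<lambda>z. ln (\<mu> z))\<bar> \<le> M) \<Longrightarrow> char_fun \<mu> R \<le> 1 + M"
proof -
  define T where "T = (\<lambda>t. \<bar>circle_mean t (\<lambda>z. ln (\<mu> z))\<bar>)"
  have cT: "continuous_on UNIV T"
    unfolding T_def by (intro continuous_on_rabs circle_mean_ln_continuous c pos)
  have bdd: "bdd_above (T ` {1..R})" for R
  proof -
    have "compact (T ` {1..R})"
      by (intro compact_continuous_image continuous_on_subset[OF cT]) auto
    then show ?thesis by (intro bounded_imp_bdd_above compact_imp_bounded)
  qed
  have T: "T t \<le> (SUP t\<in>{1..R}. T t)" if "1 \<le> t" "t \<le> R" for t R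
    using that bdd by (intro cSUP_upper) auto
  have e: "char_fun \<mu> R = 1 + (SUP t\<in>{1..R}. T t)" for R by (simp add: char_fun_def T_def)
  show "growth (char_fun \<mu>)"
    unfolding growth_def
  proof (intro conjI allI impI)
    fix S :: real assume S: "1 \<le> S"
    have "0 \<le> T 1" by (simp add: T_def)
    then show "1 \<le> char_fun \<mu> S" using T[of 1 S] S by (simp add: e)
    fix r S :: real assume "1 \<le> r" "r \<le> S"
    then show "char_fun \<mu> r \<le> char_fun \<mu> S"
      unfolding e by (intro add_left_mono cSUP_subset_mono bdd) auto
  qed
  show "\<bar>circle_mean t (\<lambda>z. ln (\<mu> z))\<bar> \<le> char_fun \<mu> R" if "1 \<le> t" "t \<le> R"
    using T[OF that] unfolding e by (simp add: T_def)
  show "char_fun \<mu> R \<le> 1 + M" if "1 \<le> R" "\<And>t. 1 \<le> t \<Longrightarrow> t \<le> R \<Longrightarrow> \<bar>circle_mean t (\<lambda>z. ln (\<mu> z))\<bar> \<le> M"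
    unfolding e using that by (intro add_left_mono cSUP_least) (auto simp: T_def)
qed

lemma entire_nonzero_cosparse:
  assumes "F holomorphic_on UNIV" "F z0 \<noteq> 0"
  shows "\<forall>\<^sub>\<approx>z. F z \<noteq> 0"
  using nicely_meromorphic_imp_constant_or_avoid[of F UNIV 0] assms
    analytic_on_imp_nicely_meromorphic_on[of F UNIV] analytic_on_open[of UNIV F]
  by (auto simp: connected_UNIV)

lemma generic_above:
  fixes r s :: real
  assumes "countable D" "r < s"
  obtains x where "r < x" "x < s" "x \<notin> D"
  using real_interval_avoid_countable_set[of r s D] assms by auto

text \<open>
  Taking circle means of logarithms in \<open>|Om| * \<mu> ^ k \<le> |\<psi>|\<close> shows that the mean of \<open>ln \<mu>\<close> is
  at most a constant multiple of the error term, which \<open>no_slow_growth\<close> forbids if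
  \<open>char_fun \<mu>\<close> is unbounded. The auxiliary entire function \<open>u\<close> is what makes it unbounded:
  having a zero, \<open>ln |u|\<close> has circle means that grow at least like \<open>ln r\<close>.
\<close>

lemma entire_small_impossible:
  fixes \<mu> :: "complex \<Rightarrow> real"
  assumes c: "continuous_on UNIV \<mu>" and pos: "\<And>z. 0 < \<mu> z"
    and u: "u holomorphic_on UNIV" "u z0 \<noteq> 0" "u a = 0" and u\<mu>: "\<And>z. norm (u z) \<le> B * \<mu> z"
    and Om: "Om holomorphic_on UNIV" "Om z1 \<noteq> 0"
    and \<psi>: "small (char_fun \<mu>) \<psi>" and k: "1 \<le> (k::nat)"
    and le: "\<forall>\<^sub>\<approx>z. norm (Om z) * \<mu> z ^ k \<le> norm (\<psi> z)"
  shows False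
proof -
  define T where "T = (\<lambda>t. circle_mean t (\<lambda>z. ln (\<mu> z)))"
  define \<Lambda> where "\<Lambda> = char_fun \<mu>"
  have g: "growth \<Lambda>" unfolding \<Lambda>_def by (rule growth_char_fun[OF c pos])
  have cl: "continuous_on S (\<lambda>z. ln (\<mu> z))" for S
    using pos by (intro continuous_on_ln continuous_on_subset[OF c]) (auto, metis less_irrefl)
  obtain j W where W: "W holomorphic_on UNIV" "W a \<noteq> 0" "\<And>z. u z = (z - a) ^ j * W z"
    using entire_split_zero[OF u(1,2), of a] by blast
  have j: "j \<noteq> 0" using W(2) W(3)[of a] u(3) by (cases j) auto
  define V where "V = (\<lambda>z. (z - a) ^ (j - 1) * W z)"
  have V: "V holomorphic_on UNIV" "V z0 \<noteq> 0" "\<And>z. u z = (\<Prod>b\<leftarrow>[a]. z - b) * V z"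
  proof -
    show "V holomorphic_on UNIV" unfolding V_def by (intro holomorphic_intros W)
    show e: "u z = (\<Prod>b\<leftarrow>[a]. z - b) * V z" for z
      using W(3)[of z] j by (cases j) (auto simp: V_def)
    show "V z0 \<noteq> 0" using e[of z0] u(2) by auto
  qed
  obtain CV where CV: "\<And>r. 1 \<le> r \<Longrightarrow> (\<forall>z. norm z = r \<longrightarrow> V z \<noteq> 0) \<Longrightarrow> - CV \<le> circle_mean r (\<lambda>z. ln (norm (V z)))"
    using circle_mean_ln_lower_bound[OF V(1,2)] by blast
  obtain CU where CU: "\<And>r. 1 \<le> r \<Longrightarrow> (\<forall>z. norm z = r \<longrightarrow> u z \<noteq> 0) \<Longrightarrow> - CU \<le> circle_mean r (\<lambda>z. ln (norm (u z)))"
    using circle_mean_ln_lower_bound[OF u(1,2)] by blast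
  obtain CO where CO: "0 \<le> CO" "\<And>r. 1 \<le> r \<Longrightarrow> (\<forall>z. norm z = r \<longrightarrow> Om z \<noteq> 0) \<Longrightarrow> - CO \<le> circle_mean r (\<lambda>z. ln (norm (Om z)))"
    using circle_mean_ln_lower_bound[OF Om] by blast
  have B: "0 < B"
  proof -
    have "0 < norm (u z0)" using u(2) by simp
    then have "0 < B * \<mu> z0" using u\<mu>[of z0] by (rule less_le_trans)
    then show ?thesis using pos[of z0] by (simp add: zero_less_mult_iff)
  qed
  obtain C D0 where C: "0 \<le> C" "countable D0"
    "\<And>r. 1 \<le> r \<Longrightarrow> r \<notin> D0 \<Longrightarrow> continuous_on (sphere 0 r) \<psi> \<and>
     (\<forall>S>r. circle_mean r (\<lambda>z. ln (1 + norm (\<psi> z))) \<le> C * err \<Lambda> r S)"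
    using \<psi> unfolding small_def \<Lambda>_def by blast
  have "\<forall>\<^sub>\<approx>z. (u z \<noteq> 0 \<and> Om z \<noteq> 0) \<and> norm (Om z) * \<mu> z ^ k \<le> norm (\<psi> z)"
    using entire_nonzero_cosparse[OF u(1,2)] entire_nonzero_cosparse[OF Om] le by eventually_elim auto
  from cosparse_generic_radius[OF this] obtain D1 where D1: "countable D1"
    "\<And>r z. r \<notin> D1 \<Longrightarrow> norm z = r \<Longrightarrow> (u z \<noteq> 0 \<and> Om z \<noteq> 0) \<and> norm (Om z) * \<mu> z ^ k \<le> norm (\<psi> z)"
    by blast
  define D where "D = D0 \<union> D1"
  have D: "countable D" using C D1 by (simp add: D_def)
  have cont: "continuous_on S u" "continuous_on S Om" for S
    using u(1) Om(1) by (auto intro: holomorphic_on_imp_continuous_on continuous_on_subset)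
  have uT: "circle_mean r (\<lambda>z. ln (norm (u z))) - ln B \<le> T r" if r: "1 \<le> r" "r \<notin> D" for r
  proof -
    have nz: "u z \<noteq> 0" if "norm z = r" for z using D1(2)[of r z] r that by (auto simp: D_def)
    have cu: "continuous_on (sphere 0 r) (\<lambda>z. ln (norm (u z)))"
      using nz by (intro continuous_on_ln_norm cont) auto
    have "circle_mean r (\<lambda>z. ln (norm (u z))) \<le> circle_mean r (\<lambda>z. ln B + ln (\<mu> z))"
    proof (rule circle_mean_mono[OF cu])
      fix z :: complex assume "norm z = r"
      then have "0 < norm (u z)" using nz by simp
      then have "ln (norm (u z)) \<le> ln (B * \<mu> z)" using u\<mu>[of z] by (intro ln_mono) auto
      then show "ln (norm (u z)) \<le> ln B + ln (\<mu> z)" using B pos[of z] by (simp add: ln_mult_pos)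
    qed (use r in \<open>auto intro!: continuous_on_add continuous_on_const cl\<close>)
    also have "\<dots> = ln B + T r"
      using circle_mean_add[OF continuous_on_const cl, of r "ln B"] r by (simp add: T_def)
    finally show ?thesis by simp
  qed
  have unbT: "ln r - (CV + ln B) \<le> T r" if r: "1 \<le> r" "r \<notin> D" "norm a < r" for r
  proof -
    have nz: "u z \<noteq> 0" if "norm z = r" for z using D1(2)[of r z] r that by (auto simp: D_def)
    have nzV: "\<forall>z. norm z = r \<longrightarrow> V z \<noteq> 0" using nz V(3) by auto
    have "circle_mean r (\<lambda>z. ln (norm (u z))) = length [a] * ln r + circle_mean r (\<lambda>z. ln (norm (V z)))"
      by (rule circle_mean_ln_factored[OF V(1,3)]) (use r nz in auto)
    then show ?thesis using uT[OF r(1,2)] CV[OF r(1) nzV] by simp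
  qed
  have lowT: "- (\<bar>CU\<bar> + \<bar>ln B\<bar>) \<le> T r" if r: "1 \<le> r" "r \<notin> D" for r
  proof -
    have nz: "\<forall>z. norm z = r \<longrightarrow> u z \<noteq> 0" using D1(2)[of r] r by (auto simp: D_def)
    show ?thesis using uT[OF r] CU[OF r(1) nz] by linarith
  qed
  define C0 where "C0 = \<bar>CU\<bar> + \<bar>ln B\<bar>"
  have C0: "0 \<le> C0" by (simp add: C0_def)
  have upT: "real k * T r \<le> C * err \<Lambda> r S + CO" if r: "1 \<le> r" "r \<notin> D" and S: "r < S" for r S
  proof -
    have p: "u z \<noteq> 0" "Om z \<noteq> 0" "norm (Om z) * \<mu> z ^ k \<le> norm (\<psi> z)" if "norm z = r" for z
      using D1(2)[of r z] r that by (auto simp: D_def)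
    have c\<psi>: "continuous_on (sphere 0 r) \<psi>" and m\<psi>: "circle_mean r (\<lambda>z. ln (1 + norm (\<psi> z))) \<le> C * err \<Lambda> r S"
      using C(3)[of r] r S by (auto simp: D_def)
    have cO: "continuous_on (sphere 0 r) (\<lambda>z. ln (norm (Om z)))"
      using p(2) by (intro continuous_on_ln_norm cont) auto
    have c1: "continuous_on (sphere 0 r) (\<lambda>z. ln (1 + norm (\<psi> z)))"
      by (rule continuous_on_ln_1_plus_norm[OF c\<psi>])
    have "circle_mean r (\<lambda>z. real k * ln (\<mu> z)) \<le> circle_mean r (\<lambda>z. ln (1 + norm (\<psi> z)) - ln (norm (Om z)))"
    proof (rule circle_mean_mono)
      fix z :: complex assume z: "norm z = r"
      have q: "0 < norm (Om z)" "0 < \<mu> z ^ k" using p(2)[OF z] pos[of z] by auto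
      have "ln (norm (Om z) * \<mu> z ^ k) \<le> ln (1 + norm (\<psi> z))"
        using p(3)[OF z] q by (intro ln_mono mult_pos_pos) auto
      then show "real k * ln (\<mu> z) \<le> ln (1 + norm (\<psi> z)) - ln (norm (Om z))"
        using q pos[of z] by (simp add: ln_mult_pos ln_realpow)
    qed (use r in \<open>auto intro!: continuous_on_diff continuous_on_mult continuous_on_const cl cO c1\<close>)
    also have "\<dots> = circle_mean r (\<lambda>z. ln (1 + norm (\<psi> z))) - circle_mean r (\<lambda>z. ln (norm (Om z)))"
      using r by (intro circle_mean_diff c1 cO) auto
    also have "\<dots> \<le> C * err \<Lambda> r S + CO"
      using m\<psi> CO(2)[OF r(1)] p(2) by force
    finally show ?thesis unfolding circle_mean_cmult T_def .
  qed
  define C4 where "C4 = C + CO + real k * C0"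
  have absT: "\<bar>T r\<bar> \<le> C4 * err \<Lambda> r S" if r: "1 \<le> r" "r \<notin> D" and S: "r < S" for r S
  proof -
    have e: "1 \<le> err \<Lambda> r S" using err_ge_1[OF g r(1) S] .
    have l: "- C0 \<le> T r" using lowT[OF r] by (simp add: C0_def)
    have "T r \<le> real k * T r + (real k - 1) * C0"
    proof -
      have "0 \<le> (real k - 1) * (T r + C0)" using k l by (intro mult_nonneg_nonneg) auto
      then show ?thesis by (simp add: algebra_simps)
    qed
    also have "\<dots> \<le> C * err \<Lambda> r S + CO + real k * C0"
      using upT[OF r S] C0 by (simp add: algebra_simps)
    also have "\<dots> \<le> C4 * err \<Lambda> r S"
    proof -
      have "CO * 1 \<le> CO * err \<Lambda> r S" "real k * C0 * 1 \<le> real k * C0 * err \<Lambda> r S"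
        using mult_left_mono[OF e CO(1)] mult_left_mono[OF e, of "real k * C0"] C0 by auto
      then show ?thesis by (simp add: C4_def algebra_simps)
    qed
    finally have 1: "T r \<le> C4 * err \<Lambda> r S" .
    have "C0 \<le> real k * C0" using k C0 by (simp add: mult_le_cancel_right1)
    then have "C0 \<le> C4" using C CO by (simp add: C4_def)
    moreover have "C4 * 1 \<le> C4 * err \<Lambda> r S" using e C CO C0
      by (intro mult_left_mono) (auto simp: C4_def)
    ultimately have "- T r \<le> C4 * err \<Lambda> r S" using l by simp
    then show ?thesis using 1 by simp
  qed
  have C4: "0 \<le> C4" using C CO C0 by (simp add: C4_def)
  have err_mid: "err \<Lambda> x S \<le> 2 * err \<Lambda> r S" if r: "1 \<le> r" "r < S" and x: "1 \<le> x" "x \<le> (r + S) / 2" for x r S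
  proof -
    have xS: "x < S" using r x by auto
    have "\<Lambda> S * (S / (S - x)) \<le> 2 * (\<Lambda> S * (S / (S - r)))"
    proof -
      have "S / (S - x) \<le> S / ((S - r) / 2)" using r x by (intro divide_left_mono mult_pos_pos) auto
      also have "\<dots> = 2 * (S / (S - r))" by simp
      finally have "\<Lambda> S * (S / (S - x)) \<le> \<Lambda> S * (2 * (S / (S - r)))"
        using err_arg_ge_1(2)[OF g r] by (intro mult_left_mono) auto
      then show ?thesis by (simp only: mult.left_commute)
    qed
    then have "ln (\<Lambda> S * (S / (S - x))) \<le> ln (2 * (\<Lambda> S * (S / (S - r))))"
      using err_arg_ge_1(3)[OF g x(1) xS] by (intro ln_mono) auto
    also have "\<dots> = ln 2 + ln (\<Lambda> S * (S / (S - r)))"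
      using err_arg_ge_1(3)[OF g r] by (intro ln_mult_pos) auto
    finally show ?thesis using ln_2_less_1 err_arg_ge_1(3)[OF g r] unfolding err_def
      by (smt (verit) ln_ge_zero)
  qed
  have Tc: "continuous_on UNIV T" unfolding T_def by (rule circle_mean_ln_continuous[OF c pos])
  \<comment> \<open>The mean is continuous in the radius, so the bound extends from generic radii to all radii
    at the cost of a factor \<open>2\<close>.\<close>
  have absT': "\<bar>T r\<bar> \<le> 2 * C4 * err \<Lambda> r S" if r: "1 \<le> r" "r < S" for r S
  proof (rule ccontr)
    assume "\<not> ?thesis"
    then have "r \<in> {t. 2 * C4 * err \<Lambda> r S < \<bar>T t\<bar>}" by simp
    moreover have "open {t. 2 * C4 * err \<Lambda> r S < \<bar>T t\<bar>}"
      by (intro open_Collect_less continuous_on_const continuous_on_rabs Tc)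
    ultimately obtain d where d: "0 < d" "ball r d \<subseteq> {t. 2 * C4 * err \<Lambda> r S < \<bar>T t\<bar>}"
      using open_contains_ball by blast
    obtain x where x: "r < x" "x < min (r + d) ((r + S) / 2)" "x \<notin> D"
      using generic_above[OF D, of r "min (r + d) ((r + S) / 2)"] d r by auto
    have "x \<in> ball r d" using x by (simp add: dist_real_def)
    then have "2 * C4 * err \<Lambda> r S < \<bar>T x\<bar>" using d by blast
    also have "\<dots> \<le> C4 * err \<Lambda> x S" using x r by (intro absT) auto
    also have "\<dots> \<le> C4 * (2 * err \<Lambda> r S)" using x r C4 by (intro mult_left_mono err_mid) auto
    finally show False by simp
  qed
  show False
  proof (rule no_slow_growth[OF g])
    fix r S :: real assume r: "1 \<le> r" "r < S"
    have "\<Lambda> r \<le> 1 + 2 * C4 * err \<Lambda> r S"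
      unfolding \<Lambda>_def
    proof (rule char_fun_le[OF c pos r(1)])
      fix t :: real assume t: "1 \<le> t" "t \<le> r"
      have "\<bar>T t\<bar> \<le> 2 * C4 * err \<Lambda> t S" using t r by (intro absT') auto
      also have "\<dots> \<le> 2 * C4 * err \<Lambda> r S"
      proof -
        have "S / (S - t) \<le> S / (S - r)" using t r by (intro divide_left_mono mult_pos_pos) auto
        then have "\<Lambda> S * (S / (S - t)) \<le> \<Lambda> S * (S / (S - r))"
          using err_arg_ge_1(2)[OF g r] by (intro mult_left_mono) auto
        then have "err \<Lambda> t S \<le> err \<Lambda> r S"
          unfolding err_def using err_arg_ge_1(3)[OF g t(1), of S] t r by (intro add_left_mono ln_mono) auto
        then show ?thesis using C4 by (intro mult_left_mono) auto
      qed
      finally show "\<bar>circle_mean t (\<lambda>z. ln (\<mu> z))\<bar> \<le> 2 * C4 * err (char_fun \<mu>) r S"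
        by (simp add: T_def \<Lambda>_def)
    qed
    also have "\<dots> \<le> (1 + 2 * C4) * err \<Lambda> r S" using err_ge_1[OF g r] by (simp add: algebra_simps)
    finally show "\<Lambda> r \<le> (1 + 2 * C4) * err \<Lambda> r S" .
  next
    fix B' :: real
    define s where "s = max (norm a + 1) (max 1 (exp (B' + CV + ln B)))"
    obtain r where r: "s < r" "r < s + 1" "r \<notin> D" using generic_above[OF D, of s "s + 1"] by auto
    have r1: "1 \<le> r" "norm a < r" "exp (B' + CV + ln B) \<le> r" using r(1) by (auto simp: s_def)
    have "B' + CV + ln B \<le> ln r" using r1 by (subst ln_ge_iff) auto
    then have "B' \<le> T r" using unbT[OF r1(1) r(3) r1(2)] by simp
    also have "\<dots> \<le> \<Lambda> r" using le_char_fun[OF c pos r1(1) order_refl] by (simp add: T_def \<Lambda>_def)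
    finally show "\<exists>r\<ge>1. B' \<le> \<Lambda> r" using r1 by blast
  qed
qed

section \<open>The second main theorem in pointwise form\<close>

text \<open>
  A point \<open>w\<close> is close to at most one element \<open>x\<close> of \<open>A\<close>, and its distance from each of the
  others is at least a constant times \<open>max 1 |w|\<close>.
\<close>

lemma product_of_differences_bound:
  fixes A :: "complex set"
  assumes fin: "finite A" and ne: "A \<noteq> {}"
  shows "\<exists>C>0. \<forall>w. max 1 (norm w) ^ (card A - 1) \<le> C * (\<Sum>x\<in>A. \<Prod>y\<in>A-{x}. norm (w - y))"
proof -
  obtain d where d: "0 < d" "\<And>x y. x \<in> A \<Longrightarrow> y \<in> A \<Longrightarrow> x \<noteq> y \<Longrightarrow> 2 * d \<le> dist x y"
  proof -
    define E where "E = insert 1 {dist x y | x y. x \<in> A \<and> y \<in> A \<and> x \<noteq> y}"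
    have "{dist x y | x y. x \<in> A \<and> y \<in> A \<and> x \<noteq> y} \<subseteq> (\<lambda>(x,y). dist x y) ` (A \<times> A)" by auto
    then have "finite {dist x y | x y. x \<in> A \<and> y \<in> A \<and> x \<noteq> y}"
      by (rule finite_subset) (use fin in auto)
    then have finE: "finite E" by (simp add: E_def)
    have "0 < Min E" using finE by (subst Min_gr_iff) (auto simp: E_def)
    moreover have "Min E \<le> dist x y" if "x \<in> A" "y \<in> A" "x \<noteq> y" for x y
      using finE that by (intro Min_le) (auto simp: E_def)
    ultimately show ?thesis using that[of "Min E / 2"] by auto
  qed
  define M where "M = Max (norm ` A)"
  have M: "norm y \<le> M" if "y \<in> A" for y using that fin by (auto simp: M_def)
  define c where "c = 1 + max 1 M / d"
  have M1: "0 \<le> max 1 M" by simp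
  have c: "0 < c" using d(1) by (simp add: c_def add_pos_nonneg)
  have key: "max 1 (norm w) \<le> c * norm (w - y)" if y: "y \<in> A" "d \<le> norm (w - y)" for w y
  proof -
    have "norm w \<le> norm (w - y) + norm y" using norm_triangle_ineq[of "w - y" y] by simp
    then have "max 1 (norm w) \<le> norm (w - y) + max 1 M" 
      using M[OF y(1)] max.cobounded1[of 1 M] max.cobounded2[of M 1] norm_ge_zero[of "w - y"]
      unfolding max.bounded_iff by linarith
    also have "max 1 M \<le> max 1 M / d * norm (w - y)"
    proof -
      have "max 1 M / d * d \<le> max 1 M / d * norm (w - y)" using y d(1) M1 by (intro mult_left_mono) auto
      then show ?thesis using d(1) by simp
    qed
    finally show ?thesis by (simp add: c_def algebra_simps)
  qed
  have "max 1 (norm w) ^ (card A - 1) \<le> c ^ (card A - 1) * (\<Sum>x\<in>A. \<Prod>y\<in>A-{x}. norm (w - y))" for w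
  proof -
    obtain x where x: "x \<in> A" "\<And>y. y \<in> A - {x} \<Longrightarrow> d \<le> norm (w - y)"
    proof (cases "\<exists>x\<in>A. norm (w - x) < d")
      case True
      then obtain x where x: "x \<in> A" "norm (w - x) < d" by blast
      have "d \<le> norm (w - y)" if "y \<in> A - {x}" for y
      proof -
        have "2 * d \<le> dist x y" using d(2) x that by auto
        also have "\<dots> \<le> norm (w - x) + norm (w - y)"
          using dist_triangle[of x y w] by (simp add: dist_norm norm_minus_commute)
        finally show ?thesis using x by simp
      qed
      then show ?thesis using that x by blast
    next
      case False
      then show ?thesis using that ne by fastforce
    qed
    have "max 1 (norm w) ^ (card A - 1) = (\<Prod>y\<in>A-{x}. max 1 (norm w))"
      using x(1) fin by simp
    also have "\<dots> \<le> (\<Prod>y\<in>A-{x}. c * norm (w - y))"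
      using key x by (intro prod_mono) auto
    also have "\<dots> = c ^ (card A - 1) * (\<Prod>y\<in>A-{x}. norm (w - y))"
      using x(1) fin by (simp add: prod.distrib)
    also have "\<dots> \<le> c ^ (card A - 1) * (\<Sum>x\<in>A. \<Prod>y\<in>A-{x}. norm (w - y))"
      using x(1) fin c by (intro mult_left_mono member_le_sum) (auto intro: prod_nonneg)
    finally show ?thesis .
  qed
  then show ?thesis using c by (intro exI[of _ "c ^ (card A - 1)"]) auto
qed

text \<open>
  In applications \<open>w = f z\<close> and \<open>d = f' z\<close>, and the last sum is a sum of logarithmic
  derivatives.
\<close>

lemma pointwise_second_main:
  fixes A :: "complex set"
  assumes fin: "finite A" and ne: "A \<noteq> {}"
  shows "\<exists>C>0. \<forall>w d. w \<notin> A \<longrightarrow> max 1 (norm w) ^ (card A - 1) * norm d \<le>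
      C * ((\<Prod>y\<in>A. norm (w - y)) * (\<Sum>x\<in>A. norm (d / (w - x))))"
proof -
  obtain C where C: "0 < C" "\<And>w. max 1 (norm w) ^ (card A - 1) \<le> C * (\<Sum>x\<in>A. \<Prod>y\<in>A-{x}. norm (w - y))"
    using product_of_differences_bound[OF assms] by blast
  have "max 1 (norm w) ^ (card A - 1) * norm d \<le>
      C * ((\<Prod>y\<in>A. norm (w - y)) * (\<Sum>x\<in>A. norm (d / (w - x))))" if w: "w \<notin> A" for w d
  proof -
    have "max 1 (norm w) ^ (card A - 1) * norm d \<le> C * (\<Sum>x\<in>A. \<Prod>y\<in>A-{x}. norm (w - y)) * norm d"
      using C(2)[of w] by (intro mult_right_mono) auto
    also have "\<dots> = C * (\<Sum>x\<in>A. (\<Prod>y\<in>A-{x}. norm (w - y)) * norm d)"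
      by (simp add: sum_distrib_right mult.assoc)
    also have "(\<Sum>x\<in>A. (\<Prod>y\<in>A-{x}. norm (w - y)) * norm d) = (\<Sum>x\<in>A. (\<Prod>y\<in>A. norm (w - y)) * norm (d / (w - x)))"
    proof (rule sum.cong)
      fix x assume x: "x \<in> A"
      have "w - x \<noteq> 0" using w x by auto
      then show "(\<Prod>y\<in>A-{x}. norm (w - y)) * norm d = (\<Prod>y\<in>A. norm (w - y)) * norm (d / (w - x))"
        using fin x by (simp add: prod.remove[of A x] norm_divide)
    qed simp
    finally show ?thesis by (simp add: sum_distrib_left)
  qed
  then show ?thesis using C(1) by blast
qed

section \<open>Orders of meromorphic functions at a point\<close>

text \<open>
  Values at the point \<open>z\<close> itself are disregarded, so the dummy value at a pole does not
  matter; the zero function has order at least \<open>k\<close> for every \<open>k\<close>.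
\<close>

definition ord_ge :: "(complex \<Rightarrow> complex) \<Rightarrow> complex \<Rightarrow> int \<Rightarrow> bool" where
  "ord_ge F z k \<longleftrightarrow> (\<exists>h. h analytic_on {z} \<and> (\<forall>\<^sub>F w in at z. F w = (w - z) powi k * h w))"

definition has_ord :: "(complex \<Rightarrow> complex) \<Rightarrow> complex \<Rightarrow> int \<Rightarrow> bool" where
  "has_ord F z k \<longleftrightarrow> (\<exists>h. h analytic_on {z} \<and> h z \<noteq> 0 \<and> (\<forall>\<^sub>F w in at z. F w = (w - z) powi k * h w))"

lemma eventually_ne: "\<forall>\<^sub>F w in at z. w - z \<noteq> (0::complex)"
  by (simp add: eventually_at_filter)

lemma has_ord_imp_ord_ge: "has_ord F z k \<Longrightarrow> ord_ge F z k"
  unfolding has_ord_def ord_ge_def by blast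

lemma has_ord_cong:
  assumes "has_ord F z k" "\<forall>\<^sub>F w in at z. F w = G w" shows "has_ord G z k"
proof -
  obtain h where h: "h analytic_on {z}" "h z \<noteq> 0" "\<forall>\<^sub>F w in at z. F w = (w - z) powi k * h w"
    using assms(1) unfolding has_ord_def by blast
  have "\<forall>\<^sub>F w in at z. G w = (w - z) powi k * h w"
    using h(3) assms(2) by eventually_elim simp
  then show ?thesis using h unfolding has_ord_def by blast
qed

lemma ord_ge_cong:
  assumes "ord_ge F z k" "\<forall>\<^sub>F w in at z. F w = G w" shows "ord_ge G z k"
proof -
  obtain h where h: "h analytic_on {z}" "\<forall>\<^sub>F w in at z. F w = (w - z) powi k * h w"
    using assms(1) unfolding ord_ge_def by blast
  have "\<forall>\<^sub>F w in at z. G w = (w - z) powi k * h w"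
    using h(2) assms(2) by eventually_elim simp
  then show ?thesis using h unfolding ord_ge_def by blast
qed

lemma ord_ge_analytic: "F analytic_on {z} \<Longrightarrow> ord_ge F z 0"
  unfolding ord_ge_def by (intro exI[of _ F]) auto

lemma has_ord_analytic: "F analytic_on {z} \<Longrightarrow> F z \<noteq> 0 \<Longrightarrow> has_ord F z 0"
  unfolding has_ord_def by (intro exI[of _ F]) auto

lemma has_ord_const: "c \<noteq> 0 \<Longrightarrow> has_ord (\<lambda>w. c) z 0"
  by (rule has_ord_analytic) auto

lemma ord_ge_const: "ord_ge (\<lambda>w. c) z 0"
  by (rule ord_ge_analytic) auto

lemma ord_ge_mult:
  assumes "ord_ge F z j" "ord_ge G z k" shows "ord_ge (\<lambda>w. F w * G w) z (j + k)"
proof -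
  obtain a where a: "a analytic_on {z}" "\<forall>\<^sub>F w in at z. F w = (w - z) powi j * a w"
    using assms(1) unfolding ord_ge_def by blast
  obtain b where b: "b analytic_on {z}" "\<forall>\<^sub>F w in at z. G w = (w - z) powi k * b w"
    using assms(2) unfolding ord_ge_def by blast
  have "\<forall>\<^sub>F w in at z. F w * G w = (w - z) powi (j + k) * (a w * b w)"
    using a(2) b(2) eventually_ne by eventually_elim (simp add: power_int_add)
  moreover have "(\<lambda>w. a w * b w) analytic_on {z}" using a b by (intro analytic_intros)
  ultimately show ?thesis unfolding ord_ge_def by blast
qed

lemma has_ord_mult:
  assumes "has_ord F z j" "has_ord G z k" shows "has_ord (\<lambda>w. F w * G w) z (j + k)"
proof -
  obtain a where a: "a analytic_on {z}" "a z \<noteq> 0" "\<forall>\<^sub>F w in at z. F w = (w - z) powi j * a w"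
    using assms(1) unfolding has_ord_def by blast
  obtain b where b: "b analytic_on {z}" "b z \<noteq> 0" "\<forall>\<^sub>F w in at z. G w = (w - z) powi k * b w"
    using assms(2) unfolding has_ord_def by blast
  have "\<forall>\<^sub>F w in at z. F w * G w = (w - z) powi (j + k) * (a w * b w)"
    using a(3) b(3) eventually_ne by eventually_elim (simp add: power_int_add)
  moreover have "(\<lambda>w. a w * b w) analytic_on {z}" using a b by (intro analytic_intros)
  ultimately show ?thesis unfolding has_ord_def using a(2) b(2) by (intro exI[of _ "\<lambda>w. a w * b w"]) auto
qed

lemma ord_ge_add:
  assumes "ord_ge F z k" "ord_ge G z k" shows "ord_ge (\<lambda>w. F w + G w) z k"
proof -
  obtain a where a: "a analytic_on {z}" "\<forall>\<^sub>F w in at z. F w = (w - z) powi k * a w"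
    using assms(1) unfolding ord_ge_def by blast
  obtain b where b: "b analytic_on {z}" "\<forall>\<^sub>F w in at z. G w = (w - z) powi k * b w"
    using assms(2) unfolding ord_ge_def by blast
  have "\<forall>\<^sub>F w in at z. F w + G w = (w - z) powi k * (a w + b w)"
    using a(2) b(2) by eventually_elim (simp add: algebra_simps)
  moreover have "(\<lambda>w. a w + b w) analytic_on {z}" using a b by (intro analytic_intros)
  ultimately show ?thesis unfolding ord_ge_def by blast
qed

lemma ord_ge_cmult: "ord_ge F z k \<Longrightarrow> ord_ge (\<lambda>w. c * F w) z k"
  using ord_ge_mult[OF ord_ge_const[of c z]] by fastforce

lemma ord_ge_diff:
  assumes "ord_ge F z k" "ord_ge G z k" shows "ord_ge (\<lambda>w. F w - G w) z k"
  using ord_ge_add[OF assms(1) ord_ge_cmult[OF assms(2), of "-1"]] by simp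

lemma ord_ge_mono:
  assumes "ord_ge F z k" "j \<le> k" shows "ord_ge F z j"
proof -
  obtain a where a: "a analytic_on {z}" "\<forall>\<^sub>F w in at z. F w = (w - z) powi k * a w"
    using assms(1) unfolding ord_ge_def by blast
  obtain n where n: "k = j + int n" using assms(2) zle_iff_zadd by blast
  have "\<forall>\<^sub>F w in at z. F w = (w - z) powi j * ((w - z) ^ n * a w)"
    using a(2) eventually_ne by eventually_elim (simp add: n power_int_add mult.assoc)
  moreover have "(\<lambda>w. (w - z) ^ n * a w) analytic_on {z}" using a by (intro analytic_intros)
  ultimately show ?thesis unfolding ord_ge_def by blast
qed

lemma has_ord_inverse:
  assumes "has_ord F z k" shows "has_ord (\<lambda>w. inverse (F w)) z (- k)"
proof -
  obtain a where a: "a analytic_on {z}" "a z \<noteq> 0" "\<forall>\<^sub>F w in at z. F w = (w - z) powi k * a w"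
    using assms(1) unfolding has_ord_def by blast
  have "\<forall>\<^sub>F w in at z. inverse (F w) = (w - z) powi (- k) * inverse (a w)"
    using a(3) by eventually_elim (simp add: power_int_minus)
  moreover have "(\<lambda>w. inverse (a w)) analytic_on {z}" using a by (intro analytic_intros) auto
  ultimately show ?thesis unfolding has_ord_def using a(2) by (intro exI[of _ "\<lambda>w. inverse (a w)"]) auto
qed

lemma has_ord_divide: "has_ord F z j \<Longrightarrow> has_ord G z k \<Longrightarrow> has_ord (\<lambda>w. F w / G w) z (j - k)"
  using has_ord_mult[OF _ has_ord_inverse, of F z j G k] by (simp add: divide_inverse)

lemma has_ord_power: "has_ord F z j \<Longrightarrow> has_ord (\<lambda>w. F w ^ k) z (int k * j)"
proof (induction k)
  case 0 show ?case using has_ord_const[of 1 z] by simp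
next
  case (Suc k)
  show ?case using has_ord_mult[OF Suc.prems Suc.IH[OF Suc.prems]] by (simp add: algebra_simps)
qed

lemma ord_ge_power: "ord_ge F z j \<Longrightarrow> ord_ge (\<lambda>w. F w ^ k) z (int k * j)"
proof (induction k)
  case 0 show ?case using ord_ge_const[of 1 z] by simp
next
  case (Suc k)
  show ?case using ord_ge_mult[OF Suc.prems Suc.IH[OF Suc.prems]] by (simp add: algebra_simps)
qed

lemma has_ord_prod:
  "(\<And>i. i \<in> I \<Longrightarrow> has_ord (F i) z (k i)) \<Longrightarrow> has_ord (\<lambda>w. \<Prod>i\<in>I. F i w) z (\<Sum>i\<in>I. k i)"
proof (induction I rule: infinite_finite_induct)
  case (insert i I)
  then show ?case using has_ord_mult[of "F i" z "k i"] by simp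
qed (use has_ord_const[of 1 z] in auto)

lemma ord_ge_divide: "ord_ge F z j \<Longrightarrow> has_ord G z k \<Longrightarrow> ord_ge (\<lambda>w. F w / G w) z (j - k)"
  using ord_ge_mult[OF _ has_ord_imp_ord_ge[OF has_ord_inverse], of F z j G k] by (simp add: divide_inverse)

lemma has_ord_nonzero:
  assumes "has_ord F z k" shows "\<forall>\<^sub>F w in at z. F w \<noteq> 0"
proof -
  obtain a where a: "a analytic_on {z}" "a z \<noteq> 0" "\<forall>\<^sub>F w in at z. F w = (w - z) powi k * a w"
    using assms(1) unfolding has_ord_def by blast
  have "isCont a z" using a(1) by (rule analytic_at_imp_isCont)
  then have "a \<midarrow>z\<rightarrow> a z" by (simp add: isCont_def)
  then have "\<forall>\<^sub>F w in at z. a w \<noteq> 0" using a(2) by (rule tendsto_imp_eventually_ne)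
  then show ?thesis using a(3) eventually_ne by eventually_elim auto
qed

lemma eventually_at_nhds:
  assumes "\<forall>\<^sub>F w in at (z::complex). P w" shows "\<forall>\<^sub>F w in at z. \<forall>\<^sub>F x in nhds w. P x"
proof -
  obtain S where S: "open S" "z \<in> S" "\<And>x. x \<in> S \<Longrightarrow> x \<noteq> z \<Longrightarrow> P x"
    using assms unfolding eventually_at_topological by blast
  show ?thesis unfolding eventually_at_topological
  proof (intro exI[of _ S] conjI ballI impI S(1,2))
    fix w assume "w \<in> S" "w \<noteq> z"
    then show "\<forall>\<^sub>F x in nhds w. P x" unfolding eventually_nhds
      using S by (intro exI[of _ "S - {z}"]) (auto intro: open_delete)
  qed
qed

lemma analytic_eventually_differentiable:
  assumes "h analytic_on {z}"
  shows "\<forall>\<^sub>F w in at z. (h has_field_derivative deriv h w) (at w)"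
proof -
  obtain e where e: "0 < e" "h holomorphic_on ball z e"
    using assms by (auto simp: analytic_on_def)
  have "\<forall>\<^sub>F w in at z. w \<in> ball z e" using e(1) by (intro eventually_at_in_open') auto
  then show ?thesis by eventually_elim (use e in \<open>auto intro: holomorphic_derivI\<close>)
qed

lemma deriv_factored:
  assumes h: "h analytic_on {z}" and F: "\<forall>\<^sub>F w in at z. F w = (w - z) powi k * h w"
  shows "\<forall>\<^sub>F w in at z. deriv F w = (w - z) powi (k - 1) * (of_int k * h w + (w - z) * deriv h w)"
  using eventually_at_nhds[OF F] eventually_ne analytic_eventually_differentiable[OF h]
proof eventually_elim
  case (elim w)
  have "((\<lambda>x. (x - z) powi k) has_field_derivative of_int k * (w - z) powi (k - 1) * (1 - 0)) (at w)"
    using elim(2) by (intro DERIV_power_int DERIV_diff DERIV_ident DERIV_const) auto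
  from DERIV_mult[OF this elim(3)]
  have d: "((\<lambda>x. (x - z) powi k * h x) has_field_derivative
    of_int k * (w - z) powi (k - 1) * (1 - 0) * h w + deriv h w * (w - z) powi k) (at w)" .
  have "deriv F w = deriv (\<lambda>x. (x - z) powi k * h x) w"
    using elim(1) by (intro deriv_cong_ev) auto
  also have "\<dots> = of_int k * (w - z) powi (k - 1) * (1 - 0) * h w + deriv h w * (w - z) powi k"
    using d by (rule DERIV_imp_deriv)
  also have "(w - z) powi k = (w - z) powi (k - 1) * (w - z)"
    using elim(2) by (simp flip: power_int_add_1)
  finally show ?case by (simp add: algebra_simps)
qed

lemma has_ord_deriv:
  assumes "has_ord F z k" "k \<noteq> 0" shows "has_ord (deriv F) z (k - 1)"
proof -
  obtain h where h: "h analytic_on {z}" "h z \<noteq> 0" "\<forall>\<^sub>F w in at z. F w = (w - z) powi k * h w"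
    using assms(1) unfolding has_ord_def by blast
  have "(\<lambda>w. of_int k * h w + (w - z) * deriv h w) analytic_on {z}"
    using h(1) by (intro analytic_intros analytic_deriv)
  moreover have "of_int k * h z + (z - z) * deriv h z \<noteq> 0" using h(2) assms(2) by simp
  ultimately show ?thesis using deriv_factored[OF h(1,3)] unfolding has_ord_def
    by (intro exI[of _ "\<lambda>w. of_int k * h w + (w - z) * deriv h w"]) simp
qed

lemma ord_ge_deriv_analytic: "F analytic_on {z} \<Longrightarrow> ord_ge (deriv F) z 0"
  by (intro ord_ge_analytic analytic_deriv)

lemma has_ord_log_deriv:
  assumes "has_ord F z k"
  shows "\<exists>h. h analytic_on {z} \<and> (\<forall>\<^sub>F w in at z. deriv F w / F w = of_int k / (w - z) + h w)"
proof -
  obtain h where h: "h analytic_on {z}" "h z \<noteq> 0" "\<forall>\<^sub>F w in at z. F w = (w - z) powi k * h w"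
    using assms unfolding has_ord_def by blast
  have "(\<lambda>w. deriv h w / h w) analytic_on {z}"
    using h by (intro analytic_intros analytic_deriv) auto
  moreover have "h \<midarrow>z\<rightarrow> h z" using analytic_at_imp_isCont[OF h(1)] by (simp add: isCont_def)
  then have "\<forall>\<^sub>F w in at z. h w \<noteq> 0" using h(2) by (rule tendsto_imp_eventually_ne)
  then have "\<forall>\<^sub>F w in at z. deriv F w / F w = of_int k / (w - z) + deriv h w / h w"
    using deriv_factored[OF h(1,3)] h(3) eventually_ne
  proof eventually_elim
    case (elim w)
    have "(w - z) powi k = (w - z) powi (k - 1) * (w - z)"
      using elim(4) by (simp flip: power_int_add_1)
    moreover have "(p * (K * a + q * d)) / (p * q * a) = K / q + d / a"
      if "p \<noteq> 0" "q \<noteq> 0" "a \<noteq> 0" for p K a q d :: complex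
      using that by (simp add: field_simps)
    from this[of "(w - z) powi (k - 1)" "w - z" "h w"] have
      "((w - z) powi (k - 1) * (of_int k * h w + (w - z) * deriv h w)) / ((w - z) powi (k - 1) * (w - z) * h w)
         = of_int k / (w - z) + deriv h w / h w" using elim by (simp add: power_int_eq_0_iff)
    ultimately show ?case using elim by simp
  qed
  ultimately show ?thesis by blast
qed

lemma ord_ge_log_deriv:
  assumes "has_ord F z k" shows "ord_ge (\<lambda>w. deriv F w / F w) z (-1)"
proof -
  obtain h where h: "h analytic_on {z}" "\<forall>\<^sub>F w in at z. deriv F w / F w = of_int k / (w - z) + h w"
    using has_ord_log_deriv[OF assms] by blast
  have "(\<lambda>w. of_int k + (w - z) * h w) analytic_on {z}" using h by (intro analytic_intros)
  moreover have "\<forall>\<^sub>F w in at z. deriv F w / F w = (w - z) powi (-1) * (of_int k + (w - z) * h w)"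
    using h(2) eventually_ne by eventually_elim (simp add: power_int_minus field_simps)
  ultimately show ?thesis unfolding ord_ge_def by blast
qed

lemma ord_ge_zero_analytic:
  assumes F: "F analytic_on {z}" "F z = 0" shows "ord_ge F z 1"
proof -
  obtain e where e: "0 < e" "F holomorphic_on ball z e"
    using F(1) by (auto simp: analytic_on_def)
  define h where "h = (\<lambda>w. if w = z then deriv F z else (F w - F z) / (w - z))"
  have "h holomorphic_on ball z e" unfolding h_def
    using pole_lemma[OF e(2), of z] e(1) by simp
  then have "h analytic_on {z}" using e(1) analytic_at[of h z] open_ball centre_in_ball by blast
  moreover have "\<forall>\<^sub>F w in at z. F w = (w - z) powi 1 * h w"
    using eventually_ne by eventually_elim (simp add: h_def F(2))
  ultimately show ?thesis unfolding ord_ge_def by blast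
qed

lemma has_ord_tendsto:
  assumes "has_ord F z 0" shows "\<exists>c. c \<noteq> 0 \<and> F \<midarrow>z\<rightarrow> c"
proof -
  obtain h where h: "h analytic_on {z}" "h z \<noteq> 0" "\<forall>\<^sub>F w in at z. F w = (w - z) powi 0 * h w"
    using assms unfolding has_ord_def by blast
  have "h \<midarrow>z\<rightarrow> h z" using analytic_at_imp_isCont[OF h(1)] by (simp add: isCont_def)
  moreover have "\<forall>\<^sub>F w in at z. h w = F w" using h(3) by eventually_elim simp
  ultimately show ?thesis using h(2) by (metis tendsto_cong)
qed

lemma ord_ge_pos_tendsto_0:
  assumes "ord_ge F z k" "0 < k" shows "F \<midarrow>z\<rightarrow> 0"
proof -
  have "ord_ge F z 1" using ord_ge_mono[OF assms(1)] assms(2) by simp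
  then obtain h where h: "h analytic_on {z}" "\<forall>\<^sub>F w in at z. F w = (w - z) powi 1 * h w"
    unfolding ord_ge_def by blast
  have hz: "h \<midarrow>z\<rightarrow> h z" using analytic_at_imp_isCont[OF h(1)] by (simp add: isCont_def)
  have "(\<lambda>w. (w - z) * h w) \<midarrow>z\<rightarrow> (z - z) * h z" by (intro tendsto_intros hz)
  moreover have "\<forall>\<^sub>F w in at z. (w - z) * h w = F w" using h(2) by eventually_elim simp
  ultimately show ?thesis by (simp add: tendsto_cong)
qed

lemma has_ord_unique:
  assumes "has_ord F z j" "has_ord F z k" shows "j = k"
proof (rule ccontr)
  assume ne: "j \<noteq> k"
  have one: "has_ord (\<lambda>w. 1::complex) z d" if "has_ord F z a" "has_ord F z b" "d = a - b" for a b d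
  proof (rule has_ord_cong)
    show "has_ord (\<lambda>w. F w / F w) z d" using has_ord_divide[OF that(1,2)] that(3) by simp
    show "\<forall>\<^sub>F w in at z. F w / F w = 1" using has_ord_nonzero[OF that(1)] by eventually_elim simp
  qed
  obtain d where d: "0 < d" "has_ord (\<lambda>w. 1::complex) z d"
  proof (cases "j < k")
    case True
    then show ?thesis using one[OF assms(2,1), of "k - j"] that[of "k - j"] by simp
  next
    case False
    then show ?thesis using one[OF assms, of "j - k"] that[of "j - k"] ne by simp
  qed
  have "(\<lambda>w. 1::complex) \<midarrow>z\<rightarrow> 0" using ord_ge_pos_tendsto_0[OF has_ord_imp_ord_ge[OF d(2)] d(1)] .
  then show False using LIM_unique[OF tendsto_const] by force
qed

lemma has_ord_zorder:
  assumes "has_ord F z k" shows "zorder F z = k"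
proof -
  obtain h where h: "h analytic_on {z}" "h z \<noteq> 0" "\<forall>\<^sub>F w in at z. F w = (w - z) powi k * h w"
    using assms unfolding has_ord_def by blast
  obtain e where e: "0 < e" "h holomorphic_on ball z e" using h(1) by (auto simp: analytic_on_def)
  obtain S where S: "open S" "z \<in> S" "\<And>x. x \<in> S \<Longrightarrow> x \<noteq> z \<Longrightarrow> F x = (x - z) powi k * h x"
    using h(3) unfolding eventually_at_topological by blast
  show ?thesis
  proof (rule zorder_eqI)
    show "open (S \<inter> ball z e)" "z \<in> S \<inter> ball z e" using S e by auto
    show "h holomorphic_on S \<inter> ball z e" by (rule holomorphic_on_subset[OF e(2)]) auto
    show "h z \<noteq> 0" by (fact h)
  qed (use S in auto)
qed

lemma entire_has_ord:
  assumes "F holomorphic_on UNIV" "F z0 \<noteq> 0"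
  shows "\<exists>k::nat. has_ord F z (int k) \<and> (k = 0 \<longleftrightarrow> F z \<noteq> 0)"
proof -
  obtain k W where W: "W holomorphic_on UNIV" "W z \<noteq> 0" "\<And>w. F w = (w - z) ^ k * W w"
    using entire_split_zero[OF assms, of z] by blast
  have "W analytic_on {z}" using W(1) holomorphic_on_imp_analytic_at[OF W(1)] by auto
  then have "has_ord F z (int k)" unfolding has_ord_def using W by (intro exI[of _ W]) auto
  moreover have "k = 0 \<longleftrightarrow> F z \<noteq> 0" using W(2) W(3)[of z] by (cases k) auto
  ultimately show ?thesis by blast
qed

text \<open>
  A function with removable singularities only agrees off a discrete set with its pointwise
  limits, and these form an entire function.
\<close>

lemma ord_ge_0_entire:
  assumes "\<And>z. ord_ge F z 0"
  shows "\<exists>G. G holomorphic_on UNIV \<and> (\<forall>\<^sub>\<approx>z. F z = G z)"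
proof -
  define G where "G = (\<lambda>z. Lim (at z) F)"
  have loc: "\<exists>S h. open S \<and> z \<in> S \<and> h holomorphic_on S \<and> (\<forall>w\<in>S. G w = h w) \<and> (\<forall>w\<in>S - {z}. F w = h w)" for z
  proof -
    obtain h where h: "h analytic_on {z}" "\<forall>\<^sub>F w in at z. F w = (w - z) powi 0 * h w"
      using assms[of z] unfolding ord_ge_def by blast
    obtain e where e: "0 < e" "h holomorphic_on ball z e" using h(1) by (auto simp: analytic_on_def)
    obtain S where S: "open S" "z \<in> S" "\<And>x. x \<in> S \<Longrightarrow> x \<noteq> z \<Longrightarrow> F x = h x"
      using h(2) unfolding eventually_at_topological by auto
    have "G w = h w" if w: "w \<in> S \<inter> ball z e" for w
    proof -
      have o: "open (S \<inter> ball z e - {z} \<union> {w})"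
      proof (cases "w = z")
        case True
        have "S \<inter> ball z e - {z} \<union> {z} = S \<inter> ball z e" using S(2) e(1) by auto
        then show ?thesis using True S(1) by auto
      next
        case False
        then have "S \<inter> ball z e - {z} \<union> {w} = S \<inter> ball z e - {z}" using w by auto
        then show ?thesis using S(1) by (auto intro!: open_delete open_Int)
      qed
      have "\<forall>\<^sub>F x in at w. x \<in> S \<inter> ball z e - {z} \<union> {w} - {w}"
        using o by (intro eventually_at_in_open) auto
      then have ev: "\<forall>\<^sub>F x in at w. h x = F x" by eventually_elim (use S(3) in auto)
      have "continuous_on (ball z e) h" using e(2) by (rule holomorphic_on_imp_continuous_on)
      then have "h \<midarrow>w\<rightarrow> h w" using w by (auto simp: continuous_on_eq_continuous_at isCont_def)
      then have "F \<midarrow>w\<rightarrow> h w" using ev by (simp add: tendsto_cong)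
      then show ?thesis unfolding G_def by (intro tendsto_Lim) auto
    qed
    then show ?thesis using S e
      by (intro exI[of _ "S \<inter> ball z e"] exI[of _ h]) (auto intro: holomorphic_on_subset[OF e(2)])
  qed
  have "G holomorphic_on UNIV"
  proof (rule analytic_imp_holomorphic, subst analytic_on_analytic_at, intro ballI)
    fix z :: complex
    obtain S h where S: "open S" "z \<in> S" "h holomorphic_on S" "\<forall>w\<in>S. G w = h w"
      using loc[of z] by blast
    have "G holomorphic_on S" using S(3) by (rule holomorphic_transform) (use S(4) in auto)
    then show "G analytic_on {z}" using S(1,2) analytic_at by blast
  qed
  moreover have "\<forall>\<^sub>\<approx>z. F z = G z"
  proof (subst eventually_cosparse_open_eq; (intro ballI)?)
    fix z :: complex
    obtain S h where S: "open S" "z \<in> S" "\<forall>w\<in>S. G w = h w" "\<forall>w\<in>S - {z}. F w = h w"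
      using loc[of z] by blast
    show "\<forall>\<^sub>F w in at z. F w = G w" unfolding eventually_at_topological
      using S by (intro exI[of _ S]) auto
  qed auto
  ultimately show ?thesis by blast
qed

section \<open>Meromorphic functions as quotients of entire functions\<close>

definition hmax :: "(complex \<Rightarrow> complex) \<Rightarrow> (complex \<Rightarrow> complex) \<Rightarrow> complex \<Rightarrow> real" where
  "hmax f1 f2 z = max (norm (f1 z)) (norm (f2 z))"

text \<open>
  The equation \<open>f z = f1 z / f2 z\<close> holds at poles too, where both sides are \<open>0\<close>.
\<close>

definition quot_rep :: "(complex \<Rightarrow> complex) \<Rightarrow> (complex \<Rightarrow> complex) \<Rightarrow> (complex \<Rightarrow> complex) \<Rightarrow> bool" where
  "quot_rep f f1 f2 \<longleftrightarrow> f1 holomorphic_on UNIV \<and> f2 holomorphic_on UNIV \<and> (\<forall>z. f z = f1 z / f2 z) \<and>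
     (\<forall>z. f2 z = 0 \<longleftrightarrow> is_pole f z) \<and> (\<forall>z. f1 z \<noteq> 0 \<or> f2 z \<noteq> 0) \<and> (\<forall>x. \<exists>z. f1 z \<noteq> x * f2 z) \<and> (\<exists>z. f2 z \<noteq> 0)"

text \<open>
  Weierstrass products provide the zeros and poles; the remaining zero-free factor \<open>h\<close> is
  absorbed into the numerator.
\<close>

lemma exists_quot_rep:
  assumes f: "f nicely_meromorphic_on UNIV" and nc: "\<not> f constant_on UNIV"
  shows "\<exists>f1 f2. quot_rep f f1 f2"
proof -
  obtain h f1 f2 where h: "h holomorphic_on UNIV" "f1 holomorphic_on UNIV" "f2 holomorphic_on UNIV"
    "\<forall>z. f1 z = 0 \<longleftrightarrow> \<not>is_pole f z \<and> f z = 0" "\<forall>z. f2 z = 0 \<longleftrightarrow> is_pole f z"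
    "\<forall>z. h z \<noteq> 0" "\<forall>z. f z = h z * f1 z / f2 z"
    using weierstrass_factorization_meromorphic_UNIV[OF f] by metis
  have nz: "h z * f1 z \<noteq> 0 \<or> f2 z \<noteq> 0" for z using h by auto
  have nc': "\<exists>z. h z * f1 z \<noteq> x * f2 z" for x
  proof (rule ccontr)
    assume "\<nexists>z. h z * f1 z \<noteq> x * f2 z"
    then have e: "h z * f1 z = x * f2 z" for z by auto
    then have "f2 z \<noteq> 0" for z using nz[of z] by auto
    then have "f z = x" for z using h(7) e[of z] by simp
    then show False using nc by (auto simp: constant_on_def)
  qed
  have "\<exists>z. f2 z \<noteq> 0"
  proof (rule ccontr)
    assume "\<not> ?thesis"
    then have "f z = 0" for z using h(7) by auto
    then show False using nc by (auto simp: constant_on_def)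
  qed
  then have "quot_rep f (\<lambda>z. h z * f1 z) f2" unfolding quot_rep_def
    using h nz nc' by (intro conjI holomorphic_intros) auto
  then show ?thesis by blast
qed

lemma deriv_minus_const: "deriv (\<lambda>w. f w - x) = deriv (f :: complex \<Rightarrow> complex)"
proof
  fix z
  have "((\<lambda>w. f w - x) has_field_derivative D) (at z) \<longleftrightarrow> (f has_field_derivative D) (at z)" for D
  proof
    assume "((\<lambda>w. f w - x) has_field_derivative D) (at z)"
    from DERIV_add[OF this DERIV_const[of x]] show "(f has_field_derivative D) (at z)" by simp
  next
    assume "(f has_field_derivative D) (at z)"
    from DERIV_diff[OF this DERIV_const[of x]] show "((\<lambda>w. f w - x) has_field_derivative D) (at z)" by simp
  qed
  then show "deriv (\<lambda>w. f w - x) z = deriv f z" by (simp add: deriv_def)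
qed

locale quotient =
  fixes f f1 f2 :: "complex \<Rightarrow> complex"
  assumes rep: "quot_rep f f1 f2"
begin

lemma holo: "f1 holomorphic_on UNIV" "f2 holomorphic_on UNIV"
  and feq: "f z = f1 z / f2 z"
  and pole_iff: "is_pole f z \<longleftrightarrow> f2 z = 0"
  and no_common: "f1 z \<noteq> 0 \<or> f2 z \<noteq> 0"
  and nonconst: "\<exists>z. f1 z \<noteq> x * f2 z"
  and den_nz: "\<exists>z. f2 z \<noteq> 0"
  using rep unfolding quot_rep_def by blast+

lemma holo_num: "(\<lambda>z. f1 z - x * f2 z) holomorphic_on UNIV"
  by (intro holomorphic_intros holo)

lemma num_nz: "\<exists>z. f1 z - x * f2 z \<noteq> 0"
  using nonconst[of x] by auto

lemma analytic1: "f1 analytic_on {z}" "f2 analytic_on {z}"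
  using holo holomorphic_on_imp_analytic_at by blast+

lemma f_fun: "f = (\<lambda>z. f1 z / f2 z)"
  using feq by auto

lemma analytic: "f2 z \<noteq> 0 \<Longrightarrow> f analytic_on {z}"
  unfolding f_fun by (intro analytic_intros analytic1) auto

lemma den_ne_nhds: "f2 z \<noteq> 0 \<Longrightarrow> \<forall>\<^sub>F w in nhds z. f2 w \<noteq> 0"
proof -
  assume z: "f2 z \<noteq> 0"
  have "open {w. f2 w \<noteq> 0}"
    using holomorphic_on_imp_continuous_on[OF holo(2)] by (intro open_Collect_neq) auto
  then show ?thesis unfolding eventually_nhds using z by blast
qed

lemma pole_order:
  assumes z: "f2 z = 0"
  shows "\<exists>p>0. has_ord f2 z (int p) \<and> (\<forall>x. has_ord (\<lambda>w. f w - x) z (- int p))"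
proof -
  obtain z0 where "f2 z0 \<noteq> 0" using den_nz by blast
  then obtain p :: nat where p: "has_ord f2 z (int p)" "p = 0 \<longleftrightarrow> f2 z \<noteq> 0"
    using entire_has_ord[OF holo(2)] by blast
  have "has_ord (\<lambda>w. f w - x) z (- int p)" for x
  proof -
    have "has_ord (\<lambda>w. f1 w - x * f2 w) z 0"
      using no_common[of z] z by (intro has_ord_analytic analytic_intros analytic1) auto
    from has_ord_divide[OF this p(1)]
    have "has_ord (\<lambda>w. (f1 w - x * f2 w) / f2 w) z (- int p)" by simp
    then show ?thesis
    proof (rule has_ord_cong)
      show "\<forall>\<^sub>F w in at z. (f1 w - x * f2 w) / f2 w = f w - x"
        using has_ord_nonzero[OF p(1)] by eventually_elim (simp add: feq field_simps)
    qed
  qed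
  then show ?thesis using p z by auto
qed

lemma value_order:
  assumes z: "f2 z \<noteq> 0" "f z = x"
  shows "\<exists>p>0. has_ord (\<lambda>w. f w - x) z (int p)"
proof -
  obtain z0 where "f1 z0 - x * f2 z0 \<noteq> 0" using num_nz by blast
  then obtain p :: nat where p: "has_ord (\<lambda>w. f1 w - x * f2 w) z (int p)" "p = 0 \<longleftrightarrow> f1 z - x * f2 z \<noteq> 0"
    using entire_has_ord[OF holo_num] by blast
  have "f1 z - x * f2 z = 0" using z by (simp add: feq field_simps)
  then have p0: "0 < p" using p by auto
  have d: "has_ord f2 z 0" using z by (intro has_ord_analytic analytic1)
  have "has_ord (\<lambda>w. f w - x) z (int p)"
  proof (rule has_ord_cong)
    show "has_ord (\<lambda>w. (f1 w - x * f2 w) / f2 w) z (int p)" using has_ord_divide[OF p(1) d] by simp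
    show "\<forall>\<^sub>F w in at z. (f1 w - x * f2 w) / f2 w = f w - x"
      using has_ord_nonzero[OF d] by eventually_elim (simp add: feq field_simps)
  qed
  then show ?thesis using p0 by blast
qed

lemma regular_order: "f2 z \<noteq> 0 \<Longrightarrow> f z \<noteq> x \<Longrightarrow> has_ord (\<lambda>w. f w - x) z 0"
  by (intro has_ord_analytic analytic_intros analytic) auto

lemma order_exists: "\<exists>k. has_ord (\<lambda>w. f w - x) z k"
  using pole_order[of z] value_order[of z x] regular_order[of z x] by blast

lemma value_ne_cosparse: "\<forall>\<^sub>\<approx>z. f2 z \<noteq> 0" "\<forall>\<^sub>\<approx>z. f z \<noteq> x"
proof -
  show 1: "\<forall>\<^sub>\<approx>z. f2 z \<noteq> 0" using entire_nonzero_cosparse[OF holo(2)] den_nz by blast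
  have "\<forall>\<^sub>\<approx>z. f1 z - x * f2 z \<noteq> 0" using entire_nonzero_cosparse[OF holo_num] num_nz by blast
  then show "\<forall>\<^sub>\<approx>z. f z \<noteq> x" using 1 by eventually_elim (auto simp: feq)
qed

definition wron :: "complex \<Rightarrow> complex" where
  "wron z = deriv f1 z * f2 z - f1 z * deriv f2 z"

lemma holo_wron: "wron holomorphic_on UNIV"
  unfolding wron_def[abs_def] by (intro holomorphic_intros holo) auto

lemma deriv_f: "f2 z \<noteq> 0 \<Longrightarrow> deriv f z = wron z / (f2 z)\<^sup>2"
proof -
  assume z: "f2 z \<noteq> 0"
  have "(f1 has_field_derivative deriv f1 z) (at z)" "(f2 has_field_derivative deriv f2 z) (at z)"
    using holo by (auto intro: holomorphic_derivI)
  from DERIV_divide[OF this z] show ?thesis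
    unfolding f_fun by (simp add: DERIV_imp_deriv wron_def power2_eq_square)
qed

lemma deriv_order: "has_ord (\<lambda>w. f w - x) z k \<Longrightarrow> k \<noteq> 0 \<Longrightarrow> has_ord (deriv f) z (k - 1)"
  using has_ord_deriv[of "\<lambda>w. f w - x" z k] by (simp add: deriv_minus_const)

lemma deriv_nz: "\<exists>z. wron z \<noteq> 0"
proof -
  obtain z where z: "f2 z \<noteq> 0" using den_nz by blast
  obtain p where p: "p > 0" "has_ord (\<lambda>w. f w - f z) z (int p)" using value_order[OF z refl] by blast
  have d: "\<forall>\<^sub>F w in at z. deriv f w \<noteq> 0" using has_ord_nonzero[OF deriv_order[OF p(2)]] p(1) by auto
  have "has_ord f2 z 0" using z by (intro has_ord_analytic analytic1)
  from has_ord_nonzero[OF this] d have "\<forall>\<^sub>F w in at z. wron w \<noteq> 0"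
    by eventually_elim (auto simp: deriv_f)
  then show ?thesis using eventually_happens by fastforce
qed

lemma deriv_ne_cosparse: "\<forall>\<^sub>\<approx>z. deriv f z \<noteq> 0"
proof -
  have "\<forall>\<^sub>\<approx>z. wron z \<noteq> 0" using entire_nonzero_cosparse[OF holo_wron] deriv_nz by blast
  then show ?thesis using value_ne_cosparse(1) by eventually_elim (auto simp: deriv_f)
qed

lemma hmax_pos: "0 < hmax f1 f2 z"
  using no_common[of z] by (auto simp: hmax_def less_max_iff_disj)

lemma hmax_cont: "continuous_on S (hmax f1 f2)"
  unfolding hmax_def[abs_def] using holo
  by (intro continuous_on_max continuous_on_norm) (auto intro: holomorphic_on_imp_continuous_on continuous_on_subset)

lemma hmax_eq: "f2 z \<noteq> 0 \<Longrightarrow> hmax f1 f2 z = norm (f2 z) * max 1 (norm (f z))"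
  by (simp add: hmax_def feq norm_divide max_mult_distrib_left max.commute)

end

text \<open>
  The circle means of \<open>ln (max |u1| |u2|)\<close>, that is, the characteristic of \<open>u1 / u2\<close>, are
  controlled by \<open>\<Lambda>\<close>. The form of the bound is the one in which it enters \<open>small_log_deriv\<close>.
\<close>

definition dominated :: "(real \<Rightarrow> real) \<Rightarrow> (complex \<Rightarrow> complex) \<Rightarrow> (complex \<Rightarrow> complex) \<Rightarrow> bool" where
  "dominated \<Lambda> u1 u2 \<longleftrightarrow> (\<exists>C D. countable D \<and> (\<forall>t\<ge>1. t \<notin> D \<longrightarrow> (\<forall>S>t.
      circle_mean t (\<lambda>z. ln (max (norm (u1 z)) (norm (u2 z)))) \<le> C * (\<Lambda> S * (S / (S - t))))))"

text \<open>
  The functions \<open>f - x\<close> and \<open>f'\<close> have characteristics bounded in terms of that of \<open>f\<close>; for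
  \<open>f'\<close> the factor \<open>1 + |\<psi>|\<close> is needed with \<open>\<psi> = f' / f\<close>.
\<close>

lemma dominated_transfer:
  assumes g: "growth \<Lambda>" and dom: "dominated \<Lambda> f1 f2" and Q: "quotient f f1 f2"
    and u: "u1 holomorphic_on UNIV" "u2 holomorphic_on UNIV" "u1 z1 \<noteq> 0" and \<psi>: "small \<Lambda> \<psi>"
    and le: "\<forall>\<^sub>\<approx>z. max (norm (u1 z)) (norm (u2 z)) \<le> hmax f1 f2 z ^ k * (1 + norm (\<psi> z))"
  shows "dominated \<Lambda> u1 u2"
proof -
  interpret quotient f f1 f2 by (fact Q)
  obtain C D where C: "countable D" "\<And>t S. 1 \<le> t \<Longrightarrow> t \<notin> D \<Longrightarrow> t < S \<Longrightarrow>
      circle_mean t (\<lambda>z. ln (hmax f1 f2 z)) \<le> C * (\<Lambda> S * (S / (S - t)))"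
    using dom unfolding dominated_def hmax_def by blast
  obtain C' D' where C': "0 \<le> C'" "countable D'"
    "\<And>r. 1 \<le> r \<Longrightarrow> r \<notin> D' \<Longrightarrow> continuous_on (sphere 0 r) \<psi> \<and>
     (\<forall>S>r. circle_mean r (\<lambda>z. ln (1 + norm (\<psi> z))) \<le> C' * err \<Lambda> r S)"
    using \<psi> unfolding small_def by blast
  have "\<forall>\<^sub>\<approx>z. u1 z \<noteq> 0 \<and> max (norm (u1 z)) (norm (u2 z)) \<le> hmax f1 f2 z ^ k * (1 + norm (\<psi> z))"
    using entire_nonzero_cosparse[OF u(1,3)] le by eventually_elim auto
  from cosparse_generic_radius[OF this] obtain E where E: "countable E"
    "\<And>r z. r \<notin> E \<Longrightarrow> norm z = r \<Longrightarrow> u1 z \<noteq> 0 \<and> max (norm (u1 z)) (norm (u2 z)) \<le> hmax f1 f2 z ^ k * (1 + norm (\<psi> z))"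
    by blast
  have "circle_mean t (\<lambda>z. ln (max (norm (u1 z)) (norm (u2 z)))) \<le> (real k * C + C') * (\<Lambda> S * (S / (S - t)))"
    if t: "1 \<le> t" "t \<notin> D \<union> D' \<union> E" "t < S" for t S
  proof -
    have p: "u1 z \<noteq> 0" "max (norm (u1 z)) (norm (u2 z)) \<le> hmax f1 f2 z ^ k * (1 + norm (\<psi> z))" if "norm z = t" for z
      using E(2)[of t z] t that by auto
    have c\<psi>: "continuous_on (sphere 0 t) (\<lambda>z. ln (1 + norm (\<psi> z)))"
      using C'(3)[of t] t by (intro continuous_on_ln_1_plus_norm) auto
    have ch: "continuous_on (sphere 0 t) (\<lambda>z. real k * ln (hmax f1 f2 z))"
      using hmax_pos by (intro continuous_on_mult continuous_on_const continuous_on_ln hmax_cont) (metis less_irrefl)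
    have "circle_mean t (\<lambda>z. ln (max (norm (u1 z)) (norm (u2 z)))) \<le>
        circle_mean t (\<lambda>z. real k * ln (hmax f1 f2 z) + ln (1 + norm (\<psi> z)))"
    proof (rule circle_mean_mono)
      have "\<forall>z\<in>sphere 0 t. max (norm (u1 z)) (norm (u2 z)) \<noteq> 0" using p(1) by (auto simp: max_def)
      then show "continuous_on (sphere 0 t) (\<lambda>z. ln (max (norm (u1 z)) (norm (u2 z))))"
        using u by (intro continuous_on_ln continuous_on_max continuous_on_norm)
          (auto intro: holomorphic_on_imp_continuous_on continuous_on_subset)
      show "continuous_on (sphere 0 t) (\<lambda>z. real k * ln (hmax f1 f2 z) + ln (1 + norm (\<psi> z)))"
        by (intro continuous_on_add ch c\<psi>)
      fix z :: complex assume z: "norm z = t"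
      have "0 < 1 + norm (\<psi> z)" by (simp add: add_pos_nonneg)
      moreover have "0 < max (norm (u1 z)) (norm (u2 z))" using p(1)[OF z] by (simp add: less_max_iff_disj)
      then have "ln (max (norm (u1 z)) (norm (u2 z))) \<le> ln (hmax f1 f2 z ^ k * (1 + norm (\<psi> z)))"
        using p(2)[OF z] by (intro ln_mono) auto
      ultimately show "ln (max (norm (u1 z)) (norm (u2 z))) \<le> real k * ln (hmax f1 f2 z) + ln (1 + norm (\<psi> z))"
        using hmax_pos[of z] by (simp add: ln_mult_pos ln_realpow)
    qed (use t in auto)
    also have "\<dots> = real k * circle_mean t (\<lambda>z. ln (hmax f1 f2 z)) + circle_mean t (\<lambda>z. ln (1 + norm (\<psi> z)))"
      using circle_mean_add[OF ch c\<psi>] t by (simp add: circle_mean_cmult)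
    also have "\<dots> \<le> real k * (C * (\<Lambda> S * (S / (S - t)))) + C' * (\<Lambda> S * (S / (S - t)))"
    proof (intro add_mono mult_left_mono)
      show "circle_mean t (\<lambda>z. ln (hmax f1 f2 z)) \<le> C * (\<Lambda> S * (S / (S - t)))" using C(2) t by auto
      have "circle_mean t (\<lambda>z. ln (1 + norm (\<psi> z))) \<le> C' * err \<Lambda> t S" using C'(3) t by auto
      also have "\<dots> \<le> C' * (\<Lambda> S * (S / (S - t)))"
      proof (rule mult_left_mono)
        show "err \<Lambda> t S \<le> \<Lambda> S * (S / (S - t))"
          unfolding err_def using err_arg_ge_1(3)[OF g t(1,3)] ln_le_minus_one[of "\<Lambda> S * (S / (S - t))"] by simp
      qed (fact C')
      finally show "circle_mean t (\<lambda>z. ln (1 + norm (\<psi> z))) \<le> C' * (\<Lambda> S * (S / (S - t)))" .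
    qed auto
    finally show ?thesis by (simp only: distrib_right mult.assoc)
  qed
  then show ?thesis unfolding dominated_def using C(1) C'(2) E(1)
    by (intro exI[of _ "real k * C + C'"] exI[of _ "D \<union> D' \<union> E"]) auto
qed

lemma log_deriv_quotient:
  assumes "u1 holomorphic_on UNIV" "u2 holomorphic_on UNIV" "u1 z \<noteq> 0" "u2 z \<noteq> 0"
    and "\<forall>\<^sub>F w in nhds z. F w = u1 w / u2 w"
  shows "deriv F z / F z = deriv u1 z / u1 z - deriv u2 z / u2 z"
proof -
  have "(u1 has_field_derivative deriv u1 z) (at z)" "(u2 has_field_derivative deriv u2 z) (at z)"
    using assms by (auto intro: holomorphic_derivI)
  from DERIV_divide[OF this assms(4)]
  have "deriv (\<lambda>w. u1 w / u2 w) z = (deriv u1 z * u2 z - u1 z * deriv u2 z) / (u2 z * u2 z)"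
    by (rule DERIV_imp_deriv)
  moreover have "deriv F z = deriv (\<lambda>w. u1 w / u2 w) z" by (rule deriv_cong_ev[OF assms(5) refl])
  moreover have "F z = u1 z / u2 z" using eventually_nhds_x_imp_x[OF assms(5)] .
  moreover have "(d * q - p * e) / (q * q) / (p / q) = d / p - e / q" if "p \<noteq> 0" "q \<noteq> 0" for p q d e :: complex
    using that by (simp add: field_simps)
  ultimately show ?thesis using assms(3,4) by simp
qed

context quotient
begin

lemma small_value:
  assumes g: "growth \<Lambda>" and dom: "dominated \<Lambda> f1 f2"
  shows "small \<Lambda> (\<lambda>z. deriv f z / (f z - x))"
proof -
  obtain z1 where z1: "f1 z1 - x * f2 z1 \<noteq> 0" using num_nz by blast
  obtain z2 where z2: "f2 z2 \<noteq> 0" using den_nz by blast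
  have "dominated \<Lambda> (\<lambda>z. f1 z - x * f2 z) f2"
  proof (rule dominated_transfer[OF g dom, of f])
    show "small \<Lambda> (\<lambda>z. x)" by (rule small_const[OF g])
    show "quotient f f1 f2" by unfold_locales
    have "max (norm (f1 z - x * f2 z)) (norm (f2 z)) \<le> hmax f1 f2 z ^ 1 * (1 + norm x)" for z
    proof -
      have h: "norm (f1 z) \<le> hmax f1 f2 z" "norm (f2 z) \<le> hmax f1 f2 z" "0 \<le> hmax f1 f2 z"
        using hmax_pos[of z] by (auto simp: hmax_def)
      have "norm (f1 z - x * f2 z) \<le> norm (f1 z) + norm x * norm (f2 z)"
        using norm_triangle_ineq4[of "f1 z" "x * f2 z"] by (simp add: norm_mult)
      also have "\<dots> \<le> hmax f1 f2 z + norm x * hmax f1 f2 z"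
        using h by (intro add_mono mult_left_mono) auto
      finally have "norm (f1 z - x * f2 z) \<le> hmax f1 f2 z + norm x * hmax f1 f2 z" .
      moreover have "0 \<le> norm x * hmax f1 f2 z" using h(3) by (rule mult_nonneg_nonneg[OF norm_ge_zero])
      ultimately have "max (norm (f1 z - x * f2 z)) (norm (f2 z)) \<le> hmax f1 f2 z + norm x * hmax f1 f2 z"
        using h(2) by linarith
      then show ?thesis by (simp add: algebra_simps)
    qed
    then show "\<forall>\<^sub>\<approx>z. max (norm (f1 z - x * f2 z)) (norm (f2 z)) \<le> hmax f1 f2 z ^ 1 * (1 + norm x)" by simp
  qed (use holo holo_num z1 in auto)
  from small_log_deriv[OF g holo_num holo(2) z1 z2 this[unfolded dominated_def]]
  have "small \<Lambda> (\<lambda>z. deriv (\<lambda>z. f1 z - x * f2 z) z / (f1 z - x * f2 z) - deriv f2 z / f2 z)" .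
  then show ?thesis
  proof (rule small_cong)
    show "\<forall>\<^sub>\<approx>z. deriv (\<lambda>z. f1 z - x * f2 z) z / (f1 z - x * f2 z) - deriv f2 z / f2 z = deriv f z / (f z - x)"
      using value_ne_cosparse(1) value_ne_cosparse(2)[of x]
    proof eventually_elim
      case (elim z)
      have n: "f1 z - x * f2 z \<noteq> 0" using elim by (auto simp: feq field_simps)
      have "\<forall>\<^sub>F w in nhds z. f2 w \<noteq> 0"
        using elim(1) by (rule den_ne_nhds)
      then have "\<forall>\<^sub>F w in nhds z. f w - x = (f1 w - x * f2 w) / f2 w"
        by eventually_elim (simp add: feq field_simps)
      from log_deriv_quotient[OF holo_num holo(2) n elim(1) this]
      show ?case by (simp add: deriv_minus_const)
    qed
  qed
qed

text \<open>
  The derivative is the quotient of \<open>wron\<close> and \<open>f2\<^sup>2\<close>, and \<open>wron = f1 * f2 * (f' / f)\<close>.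
\<close>

lemma small_second:
  assumes g: "growth \<Lambda>" and dom: "dominated \<Lambda> f1 f2"
  shows "small \<Lambda> (\<lambda>z. deriv (deriv f) z / deriv f z)"
proof -
  obtain z1 where z1: "wron z1 \<noteq> 0" using deriv_nz by blast
  obtain z2 where z2: "f2 z2 \<noteq> 0" using den_nz by blast
  then have z2': "(f2 z2)\<^sup>2 \<noteq> 0" by simp
  have h2: "(\<lambda>z. (f2 z)\<^sup>2) holomorphic_on UNIV" by (intro holomorphic_intros holo)
  have "dominated \<Lambda> wron (\<lambda>z. (f2 z)\<^sup>2)"
  proof (rule dominated_transfer[OF g dom, of f])
    show "small \<Lambda> (\<lambda>z. deriv f z / (f z - 0))" by (rule small_value[OF g dom])
    show "quotient f f1 f2" by unfold_locales
    show "\<forall>\<^sub>\<approx>z. max (norm (wron z)) (norm ((f2 z)\<^sup>2)) \<le> hmax f1 f2 z ^ 2 * (1 + norm (deriv f z / (f z - 0)))"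
      using value_ne_cosparse(1) value_ne_cosparse(2)[of 0]
    proof eventually_elim
      case (elim z)
      have h: "norm (f1 z) \<le> hmax f1 f2 z" "norm (f2 z) \<le> hmax f1 f2 z" "0 \<le> hmax f1 f2 z"
        using hmax_pos[of z] by (auto simp: hmax_def)
      have "wron z = (f1 z * f2 z) * (deriv f z / (f z - 0))"
        using elim by (simp add: deriv_f feq power2_eq_square)
      then have "norm (wron z) = (norm (f1 z) * norm (f2 z)) * norm (deriv f z / (f z - 0))"
        by (simp only: norm_mult)
      also have "\<dots> \<le> (hmax f1 f2 z * hmax f1 f2 z) * norm (deriv f z / (f z - 0))"
        using h by (intro mult_right_mono mult_mono) auto
      finally have 1: "norm (wron z) \<le> hmax f1 f2 z ^ 2 * norm (deriv f z / (f z - 0))"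
        by (simp add: power2_eq_square)
      have 2: "norm ((f2 z)\<^sup>2) \<le> hmax f1 f2 z ^ 2" using h by (simp add: norm_power power_mono)
      have "0 \<le> hmax f1 f2 z ^ 2 * norm (deriv f z / (f z - 0))" by simp
      moreover have "0 \<le> hmax f1 f2 z ^ 2" by simp
      ultimately show ?case using 1 2 unfolding distrib_left mult_1_right by linarith
    qed
  qed (use holo_wron h2 z1 in auto)
  from small_log_deriv[OF g holo_wron h2 z1 z2' this[unfolded dominated_def]]
  have "small \<Lambda> (\<lambda>z. deriv wron z / wron z - deriv (\<lambda>z. (f2 z)\<^sup>2) z / (f2 z)\<^sup>2)" .
  then show ?thesis
  proof (rule small_cong)
    show "\<forall>\<^sub>\<approx>z. deriv wron z / wron z - deriv (\<lambda>z. (f2 z)\<^sup>2) z / (f2 z)\<^sup>2 = deriv (deriv f) z / deriv f z"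
      using value_ne_cosparse(1) deriv_ne_cosparse
    proof eventually_elim
      case (elim z)
      have n: "wron z \<noteq> 0" "(f2 z)\<^sup>2 \<noteq> 0" using elim by (auto simp: deriv_f)
      have "\<forall>\<^sub>F w in nhds z. f2 w \<noteq> 0"
        using elim(1) by (rule den_ne_nhds)
      then have "\<forall>\<^sub>F w in nhds z. deriv f w = wron w / (f2 w)\<^sup>2"
        by eventually_elim (simp add: deriv_f)
      from log_deriv_quotient[OF holo_wron h2 n this]
      show ?case by simp
    qed
  qed
qed

lemma second_main:
  assumes g: "growth \<Lambda>" and dom: "dominated \<Lambda> f1 f2" and A: "finite A" "A \<noteq> {}"
  shows "\<exists>\<psi>. small \<Lambda> \<psi> \<and> (\<forall>\<^sub>\<approx>z. hmax f1 f2 z ^ (card A - 1) * norm (deriv f z)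
      \<le> norm (\<psi> z) * (norm (f2 z) ^ (card A - 1) * (\<Prod>y\<in>A. norm (f z - y))))"
proof -
  obtain C where C: "0 < C" "\<And>w d. w \<notin> A \<Longrightarrow> max 1 (norm w) ^ (card A - 1) * norm d \<le>
      C * ((\<Prod>y\<in>A. norm (w - y)) * (\<Sum>x\<in>A. norm (d / (w - x))))"
    using pointwise_second_main[OF A] by blast
  define \<psi> :: "complex \<Rightarrow> complex"
    where "\<psi> = (\<lambda>z. of_real C * (\<Sum>x\<in>A. of_real (norm (deriv f z / (f z - x)))))"
  have "small \<Lambda> \<psi>" unfolding \<psi>_def
    by (intro small_cmult small_sum small_norm small_value g dom)
  moreover have n\<psi>: "norm (\<psi> z) = C * (\<Sum>x\<in>A. norm (deriv f z / (f z - x)))" for z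
  proof -
    have "\<psi> z = of_real (C * (\<Sum>x\<in>A. norm (deriv f z / (f z - x))))" by (simp add: \<psi>_def)
    also have "norm \<dots> = C * (\<Sum>x\<in>A. norm (deriv f z / (f z - x)))"
      unfolding norm_of_real using C(1) by (intro abs_of_nonneg mult_nonneg_nonneg sum_nonneg) auto
    finally show ?thesis .
  qed
  have "\<forall>\<^sub>\<approx>z. \<forall>x\<in>A. f z \<noteq> x" using A(1) value_ne_cosparse(2) by (intro eventually_ball_finite) auto
  then have "\<forall>\<^sub>\<approx>z. hmax f1 f2 z ^ (card A - 1) * norm (deriv f z)
      \<le> norm (\<psi> z) * (norm (f2 z) ^ (card A - 1) * (\<Prod>y\<in>A. norm (f z - y)))"
    using value_ne_cosparse(1)
  proof eventually_elim
    case (elim z)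
    have "hmax f1 f2 z ^ (card A - 1) * norm (deriv f z) =
        norm (f2 z) ^ (card A - 1) * (max 1 (norm (f z)) ^ (card A - 1) * norm (deriv f z))"
      using elim by (simp add: hmax_eq power_mult_distrib)
    also have "\<dots> \<le> norm (f2 z) ^ (card A - 1) * (C * ((\<Prod>y\<in>A. norm (f z - y)) * (\<Sum>x\<in>A. norm (deriv f z / (f z - x)))))"
      using C(2)[of "f z" "deriv f z"] elim by (intro mult_left_mono) auto
    also have "\<dots> = norm (\<psi> z) * (norm (f2 z) ^ (card A - 1) * (\<Prod>y\<in>A. norm (f z - y)))"
      unfolding n\<psi> by (simp add: mult_ac)
    finally show ?case .
  qed
  ultimately show ?thesis by blast
qed

end

text \<open>
  The circle means of \<open>ln (max |g1| |g2|)\<close> are bounded below, so the mean for \<open>f\<close> alone is at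
  most the mean for the product up to a constant.
\<close>

lemma dominated_pair:
  assumes F: "quotient f f1 f2" and G: "quotient g g1 g2"
  shows "growth (char_fun (\<lambda>z. hmax f1 f2 z * hmax g1 g2 z))"
    "dominated (char_fun (\<lambda>z. hmax f1 f2 z * hmax g1 g2 z)) f1 f2"
proof -
  interpret F: quotient f f1 f2 by (fact F)
  interpret G: quotient g g1 g2 by (fact G)
  define \<mu> where "\<mu> = (\<lambda>z. hmax f1 f2 z * hmax g1 g2 z)"
  have c: "continuous_on UNIV \<mu>" unfolding \<mu>_def by (intro continuous_on_mult F.hmax_cont G.hmax_cont)
  have pos: "0 < \<mu> z" for z unfolding \<mu>_def by (intro mult_pos_pos F.hmax_pos G.hmax_pos)
  show g: "growth (char_fun (\<lambda>z. hmax f1 f2 z * hmax g1 g2 z))"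
    using growth_char_fun[OF c pos] by (simp add: \<mu>_def)
  obtain z2 where z2: "g2 z2 \<noteq> 0" using G.den_nz by blast
  obtain C where C: "0 \<le> C" "\<And>r. 1 \<le> r \<Longrightarrow> (\<forall>z. norm z = r \<longrightarrow> g2 z \<noteq> 0) \<Longrightarrow>
      - C \<le> circle_mean r (\<lambda>z. ln (norm (g2 z)))"
    using circle_mean_ln_lower_bound[OF G.holo(2) z2] by blast
  obtain D where D: "countable D" "\<And>r z. r \<notin> D \<Longrightarrow> norm z = r \<Longrightarrow> g2 z \<noteq> 0"
    using cosparse_generic_radius[OF G.value_ne_cosparse(1)] by blast
  have "circle_mean t (\<lambda>z. ln (hmax f1 f2 z)) \<le> (1 + C) * (char_fun \<mu> S * (S / (S - t)))"
    if t: "1 \<le> t" "t \<notin> D" "t < S" for t S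
  proof -
    have lc: "continuous_on (sphere 0 t) (\<lambda>z. ln (hmax f1 f2 z))" "continuous_on (sphere 0 t) (\<lambda>z. ln (hmax g1 g2 z))"
      using F.hmax_pos G.hmax_pos by (intro continuous_on_ln F.hmax_cont G.hmax_cont; metis less_irrefl)+
    have "- C \<le> circle_mean t (\<lambda>z. ln (norm (g2 z)))" using C(2) t D(2) by blast
    also have "\<dots> \<le> circle_mean t (\<lambda>z. ln (hmax g1 g2 z))"
    proof (rule circle_mean_mono[OF _ lc(2)])
      show "continuous_on (sphere 0 t) (\<lambda>z. ln (norm (g2 z)))"
        using D(2) t G.holo(2) by (intro continuous_on_ln_norm) (auto intro: holomorphic_on_imp_continuous_on continuous_on_subset)
      fix z :: complex assume "norm z = t"
      then have "0 < norm (g2 z)" using D(2) t by simp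
      then show "ln (norm (g2 z)) \<le> ln (hmax g1 g2 z)" by (intro ln_mono) (auto simp: hmax_def)
    qed (use t in auto)
    finally have 1: "- C \<le> circle_mean t (\<lambda>z. ln (hmax g1 g2 z))" .
    have "circle_mean t (\<lambda>z. ln (\<mu> z)) = circle_mean t (\<lambda>z. ln (hmax f1 f2 z) + ln (hmax g1 g2 z))"
      using F.hmax_pos G.hmax_pos t by (intro circle_mean_cong) (auto simp: \<mu>_def ln_mult_pos)
    also have "\<dots> = circle_mean t (\<lambda>z. ln (hmax f1 f2 z)) + circle_mean t (\<lambda>z. ln (hmax g1 g2 z))"
      using t by (intro circle_mean_add lc) auto
    finally have "circle_mean t (\<lambda>z. ln (hmax f1 f2 z)) \<le> circle_mean t (\<lambda>z. ln (\<mu> z)) + C" using 1 by simp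
    also have "\<dots> \<le> char_fun \<mu> S + C" using le_char_fun[OF c pos t(1), of S] t by simp
    also have "\<dots> \<le> (1 + C) * (char_fun \<mu> S * (S / (S - t)))"
    proof -
      have e: "1 \<le> S / (S - t)" "1 \<le> char_fun \<mu> S" "1 \<le> char_fun \<mu> S * (S / (S - t))"
        using err_arg_ge_1[OF growth_char_fun[OF c pos] t(1,3)] by auto
      have "char_fun \<mu> S * 1 \<le> char_fun \<mu> S * (S / (S - t))" using e by (intro mult_left_mono) auto
      moreover have "C * 1 \<le> C * (char_fun \<mu> S * (S / (S - t)))" using mult_left_mono[OF e(3) C(1)] .
      ultimately show ?thesis unfolding distrib_right by linarith
    qed
    finally show ?thesis .
  qed
  then show "dominated (char_fun (\<lambda>z. hmax f1 f2 z * hmax g1 g2 z)) f1 f2"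
    unfolding dominated_def \<mu>_def[symmetric] using D(1) unfolding hmax_def by blast
qed

lemma dominated_pair2:
  assumes F: "quotient f f1 f2" and G: "quotient g g1 g2"
  shows "dominated (char_fun (\<lambda>z. hmax f1 f2 z * hmax g1 g2 z)) g1 g2"
  using dominated_pair(2)[OF G F] by (simp add: mult.commute)

text \<open>
  The function \<open>u\<close> required by \<open>entire_small_impossible\<close> is \<open>(f1 - f a * f2) * g2\<close>, which
  vanishes at \<open>a\<close> and is bounded by a multiple of the product of the two maxima.
\<close>

lemma key_contradiction:
  assumes F: "quotient f f1 f2" and G: "quotient g g1 g2"
    and Om: "\<And>z. ord_ge Om z 0" "\<not> (\<forall>\<^sub>\<approx>z. Om z = 0)"
    and \<psi>: "small (char_fun (\<lambda>z. hmax f1 f2 z * hmax g1 g2 z)) \<psi>" and k: "1 \<le> k"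
    and le: "\<forall>\<^sub>\<approx>z. norm (Om z) * (hmax f1 f2 z * hmax g1 g2 z) ^ k \<le> norm (\<psi> z)"
  shows False
proof -
  interpret F: quotient f f1 f2 by (fact F)
  interpret G: quotient g g1 g2 by (fact G)
  obtain O' where O': "O' holomorphic_on UNIV" "\<forall>\<^sub>\<approx>z. Om z = O' z"
    using ord_ge_0_entire[OF Om(1)] by blast
  obtain z1 where z1: "O' z1 \<noteq> 0"
  proof (rule ccontr)
    assume "\<not> thesis"
    then have "O' z = 0" for z using that by blast
    then show False using O'(2) Om(2) by simp
  qed
  obtain a where a: "f2 a \<noteq> 0" using F.den_nz by blast
  define u where "u = (\<lambda>z. (f1 z - f a * f2 z) * g2 z)"
  have uh: "u holomorphic_on UNIV" unfolding u_def by (intro holomorphic_on_mult F.holo_num G.holo)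
  obtain z0 where z0: "u z0 \<noteq> 0"
  proof -
    obtain x where "f1 x - f a * f2 x \<noteq> 0" using F.num_nz by blast
    from entire_nonzero_cosparse[OF F.holo_num this] G.value_ne_cosparse(1)
    have "\<forall>\<^sub>\<approx>z. u z \<noteq> 0" by eventually_elim (simp add: u_def)
    then have "\<forall>\<^sub>F z in at 0. u z \<noteq> 0" by (simp add: eventually_cosparse_open_eq)
    then show ?thesis using that eventually_happens by fastforce
  qed
  show False
  proof (rule entire_small_impossible[OF _ _ uh z0 _ _ O'(1) z1 \<psi> k])
    show "continuous_on UNIV (\<lambda>z. hmax f1 f2 z * hmax g1 g2 z)"
      by (intro continuous_on_mult F.hmax_cont G.hmax_cont)
    show "0 < hmax f1 f2 z * hmax g1 g2 z" for z by (intro mult_pos_pos F.hmax_pos G.hmax_pos)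
    show "u a = 0" using a by (simp add: u_def F.feq)
    show "norm (u z) \<le> (1 + norm (f a)) * (hmax f1 f2 z * hmax g1 g2 z)" for z
    proof -
      have h: "norm (f1 z) \<le> hmax f1 f2 z" "norm (f2 z) \<le> hmax f1 f2 z" "norm (g2 z) \<le> hmax g1 g2 z" "0 \<le> hmax f1 f2 z"
        using F.hmax_pos[of z] by (auto simp: hmax_def)
      have "norm (f1 z - f a * f2 z) \<le> norm (f1 z) + norm (f a) * norm (f2 z)"
        using norm_triangle_ineq4[of "f1 z" "f a * f2 z"] by (simp add: norm_mult)
      also have "\<dots> \<le> hmax f1 f2 z + norm (f a) * hmax f1 f2 z"
        using h by (intro add_mono mult_left_mono) auto
      finally have "norm (f1 z - f a * f2 z) \<le> (1 + norm (f a)) * hmax f1 f2 z" by (simp add: algebra_simps)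
      then have "norm (u z) \<le> ((1 + norm (f a)) * hmax f1 f2 z) * hmax g1 g2 z"
        unfolding u_def norm_mult using h by (intro mult_mono) auto
      then show ?thesis by (simp add: mult.assoc)
    qed
    show "\<forall>\<^sub>\<approx>z. norm (O' z) * (hmax f1 f2 z * hmax g1 g2 z) ^ k \<le> norm (\<psi> z)"
      using O'(2) le by eventually_elim simp
  qed
qed

section \<open>Polynomials of meromorphic functions\<close>

lemma poly_eq_prod_roots:
  "poly q z = lead_coeff q * (\<Prod>x | poly q x = 0. (z - x) ^ order x q)" for q :: "complex poly"
proof -
  have "poly (smult (lead_coeff q) (\<Prod>x|poly q x = 0. [:-x, 1:] ^ order x q)) z =
      lead_coeff q * (\<Prod>x | poly q x = 0. (z - x) ^ order x q)"
    by (simp add: poly_prod)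
  then show ?thesis unfolding complex_poly_decompose .
qed

lemma sum_order_roots:
  fixes q :: "complex poly"
  assumes "q \<noteq> 0" shows "(\<Sum>x | poly q x = 0. order x q) = degree q"
proof -
  have "degree q = degree (\<Prod>x|poly q x = 0. [:-x, 1:] ^ order x q)"
    using complex_poly_decompose[of q] assms by (metis degree_smult_eq leading_coeff_0_iff)
  also have "\<dots> = (\<Sum>x | poly q x = 0. order x q)"
    by (subst degree_prod_sum_eq) (auto simp: degree_power_eq)
  finally show ?thesis by simp
qed

lemma poly_comp_order:
  fixes q :: "complex poly"
  assumes q: "q \<noteq> 0" and k: "\<And>x. poly q x = 0 \<Longrightarrow> has_ord (\<lambda>w. f w - x) z (k x)"
  shows "has_ord (\<lambda>w. poly q (f w)) z (\<Sum>x | poly q x = 0. int (order x q) * k x)"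
proof -
  have "has_ord (\<lambda>w. \<Prod>x | poly q x = 0. (f w - x) ^ order x q) z (\<Sum>x | poly q x = 0. int (order x q) * k x)"
    by (intro has_ord_prod has_ord_power k) simp
  from has_ord_mult[OF has_ord_const[of "lead_coeff q" z] this]
  have "has_ord (\<lambda>w. lead_coeff q * (\<Prod>x | poly q x = 0. (f w - x) ^ order x q)) z
      (0 + (\<Sum>x | poly q x = 0. int (order x q) * k x))" using q by simp
  moreover have "(\<lambda>w. poly q (f w)) = (\<lambda>w. lead_coeff q * (\<Prod>x | poly q x = 0. (f w - x) ^ order x q))"
    by (rule ext, rule poly_eq_prod_roots)
  ultimately show ?thesis by (simp only: add_0)
qed

lemma poly_upper_bound:
  fixes q :: "complex poly"
  shows "\<exists>C>0. \<forall>w. norm (poly q w) \<le> C * max 1 (norm w) ^ degree q"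
proof -
  define C where "C = 1 + (\<Sum>i\<le>degree q. norm (coeff q i))"
  have "norm (poly q w) \<le> C * max 1 (norm w) ^ degree q" for w
  proof -
    have "norm (poly q w) \<le> (\<Sum>i\<le>degree q. norm (coeff q i * w ^ i))"
      unfolding poly_altdef by (rule norm_sum)
    also have "\<dots> \<le> (\<Sum>i\<le>degree q. norm (coeff q i) * max 1 (norm w) ^ degree q)"
    proof (rule sum_mono)
      fix i assume i: "i \<in> {..degree q}"
      have "norm w ^ i \<le> max 1 (norm w) ^ i" by (intro power_mono) auto
      also have "\<dots> \<le> max 1 (norm w) ^ degree q" using i by (intro power_increasing) auto
      finally show "norm (coeff q i * w ^ i) \<le> norm (coeff q i) * max 1 (norm w) ^ degree q"
        by (simp add: norm_mult norm_power mult_left_mono)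
    qed
    also have "\<dots> = (\<Sum>i\<le>degree q. norm (coeff q i)) * max 1 (norm w) ^ degree q"
      by (simp add: sum_distrib_right)
    also have "\<dots> \<le> C * max 1 (norm w) ^ degree q" unfolding C_def by (intro mult_right_mono) auto
    finally show ?thesis .
  qed
  moreover have "0 < C" unfolding C_def by (intro add_pos_nonneg sum_nonneg) auto
  ultimately show ?thesis by blast
qed

lemma poly_lower_bound:
  fixes q :: "complex poly"
  assumes q: "q \<noteq> 0"
  shows "\<exists>C>0. \<forall>w. max 1 (norm w) ^ degree q \<le> C * (1 + norm (poly q w))"
proof -
  define R where "R = 1 + 2 * (\<Sum>x | poly q x = 0. norm x)"
  have fin: "finite {x. poly q x = 0}" using q by (rule poly_roots_finite)
  have R1: "1 \<le> R" unfolding R_def by (simp add: sum_nonneg)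
  have xR: "2 * norm x \<le> R" if "poly q x = 0" for x
    using member_le_sum[of x "{x. poly q x = 0}" norm] fin that by (simp add: R_def)
  define l where "l = norm (lead_coeff q)"
  have l: "0 < l" using q by (simp add: l_def)
  define C where "C = R ^ degree q + 2 ^ degree q / l"
  have C: "0 < C" using R1 l by (simp add: C_def add_pos_nonneg)
  have "max 1 (norm w) ^ degree q \<le> C * (1 + norm (poly q w))" for w
  proof (cases "norm w \<le> R")
    case True
    have "max 1 (norm w) ^ degree q \<le> R ^ degree q" using True R1 by (intro power_mono) auto
    also have "\<dots> \<le> C * 1" using l by (simp add: C_def)
    also have "\<dots> \<le> C * (1 + norm (poly q w))" using C by (intro mult_left_mono) auto
    finally show ?thesis .
  next
    case False
    have "(norm w / 2) ^ degree q = (\<Prod>x | poly q x = 0. (norm w / 2) ^ order x q)"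
      by (simp add: power_sum sum_order_roots[OF q, symmetric])
    also have "\<dots> \<le> (\<Prod>x | poly q x = 0. norm (w - x) ^ order x q)"
    proof (intro prod_mono conjI power_mono)
      fix x assume "x \<in> {x. poly q x = 0}"
      then have "2 * norm x \<le> R" using xR by auto
      then show "norm w / 2 \<le> norm (w - x)" using False norm_triangle_ineq2[of w x] by simp
    qed auto
    finally have "l * (norm w / 2) ^ degree q \<le> norm (poly q w)"
      unfolding poly_eq_prod_roots[of q w] norm_mult l_def
      by (simp add: prod_norm[symmetric] norm_power mult_left_mono)
    then have "norm w ^ degree q \<le> 2 ^ degree q / l * norm (poly q w)"
      using l by (simp add: field_simps power_divide)
    also have "\<dots> \<le> C * (1 + norm (poly q w))"
    proof -
      have "2 ^ degree q / l * norm (poly q w) \<le> C * norm (poly q w)"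
        using R1 by (intro mult_right_mono) (auto simp: C_def)
      then show ?thesis using C by (simp add: algebra_simps)
    qed
    finally show ?thesis using False R1 by (simp add: max_def)
  qed
  then show ?thesis using C by blast
qed

context quotient
begin

lemma poly_comp_pole:
  assumes q: "q \<noteq> 0" and k: "\<And>x. has_ord (\<lambda>w. f w - x) z (- int k)"
  shows "has_ord (\<lambda>w. poly q (f w)) z (- (int (degree q) * int k))"
proof -
  have "has_ord (\<lambda>w. poly q (f w)) z (\<Sum>x | poly q x = 0. int (order x q) * (- int k))"
    by (intro poly_comp_order q k)
  also have "(\<Sum>x | poly q x = 0. int (order x q) * (- int k)) = - (int (degree q) * int k)"
    by (simp add: sum_order_roots[OF q, symmetric] sum_distrib_right sum_negf)
  finally show ?thesis .
qed

lemma poly_comp_analytic: "f2 z \<noteq> 0 \<Longrightarrow> (\<lambda>w. poly q (f w)) analytic_on {z}"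
  unfolding poly_altdef by (intro analytic_intros analytic) auto

lemma poly_comp_zero:
  assumes q: "q \<noteq> 0" and z: "f2 z \<noteq> 0" and k: "has_ord (\<lambda>w. f w - f z) z k"
  shows "has_ord (\<lambda>w. poly q (f w)) z (int (order (f z) q) * k)"
proof (cases "poly q (f z) = 0")
  case True
  define kk where "kk = (\<lambda>x. if x = f z then k else 0)"
  have "has_ord (\<lambda>w. poly q (f w)) z (\<Sum>x | poly q x = 0. int (order x q) * kk x)"
    by (intro poly_comp_order q) (use regular_order[OF z] k in \<open>auto simp: kk_def\<close>)
  also have "(\<Sum>x | poly q x = 0. int (order x q) * kk x) = (\<Sum>x\<in>{f z}. int (order x q) * kk x)"
    by (rule sum.mono_neutral_right) (use True q poly_roots_finite in \<open>auto simp: kk_def\<close>)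
  finally show ?thesis by (simp add: kk_def)
next
  case False
  then have "order (f z) q = 0" by (rule order_0I)
  moreover have "has_ord (\<lambda>w. poly q (f w)) z 0" using False by (intro has_ord_analytic poly_comp_analytic z)
  ultimately show ?thesis by simp
qed

lemma poly_comp_order_exists:
  assumes "q \<noteq> 0" shows "\<exists>k. has_ord (\<lambda>w. poly q (f w)) z k"
proof -
  obtain k where "\<And>x. has_ord (\<lambda>w. f w - x) z (k x)" using order_exists[of _ z] by metis
  then show ?thesis using poly_comp_order[OF assms] by blast
qed

lemma poly_comp_ne_cosparse:
  assumes "q \<noteq> 0" shows "\<forall>\<^sub>\<approx>z. poly q (f z) \<noteq> 0"
proof -
  have "\<forall>\<^sub>\<approx>z. \<forall>x\<in>{x. poly q x = 0}. f z \<noteq> x"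
    using poly_roots_finite[OF assms] value_ne_cosparse(2) by (intro eventually_ball_finite) auto
  then show ?thesis by eventually_elim auto
qed

lemma poly_le_hmax:
  "\<exists>C>0. \<forall>z. f2 z \<noteq> 0 \<longrightarrow> norm (f2 z) ^ degree q * norm (poly q (f z)) \<le> C * hmax f1 f2 z ^ degree q"
proof -
  obtain C where C: "0 < C" "\<And>w. norm (poly q w) \<le> C * max 1 (norm w) ^ degree q"
    using poly_upper_bound[of q] by blast
  have "norm (f2 z) ^ degree q * norm (poly q (f z)) \<le> C * hmax f1 f2 z ^ degree q" if z: "f2 z \<noteq> 0" for z
  proof -
    have "norm (f2 z) ^ degree q * norm (poly q (f z)) \<le> norm (f2 z) ^ degree q * (C * max 1 (norm (f z)) ^ degree q)"
      using C(2) by (intro mult_left_mono) auto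
    also have "\<dots> = C * hmax f1 f2 z ^ degree q" using z by (simp add: hmax_eq power_mult_distrib)
    finally show ?thesis .
  qed
  then show ?thesis using C(1) by blast
qed

lemma key_contradiction_single:
  assumes Om: "\<And>z. ord_ge Om z 0" "\<not> (\<forall>\<^sub>\<approx>z. Om z = 0)"
    and \<psi>: "small (char_fun (\<lambda>z. hmax f1 f2 z * hmax f1 f2 z)) \<psi>" and k: "1 \<le> k"
    and le: "\<forall>\<^sub>\<approx>z. norm (Om z) * hmax f1 f2 z ^ k \<le> norm (\<psi> z)"
  shows False
proof -
  have Q: "quotient f f1 f2" by unfold_locales
  show False
  proof (rule key_contradiction[OF Q Q])
    show "ord_ge (\<lambda>z. Om z ^ 2) z 0" for z using ord_ge_power[OF Om(1)[of z], of 2] by simp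
    show "\<not> (\<forall>\<^sub>\<approx>z. Om z ^ 2 = 0)" using Om(2) by simp
    show "small (char_fun (\<lambda>z. hmax f1 f2 z * hmax f1 f2 z)) (\<lambda>z. \<psi> z ^ 2)"
      by (intro small_power \<psi> dominated_pair(1)[OF Q Q])
    show "1 \<le> k" by (fact k)
    show "\<forall>\<^sub>\<approx>z. norm (Om z ^ 2) * (hmax f1 f2 z * hmax f1 f2 z) ^ k \<le> norm (\<psi> z ^ 2)"
      using le
    proof eventually_elim
      case (elim z)
      have "(norm (Om z) * hmax f1 f2 z ^ k) ^ 2 \<le> norm (\<psi> z) ^ 2"
        using elim hmax_pos[of z] by (intro power_mono) auto
      then show ?case by (simp add: norm_mult norm_power power_mult_distrib power2_eq_square mult_ac)
    qed
  qed
qed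

text \<open>
  A nonconstant meromorphic function cannot take three values with multiplicity at least \<open>4\<close>
  only. With \<open>P\<close> the product of the three factors \<open>f - x\<close>, the quotient \<open>f'\<^sup>4 / (P\<^sup>3 * f2)\<close> is
  regular: a value of multiplicity \<open>j\<close> contributes \<open>4 * (j - 1) - 3 * j = j - 4\<close>, and a pole
  of order \<open>k\<close> contributes \<open>4 * k - 4\<close>.
\<close>

lemma totally_ramified_values:
  assumes A: "card A = 3"
    and ram: "\<And>z. f2 z \<noteq> 0 \<Longrightarrow> f z \<in> A \<Longrightarrow> \<exists>j\<ge>4. has_ord (\<lambda>w. f w - f z) z (int j)"
  shows False
proof -
  have fin: "finite A" "A \<noteq> {}" using A by (auto intro: card_ge_0_finite)
  have Q: "quotient f f1 f2" by unfold_locales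
  define \<Lambda> where "\<Lambda> = char_fun (\<lambda>z. hmax f1 f2 z * hmax f1 f2 z)"
  have g: "growth \<Lambda>" and dom: "dominated \<Lambda> f1 f2" unfolding \<Lambda>_def using dominated_pair[OF Q Q] by auto
  define P where "P = (\<lambda>z. \<Prod>x\<in>A. f z - x)"
  define Om where "Om = (\<lambda>z. deriv f z ^ 4 / (P z ^ 3 * f2 z))"
  obtain \<psi> where \<psi>: "small \<Lambda> \<psi>" "\<forall>\<^sub>\<approx>z. hmax f1 f2 z ^ (card A - 1) * norm (deriv f z)
      \<le> norm (\<psi> z) * (norm (f2 z) ^ (card A - 1) * (\<Prod>y\<in>A. norm (f z - y)))"
    using second_main[OF g dom fin] by blast
  define q where "q = (\<Prod>x\<in>A. [:-x, 1:])"
  have dq: "degree q = 3" unfolding q_def using A by (subst degree_prod_sum_eq) auto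
  have qP: "poly q (f z) = P z" for z by (simp add: q_def poly_prod P_def)
  obtain C where C: "0 < C" "\<And>z. f2 z \<noteq> 0 \<Longrightarrow> norm (f2 z) ^ 3 * norm (P z) \<le> C * hmax f1 f2 z ^ 3"
    using poly_le_hmax[of q] unfolding dq qP by blast
  have P0: "\<forall>\<^sub>\<approx>z. P z \<noteq> 0"
  proof -
    have "q \<noteq> 0" using dq by auto
    from poly_comp_ne_cosparse[OF this] show ?thesis unfolding qP .
  qed
  show False
  proof (rule key_contradiction_single[of Om "\<lambda>z. of_real C * \<psi> z ^ 4" 1])
    show "small (char_fun (\<lambda>z. hmax f1 f2 z * hmax f1 f2 z)) (\<lambda>z. of_real C * \<psi> z ^ 4)"
      using \<psi>(1) g unfolding \<Lambda>_def by (intro small_cmult small_power)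
    have "\<forall>\<^sub>\<approx>z. Om z \<noteq> 0"
      using value_ne_cosparse(1) deriv_ne_cosparse P0 by eventually_elim (auto simp: Om_def)
    then show "\<not> (\<forall>\<^sub>\<approx>z. Om z = 0)"
      using eventually_happens[OF eventually_conj, of _ "cosparse (UNIV::complex set)"] by fastforce
    show "\<forall>\<^sub>\<approx>z. norm (Om z) * hmax f1 f2 z ^ 1 \<le> norm (of_real C * \<psi> z ^ 4)"
      using \<psi>(2) value_ne_cosparse(1) P0
    proof eventually_elim
      case (elim z)
      define h where "h = hmax f1 f2 z"
      define d where "d = norm (f2 z)"
      define t where "t = norm (P z)"
      define s where "s = norm (deriv f z)"
      have h: "0 < h" "d \<le> h" "0 < d" "0 < t" using hmax_pos[of z] elim by (auto simp: h_def d_def t_def hmax_def)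
      have e1: "h ^ 2 * s \<le> norm (\<psi> z) * (d ^ 2 * t)"
        using elim(1) A by (simp add: h_def s_def d_def t_def P_def prod_norm)
      have e2: "d ^ 3 * t \<le> C * h ^ 3" using C(2) elim by (simp add: h_def d_def t_def)
      have "(h ^ 2 * s) ^ 4 \<le> (norm (\<psi> z) * (d ^ 2 * t)) ^ 4" using e1 h by (intro power_mono) (auto simp: s_def)
      then have "h ^ 8 * s ^ 4 \<le> norm (\<psi> z) ^ 4 * (d ^ 8 * t ^ 4)" by (simp add: power_mult_distrib power_mult[symmetric])
      then have "h ^ 8 * (s ^ 4 / (t ^ 3 * d)) \<le> norm (\<psi> z) ^ 4 * (d ^ 4 * (d ^ 3 * t))"
        using h by (simp add: field_simps power_numeral_reduce)
      also have "\<dots> \<le> norm (\<psi> z) ^ 4 * (h ^ 4 * (C * h ^ 3))"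
        using h e2 by (intro mult_left_mono mult_mono[OF power_mono e2]) auto
      finally have "h ^ 8 * (s ^ 4 / (t ^ 3 * d)) \<le> norm (\<psi> z) ^ 4 * (h ^ 4 * (C * h ^ 3))" .
      moreover have "h ^ 8 = h ^ 7 * h" "h ^ 4 * (C * h ^ 3) = h ^ 7 * C"
        by (simp_all add: eval_nat_numeral mult_ac)
      ultimately have "h ^ 7 * h * (s ^ 4 / (t ^ 3 * d)) \<le> norm (\<psi> z) ^ 4 * (h ^ 7 * C)"
        by (simp only:)
      then have "h ^ 7 * (h * (s ^ 4 / (t ^ 3 * d))) \<le> h ^ 7 * (C * norm (\<psi> z) ^ 4)"
        by (simp only: mult_ac)
      then have "h * (s ^ 4 / (t ^ 3 * d)) \<le> C * norm (\<psi> z) ^ 4"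
        by (rule mult_left_le_imp_le) (use h in simp)
      moreover have "norm (Om z) = s ^ 4 / (t ^ 3 * d)"
        by (simp only: Om_def s_def t_def d_def norm_mult norm_divide norm_power)
      moreover have "norm (of_real C * \<psi> z ^ 4) = C * norm (\<psi> z) ^ 4"
        using C(1) by (simp add: norm_mult norm_power)
      ultimately show ?case by (simp only: h_def power_one_right mult.commute)
    qed
    show "ord_ge Om z 0" for z
    proof (cases "f2 z = 0")
      case True
      then obtain k where k: "k > 0" "has_ord f2 z (int k)" "\<And>x. has_ord (\<lambda>w. f w - x) z (- int k)"
        using pole_order by blast
      have dd: "has_ord (deriv f) z (- int k - 1)" using deriv_order[OF k(3)] k(1) by simp
      have PP: "has_ord P z (- (3 * int k))"
      proof -
        have "q \<noteq> 0" using dq by auto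
        from poly_comp_pole[OF this k(3)] show ?thesis unfolding qP dq by simp
      qed
      have "has_ord Om z (int 4 * (- int k - 1) - (int 3 * (- (3 * int k)) + int k))"
        unfolding Om_def by (intro has_ord_divide has_ord_mult has_ord_power dd PP k(2))
      then show ?thesis using k(1) by (auto intro: ord_ge_mono has_ord_imp_ord_ge)
    next
      case False
      have d2: "has_ord f2 z 0" using False by (intro has_ord_analytic analytic1)
      show ?thesis
      proof (cases "f z \<in> A")
        case True
        then obtain j where j: "4 \<le> j" "has_ord (\<lambda>w. f w - f z) z (int j)" using ram[OF False] by blast
        have dd: "has_ord (deriv f) z (int j - 1)" using deriv_order[OF j(2)] j(1) by simp
        have "has_ord P z (\<Sum>x\<in>A. if x = f z then int j else 0)"
          unfolding P_def using j(2) regular_order[OF False] by (intro has_ord_prod) auto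
        then have PP: "has_ord P z (int j)" using True fin by simp
        have "has_ord Om z (int 4 * (int j - 1) - (int 3 * int j + 0))"
          unfolding Om_def by (intro has_ord_divide has_ord_mult has_ord_power dd PP d2)
        then show ?thesis using j(1) by (auto intro: ord_ge_mono has_ord_imp_ord_ge)
      next
        case fA: False
        have "P z \<noteq> 0" using fA fin by (auto simp: P_def)
        moreover have "P analytic_on {z}" unfolding P_def by (intro analytic_intros analytic False)
        ultimately have PP: "has_ord P z 0" by (intro has_ord_analytic)
        have dd: "ord_ge (deriv f) z 0" by (intro ord_ge_deriv_analytic analytic False)
        have "ord_ge Om z (int 4 * 0 - (int 3 * 0 + 0))"
          unfolding Om_def by (intro ord_ge_divide ord_ge_power has_ord_mult has_ord_power dd PP d2)
        then show ?thesis by simp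
      qed
    qed
  qed simp
qed

end

section \<open>Polynomials with two critical points\<close>

locale two_crit =
  fixes p :: "complex poly" and a b :: complex and n m :: nat
  assumes pd: "pderiv p = [:-a, 1:] ^ n * [:-b, 1:] ^ m" and ab: "a \<noteq> b" and n2: "2 \<le> n" and m2: "2 \<le> m"
begin

text \<open>
  Statements about \<open>b\<close> are obtained from those about \<open>a\<close> by this symmetry.
\<close>

lemma two_crit_swap: "two_crit p b a m n"
proof
  show "pderiv p = [:-b, 1:] ^ m * [:-a, 1:] ^ n" unfolding pd by (rule mult.commute)
qed (use ab n2 m2 in auto)

lemma degree_p: "degree p = n + m + 1"
proof -
  have "degree (pderiv p) = n + m" unfolding pd by (subst degree_mult_eq) (auto simp: degree_power_eq)
  then show ?thesis using n2 by (simp add: degree_pderiv)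
qed

lemma poly_pderiv: "poly (pderiv p) z = (z - a) ^ n * (z - b) ^ m"
  unfolding pd by simp

lemma shift: "degree (p - [:v:]) = n + m + 1" "p - [:v:] \<noteq> 0" "pderiv (p - [:v:]) = pderiv p"
proof -
  show 1: "degree (p - [:v:]) = n + m + 1"
  proof -
    have "degree (p + - [:v:]) = degree p" by (rule degree_add_eq_left) (simp add: degree_p)
    then show ?thesis by (simp only: diff_conv_add_uminus degree_p)
  qed
  then show "p - [:v:] \<noteq> 0" by auto
  show "pderiv (p - [:v:]) = pderiv p" by (simp add: pderiv_diff pderiv_pCons)
qed

lemma order_shift:
  assumes "poly p x = v"
  shows "order x (p - [:v:]) = (if x = a then n + 1 else if x = b then m + 1 else 1)"
proof -
  have o: "poly (p - [:v:]) x = 0" using assms by simp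
  have "order x (p - [:v:]) = Suc (order x (pderiv p))"
    using order_pderiv[OF shift(2) o] unfolding shift(3) .
  also have "order x (pderiv p) = (if x = a then n else 0) + (if x = b then m else 0)"
    unfolding pd by (subst order_mult) (auto simp: order_power_n_n order_0I)
  finally show ?thesis using ab by auto
qed

text \<open>
  The difference \<open>p b - p a\<close> is a nonzero multiple of a Beta integral.
\<close>

lemma crit_values_ne: "poly p a \<noteq> poly p b"
proof
  assume eq: "poly p a = poly p b"
  define d where "d = b - a"
  define c where "c = d ^ (n + m + 1) * (-1) ^ m"
  have c: "c \<noteq> 0" using ab by (simp add: c_def d_def)
  define \<phi> where "\<phi> = (\<lambda>t::real. Re (poly p (a + of_real t * d) / c))"
  have D: "(\<phi> has_real_derivative t ^ n * (1 - t) ^ m) (at t)" for t :: real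
  proof -
    have "((\<lambda>s. a + s * d) has_field_derivative d) (at (of_real t))"
      by (auto intro!: derivative_eq_intros)
    from DERIV_cdivide[OF DERIV_chain2[OF poly_DERIV this]]
    have "((\<lambda>s. poly p (a + s * d) / c) has_field_derivative poly (pderiv p) (a + of_real t * d) * d / c) (at (of_real t))" .
    also have "poly (pderiv p) (a + of_real t * d) * d / c = of_real (t ^ n * (1 - t) ^ m)"
    proof -
      have "a + of_real t * d - b = - of_real (1 - t) * d" by (simp add: d_def algebra_simps)
      then have "poly (pderiv p) (a + of_real t * d) = (of_real t * d) ^ n * (- of_real (1 - t) * d) ^ m"
        by (simp add: poly_pderiv)
      also have "\<dots> = of_real (t ^ n * (1 - t) ^ m) * (d ^ (n + m) * (-1) ^ m)"
      proof -
        have "(y * d) ^ n * (- x * d) ^ m = (y ^ n * x ^ m) * (d ^ (n + m) * (-1) ^ m)" for x y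
        proof -
          have "(y * d) ^ n * (- x * d) ^ m = y ^ n * d ^ n * ((- x) ^ m * d ^ m)"
            by (simp only: power_mult_distrib)
          also have "\<dots> = (y ^ n * x ^ m) * (d ^ (n + m) * (-1) ^ m)"
            by (simp only: power_minus[of x m] power_add mult_ac)
          finally show ?thesis .
        qed
        from this[of "of_real t" "of_real (1 - t)"] show ?thesis by simp
      qed
      finally show ?thesis using c by (simp add: c_def)
    qed
    finally have "((\<lambda>s. poly p (a + s * d) / c) has_field_derivative of_real (t ^ n * (1 - t) ^ m)) (at (of_real t))" .
    from has_field_derivative_Re[OF has_vector_derivative_real_field[OF this]]
    show ?thesis by (simp add: \<phi>_def)
  qed
  have "\<phi> 0 < \<phi> 1"
  proof (rule DERIV_pos_imp_increasing_open[of 0 1 \<phi>])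
    fix t :: real assume t: "0 < t" "t < 1"
    then show "\<exists>y. (\<phi> has_real_derivative y) (at t) \<and> y > 0"
      using D[of t] by (intro exI[of _ "t ^ n * (1 - t) ^ m"]) auto
  next
    show "continuous_on {0..1} \<phi>" using D by (intro DERIV_continuous_on[where D = "\<lambda>t. t ^ n * (1 - t) ^ m"]) (auto intro: has_field_derivative_at_within)
  qed simp
  moreover have "\<phi> 0 = \<phi> 1" using eq by (simp add: \<phi>_def d_def)
  ultimately show False by simp
qed

lemma card_simple_roots:
  assumes "v \<noteq> poly p a" "v \<noteq> poly p b"
  shows "card {x. poly p x = v} = n + m + 1"
    "poly p z - v = lead_coeff p * (\<Prod>x | poly p x = v. z - x)"
proof -
  have o: "order x (p - [:v:]) = 1" if "poly p x = v" for x
    using order_shift[OF that] that assms by auto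
  have s: "{x. poly (p - [:v:]) x = 0} = {x. poly p x = v}" by auto
  have "(\<Sum>x | poly p x = v. order x (p - [:v:])) = n + m + 1"
    using sum_order_roots[OF shift(2)[of v]] shift(1)[of v] unfolding s by simp
  then show "card {x. poly p x = v} = n + m + 1" using o by simp
  have lc: "lead_coeff (p - [:v:]) = lead_coeff p"
    using degree_p shift(1)[of v] by (simp add: coeff_pCons split: nat.split)
  have "poly (p - [:v:]) z = lead_coeff p * (\<Prod>x | poly p x = v. (z - x) ^ order x (p - [:v:]))"
    using poly_eq_prod_roots[of "p - [:v:]" z] unfolding s lc .
  then show "poly p z - v = lead_coeff p * (\<Prod>x | poly p x = v. z - x)" using o by simp
qed

text \<open>
  Only \<open>a\<close> and \<open>b\<close> can be multiple roots of \<open>p - v\<close>, and not both, since \<open>p a \<noteq> p b\<close>. So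
  \<open>n + m + 1\<close> roots counted with multiplicity give at least \<open>1 + min n m\<close> different ones.
\<close>

lemma three_roots: "\<exists>A. card A = 3 \<and> A \<subseteq> {x. poly p x = v}"
proof -
  define R where "R = {x. poly p x = v}"
  have s: "{x. poly (p - [:v:]) x = 0} = R" by (auto simp: R_def)
  have fin: "finite R" using poly_roots_finite[OF shift(2)[of v]] unfolding s .
  have sum: "(\<Sum>x\<in>R. order x (p - [:v:])) = n + m + 1"
    using sum_order_roots[OF shift(2)[of v]] shift(1)[of v] unfolding s by simp
  have "(\<Sum>x\<in>R. order x (p - [:v:])) \<le> (\<Sum>x\<in>R. 1 + (if x = a then n else 0) + (if x = b then m else 0))"
    by (intro sum_mono) (auto simp: R_def order_shift)
  also have "\<dots> = card R + (if a \<in> R then n else 0) + (if b \<in> R then m else 0)"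
    unfolding sum.distrib using fin by (simp add: sum.delta)
  finally have "3 \<le> card R" using sum crit_values_ne n2 m2 by (auto simp: R_def split: if_splits)
  then show ?thesis using obtain_subset_with_card_n[of 3 R] by (metis R_def)
qed

lemma factor_critical:
  "\<exists>s. degree s = m \<and> poly s a \<noteq> 0 \<and> (\<forall>z. poly p z - poly p a = (z - a) ^ (n + 1) * poly s z)"
proof -
  define q where "q = p - [:poly p a:]"
  have q: "q \<noteq> 0" "degree q = n + m + 1" using shift by (auto simp: q_def)
  have "order a q = n + 1" using order_shift[of a] by (simp add: q_def)
  then obtain s where s: "q = [:-a, 1:] ^ (n + 1) * s" "\<not> [:-a, 1:] dvd s"
    using order_decomp[OF q(1), of a] by metis
  have "s \<noteq> 0" using s(1) q by auto
  have "degree q = degree ([:-a, 1:] ^ (n + 1)) + degree s"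
    unfolding s(1) by (rule degree_mult_eq[OF _ \<open>s \<noteq> 0\<close>]) (unfold power_eq_0_iff, simp)
  moreover have "degree ([:-a, 1:] ^ (n + 1)) = n + 1" by (subst degree_power_eq) auto
  ultimately have "degree s = m" using q(2) by simp
  moreover have "poly s a \<noteq> 0" using s(2) by (simp add: poly_eq_0_iff_dvd)
  moreover have "poly p z - poly p a = (z - a) ^ (n + 1) * poly s z" for z
  proof -
    have "poly q z = (z - a) ^ (n + 1) * poly s z" unfolding s(1) poly_mult poly_power by simp
    then show ?thesis by (simp add: q_def)
  qed
  ultimately show ?thesis by blast
qed

end

section \<open>Proportional compositions\<close>

lemma ord_ge_le_has_ord:
  assumes "ord_ge F z j" "has_ord F z k" shows "j \<le> k"
proof (rule ccontr)
  assume "\<not> j \<le> k"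
  then have "(\<lambda>w. F w / F w) \<midarrow>z\<rightarrow> 0"
    using ord_ge_pos_tendsto_0[OF ord_ge_divide[OF assms]] by simp
  moreover have "\<forall>\<^sub>F w in at z. F w / F w = 1" using has_ord_nonzero[OF assms(2)] by eventually_elim simp
  ultimately have "(\<lambda>w. 1::complex) \<midarrow>z\<rightarrow> 0" by (rule Lim_transform_eventually)
  then show False using LIM_unique[OF tendsto_const] by force
qed

lemma analytic_eq_at:
  assumes "F analytic_on {z}" "G analytic_on {z}" "\<forall>\<^sub>F w in at z. F w = G w"
  shows "F z = G z"
proof -
  have "F \<midarrow>z\<rightarrow> F z" "G \<midarrow>z\<rightarrow> G z"
    using analytic_at_imp_isCont[OF assms(1)] analytic_at_imp_isCont[OF assms(2)] by (auto simp: isCont_def)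
  then show ?thesis using assms(3) by (metis LIM_unique tendsto_cong)
qed

lemma cosparse_at: "\<forall>\<^sub>\<approx>z. P z \<Longrightarrow> \<forall>\<^sub>F w in at (z::complex). P w"
  by (simp add: eventually_cosparse_open_eq)

lemma cosparse_nhds: "\<forall>\<^sub>\<approx>z::complex. P z \<Longrightarrow> \<forall>\<^sub>\<approx>z. \<forall>\<^sub>F w in nhds z. P w"
  by (simp add: eventually_cosparse_open_eq eventually_at_nhds)

lemma cosparse_not_false: "\<not> (\<forall>\<^sub>\<approx>z::complex. False)"
  by (simp add: eventually_cosparse_open_eq)

lemma cosparse_contradiction: "\<forall>\<^sub>\<approx>z::complex. P z \<Longrightarrow> \<forall>\<^sub>\<approx>z. \<not> P z \<Longrightarrow> False"
proof -
  assume "\<forall>\<^sub>\<approx>z. P z" "\<forall>\<^sub>\<approx>z. \<not> P z"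
  then have "\<forall>\<^sub>\<approx>z::complex. False" by eventually_elim blast
  then show False using cosparse_not_false by blast
qed

lemma deriv_zero_constant:
  assumes "\<forall>\<^sub>\<approx>z. F analytic_on {z} \<and> deriv F z = 0"
  shows "\<exists>c. \<forall>\<^sub>\<approx>z. F z = (c::complex)"
proof -
  define S where "S = {z. \<not> (F analytic_on {z} \<and> deriv F z = 0)}"
  have S: "S sparse_in UNIV" using assms by (simp add: eventually_cosparse S_def)
  have con: "connected (UNIV - S)" by (rule sparse_imp_connected) (use S in auto)
  have op: "open (UNIV - S)" by (rule open_diff_sparse_pts) (use S in auto)
  have D: "(F has_field_derivative 0) (at z)" if "z \<in> UNIV - S" for z
  proof -
    have "F analytic_on {z}" "deriv F z = 0" using that by (auto simp: S_def)
    then show ?thesis by (metis analytic_on_imp_differentiable_at DERIV_deriv_iff_field_differentiable insertI1)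
  qed
  obtain c where c: "\<And>z. z \<in> UNIV - S \<Longrightarrow> F z = c"
    using DERIV_zero_connected_constant[OF con op, of "{}" F] D
      continuous_at_imp_continuous_on[of "UNIV - S" F] DERIV_isCont by (metis Diff_empty finite.emptyI)
  have "\<forall>\<^sub>\<approx>z. z \<notin> S" using S by (rule eventually_not_in_cosparse)
  then show ?thesis by (intro exI[of _ c], eventually_elim) (use c in auto)
qed

text \<open>
  The quotient has order \<open>0\<close> everywhere.
\<close>

lemma common_order_unit:
  assumes "\<And>z. \<exists>k. has_ord F z k \<and> has_ord G z k"
  shows "\<exists>U. U holomorphic_on UNIV \<and> (\<forall>z. U z \<noteq> 0) \<and> (\<forall>\<^sub>\<approx>z. F z = U z * G z)"
proof -
  have o: "has_ord (\<lambda>w. F w / G w) z 0" for z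
  proof -
    obtain k where "has_ord F z k" "has_ord G z k" using assms by blast
    from has_ord_divide[OF this] show ?thesis by simp
  qed
  obtain U where U: "U holomorphic_on UNIV" "\<forall>\<^sub>\<approx>z. F z / G z = U z"
    using ord_ge_0_entire[OF has_ord_imp_ord_ge[OF o]] by blast
  have "U z \<noteq> 0" for z
  proof -
    obtain c where c: "c \<noteq> 0" "(\<lambda>w. F w / G w) \<midarrow>z\<rightarrow> c" using has_ord_tendsto[OF o] by blast
    have "U \<midarrow>z\<rightarrow> U z" using holomorphic_on_imp_analytic_at[OF U(1)] analytic_at_imp_isCont by (auto simp: isCont_def)
    moreover have "U \<midarrow>z\<rightarrow> c" using c(2) cosparse_at[OF U(2), of z] by (simp add: tendsto_cong)
    ultimately show ?thesis using c(1) LIM_unique by blast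
  qed
  moreover have "\<forall>\<^sub>\<approx>z. G z \<noteq> 0"
    using assms has_ord_nonzero by (fastforce simp: eventually_cosparse_open_eq)
  then have "\<forall>\<^sub>\<approx>z. F z = U z * G z" using U(2) by eventually_elim (auto simp: field_simps)
  ultimately show ?thesis using U(1) by blast
qed

context two_crit
begin

text \<open>
  The factor \<open>K\<close> is nonzero so that the relation is symmetric up to inversion of \<open>K\<close>.
\<close>

definition related :: "complex \<Rightarrow> (complex \<Rightarrow> complex) \<Rightarrow> (complex \<Rightarrow> complex) \<Rightarrow> bool" where
  "related K f g \<longleftrightarrow> K \<noteq> 0 \<and> (\<forall>\<^sub>\<approx>z. poly p (f z) = K * poly p (g z))"

lemma related_sym: "related K f g \<Longrightarrow> related (inverse K) g f"
  unfolding related_def by (auto elim!: eventually_mono simp: field_simps)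

lemma related_at: "related K f g \<Longrightarrow> \<forall>\<^sub>F w in at z. poly p (f w) = K * poly p (g w)"
  unfolding related_def by (blast intro: cosparse_at)

lemma p_nz: "p \<noteq> 0"
  using degree_p by auto

lemma related_pole:
  assumes F: "quotient f f1 f2" and G: "quotient g g1 g2" and rel: "related K f g" and z: "f2 z = 0"
  shows "g2 z = 0"
proof (rule ccontr)
  interpret F: quotient f f1 f2 by (fact F)
  interpret G: quotient g g1 g2 by (fact G)
  assume g: "g2 z \<noteq> 0"
  obtain k where k: "k > 0" "\<And>x. has_ord (\<lambda>w. f w - x) z (- int k)" using F.pole_order[OF z] by blast
  have "has_ord (\<lambda>w. poly p (f w)) z (- (int (degree p) * int k))"
    by (rule F.poly_comp_pole[OF p_nz k(2)])
  then have "has_ord (\<lambda>w. K * poly p (g w)) z (- (int (degree p) * int k))"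
    by (rule has_ord_cong) (rule related_at[OF rel])
  moreover have "ord_ge (\<lambda>w. K * poly p (g w)) z 0"
    by (intro ord_ge_cmult ord_ge_analytic G.poly_comp_analytic g)
  ultimately have "0 \<le> - (int (degree p) * int k)" by (rule ord_ge_le_has_ord[rotated])
  then show False using k(1) degree_p by (simp add: mult_le_0_iff)
qed

lemma related_pole_order:
  assumes F: "quotient f f1 f2" and G: "quotient g g1 g2" and rel: "related K f g" and z: "f2 z = 0"
  shows "\<exists>k>0. has_ord f2 z (int k) \<and> (\<forall>x. has_ord (\<lambda>w. f w - x) z (- int k)) \<and> (\<forall>x. has_ord (\<lambda>w. g w - x) z (- int k))"
proof -
  interpret F: quotient f f1 f2 by (fact F)
  interpret G: quotient g g1 g2 by (fact G)
  obtain k where k: "k > 0" "has_ord f2 z (int k)" "\<And>x. has_ord (\<lambda>w. f w - x) z (- int k)" using F.pole_order[OF z] by blast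
  obtain j where j: "j > 0" "\<And>x. has_ord (\<lambda>w. g w - x) z (- int j)"
    using G.pole_order[OF related_pole[OF F G rel z]] by blast
  have "has_ord (\<lambda>w. poly p (f w)) z (- (int (degree p) * int k))"
    by (rule F.poly_comp_pole[OF p_nz k(3)])
  then have "has_ord (\<lambda>w. K * poly p (g w)) z (- (int (degree p) * int k))"
    by (rule has_ord_cong) (rule related_at[OF rel])
  moreover have "has_ord (\<lambda>w. K * poly p (g w)) z (0 + - (int (degree p) * int j))"
    by (intro has_ord_mult has_ord_const G.poly_comp_pole[OF p_nz j(2)]) (use rel in \<open>auto simp: related_def\<close>)
  ultimately have "- (int (degree p) * int k) = 0 + - (int (degree p) * int j)" by (rule has_ord_unique)
  then have "k = j" using degree_p by simp
  then show ?thesis using k j by blast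
qed

lemma related_value:
  assumes F: "quotient f f1 f2" and G: "quotient g g1 g2" and rel: "related K f g" and z: "f2 z \<noteq> 0"
  shows "g2 z \<noteq> 0" "poly p (f z) = K * poly p (g z)"
proof -
  interpret F: quotient f f1 f2 by (fact F)
  interpret G: quotient g g1 g2 by (fact G)
  show g: "g2 z \<noteq> 0" using related_pole[OF G F related_sym[OF rel], of z] z by auto
  show "poly p (f z) = K * poly p (g z)"
  proof (rule analytic_eq_at[where F = "\<lambda>w. poly p (f w)" and G = "\<lambda>w. K * poly p (g w)"])
    show "(\<lambda>w. poly p (f w)) analytic_on {z}" by (rule F.poly_comp_analytic[OF z])
    show "(\<lambda>w. K * poly p (g w)) analytic_on {z}" by (intro analytic_intros G.poly_comp_analytic[OF g])
    show "\<forall>\<^sub>F w in at z. poly p (f w) = K * poly p (g w)" by (rule related_at[OF rel])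
  qed
qed

text \<open>
  Both sides have the same degree in \<open>x\<close> and \<open>y\<close>, so \<open>x\<close> and \<open>y\<close> have comparable size.
\<close>

lemma related_max_bound:
  assumes "K \<noteq> 0"
  shows "\<exists>C>0. \<forall>x y. poly p x = K * poly p y \<longrightarrow> max 1 (norm y) \<le> C * max 1 (norm x)"
proof -
  obtain C1 where C1: "0 < C1" "\<And>w. norm (poly p w) \<le> C1 * max 1 (norm w) ^ degree p"
    using poly_upper_bound[of p] by blast
  obtain C2 where C2: "0 < C2" "\<And>w. max 1 (norm w) ^ degree p \<le> C2 * (1 + norm (poly p w))"
    using poly_lower_bound[OF p_nz] by blast
  define C where "C = 1 + C2 * (1 + C1 / norm K)"
  have C: "1 \<le> C" using C1(1) C2(1) by (simp add: C_def)
  have "max 1 (norm y) \<le> C * max 1 (norm x)" if e: "poly p x = K * poly p y" for x y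
  proof (rule power_le_imp_le_base[of _ "n + m"])
    define X where "X = max 1 (norm x) ^ degree p"
    have X: "1 \<le> X" unfolding X_def by (intro one_le_power) auto
    have "norm K * norm (poly p y) = norm (poly p x)" by (simp add: e norm_mult)
    then have "norm (poly p y) \<le> C1 / norm K * X"
      using C1(2)[of x] assms by (simp add: X_def field_simps)
    then have "C2 * (1 + norm (poly p y)) \<le> C2 * (X + C1 / norm K * X)"
      using C2(1) X by (intro mult_left_mono) auto
    then have "max 1 (norm y) ^ degree p \<le> C2 * (1 + C1 / norm K) * X"
      using C2(2)[of y] by (simp add: algebra_simps)
    also have "\<dots> \<le> C * X" using X by (intro mult_right_mono) (auto simp: C_def)
    also have "\<dots> \<le> C ^ degree p * X"
      using C X self_le_power[OF C, of "degree p"] degree_p by (intro mult_right_mono) auto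
    finally show "max 1 (norm y) ^ Suc (n + m) \<le> (C * max 1 (norm x)) ^ Suc (n + m)"
      using degree_p by (simp only: X_def power_mult_distrib Suc_eq_plus1)
  qed (use C in auto)
  then show ?thesis using C by (intro exI[of _ C]) auto
qed

text \<open>
  Let \<open>v = K * p a\<close>. The \<open>n + m + 1\<close> roots of \<open>p - v\<close> are simple. Where \<open>f\<close> takes one of them,
  \<open>p g = p a\<close>; as \<open>g\<close> omits \<open>a\<close>, it takes there a zero of the cofactor \<open>s\<close> in
  \<open>p - p a = (z - a) ^ (n + 1) * s\<close>. Hence \<open>s \<circ> g\<close> cancels the poles of \<open>f' / (p f - v)\<close>.
  Since \<open>s\<close> has degree \<open>m\<close> only, a factor \<open>f2 ^ (n - 1)\<close> can be put into the denominator as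
  well, which leaves the power \<open>n - 1\<close> of the maximum.
\<close>

lemma no_relation_omitting:
  assumes F: "quotient f f1 f2" and G: "quotient g g1 g2" and rel: "related K f g"
    and omit: "\<And>z. g2 z \<noteq> 0 \<Longrightarrow> g z \<noteq> a"
    and Ka: "K * poly p a \<noteq> poly p a" "K * poly p a \<noteq> poly p b"
  shows False
proof -
  interpret F: quotient f f1 f2 by (fact F)
  interpret G: quotient g g1 g2 by (fact G)
  define \<Lambda> where "\<Lambda> = char_fun (\<lambda>z. hmax f1 f2 z * hmax f1 f2 z)"
  have gr: "growth \<Lambda>" and dom: "dominated \<Lambda> f1 f2" unfolding \<Lambda>_def using dominated_pair[OF F F] by auto
  define v where "v = K * poly p a"
  define A where "A = {x. poly p x = v}"
  define l where "l = lead_coeff p"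
  have va: "v \<noteq> poly p a" "v \<noteq> poly p b" using Ka by (simp_all only: v_def not_False_eq_True)
  have cA: "card A = n + m + 1" unfolding A_def by (rule card_simple_roots(1)[OF va])
  have pA: "poly p z - v = l * (\<Prod>x\<in>A. z - x)" for z
    unfolding A_def l_def by (rule card_simple_roots(2)[OF va])
  have fin: "finite A" "A \<noteq> {}" using cA card_ge_0_finite[of A] by auto
  have l: "l \<noteq> 0" using p_nz by (simp add: l_def)
  have K: "K \<noteq> 0" using rel by (simp add: related_def)
  obtain s where s: "degree s = m" "poly s a \<noteq> 0" "\<And>z. poly p z - poly p a = (z - a) ^ (n + 1) * poly s z"
    using factor_critical by blast
  have s0: "s \<noteq> 0" using s(2) by auto
  have q0: "p - [:v:] \<noteq> 0" by (rule shift)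
  define Om where "Om = (\<lambda>z. deriv f z * poly s (g z) / (poly (p - [:v:]) (f z) * f2 z ^ (n - 1)))"
  obtain \<psi> where \<psi>: "small \<Lambda> \<psi>" "\<forall>\<^sub>\<approx>z. hmax f1 f2 z ^ (card A - 1) * norm (deriv f z)
      \<le> norm (\<psi> z) * (norm (f2 z) ^ (card A - 1) * (\<Prod>y\<in>A. norm (f z - y)))"
    using F.second_main[OF gr dom fin] by blast
  obtain C1 where C1: "0 < C1" "\<And>w. norm (poly s w) \<le> C1 * max 1 (norm w) ^ m"
    using poly_upper_bound[of s] s(1) by auto
  obtain C2 where C2: "0 < C2" "\<And>x y. poly p x = K * poly p y \<Longrightarrow> max 1 (norm y) \<le> C2 * max 1 (norm x)"
    using related_max_bound[OF K] by blast
  define C where "C = C1 * C2 ^ m / norm l"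
  have C: "0 < C" using C1(1) C2(1) l by (simp add: C_def)
  have ne: "\<forall>\<^sub>\<approx>z. f2 z \<noteq> 0 \<and> poly (p - [:v:]) (f z) \<noteq> 0 \<and> poly s (g z) \<noteq> 0 \<and> deriv f z \<noteq> 0"
    using F.value_ne_cosparse(1) F.poly_comp_ne_cosparse[OF q0] G.poly_comp_ne_cosparse[OF s0] F.deriv_ne_cosparse
    by eventually_elim auto
  show False
  proof (rule F.key_contradiction_single[of Om "\<lambda>z. of_real C * \<psi> z" "n - 1"])
    show "small (char_fun (\<lambda>z. hmax f1 f2 z * hmax f1 f2 z)) (\<lambda>z. of_real C * \<psi> z)"
      using \<psi>(1) gr unfolding \<Lambda>_def by (intro small_cmult)
    show "1 \<le> n - 1" using n2 by simp
    have "\<forall>\<^sub>\<approx>z. Om z \<noteq> 0" using ne by eventually_elim (auto simp: Om_def)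
    then show "\<not> (\<forall>\<^sub>\<approx>z. Om z = 0)" using cosparse_contradiction by blast
    show "\<forall>\<^sub>\<approx>z. norm (Om z) * hmax f1 f2 z ^ (n - 1) \<le> norm (of_real C * \<psi> z)"
      using \<psi>(2) ne
    proof eventually_elim
      case (elim z)
      define h where "h = hmax f1 f2 z"
      define d where "d = norm (f2 z)"
      define t where "t = norm (poly (p - [:v:]) (f z))"
      define e where "e = norm (deriv f z)"
      define r where "r = norm (poly s (g z))"
      have h: "0 < h" "d \<le> h" "0 < d" "0 < t" using F.hmax_pos[of z] elim by (auto simp: h_def d_def t_def hmax_def)
      have hm: "h = d * max 1 (norm (f z))" using elim by (simp add: h_def d_def F.hmax_eq)
      have "t = norm l * (\<Prod>y\<in>A. norm (f z - y))"
        using pA[of "f z"] by (simp add: t_def norm_mult prod_norm)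
      then have e1: "h ^ (n + m) * e \<le> norm (\<psi> z) * (d ^ (n + m) * (t / norm l))"
        using elim(1) cA l by (simp add: h_def e_def d_def)
      have "poly p (f z) = K * poly p (g z)" by (rule related_value[OF F G rel]) (use elim in auto)
      then have "max 1 (norm (g z)) \<le> C2 * max 1 (norm (f z))" by (rule C2(2))
      then have "max 1 (norm (g z)) ^ m \<le> (C2 * max 1 (norm (f z))) ^ m" by (intro power_mono) auto
      then have "C1 * max 1 (norm (g z)) ^ m \<le> C1 * (C2 * max 1 (norm (f z))) ^ m"
        using C1(1) by (intro mult_left_mono) auto
      then have "r \<le> C1 * (C2 * max 1 (norm (f z))) ^ m" using C1(2)[of "g z"] by (simp add: r_def)
      then have "d ^ m * r \<le> d ^ m * (C1 * (C2 * max 1 (norm (f z))) ^ m)"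
        using h by (intro mult_left_mono) auto
      then have e2: "d ^ m * r \<le> C1 * C2 ^ m * h ^ m" by (simp add: hm power_mult_distrib mult_ac)
      have nn: "n + m = (n - 1) + 1 + m" using n2 by simp
      have "h ^ (n + m) * (e * r / (t * d ^ (n - 1))) = (h ^ (n + m) * e) * (r / (t * d ^ (n - 1)))" by simp
      also have "\<dots> \<le> (norm (\<psi> z) * (d ^ (n + m) * (t / norm l))) * (r / (t * d ^ (n - 1)))"
        using e1 h by (intro mult_right_mono) (auto simp: r_def)
      also have "\<dots> = norm (\<psi> z) * (d / norm l) * (d ^ m * r)"
      proof -
        have "d ^ (n + m) = d ^ (n - 1) * d * d ^ m" by (subst nn) (simp only: power_add power_one_right)
        then show ?thesis using h l by (simp add: field_simps)
      qed
      also have "\<dots> \<le> norm (\<psi> z) * (h / norm l) * (C1 * C2 ^ m * h ^ m)"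
        using h by (intro mult_mono[OF _ e2] mult_left_mono divide_right_mono) (auto simp: r_def)
      also have "\<dots> = h ^ (m + 1) * (C * norm (\<psi> z))" by (simp add: C_def)
      finally have "h ^ (m + 1) * (h ^ (n - 1) * (e * r / (t * d ^ (n - 1)))) \<le> h ^ (m + 1) * (C * norm (\<psi> z))"
        unfolding nn power_add by (simp add: mult_ac)
      then have "h ^ (n - 1) * (e * r / (t * d ^ (n - 1))) \<le> C * norm (\<psi> z)"
        by (rule mult_left_le_imp_le) (use h in simp)
      moreover have "norm (Om z) = e * r / (t * d ^ (n - 1))"
        by (simp only: Om_def e_def t_def d_def r_def norm_mult norm_divide norm_power)
      moreover have "norm (of_real C * \<psi> z) = C * norm (\<psi> z)" using C by (simp add: norm_mult)
      ultimately show ?case by (simp only: h_def mult.commute)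
    qed
    show "ord_ge Om z 0" for z
    proof (cases "f2 z = 0")
      case True
      obtain k where k: "k > 0" "has_ord f2 z (int k)" "\<And>x. has_ord (\<lambda>w. f w - x) z (- int k)"
        "\<And>x. has_ord (\<lambda>w. g w - x) z (- int k)"
        using related_pole_order[OF F G rel True] by blast
      have dd: "has_ord (deriv f) z (- int k - 1)" using F.deriv_order[OF k(3)] k(1) by simp
      have o: "has_ord Om z ((- int k - 1 + - (int (degree s) * int k)) - (- (int (degree (p - [:v:])) * int k) + int (n - 1) * int k))"
        unfolding Om_def
        by (intro has_ord_divide has_ord_mult has_ord_power dd k(2) F.poly_comp_pole[OF q0 k(3)] G.poly_comp_pole[OF s0 k(4)])
      have "(- int k - 1 + - (int (degree s) * int k)) - (- (int (degree (p - [:v:])) * int k) + int (n - 1) * int k) = int k - 1"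
        using n2 by (simp add: s(1) shift(1) of_nat_diff algebra_simps)
      then show ?thesis using has_ord_imp_ord_ge[OF o] k(1) by (auto intro: ord_ge_mono)
    next
      case False
      note rv = related_value[OF F G rel False]
      have d2: "has_ord (\<lambda>w. f2 w ^ (n - 1)) z (int (n - 1) * 0)"
        using False by (intro has_ord_power has_ord_analytic F.analytic1)
      show ?thesis
      proof (cases "poly p (f z) = v")
        case True
        have "poly p (g z) = poly p a" using rv(2) True K by (simp add: v_def)
        then have "(g z - a) ^ (n + 1) * poly s (g z) = 0" using s(3)[of "g z"] by simp
        then have "poly s (g z) = 0" using omit[OF rv(1)] by simp
        then have os: "ord_ge (\<lambda>w. poly s (g w)) z 1"
          by (intro ord_ge_zero_analytic G.poly_comp_analytic rv)
        obtain j where j: "j > 0" "has_ord (\<lambda>w. f w - f z) z (int j)" using F.value_order[OF False refl] by blast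
        have dd: "has_ord (deriv f) z (int j - 1)" using F.deriv_order[OF j(2)] j(1) by simp
        have "order (f z) (p - [:v:]) = 1"
          using order_shift[OF True] True Ka by (auto simp: v_def)
        then have pj: "has_ord (\<lambda>w. poly (p - [:v:]) (f w)) z (int j)"
          using F.poly_comp_zero[OF q0 False j(2)] by simp
        have "ord_ge Om z (((int j - 1) + 1) - (int j + int (n - 1) * 0))"
          unfolding Om_def
          by (intro ord_ge_divide ord_ge_mult has_ord_imp_ord_ge[OF dd] os has_ord_mult pj d2)
        then show ?thesis by simp
      next
        case nv: False
        then have pj: "has_ord (\<lambda>w. poly (p - [:v:]) (f w)) z 0"
          by (intro has_ord_analytic F.poly_comp_analytic False) simp
        have "ord_ge Om z ((0 + 0) - (0 + int (n - 1) * 0))"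
          unfolding Om_def
          by (intro ord_ge_divide ord_ge_mult has_ord_mult pj d2 ord_ge_deriv_analytic F.analytic False
                ord_ge_analytic G.poly_comp_analytic rv)
        then show ?thesis by simp
      qed
    qed
  qed
qed

text \<open>
  Then \<open>p (\<kappa> * z + d) = p z\<close> as polynomials. The substitution permutes the critical points \<open>a\<close>
  and \<open>b\<close> and preserves their different critical values, so it fixes both.
\<close>

lemma affine_relation:
  assumes G: "quotient g g1 g2" and rel: "related 1 f g" and aff: "\<forall>\<^sub>\<approx>z. f z = \<kappa> * g z + d"
  shows "\<kappa> = 1" "d = 0"
proof -
  interpret G: quotient g g1 g2 by (fact G)
  define q where "q = pcompose p [:d, \<kappa>:] - p"
  have "q = 0"
  proof (rule ccontr)
    assume "q \<noteq> 0"
    from G.poly_comp_ne_cosparse[OF this] have "\<forall>\<^sub>\<approx>z. poly q (g z) \<noteq> 0" .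
    moreover have "\<forall>\<^sub>\<approx>z. poly q (g z) = 0"
      using aff rel[unfolded related_def, THEN conjunct2]
      by eventually_elim (simp add: q_def poly_pcompose algebra_simps)
    ultimately show False using cosparse_contradiction by blast
  qed
  then have e: "pcompose p [:d, \<kappa>:] = p" by (simp add: q_def)
  have pe: "poly p (d + x * \<kappa>) = poly p x" for x
    using arg_cong[OF e, of "\<lambda>r. poly r x"] by (simp add: poly_pcompose)
  have "pderiv (pcompose p [:d, \<kappa>:]) = pderiv p" by (simp only: e)
  then have "poly (pcompose (pderiv p) [:d, \<kappa>:] * pderiv [:d, \<kappa>:]) x = poly (pderiv p) x" for x
    by (simp only: pderiv_pcompose)
  then have de: "\<kappa> * poly (pderiv p) (d + x * \<kappa>) = poly (pderiv p) x" for x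
    by (simp add: poly_pcompose pderiv_pCons)
  have \<kappa>: "\<kappa> \<noteq> 0"
  proof
    assume "\<kappa> = 0"
    then have "poly p a = poly p b" using pe[of a] pe[of b] by simp
    then show False using crit_values_ne by simp
  qed
  have crit: "x = a \<or> x = b" if "poly (pderiv p) x = 0" for x
    using that n2 m2 by (auto simp: poly_pderiv)
  have pa: "poly (pderiv p) a = 0" "poly (pderiv p) b = 0" using n2 m2 by (auto simp: poly_pderiv)
  have da: "d + a * \<kappa> = a" using crit[of "d + a * \<kappa>"] de[of a] pa \<kappa> pe[of a] crit_values_ne by auto
  have db: "d + b * \<kappa> = b" using crit[of "d + b * \<kappa>"] de[of b] pa \<kappa> pe[of b] crit_values_ne by auto
  have "\<kappa> * (a - b) = (d + a * \<kappa>) - (d + b * \<kappa>)" by (simp add: algebra_simps)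
  then have "\<kappa> * (a - b) = a - b" unfolding da db .
  then show "\<kappa> = 1" using ab by simp
  then show "d = 0" using da by simp
qed

end

section \<open>Equal compositions\<close>

lemma (in quotient) has_deriv: "f2 z \<noteq> 0 \<Longrightarrow> (f has_field_derivative deriv f z) (at z)"
  using analytic[of z] by (meson DERIV_deriv_iff_field_differentiable analytic_on_imp_differentiable_at insertI1)

lemma unit_product_DERIV:
  assumes "U holomorphic_on UNIV" "V holomorphic_on UNIV" "U z \<noteq> 0" "V z \<noteq> 0"
  shows "((\<lambda>w. U w ^ i * V w ^ j) has_field_derivative
    U z ^ i * V z ^ j * (of_nat i * (deriv U z / U z) + of_nat j * (deriv V z / V z))) (at z)"
proof -
  have P: "((\<lambda>w. W w ^ k) has_field_derivative W z ^ k * (of_nat k * (deriv W z / W z))) (at z)"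
    if "W holomorphic_on UNIV" "W z \<noteq> 0" for W k
  proof -
    have "(W has_field_derivative deriv W z) (at z)" using that(1) by (auto intro: holomorphic_derivI)
    from DERIV_power[OF this, of k]
    have "((\<lambda>w. W w ^ k) has_field_derivative of_nat k * (deriv W z * W z ^ (k - Suc 0))) (at z)" .
    moreover have "of_nat k * (deriv W z * W z ^ (k - Suc 0)) = W z ^ k * (of_nat k * (deriv W z / W z))"
      using that(2) by (cases k) auto
    ultimately show ?thesis by simp
  qed
  from DERIV_mult[OF P[OF assms(1,3), of i] P[OF assms(2,4), of j]]
  show ?thesis by (rule DERIV_cong) (simp add: algebra_simps)
qed

text \<open>
  The left-hand side of the relation is the logarithmic derivative of \<open>U ^ i * V ^ j\<close>.
\<close>

lemma unit_relation_constant: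
  assumes U: "U holomorphic_on UNIV" "\<And>z. U z \<noteq> 0" and V: "V holomorphic_on UNIV" "\<And>z. V z \<noteq> 0"
    and rel: "\<And>z. of_nat i * (deriv U z / U z) + of_nat j * (deriv V z / V z) = (0::complex)"
  shows "\<exists>\<kappa>. \<kappa> \<noteq> 0 \<and> (\<forall>z. U z ^ i * V z ^ j = \<kappa>)"
proof -
  have "((\<lambda>w. U w ^ i * V w ^ j) has_field_derivative 0) (at z)" for z
    using unit_product_DERIV[OF U(1) V(1) U(2) V(2), of i j z] unfolding rel by simp
  then have "\<exists>\<kappa>. \<forall>z\<in>UNIV. U z ^ i * V z ^ j = \<kappa>"
    by (intro has_field_derivative_zero_constant convex_UNIV) simp
  then obtain \<kappa> where k: "\<And>z. U z ^ i * V z ^ j = \<kappa>" by blast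
  have "\<kappa> \<noteq> 0" using k[of 0] U(2)[of 0] V(2)[of 0] by auto
  then show ?thesis using k by blast
qed

text \<open>
  Multiply by \<open>w - z\<close>: at \<open>z\<close> this shows \<open>U z ^ i * V z ^ j = 1\<close>, and comparing first
  derivatives there gives the relation.
\<close>

lemma local_log_relation:
  assumes U: "U holomorphic_on UNIV" "U z \<noteq> 0" and V: "V holomorphic_on UNIV" "V z \<noteq> 0"
    and C: "C analytic_on {z}" and h: "h analytic_on {z}" and k: "k \<noteq> (0::complex)"
    and eq: "\<forall>\<^sub>F w in at z. C w = (k / (w - z) + h w) * (1 - U w ^ i * V w ^ j)"
  shows "C z = - k * (of_nat i * (deriv U z / U z) + of_nat j * (deriv V z / V z))"
proof -
  define D where "D = of_nat i * (deriv U z / U z) + of_nat j * (deriv V z / V z)"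
  define \<theta> where "\<theta> = (\<lambda>w. U w ^ i * V w ^ j)"
  have an: "U analytic_on {z}" "V analytic_on {z}"
    using U V by (simp_all add: holomorphic_on_imp_analytic_at)
  define F1 where "F1 = (\<lambda>w. (w - z) * C w)"
  define F2 where "F2 = (\<lambda>w. (k + (w - z) * h w) * (1 - \<theta> w))"
  have ev: "\<forall>\<^sub>F w in at z. F1 w = F2 w"
    using eq eventually_ne by eventually_elim (simp add: F1_def F2_def \<theta>_def field_simps)
  have eqz: "F1 z = F2 z"
  proof (rule analytic_eq_at[where F = F1 and G = F2, OF _ _ ev])
    show "F1 analytic_on {z}" "F2 analytic_on {z}"
      unfolding F1_def F2_def \<theta>_def by (intro analytic_intros C h an)+
  qed
  then have \<theta>1: "\<theta> z = 1" using k by (simp add: F1_def F2_def)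
  have ev': "\<forall>\<^sub>F w in nhds z. F1 w = F2 w"
    using ev eqz by (simp add: eventually_nhds_conv_at)
  have DC: "(C has_field_derivative deriv C z) (at z)" "(h has_field_derivative deriv h z) (at z)"
    using C h by (meson DERIV_deriv_iff_field_differentiable analytic_on_imp_differentiable_at insertI1)+
  have Did: "((\<lambda>w. w - z) has_field_derivative 1) (at z)"
    using DERIV_diff[OF DERIV_ident DERIV_const[of z]] by simp
  have D1: "(F1 has_field_derivative C z) (at z)"
    using DERIV_mult[OF Did DC(1)] unfolding F1_def by simp
  have "(\<theta> has_field_derivative \<theta> z * D) (at z)"
    using unit_product_DERIV[OF U(1) V(1) U(2) V(2), of i j] unfolding \<theta>_def D_def .
  then have D2': "((\<lambda>w. 1 - \<theta> w) has_field_derivative 0 - D) (at z)"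
    using \<theta>1 by (intro DERIV_diff DERIV_const) simp
  have "((\<lambda>w. k + (w - z) * h w) has_field_derivative 0 + (1 * h z + deriv h z * (z - z))) (at z)"
    by (intro DERIV_add DERIV_const DERIV_mult[OF Did DC(2)])
  from DERIV_mult[OF this D2'] have D2: "(F2 has_field_derivative - (k * D)) (at z)"
    unfolding F2_def using \<theta>1 by (simp add: mult.commute)
  have "(F1 has_field_derivative - (k * D)) (at z)"
    using D2 DERIV_cong_ev[OF refl ev' refl] by blast
  then have "C z = - (k * D)" using D1 by (rule DERIV_unique[rotated])
  then show ?thesis by (simp add: D_def)
qed

lemma quotient_unit_log_deriv:
  assumes F: "quotient f f1 f2" and G: "quotient g g1 g2"
    and U: "U holomorphic_on UNIV" "\<And>z. U z \<noteq> 0" and e: "\<forall>\<^sub>\<approx>z. f z - x = U z * (g z - x)"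
  shows "\<forall>\<^sub>\<approx>z. deriv U z / U z = deriv f z / (f z - x) - deriv g z / (g z - x)"
proof -
  interpret F: quotient f f1 f2 by (fact F)
  interpret G: quotient g g1 g2 by (fact G)
  show ?thesis
    using cosparse_nhds[OF e] e F.value_ne_cosparse(1) G.value_ne_cosparse(1) G.value_ne_cosparse(2)[of x] F.value_ne_cosparse(2)[of x]
  proof eventually_elim
    case (elim z)
    have "(U has_field_derivative deriv U z) (at z)" using U(1) by (auto intro: holomorphic_derivI)
    moreover have "((\<lambda>w. g w - x) has_field_derivative deriv g z - 0) (at z)"
      by (intro DERIV_diff G.has_deriv elim DERIV_const)
    ultimately have "((\<lambda>w. U w * (g w - x)) has_field_derivative deriv U z * (g z - x) + (deriv g z - 0) * U z) (at z)"
      by (rule DERIV_mult)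
    then have "((\<lambda>w. f w - x) has_field_derivative deriv U z * (g z - x) + (deriv g z - 0) * U z) (at z)"
      using DERIV_cong_ev[OF refl elim(1) refl] by blast
    then have d: "deriv f z = deriv U z * (g z - x) + deriv g z * U z"
      unfolding deriv_minus_const[of f x, symmetric] by (simp add: DERIV_imp_deriv)
    have alg: "u' / u = (u' * y + y' * u) / (u * y) - y' / y" if "u \<noteq> 0" "y \<noteq> 0" for u u' y y' :: complex
      using that by (simp add: field_simps)
    show ?case unfolding elim(2) d by (rule alg) (use U(2) elim in auto)
  qed
qed

context two_crit
begin

text \<open>
  At an \<open>a\<close>-point, \<open>p f - p a = p g - p a\<close> has \<open>n + 1\<close> times the order of \<open>f - a\<close> and of
  \<open>g - a\<close>; at a pole, \<open>p f = p g\<close> has \<open>-(n + m + 1)\<close> times the pole order of either.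
\<close>

lemma common_order_at_crit:
  assumes F: "quotient f f1 f2" and G: "quotient g g1 g2" and rel: "related 1 f g"
    and sh: "\<And>z. f2 z \<noteq> 0 \<Longrightarrow> g2 z \<noteq> 0 \<Longrightarrow> f z = a \<longleftrightarrow> g z = a"
  shows "\<exists>k. has_ord (\<lambda>w. f w - a) z k \<and> has_ord (\<lambda>w. g w - a) z k"
proof -
  interpret F: quotient f f1 f2 by (fact F)
  interpret G: quotient g g1 g2 by (fact G)
  show ?thesis
  proof (cases "f2 z = 0")
    case True
    then show ?thesis using related_pole_order[OF F G rel True] by blast
  next
    case False
    note g2 = related_value(1)[OF F G rel False]
    show ?thesis
    proof (cases "f z = a")
      case True
      then have ga: "g z = a" using sh[OF False g2] by simp
      obtain j where j: "has_ord (\<lambda>w. f w - f z) z (int j)" using F.value_order[OF False refl] by blast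
      obtain k where k: "has_ord (\<lambda>w. g w - g z) z (int k)" using G.value_order[OF g2 refl] by blast
      define q where "q = p - [:poly p a:]"
      have q: "q \<noteq> 0" "order a q = n + 1" using shift order_shift[of a "poly p a"] by (simp_all add: q_def)
      have "has_ord (\<lambda>w. poly q (f w)) z (int (n + 1) * int j)"
        using F.poly_comp_zero[OF q(1) False j] unfolding True q(2) .
      then have "has_ord (\<lambda>w. poly q (g w)) z (int (n + 1) * int j)"
      proof (rule has_ord_cong)
        show "\<forall>\<^sub>F w in at z. poly q (f w) = poly q (g w)"
          using related_at[OF rel, of z] by eventually_elim (simp add: q_def)
      qed
      moreover have "has_ord (\<lambda>w. poly q (g w)) z (int (n + 1) * int k)"
        using G.poly_comp_zero[OF q(1) g2 k] unfolding ga q(2) .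
      ultimately have "int (n + 1) * int j = int (n + 1) * int k" by (rule has_ord_unique)
      then have "j = k" by simp
      then show ?thesis using j k unfolding True ga by blast
    next
      case fa: False
      then have ga: "g z \<noteq> a" using sh[OF False g2] by simp
      show ?thesis using F.regular_order[OF False fa] G.regular_order[OF g2 ga] by blast
    qed
  qed
qed

lemma related_deriv:
  assumes F: "quotient f f1 f2" and G: "quotient g g1 g2" and rel: "related 1 f g"
  shows "\<forall>\<^sub>\<approx>z. (f z - a) ^ n * (f z - b) ^ m * deriv f z = (g z - a) ^ n * (g z - b) ^ m * deriv g z"
proof -
  interpret F: quotient f f1 f2 by (fact F)
  interpret G: quotient g g1 g2 by (fact G)
  have e: "\<forall>\<^sub>\<approx>z. poly p (f z) = poly p (g z)" using rel by (simp add: related_def)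
  show ?thesis
    using cosparse_nhds[OF e] F.value_ne_cosparse(1) G.value_ne_cosparse(1)
  proof eventually_elim
    case (elim z)
    have "((\<lambda>w. poly p (f w)) has_field_derivative poly (pderiv p) (f z) * deriv f z) (at z)"
      by (rule DERIV_chain2[OF poly_DERIV F.has_deriv[OF elim(2)]])
    moreover have "((\<lambda>w. poly p (g w)) has_field_derivative poly (pderiv p) (g z) * deriv g z) (at z)"
      by (rule DERIV_chain2[OF poly_DERIV G.has_deriv[OF elim(3)]])
    then have "((\<lambda>w. poly p (f w)) has_field_derivative poly (pderiv p) (g z) * deriv g z) (at z)"
      using DERIV_cong_ev[OF refl elim(1) refl] by blast
    ultimately have "poly (pderiv p) (f z) * deriv f z = poly (pderiv p) (g z) * deriv g z"
      by (rule DERIV_unique)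
    then show ?case by (simp add: poly_pderiv)
  qed
qed

text \<open>
  Differentiating \<open>p f = p g\<close> and inserting \<open>f - a = U * (g - a)\<close> and \<open>f - b = V * (g - b)\<close>
  expresses \<open>g'\<close> by \<open>f'\<close>.
\<close>

lemma unit_identity:
  assumes F: "quotient f f1 f2" and G: "quotient g g1 g2" and rel: "related 1 f g"
    and U: "U holomorphic_on UNIV" "\<And>z. U z \<noteq> 0" "\<forall>\<^sub>\<approx>z. f z - a = U z * (g z - a)"
    and V: "V holomorphic_on UNIV" "\<And>z. V z \<noteq> 0" "\<forall>\<^sub>\<approx>z. f z - b = V z * (g z - b)"
  shows "\<forall>\<^sub>\<approx>z. deriv g z = U z ^ n * V z ^ m * deriv f z"
    "\<forall>\<^sub>\<approx>z. deriv U z / U z = deriv f z / (f z - a) * (1 - U z ^ (n + 1) * V z ^ m)"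
proof -
  interpret F: quotient f f1 f2 by (fact F)
  interpret G: quotient g g1 g2 by (fact G)
  show 1: "\<forall>\<^sub>\<approx>z. deriv g z = U z ^ n * V z ^ m * deriv f z"
    using related_deriv[OF F G rel] U(3) V(3) G.value_ne_cosparse(2)[of a] G.value_ne_cosparse(2)[of b]
  proof eventually_elim
    case (elim z)
    define c where "c = (g z - a) ^ n * (g z - b) ^ m"
    have "c \<noteq> 0" using elim by (simp add: c_def)
    moreover have "c * (U z ^ n * V z ^ m * deriv f z) = c * deriv g z"
      using elim(1) unfolding elim(2,3) by (simp add: c_def power_mult_distrib mult_ac)
    ultimately show ?case by simp
  qed
  show "\<forall>\<^sub>\<approx>z. deriv U z / U z = deriv f z / (f z - a) * (1 - U z ^ (n + 1) * V z ^ m)"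
    using 1 quotient_unit_log_deriv[OF F G U] U(3) G.value_ne_cosparse(2)[of a] F.value_ne_cosparse(2)[of a]
  proof eventually_elim
    case (elim z)
    have "f z - a \<noteq> 0" "g z - a \<noteq> 0" using elim by auto
    moreover have "D / X - (M * D) / Y = D / X * (1 - (W * M))"
      if "X = W * Y" "X \<noteq> 0" "Y \<noteq> 0" for D X Y W M :: complex
      using that by (auto simp: field_simps)
    from this[OF elim(3)] have "deriv f z / (f z - a) - (U z ^ n * V z ^ m * deriv f z) / (g z - a)
        = deriv f z / (f z - a) * (1 - U z * (U z ^ n * V z ^ m))" using calculation by blast
    ultimately show ?case unfolding elim(1,2) by (simp add: mult.assoc)
  qed
qed

text \<open>
  Here \<open>A = U' / U\<close> and \<open>B = V' / V\<close>. Each factor vanishes at one type of point: the third at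
  simple poles of \<open>f\<close>, the fourth at simple \<open>a\<close>-points, the fifth at simple \<open>b\<close>-points, \<open>A\<close> at
  multiple \<open>b\<close>-points, \<open>B\<close> at multiple \<open>a\<close>-points, and both at multiple poles.
\<close>

definition gam :: "(complex \<Rightarrow> complex) \<Rightarrow> (complex \<Rightarrow> complex) \<Rightarrow> complex \<Rightarrow> complex" where
  "gam A B z = A z * B z * (of_nat n * A z + of_nat m * B z) *
     (of_nat (n + 2) * A z + of_nat m * B z) * (of_nat n * A z + of_nat (m + 2) * B z)"

text \<open>
  The quotient \<open>f' / ((f - a) * (f - b) * f2)\<close> has poles only where \<open>f\<close> has a pole or a value
  in \<open>{a, b}\<close>, and these are simple; the product \<open>gam\<close> vanishes at each of them.
\<close>

lemma gam_order:
  assumes F: "quotient f f1 f2" and G: "quotient g g1 g2" and rel: "related 1 f g"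
    and U: "U holomorphic_on UNIV" "\<And>z. U z \<noteq> 0" "\<forall>\<^sub>\<approx>z. f z - a = U z * (g z - a)"
    and V: "V holomorphic_on UNIV" "\<And>z. V z \<noteq> 0" "\<forall>\<^sub>\<approx>z. f z - b = V z * (g z - b)"
    and A: "\<And>z. A z = deriv U z / U z" and B: "\<And>z. B z = deriv V z / V z"
  shows "ord_ge (\<lambda>w. gam A B w * (deriv f w / ((f w - a) * (f w - b) * f2 w))) z 0"
proof -
  interpret F: quotient f f1 f2 by (fact F)
  interpret G: quotient g g1 g2 by (fact G)
  interpret S: two_crit p b a m n by (rule two_crit_swap)
  have Afun: "A = (\<lambda>z. deriv U z / U z)" and Bfun: "B = (\<lambda>z. deriv V z / V z)" using A B by auto
  have anU: "U analytic_on {z}" "V analytic_on {z}"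
    using U(1) V(1) by (simp_all add: holomorphic_on_imp_analytic_at)
  have anA: "A analytic_on {z}" "B analytic_on {z}"
    unfolding Afun Bfun using U(2) V(2) by (intro analytic_intros analytic_deriv anU; simp)+
  have eA: "\<forall>\<^sub>F w in at z. A w = deriv f w / (f w - a) * (1 - U w ^ (n + 1) * V w ^ m)"
    using cosparse_at[OF unit_identity(2)[OF F G rel U V]] unfolding Afun .
  have eB: "\<forall>\<^sub>F w in at z. B w = deriv f w / (f w - b) * (1 - U w ^ n * V w ^ (m + 1))"
    using cosparse_at[OF S.unit_identity(2)[OF F G rel V U]] unfolding Bfun by (simp only: mult.commute)
  have relA: "A z = - of_int k * (of_nat (n + 1) * A z + of_nat m * B z)"
    if k: "has_ord (\<lambda>w. f w - a) z k" "k \<noteq> 0" for k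
  proof -
    obtain h where h: "h analytic_on {z}" "\<forall>\<^sub>F w in at z. deriv f w / (f w - a) = of_int k / (w - z) + h w"
      using has_ord_log_deriv[OF k(1)] unfolding deriv_minus_const by blast
    have "\<forall>\<^sub>F w in at z. A w = (of_int k / (w - z) + h w) * (1 - U w ^ (n + 1) * V w ^ m)"
      using eA h(2) by eventually_elim simp
    moreover have "of_int k \<noteq> (0::complex)" using k(2) by simp
    ultimately show ?thesis
      using local_log_relation[OF U(1,2) V(1,2) anA(1) h(1), of "of_int k" "n + 1" m]
      unfolding A[symmetric] B[symmetric] by blast
  qed
  have relB: "B z = - of_int k * (of_nat n * A z + of_nat (m + 1) * B z)"
    if k: "has_ord (\<lambda>w. f w - b) z k" "k \<noteq> 0" for k
  proof -
    obtain h where h: "h analytic_on {z}" "\<forall>\<^sub>F w in at z. deriv f w / (f w - b) = of_int k / (w - z) + h w"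
      using has_ord_log_deriv[OF k(1)] unfolding deriv_minus_const by blast
    have "\<forall>\<^sub>F w in at z. B w = (of_int k / (w - z) + h w) * (1 - U w ^ n * V w ^ (m + 1))"
      using eB h(2) by eventually_elim simp
    moreover have "of_int k \<noteq> (0::complex)" using k(2) by simp
    ultimately show ?thesis
      using local_log_relation[OF U(1,2) V(1,2) anA(2) h(1), of "of_int k" n "m + 1"]
      unfolding A[symmetric] B[symmetric] by blast
  qed
  have angam: "gam A B analytic_on {z}"
    unfolding gam_def[abs_def] by (intro analytic_intros anA)
  have gam_zero: "ord_ge (gam A B) z 1" if "gam A B z = 0"
    by (rule ord_ge_zero_analytic[OF angam that])
  show ?thesis
  proof (cases "f2 z = 0")
    case True
    obtain k where k: "k > 0" "has_ord f2 z (int k)" "\<And>x. has_ord (\<lambda>w. f w - x) z (- int k)"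
      using F.pole_order[OF True] by blast
    have dd: "has_ord (deriv f) z (- int k - 1)" using F.deriv_order[OF k(3)] k(1) by simp
    have r1: "A z = of_nat k * (of_nat (n + 1) * A z + of_nat m * B z)" using relA[OF k(3)] k(1) by simp
    have r2: "B z = of_nat k * (of_nat n * A z + of_nat (m + 1) * B z)" using relB[OF k(3)] k(1) by simp
    have "gam A B z = 0"
    proof (cases "k = 1")
      case True
      then have "of_nat n * A z + of_nat m * B z = 0" using r1 by (simp add: algebra_simps)
      then show ?thesis by (simp add: gam_def)
    next
      case False
      \<comment> \<open>For \<open>k \<ge> 2\<close> the two linear equations for \<open>A z\<close> and \<open>B z\<close> have the determinant
        \<open>(K - 1) * (K * (n + m + 1) - 1)\<close>, which is not zero.\<close>
      define K where "K = (of_nat k :: complex)"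
      have "(K - 1) * (K * of_nat (n + m + 1) - 1) * A z =
        (1 - K * of_nat (m + 1)) * (A z - K * (of_nat (n + 1) * A z + of_nat m * B z))
        + K * of_nat m * (B z - K * (of_nat n * A z + of_nat (m + 1) * B z))"
        by (simp add: algebra_simps)
      also have "\<dots> = 0" using r1 r2 by (simp add: K_def)
      finally have "(K - 1) * (K * of_nat (n + m + 1) - 1) * A z = 0" .
      moreover have "K \<noteq> 1" using False by (simp add: K_def)
      moreover have "K * of_nat (n + m + 1) \<noteq> 1"
      proof
        assume "K * of_nat (n + m + 1) = 1"
        then have "of_nat (k * (n + m + 1)) = (of_nat 1 :: complex)"
          unfolding K_def of_nat_mult of_nat_1 .
        then have "k * (n + m + 1) = 1" by (simp only: of_nat_eq_iff)
        then have "n + m + 1 = 1" by (simp only: nat_mult_eq_1_iff)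
        then show False using n2 by simp
      qed
      ultimately have "A z = 0" by simp
      then show ?thesis by (simp add: gam_def)
    qed
    from gam_zero[OF this] have g1: "ord_ge (gam A B) z 1" .
    have "ord_ge (\<lambda>w. gam A B w * (deriv f w / ((f w - a) * (f w - b) * f2 w))) z
        (1 + ((- int k - 1) - (- int k + - int k + int k)))"
      by (intro ord_ge_mult g1 ord_ge_divide has_ord_imp_ord_ge[OF dd] has_ord_mult k)
    then show ?thesis by simp
  next
    case False
    have d2: "has_ord f2 z 0" using False by (intro has_ord_analytic F.analytic1)
    have pole: ?thesis if j: "has_ord (\<lambda>w. f w - x) z (int j)" "j > 0" and xy: "has_ord (\<lambda>w. f w - y) z 0"
      and g0: "gam A B z = 0" and xx: "{x, y} = {a, b}" for x y j
    proof -
      have dd: "has_ord (deriv f) z (int j - 1)" using F.deriv_order[OF j(1)] j(2) by simp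
      have "has_ord (\<lambda>w. (f w - x) * (f w - y)) z (int j + 0)" by (intro has_ord_mult j xy)
      moreover have "(\<lambda>w. (f w - x) * (f w - y)) = (\<lambda>w. (f w - a) * (f w - b))"
        using xx by (auto simp: doubleton_eq_iff mult.commute)
      ultimately have q: "has_ord (\<lambda>w. (f w - a) * (f w - b)) z (int j)" by simp
      have "ord_ge (\<lambda>w. gam A B w * (deriv f w / ((f w - a) * (f w - b) * f2 w))) z
          (1 + ((int j - 1) - (int j + 0)))"
        by (intro ord_ge_mult gam_zero[OF g0] ord_ge_divide has_ord_imp_ord_ge[OF dd] has_ord_mult[OF q d2])
      then show ?thesis by simp
    qed
    have vanish: "C z = 0" if C: "C analytic_on {z}" and j: "has_ord (\<lambda>w. f w - x) z (int j)" "2 \<le> j"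
      and y: "has_ord (\<lambda>w. f w - y) z 0" and th: "\<theta> analytic_on {z}"
      and e: "\<forall>\<^sub>F w in at z. C w = deriv f w / (f w - y) * \<theta> w" for C \<theta> x y j
    proof -
      have dd: "has_ord (deriv f) z (int j - 1)" using F.deriv_order[OF j(1)] j(2) by simp
      have "ord_ge (\<lambda>w. deriv f w / (f w - y) * \<theta> w) z ((int j - 1) - 0 + 0)"
        by (intro ord_ge_mult ord_ge_divide has_ord_imp_ord_ge[OF dd] y ord_ge_analytic th)
      then have "(\<lambda>w. deriv f w / (f w - y) * \<theta> w) \<midarrow>z\<rightarrow> 0"
        using j(2) by (intro ord_ge_pos_tendsto_0) auto
      moreover have "C \<midarrow>z\<rightarrow> C z" using analytic_at_imp_isCont[OF C] by (simp add: isCont_def)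
      then have "(\<lambda>w. deriv f w / (f w - y) * \<theta> w) \<midarrow>z\<rightarrow> C z" using e by (rule Lim_transform_eventually)
      ultimately show ?thesis using LIM_unique by blast
    qed
    show ?thesis
    proof (cases "f z = a")
      case fa: True
      then have fb: "f z \<noteq> b" using ab by simp
      obtain j where j: "j > 0" "has_ord (\<lambda>w. f w - a) z (int j)" using F.value_order[OF False fa] by blast
      have ob: "has_ord (\<lambda>w. f w - b) z 0" by (rule F.regular_order[OF False fb])
      have "gam A B z = 0"
      proof (cases "j = 1")
        case True
        then have "A z = - (of_nat (n + 1) * A z + of_nat m * B z)" using relA[OF j(2)] by simp
        then have "of_nat (n + 2) * A z + of_nat m * B z = 0" by (simp add: algebra_simps eq_neg_iff_add_eq_0)
        then show ?thesis by (simp add: gam_def)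
      next
        case False
        have "B z = 0"
        proof (rule vanish[OF anA(2) j(2) _ ob _ eB])
          show "2 \<le> j" using False j(1) by simp
          show "(\<lambda>w. 1 - U w ^ n * V w ^ (m + 1)) analytic_on {z}" by (intro analytic_intros anU)
        qed
        then show ?thesis by (simp add: gam_def)
      qed
      then show ?thesis by (rule pole[OF j(2,1) ob]) simp
    next
      case fa: False
      have oa: "has_ord (\<lambda>w. f w - a) z 0" by (rule F.regular_order[OF False fa])
      show ?thesis
      proof (cases "f z = b")
        case fb: True
        obtain j where j: "j > 0" "has_ord (\<lambda>w. f w - b) z (int j)" using F.value_order[OF False fb] by blast
        have "gam A B z = 0"
        proof (cases "j = 1")
          case True
          then have "B z = - (of_nat n * A z + of_nat (m + 1) * B z)" using relB[OF j(2)] by simp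
          then have "of_nat n * A z + of_nat (m + 2) * B z = 0" by (simp add: algebra_simps eq_neg_iff_add_eq_0)
          then show ?thesis by (simp add: gam_def)
        next
          case False
          have "A z = 0"
          proof (rule vanish[OF anA(1) j(2) _ oa _ eA])
            show "2 \<le> j" using False j(1) by simp
            show "(\<lambda>w. 1 - U w ^ (n + 1) * V w ^ m) analytic_on {z}" by (intro analytic_intros anU)
          qed
          then show ?thesis by (simp add: gam_def)
        qed
        then show ?thesis by (rule pole[OF j(2,1) oa]) auto
      next
        case fb: False
        have "ord_ge (\<lambda>w. gam A B w * (deriv f w / ((f w - a) * (f w - b) * f2 w))) z (0 + (0 - (0 + 0 + 0)))"
          by (intro ord_ge_mult ord_ge_divide has_ord_mult d2 oa F.regular_order[OF False fb]
              ord_ge_analytic[OF angam] ord_ge_deriv_analytic F.analytic False)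
        then show ?thesis by simp
      qed
    qed
  qed
qed

text \<open>
  If the fourth factor of \<open>gam\<close> vanished identically, \<open>U ^ (n + 2) * V ^ m\<close> would be a
  constant \<open>\<kappa>\<close> and the identity for \<open>U' / U\<close> would integrate to \<open>U - \<kappa> = l * (f - a)\<close>. Then
  \<open>f\<close> and \<open>g\<close> are entire, and \<open>g - a = (1 - \<kappa> / U) / l\<close> is bounded where \<open>U\<close> is large; but
  then \<open>f\<close>, being comparable to \<open>g\<close>, and with it \<open>U\<close> are bounded, and Liouville's theorem
  applies.
\<close>

lemma unit_value_impossible:
  assumes F: "quotient f f1 f2" and G: "quotient g g1 g2" and rel: "related 1 f g"
    and U: "U holomorphic_on UNIV" "\<And>z. U z \<noteq> 0" "\<forall>\<^sub>\<approx>z. f z - a = U z * (g z - a)"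
    and V: "V holomorphic_on UNIV" "\<And>z. V z \<noteq> 0" "\<forall>\<^sub>\<approx>z. f z - b = V z * (g z - b)"
    and A: "deriv U z0 / U z0 \<noteq> 0"
    and zero: "\<And>z. of_nat (n + 2) * (deriv U z / U z) + of_nat m * (deriv V z / V z) = 0"
  shows False
proof -
  interpret F: quotient f f1 f2 by (fact F)
  interpret G: quotient g g1 g2 by (fact G)
  obtain \<kappa> where \<kappa>: "\<kappa> \<noteq> 0" "\<And>z. U z ^ (n + 2) * V z ^ m = \<kappa>"
    using unit_relation_constant[OF U(1,2) V(1,2) zero] by blast
  have UV: "U z ^ (n + 1) * V z ^ m = \<kappa> / U z" for z
    using \<kappa>(2)[of z] U(2)[of z] by (simp add: field_simps)
  have ncU: "\<not> U constant_on UNIV"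
  proof
    assume "U constant_on UNIV"
    then obtain c where "U = (\<lambda>z. c)" by (auto simp: constant_on_def)
    then show False using A by simp
  qed
  then obtain z1 where z1: "U z1 - \<kappa> \<noteq> 0" by (auto simp: constant_on_def)
  have hU\<kappa>: "(\<lambda>z. U z - \<kappa>) holomorphic_on UNIV" by (intro holomorphic_intros U)
  have neU: "\<forall>\<^sub>\<approx>z. U z - \<kappa> \<noteq> 0" by (rule entire_nonzero_cosparse[OF hU\<kappa> z1])
  have "\<forall>\<^sub>\<approx>z. (\<lambda>w. (U w - \<kappa>) / (f w - a)) analytic_on {z} \<and> deriv (\<lambda>w. (U w - \<kappa>) / (f w - a)) z = 0"
    using unit_identity(2)[OF F G rel U V] F.value_ne_cosparse(1) F.value_ne_cosparse(2)[of a]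
  proof eventually_elim
    case (elim z)
    have Uz: "U z \<noteq> 0" by (rule U(2))
    have fz: "f z - a \<noteq> 0" using elim by simp
    have an: "(\<lambda>w. (U w - \<kappa>) / (f w - a)) analytic_on {z}"
      using elim by (intro analytic_intros F.analytic holomorphic_on_imp_analytic_at[OF U(1)]) auto
    have "deriv U z = deriv f z / (f z - a) * (U z - \<kappa>)"
    proof -
      have "deriv U z / U z = deriv f z / (f z - a) * (1 - \<kappa> / U z)" using elim(1) unfolding UV .
      then have "deriv U z / U z * U z = deriv f z / (f z - a) * ((1 - \<kappa> / U z) * U z)" by (simp only: mult.assoc)
      moreover have "(1 - \<kappa> / U z) * U z = U z - \<kappa>" using Uz by (simp add: left_diff_distrib)
      ultimately show ?thesis using Uz by simp
    qed
    moreover have "((\<lambda>w. (U w - \<kappa>) / (f w - a)) has_field_derivative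
        ((deriv U z - 0) * (f z - a) - (U z - \<kappa>) * (deriv f z - 0)) / ((f z - a) * (f z - a))) (at z)"
      using U(1) by (intro DERIV_divide DERIV_diff DERIV_const F.has_deriv elim fz) (auto intro: holomorphic_derivI)
    ultimately have "deriv (\<lambda>w. (U w - \<kappa>) / (f w - a)) z = 0"
      using fz by (simp add: DERIV_imp_deriv)
    then show ?case using an by blast
  qed
  from deriv_zero_constant[OF this] obtain l where "\<forall>\<^sub>\<approx>z. (U z - \<kappa>) / (f z - a) = l" by blast
  then have lin: "\<forall>\<^sub>\<approx>z. l \<noteq> 0 \<and> U z - \<kappa> = l * (f z - a)"
    using neU F.value_ne_cosparse(2)[of a] by eventually_elim (auto simp: field_simps)
  have l: "l \<noteq> 0" using lin cosparse_contradiction[of "\<lambda>z. l \<noteq> 0 \<and> U z - \<kappa> = l * (f z - a)"] by auto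
  have f2: "f2 z \<noteq> 0" for z
  proof
    assume z: "f2 z = 0"
    obtain k where k: "k > 0" "\<And>x. has_ord (\<lambda>w. f w - x) z (- int k)" using F.pole_order[OF z] by blast
    have "has_ord (\<lambda>w. l * (f w - a)) z (0 + - int k)" by (intro has_ord_mult has_ord_const l k)
    moreover have "\<forall>\<^sub>F w in at z. l * (f w - a) = U w - \<kappa>" using cosparse_at[OF lin] by eventually_elim simp
    ultimately have "has_ord (\<lambda>w. U w - \<kappa>) z (0 + - int k)" by (rule has_ord_cong)
    moreover have "ord_ge (\<lambda>w. U w - \<kappa>) z 0"
      by (intro ord_ge_analytic holomorphic_on_imp_analytic_at[OF hU\<kappa>]) auto
    ultimately have "0 \<le> 0 + - int k" by (rule ord_ge_le_has_ord[rotated])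
    then show False using k by simp
  qed
  note g2 = related_value(1)[OF F G rel f2]
  have anU: "U analytic_on {z}" for z using U(1) by (simp add: holomorphic_on_imp_analytic_at)
  have e1: "U z - \<kappa> = l * (f z - a)" for z
  proof (rule analytic_eq_at[where F = "\<lambda>z. U z - \<kappa>" and G = "\<lambda>z. l * (f z - a)"])
    show "(\<lambda>z. U z - \<kappa>) analytic_on {z}" "(\<lambda>z. l * (f z - a)) analytic_on {z}"
      by (intro analytic_intros anU F.analytic f2)+
    show "\<forall>\<^sub>F w in at z. U w - \<kappa> = l * (f w - a)" using cosparse_at[OF lin] by eventually_elim simp
  qed
  have e2: "f z - a = U z * (g z - a)" for z
  proof (rule analytic_eq_at[where F = "\<lambda>z. f z - a" and G = "\<lambda>z. U z * (g z - a)"])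
    show "(\<lambda>z. f z - a) analytic_on {z}" "(\<lambda>z. U z * (g z - a)) analytic_on {z}"
      by (intro analytic_intros anU F.analytic G.analytic f2 g2)+
    show "\<forall>\<^sub>F w in at z. f w - a = U w * (g w - a)" by (rule cosparse_at[OF U(3)])
  qed
  obtain C where C: "0 < C" "\<And>x y. poly p x = inverse 1 * poly p y \<Longrightarrow> max 1 (norm y) \<le> C * max 1 (norm x)"
    using related_max_bound[of "inverse 1"] by auto
  define M where "M = norm a + (1 + norm \<kappa>) / norm l"
  have bound: "norm (U z) \<le> 1 + norm \<kappa> + norm l * (C * max 1 M + norm a)" for z
  proof (cases "norm (U z) \<le> 1")
    case True
    have "0 \<le> norm l * (C * max 1 M + norm a)" using C by (intro mult_nonneg_nonneg add_nonneg_nonneg) auto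
    then show ?thesis using True by (simp add: add_increasing2 add_increasing)
  next
    case False
    have "g z - a = (1 - \<kappa> / U z) / l"
    proof -
      have "l * (U z * (g z - a)) = U z - \<kappa>" using e1[of z] e2[of z] by simp
      then show ?thesis using l U(2)[of z] by (simp add: field_simps)
    qed
    then have "norm (g z - a) = norm (1 - \<kappa> / U z) / norm l" by (simp add: norm_divide)
    also have "norm (1 - \<kappa> / U z) \<le> 1 + norm (\<kappa> / U z)" using norm_triangle_ineq4[of 1 "\<kappa> / U z"] by simp
    also have "norm (\<kappa> / U z) \<le> norm \<kappa>"
    proof -
      have "norm \<kappa> / norm (U z) \<le> norm \<kappa> / 1" using False by (intro divide_left_mono) auto
      then show ?thesis by (simp add: norm_divide)
    qed
    finally have "norm (g z - a) \<le> (1 + norm \<kappa>) / norm l" using l by (simp add: divide_right_mono)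
    then have gM: "norm (g z) \<le> M" using norm_triangle_ineq2[of "g z" a] by (simp add: M_def)
    have "max 1 (norm (f z)) \<le> C * max 1 (norm (g z))"
      by (rule C(2)) (use related_value(2)[OF F G rel f2, of z] in simp)
    also have "\<dots> \<le> C * max 1 M" using gM C(1) by (intro mult_left_mono) auto
    finally have "norm (f z) \<le> C * max 1 M" by simp
    then have "norm (f z - a) \<le> C * max 1 M + norm a" using norm_triangle_ineq4[of "f z" a] by simp
    then have "norm l * norm (f z - a) \<le> norm l * (C * max 1 M + norm a)" by (intro mult_left_mono) auto
    moreover have "U z = \<kappa> + l * (f z - a)" using e1[of z] by (metis add.commute diff_add_cancel)
    then have "norm (U z) \<le> norm \<kappa> + norm (l * (f z - a))" by (metis norm_triangle_ineq)
    ultimately show ?thesis by (simp add: norm_mult)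
  qed
  have "U constant_on UNIV"
    by (rule Liouville_theorem[OF U(1)]) (use bound in \<open>auto simp: bounded_iff\<close>)
  then show False using ncU by simp
qed

text \<open>
  Let \<open>A\<close> and \<open>B\<close> be the logarithmic derivatives of the units \<open>(f - a) / (g - a)\<close> and
  \<open>(f - b) / (g - b)\<close>. They are small, and so is \<open>gam A B\<close>. If \<open>gam A B\<close> is not identically
  zero, the function of \<open>gam_order\<close>, multiplied by its analogue for \<open>g\<close>, contradicts the
  second main theorem for the two values \<open>a\<close> and \<open>b\<close>. If one of the first three factors
  vanishes identically, \<open>f\<close> and \<open>g\<close> are related by an affine map; for the last two see
  \<open>unit_value_impossible\<close>.
\<close>

lemma equal_relation:
  assumes F: "quotient f f1 f2" and G: "quotient g g1 g2" and rel: "related 1 f g"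
    and sha: "\<And>z. f2 z \<noteq> 0 \<Longrightarrow> g2 z \<noteq> 0 \<Longrightarrow> f z = a \<longleftrightarrow> g z = a"
    and shb: "\<And>z. f2 z \<noteq> 0 \<Longrightarrow> g2 z \<noteq> 0 \<Longrightarrow> f z = b \<longleftrightarrow> g z = b"
  shows "\<forall>\<^sub>\<approx>z. f z = g z"
proof (rule ccontr)
  assume neq: "\<not> (\<forall>\<^sub>\<approx>z. f z = g z)"
  interpret F: quotient f f1 f2 by (fact F)
  interpret G: quotient g g1 g2 by (fact G)
  interpret S: two_crit p b a m n by (rule two_crit_swap)
  have no_affine: False if "\<forall>\<^sub>\<approx>z. f z = \<kappa> * g z + d" for \<kappa> d
    using affine_relation[OF G rel that] that neq by simp
  obtain U where U: "U holomorphic_on UNIV" "\<And>z. U z \<noteq> 0" "\<forall>\<^sub>\<approx>z. f z - a = U z * (g z - a)"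
    using common_order_unit[OF common_order_at_crit[OF F G rel sha]] by blast
  obtain V where V: "V holomorphic_on UNIV" "\<And>z. V z \<noteq> 0" "\<forall>\<^sub>\<approx>z. f z - b = V z * (g z - b)"
    using common_order_unit[OF S.common_order_at_crit[OF F G rel shb]] by blast
  define A where "A = (\<lambda>z. deriv U z / U z)"
  define B where "B = (\<lambda>z. deriv V z / V z)"
  have hA: "A holomorphic_on UNIV" and hB: "B holomorphic_on UNIV"
    unfolding A_def B_def using U V by (intro holomorphic_intros; simp)+
  \<comment> \<open>None of the five factors of \<open>gam\<close> vanishes identically.\<close>
  have "\<exists>z. A z \<noteq> 0"
  proof (rule ccontr)
    assume "\<not> ?thesis"
    then have "of_nat 1 * (deriv U z / U z) + of_nat 0 * (deriv V z / V z) = 0" for z by (simp add: A_def)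
    from unit_relation_constant[OF U(1,2) V(1,2) this] obtain \<kappa> where k: "\<And>z. U z = \<kappa>" by auto
    have "\<forall>\<^sub>\<approx>z. f z = \<kappa> * g z + (a - \<kappa> * a)"
      using U(3) unfolding k by eventually_elim (simp add: algebra_simps)
    then show False by (rule no_affine)
  qed
  then obtain zA where zA: "A zA \<noteq> 0" by blast
  have "\<exists>z. B z \<noteq> 0"
  proof (rule ccontr)
    assume "\<not> ?thesis"
    then have "of_nat 1 * (deriv V z / V z) + of_nat 0 * (deriv U z / U z) = 0" for z by (simp add: B_def)
    from unit_relation_constant[OF V(1,2) U(1,2) this] obtain \<kappa> where k: "\<And>z. V z = \<kappa>" by auto
    have "\<forall>\<^sub>\<approx>z. f z = \<kappa> * g z + (b - \<kappa> * b)"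
      using V(3) unfolding k by eventually_elim (simp add: algebra_simps)
    then show False by (rule no_affine)
  qed
  then obtain zB where zB: "B zB \<noteq> 0" by blast
  have "\<exists>z. of_nat n * A z + of_nat m * B z \<noteq> 0"
  proof (rule ccontr)
    assume "\<not> ?thesis"
    then have "of_nat n * (deriv U z / U z) + of_nat m * (deriv V z / V z) = 0" for z by (simp add: A_def B_def)
    from unit_relation_constant[OF U(1,2) V(1,2) this] obtain \<kappa> where k: "\<kappa> \<noteq> 0" "\<And>z. U z ^ n * V z ^ m = \<kappa>" by auto
    have "\<forall>\<^sub>\<approx>z. (\<lambda>w. g w - \<kappa> * f w) analytic_on {z} \<and> deriv (\<lambda>w. g w - \<kappa> * f w) z = 0"
      using unit_identity(1)[OF F G rel U V] F.value_ne_cosparse(1) G.value_ne_cosparse(1)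
    proof eventually_elim
      case (elim z)
      have "((\<lambda>w. g w - \<kappa> * f w) has_field_derivative deriv g z - \<kappa> * deriv f z) (at z)"
        by (intro DERIV_diff DERIV_cmult F.has_deriv G.has_deriv elim)
      moreover have "deriv g z = \<kappa> * deriv f z" using elim(1) unfolding k .
      ultimately have "deriv (\<lambda>w. g w - \<kappa> * f w) z = 0" by (simp add: DERIV_imp_deriv)
      moreover have "(\<lambda>w. g w - \<kappa> * f w) analytic_on {z}"
        using elim by (intro analytic_intros F.analytic G.analytic)
      ultimately show ?case by blast
    qed
    from deriv_zero_constant[OF this] obtain d where d: "\<forall>\<^sub>\<approx>z. g z - \<kappa> * f z = d" by blast
    have "\<forall>\<^sub>\<approx>z. f z = (1 / \<kappa>) * g z + (- d / \<kappa>)"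
      using d by eventually_elim (use k(1) in \<open>auto simp: field_simps\<close>)
    then show False by (rule no_affine)
  qed
  then obtain z1 where z1: "of_nat n * A z1 + of_nat m * B z1 \<noteq> 0" by blast
  have "\<exists>z. of_nat (n + 2) * A z + of_nat m * B z \<noteq> 0"
    using unit_value_impossible[OF F G rel U V, of zA] zA unfolding A_def B_def by blast
  then obtain z2 where z2: "of_nat (n + 2) * A z2 + of_nat m * B z2 \<noteq> 0" by blast
  have "\<exists>z. of_nat (m + 2) * B z + of_nat n * A z \<noteq> 0"
    using S.unit_value_impossible[OF F G rel V U, of zB] zB unfolding A_def B_def by blast
  then obtain z3 where z3: "of_nat n * A z3 + of_nat (m + 2) * B z3 \<noteq> 0" by (auto simp: add.commute)
  have hlin: "(\<lambda>z. of_nat i * A z + of_nat j * B z) holomorphic_on UNIV" for i j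
    by (intro holomorphic_intros hA hB)
  have gam_ne: "\<forall>\<^sub>\<approx>z. gam A B z \<noteq> 0"
    using entire_nonzero_cosparse[OF hA zA] entire_nonzero_cosparse[OF hB zB] entire_nonzero_cosparse[OF hlin z1]
      entire_nonzero_cosparse[OF hlin z2] entire_nonzero_cosparse[OF hlin z3]
    by eventually_elim (simp add: gam_def)
  define \<Lambda> where "\<Lambda> = char_fun (\<lambda>z. hmax f1 f2 z * hmax g1 g2 z)"
  have gr: "growth \<Lambda>" and domf: "dominated \<Lambda> f1 f2" and domg: "dominated \<Lambda> g1 g2"
    unfolding \<Lambda>_def using dominated_pair[OF F G] dominated_pair2[OF F G] by auto
  have sA: "small \<Lambda> A"
  proof (rule small_cong)
    show "small \<Lambda> (\<lambda>z. deriv f z / (f z - a) - deriv g z / (g z - a))"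
      by (intro small_diff F.small_value G.small_value gr domf domg)
    show "\<forall>\<^sub>\<approx>z. deriv f z / (f z - a) - deriv g z / (g z - a) = A z"
      using quotient_unit_log_deriv[OF F G U] unfolding A_def by eventually_elim simp
  qed
  have sB: "small \<Lambda> B"
  proof (rule small_cong)
    show "small \<Lambda> (\<lambda>z. deriv f z / (f z - b) - deriv g z / (g z - b))"
      by (intro small_diff F.small_value G.small_value gr domf domg)
    show "\<forall>\<^sub>\<approx>z. deriv f z / (f z - b) - deriv g z / (g z - b) = B z"
      using quotient_unit_log_deriv[OF F G V] unfolding B_def by eventually_elim simp
  qed
  have sgam: "small \<Lambda> (gam A B)"
    unfolding gam_def[abs_def] by (intro small_mult small_add small_cmult gr sA sB)
  have ab2: "finite {a, b}" "{a, b} \<noteq> {}" "card {a, b} = 2" using ab by auto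
  obtain \<psi>f where \<psi>f: "small \<Lambda> \<psi>f" "\<forall>\<^sub>\<approx>z. hmax f1 f2 z ^ (card {a, b} - 1) * norm (deriv f z)
      \<le> norm (\<psi>f z) * (norm (f2 z) ^ (card {a, b} - 1) * (\<Prod>y\<in>{a, b}. norm (f z - y)))"
    using F.second_main[OF gr domf ab2(1,2)] by blast
  obtain \<psi>g where \<psi>g: "small \<Lambda> \<psi>g" "\<forall>\<^sub>\<approx>z. hmax g1 g2 z ^ (card {a, b} - 1) * norm (deriv g z)
      \<le> norm (\<psi>g z) * (norm (g2 z) ^ (card {a, b} - 1) * (\<Prod>y\<in>{a, b}. norm (g z - y)))"
    using G.second_main[OF gr domg ab2(1,2)] by blast
  define Qf where "Qf = (\<lambda>w. deriv f w / ((f w - a) * (f w - b) * f2 w))"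
  define Qg where "Qg = (\<lambda>w. deriv g w / ((g w - a) * (g w - b) * g2 w))"
  define Om where "Om = (\<lambda>w. (gam A B w * Qf w) * (gam A B w * Qg w))"
  have ne: "\<forall>\<^sub>\<approx>z. (f2 z \<noteq> 0 \<and> g2 z \<noteq> 0) \<and> (f z \<noteq> a \<and> f z \<noteq> b) \<and> (g z \<noteq> a \<and> g z \<noteq> b) \<and> deriv f z \<noteq> 0 \<and> deriv g z \<noteq> 0"
    using F.value_ne_cosparse(1) G.value_ne_cosparse(1) F.value_ne_cosparse(2)[of a] F.value_ne_cosparse(2)[of b]
      G.value_ne_cosparse(2)[of a] G.value_ne_cosparse(2)[of b] F.deriv_ne_cosparse G.deriv_ne_cosparse
    by eventually_elim auto
  show False
  proof (rule key_contradiction[OF F G, of Om "\<lambda>z. (gam A B z * \<psi>f z) * (gam A B z * \<psi>g z)" 1])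
    show "small (char_fun (\<lambda>z. hmax f1 f2 z * hmax g1 g2 z)) (\<lambda>z. (gam A B z * \<psi>f z) * (gam A B z * \<psi>g z))"
      unfolding \<Lambda>_def[symmetric] by (intro small_mult gr sgam \<psi>f(1) \<psi>g(1))
    have "\<forall>\<^sub>\<approx>z. Om z \<noteq> 0"
      using ne gam_ne by eventually_elim (auto simp: Om_def Qf_def Qg_def)
    then show "\<not> (\<forall>\<^sub>\<approx>z. Om z = 0)" using cosparse_contradiction by blast
    have bnd: "norm (d / (x * y * t)) * h \<le> s" if "h ^ (card {a, b} - 1) * norm d \<le> s * (norm t ^ (card {a, b} - 1) * (norm x * norm y))"
      "t \<noteq> 0" "x \<noteq> 0" "y \<noteq> 0" for d x y t :: complex and h s :: real
      using that ab2(3) by (simp add: norm_divide norm_mult divide_le_eq mult_ac)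
    show "\<forall>\<^sub>\<approx>z. norm (Om z) * (hmax f1 f2 z * hmax g1 g2 z) ^ 1 \<le> norm ((gam A B z * \<psi>f z) * (gam A B z * \<psi>g z))"
      using \<psi>f(2) \<psi>g(2) ne
    proof eventually_elim
      case (elim z)
      have 1: "norm (Qf z) * hmax f1 f2 z \<le> norm (\<psi>f z)"
        unfolding Qf_def by (rule bnd) (use elim ab in auto)
      have 2: "norm (Qg z) * hmax g1 g2 z \<le> norm (\<psi>g z)"
        unfolding Qg_def by (rule bnd) (use elim ab in auto)
      have "norm (Om z) * (hmax f1 f2 z * hmax g1 g2 z) ^ 1 =
          norm (gam A B z) * norm (gam A B z) * ((norm (Qf z) * hmax f1 f2 z) * (norm (Qg z) * hmax g1 g2 z))"
        by (simp add: Om_def norm_mult mult_ac)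
      also have "\<dots> \<le> norm (gam A B z) * norm (gam A B z) * (norm (\<psi>f z) * norm (\<psi>g z))"
        using G.hmax_pos[of z] by (intro mult_left_mono mult_mono 1 2) auto
      finally show ?case by (simp add: norm_mult mult_ac)
    qed
    show "ord_ge Om z 0" for z
    proof -
      have of: "ord_ge (\<lambda>w. gam A B w * Qf w) z 0"
        unfolding Qf_def by (rule gam_order[OF F G rel U V]) (simp_all add: A_def B_def)
      have relgf: "related 1 g f" using related_sym[OF rel] by simp
      have inv_unit: "(\<lambda>z. inverse (W z)) holomorphic_on UNIV" "inverse (W z) \<noteq> 0"
        "\<forall>\<^sub>\<approx>z. g z - x = inverse (W z) * (f z - x)" "- (deriv W z / W z) = deriv (\<lambda>z. inverse (W z)) z / inverse (W z)"
        if W: "W holomorphic_on UNIV" "\<And>z. W z \<noteq> 0" "\<forall>\<^sub>\<approx>z. f z - x = W z * (g z - x)" for W x z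
      proof -
        show "(\<lambda>z. inverse (W z)) holomorphic_on UNIV" using W by (intro holomorphic_intros) auto
        show "inverse (W z) \<noteq> 0" using W(2) by simp
        show "\<forall>\<^sub>\<approx>z. g z - x = inverse (W z) * (f z - x)" using W(3) by eventually_elim (simp add: W(2))
        have "(W has_field_derivative deriv W z) (at z)" using W(1) by (auto intro: holomorphic_derivI)
        from DERIV_inverse'[OF this W(2)]
        have "deriv (\<lambda>z. inverse (W z)) z = - (inverse (W z) * deriv W z * inverse (W z))" by (rule DERIV_imp_deriv)
        then show "- (deriv W z / W z) = deriv (\<lambda>z. inverse (W z)) z / inverse (W z)"
          using W(2)[of z] by (simp add: divide_inverse)
      qed
      have "ord_ge (\<lambda>w. gam (\<lambda>z. - A z) (\<lambda>z. - B z) w * Qg w) z 0"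
        unfolding Qg_def
        by (rule gam_order[OF G F relgf inv_unit(1-3)[OF U] inv_unit(1-3)[OF V]])
          (simp_all only: A_def B_def inv_unit(4)[OF U] inv_unit(4)[OF V])
      moreover have "gam (\<lambda>z. - A z) (\<lambda>z. - B z) w = - gam A B w" for w
        unfolding gam_def by (simp add: algebra_simps)
      ultimately have "ord_ge (\<lambda>w. (-1) * (gam A B w * Qg w)) z 0" by simp
      from ord_ge_cmult[OF this, of "-1"] have og: "ord_ge (\<lambda>w. gam A B w * Qg w) z 0" by simp
      show ?thesis using ord_ge_mult[OF of og] unfolding Om_def by simp
    qed
  qed simp
qed

end

section \<open>The auxiliary functions\<close>

lemma ord_ge_imp_meromorphic:
  assumes "\<And>z. \<exists>k. ord_ge F z k" shows "F meromorphic_on UNIV"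
proof -
  have "F meromorphic_on {z}" for z
  proof -
    obtain k h where h: "h analytic_on {z}" "\<forall>\<^sub>F w in at z. F w = (w - z) powi k * h w"
      using assms[of z] unfolding ord_ge_def by blast
    have "(\<lambda>w. (w - z) powi k * h w) meromorphic_on {z}"
      using h(1) by (intro meromorphic_intros analytic_on_imp_meromorphic_on)
    moreover have "F meromorphic_on {z} \<longleftrightarrow> (\<lambda>w. (w - z) powi k * h w) meromorphic_on {z}"
      by (rule meromorphic_on_cong) (use h(2) in auto)
    ultimately show ?thesis by simp
  qed
  then show ?thesis by (auto simp: meromorphic_on_def)
qed

lemma zero_or_ne_cosparse:
  assumes "\<And>z. \<exists>k. ord_ge F z k" shows "(\<forall>\<^sub>\<approx>z. F z = 0) \<or> (\<forall>\<^sub>\<approx>z. F z \<noteq> 0)"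
  using meromorphic_imp_constant_or_avoid[OF ord_ge_imp_meromorphic[OF assms], of 0] by auto

lemma log_deriv_mult:
  assumes "(F has_field_derivative dF) (at z)" "(G has_field_derivative dG) (at z)" "F z \<noteq> 0" "G z \<noteq> (0::complex)"
    and "\<forall>\<^sub>F w in nhds z. E w = F w * G w"
  shows "deriv E z / E z = dF / F z + dG / G z"
proof -
  have "((\<lambda>w. F w * G w) has_field_derivative dF * G z + dG * F z) (at z)" by (rule DERIV_mult assms)+
  moreover have "deriv E z = deriv (\<lambda>w. F w * G w) z" by (rule deriv_cong_ev[OF assms(5) refl])
  ultimately have "deriv E z = dF * G z + dG * F z" by (simp add: DERIV_imp_deriv)
  moreover have "E z = F z * G z" using eventually_nhds_x_imp_x[OF assms(5)] .
  ultimately show ?thesis using assms(3,4) by (simp add: field_simps)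
qed

text \<open>
  The quotient has derivative \<open>0\<close>, and the complement of a discrete set is connected.
\<close>

lemma equal_log_deriv_proportional:
  assumes F: "\<forall>\<^sub>\<approx>z. F analytic_on {z} \<and> F z \<noteq> 0" and G: "\<forall>\<^sub>\<approx>z. G analytic_on {z} \<and> G z \<noteq> 0"
    and eq: "\<forall>\<^sub>\<approx>z. deriv F z / F z = deriv G z / (G z :: complex)"
  shows "\<exists>K. K \<noteq> 0 \<and> (\<forall>\<^sub>\<approx>z. F z = K * G z)"
proof -
  have "\<forall>\<^sub>\<approx>z. (\<lambda>w. F w / G w) analytic_on {z} \<and> deriv (\<lambda>w. F w / G w) z = 0"
    using F G eq
  proof eventually_elim
    case (elim z)
    have "(F has_field_derivative deriv F z) (at z)" "(G has_field_derivative deriv G z) (at z)"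
      using elim by (meson DERIV_deriv_iff_field_differentiable analytic_on_imp_differentiable_at insertI1)+
    from DERIV_divide[OF this] have "deriv (\<lambda>w. F w / G w) z = (deriv F z * G z - F z * deriv G z) / (G z * G z)"
      using elim by (auto intro: DERIV_imp_deriv)
    moreover have "deriv F z * G z - F z * deriv G z = 0" using elim by (auto simp: field_simps)
    moreover have "(\<lambda>w. F w / G w) analytic_on {z}" using elim by (intro analytic_intros) auto
    ultimately show ?case by simp
  qed
  from deriv_zero_constant[OF this] obtain K where K: "\<forall>\<^sub>\<approx>z. F z / G z = K" by blast
  have e: "\<forall>\<^sub>\<approx>z. F z = K * G z" using K G by eventually_elim (auto simp: field_simps)
  have "K \<noteq> 0"
  proof
    assume K: "K = 0"
    have "\<forall>\<^sub>\<approx>z. F z = 0" using e by eventually_elim (simp add: K)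
    moreover have "\<forall>\<^sub>\<approx>z. \<not> F z = 0" using F by eventually_elim simp
    ultimately show False by (rule cosparse_contradiction)
  qed
  then show ?thesis using e by blast
qed

locale comp_quotient = two_crit p a b n m + quotient f f1 f2 for p a b n m f f1 f2 +
  assumes nm: "5 \<le> n + m" and pa: "poly p a \<noteq> 0" and pb: "poly p b \<noteq> 0"
begin

definition cmp :: "complex \<Rightarrow> complex" where "cmp z = poly p (f z)"
definition L :: "complex \<Rightarrow> complex" where "L z = deriv cmp z / cmp z"
text \<open>
  This is the logarithmic derivative of \<open>(1 / cmp)'\<close>.
\<close>

definition H :: "complex \<Rightarrow> complex" where "H z = deriv (deriv cmp) z / deriv cmp z - 2 * L z"
text \<open>
  Without the power of \<open>f2\<close> the quotient would have zeros of high order at the poles of \<open>f\<close>; they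
  are traded for the same power of the maximum in \<open>W_bound\<close>.
\<close>

definition W :: "complex \<Rightarrow> complex" where
  "W z = deriv f z ^ 2 / (((f z - a) * (f z - b)) ^ 2 * cmp z * f2 z ^ (n + m - 4))"

lemma cmp_fun: "cmp = (\<lambda>z. poly p (f z))"
  by (rule ext) (rule cmp_def)

lemma cmp_analytic: "f2 z \<noteq> 0 \<Longrightarrow> cmp analytic_on {z}"
  unfolding cmp_fun by (rule poly_comp_analytic)

lemma cmp_ne_cosparse: "\<forall>\<^sub>\<approx>z. cmp z \<noteq> 0"
  unfolding cmp_def by (rule poly_comp_ne_cosparse[OF p_nz])

lemma deriv_cmp: "f2 z \<noteq> 0 \<Longrightarrow> deriv cmp z = (f z - a) ^ n * (f z - b) ^ m * deriv f z"
  unfolding cmp_fun using DERIV_chain2[OF poly_DERIV has_deriv, of z p] by (simp add: DERIV_imp_deriv poly_pderiv)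

lemma regular_cosparse: "\<forall>\<^sub>\<approx>z. f2 z \<noteq> 0 \<and> f z \<noteq> a \<and> f z \<noteq> b \<and> cmp z \<noteq> 0 \<and> deriv f z \<noteq> 0"
  using value_ne_cosparse(1) value_ne_cosparse(2)[of a] value_ne_cosparse(2)[of b] cmp_ne_cosparse deriv_ne_cosparse
  by eventually_elim auto

lemma card_zeros: "card {x. poly p x = 0} = n + m + 1"
  and poly_factor: "poly p z = lead_coeff p * (\<Prod>x | poly p x = 0. z - x)"
  using card_simple_roots(1)[of 0] card_simple_roots(2)[of 0 z] pa pb by auto

lemma cmp_eq_prod: "cmp z = lead_coeff p * (\<Prod>x | poly p x = 0. f z - x)"
  unfolding cmp_def by (rule poly_factor)

lemma cmp_fun_prod: "cmp = (\<lambda>z. lead_coeff p * (\<Prod>x | poly p x = 0. f z - x))"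
  by (rule ext) (rule cmp_eq_prod)

lemma finite_zeros: "finite {x. poly p x = 0}"
  using poly_roots_finite[OF p_nz] .

lemma L_eq: "\<forall>\<^sub>\<approx>z. L z = (\<Sum>x | poly p x = 0. deriv f z / (f z - x))"
  using regular_cosparse
proof eventually_elim
  case (elim z)
  have "((\<lambda>w. \<Prod>x | poly p x = 0. f w - x) has_field_derivative
      (\<Prod>x | poly p x = 0. f z - x) * (\<Sum>x | poly p x = 0. deriv f z / (f z - x))) (at z)"
  proof (rule has_field_derivative_prod')
    show "f z - x \<noteq> 0" if "x \<in> {x. poly p x = 0}" for x using elim that by (auto simp: cmp_def)
    show "((\<lambda>w. f w - x) has_field_derivative deriv f z) (at z)" for x
      using DERIV_diff[OF has_deriv DERIV_const[of x], of z] elim by simp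
  qed
  note DERIV_cmult[OF this, of "lead_coeff p"]
  moreover have "(\<lambda>w. lead_coeff p * (\<Prod>x | poly p x = 0. f w - x)) = cmp"
    by (rule cmp_fun_prod[symmetric])
  moreover have "lead_coeff p * ((\<Prod>x | poly p x = 0. f z - x) * (\<Sum>x | poly p x = 0. deriv f z / (f z - x)))
      = cmp z * (\<Sum>x | poly p x = 0. deriv f z / (f z - x))"
    by (simp only: cmp_eq_prod mult.assoc)
  ultimately have "(cmp has_field_derivative cmp z * (\<Sum>x | poly p x = 0. deriv f z / (f z - x))) (at z)"
    by (simp only:)
  then have "deriv cmp z = cmp z * (\<Sum>x | poly p x = 0. deriv f z / (f z - x))" by (rule DERIV_imp_deriv)
  then show ?case using elim by (simp add: L_def)
qed

lemma H_eq: "\<forall>\<^sub>\<approx>z. H z = of_nat n * (deriv f z / (f z - a)) + of_nat m * (deriv f z / (f z - b))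
    + deriv (deriv f) z / deriv f z - 2 * L z"
  using regular_cosparse
proof eventually_elim
  case (elim z)
  have D: "((\<lambda>w. (f w - x) ^ k) has_field_derivative (f z - x) ^ k * (of_nat k * (deriv f z / (f z - x)))) (at z)"
    if "f z \<noteq> x" for x k
  proof -
    have "((\<lambda>w. f w - x) has_field_derivative deriv f z) (at z)"
      using DERIV_diff[OF has_deriv DERIV_const[of x], of z] elim by simp
    from DERIV_power[OF this, of k]
    have "((\<lambda>w. (f w - x) ^ k) has_field_derivative of_nat k * (deriv f z * (f z - x) ^ (k - Suc 0))) (at z)" .
    moreover have "of_nat k * (deriv f z * (f z - x) ^ (k - Suc 0)) = (f z - x) ^ k * (of_nat k * (deriv f z / (f z - x)))"
      using that by (cases k) auto
    ultimately show ?thesis by simp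
  qed
  have D1: "((\<lambda>w. (f w - a) ^ n * (f w - b) ^ m) has_field_derivative
      (f z - a) ^ n * (of_nat n * (deriv f z / (f z - a))) * (f z - b) ^ m +
      (f z - b) ^ m * (of_nat m * (deriv f z / (f z - b))) * (f z - a) ^ n) (at z)"
    by (rule DERIV_mult; rule D) (use elim in auto)
  have D2: "(deriv f has_field_derivative deriv (deriv f) z) (at z)"
    using analytic_deriv[OF analytic] elim
    by (meson DERIV_deriv_iff_field_differentiable analytic_on_imp_differentiable_at insertI1)
  have "\<forall>\<^sub>F w in nhds z. f2 w \<noteq> 0" using elim by (intro den_ne_nhds) auto
  then have "\<forall>\<^sub>F w in nhds z. deriv cmp w = (f w - a) ^ n * (f w - b) ^ m * deriv f w"
    by eventually_elim (rule deriv_cmp)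
  from log_deriv_mult[OF D1 D2 _ _ this] elim
  have "deriv (deriv cmp) z / deriv cmp z =
      ((f z - a) ^ n * (of_nat n * (deriv f z / (f z - a))) * (f z - b) ^ m +
      (f z - b) ^ m * (of_nat m * (deriv f z / (f z - b))) * (f z - a) ^ n) / ((f z - a) ^ n * (f z - b) ^ m)
      + deriv (deriv f) z / deriv f z" by simp
  also have "((f z - a) ^ n * (of_nat n * (deriv f z / (f z - a))) * (f z - b) ^ m +
      (f z - b) ^ m * (of_nat m * (deriv f z / (f z - b))) * (f z - a) ^ n) / ((f z - a) ^ n * (f z - b) ^ m) =
      of_nat n * (deriv f z / (f z - a)) + of_nat m * (deriv f z / (f z - b))"
  proof -
    have "(x * s * y + y * t * x) / (x * y) = s + t" if "x \<noteq> 0" "y \<noteq> 0" for x y s t :: complex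
      using that by (simp add: field_simps)
    from this[of "(f z - a) ^ n" "(f z - b) ^ m"] show ?thesis using elim by (simp only: power_eq_0_iff right_minus_eq simp_thms)
  qed
  finally show ?case by (simp add: H_def)
qed

lemma small_L:
  assumes "growth \<Lambda>" "dominated \<Lambda> f1 f2" shows "small \<Lambda> L"
proof (rule small_cong)
  show "small \<Lambda> (\<lambda>z. \<Sum>x | poly p x = 0. deriv f z / (f z - x))"
    by (intro small_sum small_value assms)
  show "\<forall>\<^sub>\<approx>z. (\<Sum>x | poly p x = 0. deriv f z / (f z - x)) = L z" using L_eq by eventually_elim simp
qed

lemma small_H:
  assumes "growth \<Lambda>" "dominated \<Lambda> f1 f2" shows "small \<Lambda> H"
proof (rule small_cong)
  show "small \<Lambda> (\<lambda>z. of_nat n * (deriv f z / (f z - a)) + of_nat m * (deriv f z / (f z - b))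
    + deriv (deriv f) z / deriv f z - 2 * L z)"
    by (intro small_add small_diff small_cmult small_value small_second small_L assms)
  show "\<forall>\<^sub>\<approx>z. of_nat n * (deriv f z / (f z - a)) + of_nat m * (deriv f z / (f z - b))
    + deriv (deriv f) z / deriv f z - 2 * L z = H z" using H_eq by eventually_elim simp
qed

text \<open>
  The second main theorem for \<open>a\<close>, \<open>b\<close> and the \<open>N = n + m + 1\<close> zeros of \<open>p\<close> bounds
  \<open>h ^ (N + 1) * |f'|\<close>, where \<open>h\<close> is the maximum of \<open>|f1|\<close> and \<open>|f2|\<close>, by a small function
  times \<open>|f2| ^ (N + 1) * |(f - a) * (f - b) * p f|\<close>. Squaring, dividing by the denominator of
  \<open>W\<close> and using \<open>|f2| ^ N * |p f| \<le> C * h ^ N\<close> and \<open>|f2| \<le> h\<close> leaves the power \<open>N - 5\<close> of \<open>h\<close>.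
\<close>

lemma W_bound:
  assumes g: "growth \<Lambda>" and dom: "dominated \<Lambda> f1 f2"
  shows "\<exists>\<psi>. small \<Lambda> \<psi> \<and> (\<forall>\<^sub>\<approx>z. norm (W z) * hmax f1 f2 z ^ (n + m - 4) \<le> norm (\<psi> z))"
proof -
  define R where "R = {x. poly p x = 0}"
  define A where "A = insert a (insert b R)"
  have fR: "finite R" "a \<notin> R" "b \<notin> R" "card R = n + m + 1"
    using finite_zeros pa pb card_zeros by (auto simp: R_def)
  have A: "finite A" "A \<noteq> {}" "card A - 1 = n + m + 2" using fR ab by (auto simp: A_def)
  obtain \<psi> where \<psi>: "small \<Lambda> \<psi>" "\<forall>\<^sub>\<approx>z. hmax f1 f2 z ^ (n + m + 2) * norm (deriv f z)
      \<le> norm (\<psi> z) * (norm (f2 z) ^ (n + m + 2) * (\<Prod>y\<in>A. norm (f z - y)))"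
    using second_main[OF g dom A(1,2)] unfolding A(3) by blast
  obtain C where C: "0 < C" "\<And>z. f2 z \<noteq> 0 \<Longrightarrow>
      norm (f2 z) ^ (n + m + 1) * norm (cmp z) \<le> C * hmax f1 f2 z ^ (n + m + 1)"
    using poly_le_hmax[of p] unfolding degree_p cmp_def by blast
  define l where "l = norm (lead_coeff p)"
  have l: "0 < l" using p_nz by (simp add: l_def)
  have "\<forall>\<^sub>\<approx>z. norm (W z) * hmax f1 f2 z ^ (n + m - 4) \<le> norm (of_real (C / l ^ 2) * \<psi> z ^ 2)"
    using \<psi>(2) regular_cosparse
  proof eventually_elim
    case (elim z)
    define h where "h = hmax f1 f2 z"
    define d where "d = norm (f2 z)"
    define t where "t = norm (cmp z)"
    define s where "s = norm (deriv f z)"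
    define u where "u = norm (f z - a) * norm (f z - b)"
    define q where "q = norm (\<psi> z)"
    have h: "0 < h" "d \<le> h" "0 < d" "0 < t" "0 < u" "0 \<le> s" "0 \<le> q"
      using hmax_pos[of z] elim by (auto simp: h_def d_def t_def u_def s_def q_def hmax_def)
    have "t = l * (\<Prod>y\<in>R. norm (f z - y))"
      unfolding t_def cmp_eq_prod R_def l_def norm_mult by (simp add: prod_norm)
    then have pr: "(\<Prod>y\<in>A. norm (f z - y)) = u * (t / l)"
      using fR ab l by (simp add: A_def u_def)
    have e1: "h ^ (n + m + 2) * s \<le> q * (d ^ (n + m + 2) * (u * (t / l)))"
      using elim(1) unfolding pr h_def s_def q_def d_def .
    have e2: "d ^ (n + m + 1) * t \<le> C * h ^ (n + m + 1)" using C(2) elim by (simp add: h_def d_def t_def)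
    have ex: "n + m + 2 = (n + m - 4) + 6" "n + m + 1 = (n + m - 4) + 5" using nm by auto
    define k where "k = n + m - 4"
    have nW: "norm (W z) = s ^ 2 / (u ^ 2 * t * d ^ k)"
      by (simp add: W_def s_def u_def t_def d_def k_def norm_divide norm_mult norm_power)
    have "(h ^ (k + 6) * s) ^ 2 \<le> (q * (d ^ (k + 6) * (u * (t / l)))) ^ 2"
      using e1 h unfolding ex k_def[symmetric] by (intro power_mono) auto
    then have "(h ^ (k + 6) * s) ^ 2 / (u ^ 2 * t * d ^ k) \<le> (q * (d ^ (k + 6) * (u * (t / l)))) ^ 2 / (u ^ 2 * t * d ^ k)"
      using h by (intro divide_right_mono) auto
    also have "\<dots> = q ^ 2 / l ^ 2 * (d ^ 7 * (d ^ (k + 5) * t))"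
    proof -
      have "(q * (D * d ^ 6 * (u * (t / l)))) ^ 2 / (u ^ 2 * t * D) = q ^ 2 / l ^ 2 * (d ^ 7 * (D * d ^ 5 * t))"
        if "0 < D" for D using that h l by (simp add: power2_eq_square eval_nat_numeral)
      from this[of "d ^ k"] show ?thesis using h by (simp add: power_add)
    qed
    also have "\<dots> \<le> q ^ 2 / l ^ 2 * (h ^ 7 * (C * h ^ (k + 5)))"
      using h e2 C(1) unfolding ex k_def[symmetric]
      by (intro mult_left_mono mult_mono[OF power_mono e2[unfolded ex k_def[symmetric]]]) auto
    finally have "(h ^ (k + 6) * s) ^ 2 / (u ^ 2 * t * d ^ k) \<le> q ^ 2 / l ^ 2 * (h ^ 7 * (C * h ^ (k + 5)))" .
    moreover have "(h ^ (k + 6) * s) ^ 2 / (u ^ 2 * t * d ^ k) = h ^ (k + 12) * (norm (W z) * h ^ k)"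
      unfolding nW by (simp add: power_add power2_eq_square eval_nat_numeral)
    moreover have "q ^ 2 / l ^ 2 * (h ^ 7 * (C * h ^ (k + 5))) = h ^ (k + 12) * (C / l ^ 2 * q ^ 2)"
      by (simp add: power_add eval_nat_numeral mult_ac)
    ultimately have "h ^ (k + 12) * (norm (W z) * h ^ k) \<le> h ^ (k + 12) * (C / l ^ 2 * q ^ 2)" by (simp only:)
    then have "norm (W z) * h ^ k \<le> C / l ^ 2 * q ^ 2"
      by (rule mult_left_le_imp_le) (use h in simp)
    moreover have "norm (of_real (C / l ^ 2) * \<psi> z ^ 2) = C / l ^ 2 * q ^ 2"
      using C(1) l by (simp add: norm_mult norm_power q_def norm_divide)
    ultimately show ?case by (simp only: h_def k_def)
  qed
  moreover have "small \<Lambda> (\<lambda>z. of_real (C / l ^ 2) * \<psi> z ^ 2)"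
    by (intro small_cmult small_power g \<psi>(1))
  ultimately show ?thesis by blast
qed

end

context comp_quotient
begin

lemma cmp_order_pole:
  assumes "\<And>x. has_ord (\<lambda>w. f w - x) z (- int k)"
  shows "has_ord cmp z (- (int (n + m + 1) * int k))"
  using poly_comp_pole[OF p_nz assms] unfolding cmp_fun degree_p .

lemma deriv_cmp_order:
  assumes z: "f2 z \<noteq> 0" and j: "has_ord (\<lambda>w. f w - f z) z (int j)" "0 < j"
  shows "has_ord (deriv cmp) z (int (if f z = a then n + 1 else if f z = b then m + 1 else 1) * int j - 1)"
proof -
  define v where "v = poly p (f z)"
  have "has_ord (\<lambda>w. poly (p - [:v:]) (f w)) z (int (order (f z) (p - [:v:])) * int j)"
    by (rule poly_comp_zero[OF shift(2) z j(1)])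
  then have "has_ord (\<lambda>w. cmp w - v) z (int (if f z = a then n + 1 else if f z = b then m + 1 else 1) * int j)"
    unfolding order_shift[OF v_def[symmetric]] by (simp add: cmp_fun)
  from has_ord_deriv[OF this] show ?thesis unfolding deriv_minus_const using j(2) by simp
qed

lemma deriv_cmp_analytic: "f2 z \<noteq> 0 \<Longrightarrow> deriv cmp analytic_on {z}"
  by (intro analytic_deriv cmp_analytic)

lemma order_of_cmp_nonzero: "f2 z \<noteq> 0 \<Longrightarrow> cmp z \<noteq> 0 \<Longrightarrow> has_ord cmp z 0"
  by (intro has_ord_analytic cmp_analytic)

lemma order_of_den: "f2 z \<noteq> 0 \<Longrightarrow> has_ord (\<lambda>w. f2 w ^ k) z 0"
  using has_ord_power[OF has_ord_analytic[OF analytic1(2)], of z k] by simp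

lemma ord_ge_H:
  assumes "has_ord (deriv cmp) z j" "ord_ge L z (-1)"
  shows "ord_ge H z (-1)"
  unfolding H_def[abs_def] by (intro ord_ge_diff ord_ge_cmult ord_ge_log_deriv[OF assms(1)] assms(2))

text \<open>
  At a pole of order \<open>k\<close> the order of \<open>W\<close> is \<open>7 * k - 2\<close>.
\<close>

lemma orders_at_pole:
  assumes z: "f2 z = 0"
  shows "ord_ge H z (-1)" "ord_ge L z (-1)" "ord_ge W z 5"
proof -
  obtain k where k: "k > 0" "has_ord f2 z (int k)" "\<And>x. has_ord (\<lambda>w. f w - x) z (- int k)"
    using pole_order[OF z] by blast
  note c = cmp_order_pole[OF k(3)]
  show L: "ord_ge L z (-1)" unfolding L_def[abs_def] by (rule ord_ge_log_deriv[OF c])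
  have "has_ord (deriv cmp) z (- (int (n + m + 1) * int k) - 1)" by (rule has_ord_deriv[OF c]) (use k(1) in simp)
  then show "ord_ge H z (-1)" using L by (rule ord_ge_H)
  have d: "has_ord (deriv f) z (- int k - 1)" using deriv_order[OF k(3)] k(1) by simp
  have o: "has_ord W z (int 2 * (- int k - 1) - (int 2 * (- int k + - int k) + - (int (n + m + 1) * int k) + int (n + m - 4) * int k))"
    unfolding W_def[abs_def] by (intro has_ord_divide has_ord_mult has_ord_power d k c)
  have nm': "int (n + m - 4) = int (n + m) - 4" using nm by simp
  have "int 2 * (- int k - 1) - (int 2 * (- int k + - int k) + - (int (n + m + 1) * int k) + int (n + m - 4) * int k) = 7 * int k - 2"
    unfolding nm' by (simp add: algebra_simps)
  then show "ord_ge W z 5" using has_ord_imp_ord_ge[OF o] k(1) by (auto intro: ord_ge_mono)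
qed

lemma orders_at_ordinary:
  assumes z: "f2 z \<noteq> 0" "f z \<noteq> a" "f z \<noteq> b" "cmp z \<noteq> 0"
  shows "ord_ge L z 0"
    "ord_ge H z 0 \<and> ord_ge W z 0 \<or> ord_ge H z (-1) \<and> ord_ge W z 2"
proof -
  obtain j where j: "j > 0" "has_ord (\<lambda>w. f w - f z) z (int j)" using value_order[OF z(1) refl] by blast
  note c = order_of_cmp_nonzero[OF z(1,4)]
  have d: "has_ord (deriv f) z (int j - 1)" using deriv_order[OF j(2)] j(1) by simp
  have dc: "has_ord (deriv cmp) z (int j - 1)" using deriv_cmp_order[OF z(1) j(2,1)] z by simp
  have "ord_ge L z (0 - 0)" unfolding L_def[abs_def]
    by (intro ord_ge_divide ord_ge_analytic deriv_cmp_analytic c z)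
  then show L: "ord_ge L z 0" by simp
  have o: "has_ord W z (int 2 * (int j - 1) - (int 2 * (0 + 0) + 0 + 0))"
    unfolding W_def[abs_def]
    by (intro has_ord_divide has_ord_mult has_ord_power d c order_of_den regular_order z)
  show "ord_ge H z 0 \<and> ord_ge W z 0 \<or> ord_ge H z (-1) \<and> ord_ge W z 2"
  proof (cases "j = 1")
    case True
    have dc0: "has_ord (deriv cmp) z 0" using dc True by simp
    have "ord_ge (\<lambda>w. deriv (deriv cmp) w / deriv cmp w) z (0 - 0)"
      by (intro ord_ge_divide ord_ge_deriv_analytic deriv_cmp_analytic dc0 z)
    then have "ord_ge (\<lambda>w. deriv (deriv cmp) w / deriv cmp w) z 0" by simp
    then have "ord_ge H z 0" unfolding H_def[abs_def] by (intro ord_ge_diff ord_ge_cmult L)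
    moreover have "ord_ge W z 0" using has_ord_imp_ord_ge[OF o] True by simp
    ultimately show ?thesis by blast
  next
    case False
    have "ord_ge H z (-1)" by (rule ord_ge_H[OF dc ord_ge_mono[OF L]]) simp
    moreover have "ord_ge W z 2" by (rule ord_ge_mono[OF has_ord_imp_ord_ge[OF o]]) (use False j(1) in simp)
    ultimately show ?thesis by blast
  qed
qed

text \<open>
  There \<open>p \<circ> f\<close> takes its value with multiplicity at least \<open>3\<close>, since \<open>n\<close> and \<open>m\<close> are at least
  \<open>2\<close>; so the derivative of \<open>p \<circ> f\<close> vanishes at least doubly.
\<close>

lemma orders_at_crit:
  assumes z: "f2 z \<noteq> 0" "f z = a \<or> f z = b"
  shows "ord_ge H z (-1)" "ord_ge L z 2" "ord_ge W z (-2)"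
proof -
  obtain j where j: "j > 0" "has_ord (\<lambda>w. f w - f z) z (int j)" using value_order[OF z(1) refl] by blast
  have "cmp z \<noteq> 0" using z(2) pa pb by (auto simp: cmp_def)
  note c = order_of_cmp_nonzero[OF z(1) this]
  have d: "has_ord (deriv f) z (int j - 1)" using deriv_order[OF j(2)] j(1) by simp
  define e where "e = (if f z = a then n + 1 else if f z = b then m + 1 else 1)"
  have e3: "3 \<le> e" using z(2) n2 m2 by (auto simp: e_def)
  have dc: "has_ord (deriv cmp) z (int e * int j - 1)" using deriv_cmp_order[OF z(1) j(2,1)] unfolding e_def .
  have "3 * 1 \<le> int e * int j" using e3 j(1) by (intro mult_mono) auto
  moreover have "ord_ge L z (int e * int j - 1 - 0)" unfolding L_def[abs_def]
    by (intro ord_ge_divide has_ord_imp_ord_ge[OF dc] c)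
  ultimately show L: "ord_ge L z 2" by (auto intro: ord_ge_mono)
  show "ord_ge H z (-1)" by (rule ord_ge_H[OF dc ord_ge_mono[OF L]]) simp
  have "has_ord (\<lambda>w. (f w - a) * (f w - b)) z (int j)"
  proof (cases "f z = a")
    case True
    have "has_ord (\<lambda>w. f w - a) z (int j)" "has_ord (\<lambda>w. f w - b) z 0"
      using j(2) True ab regular_order[OF z(1), of b] by auto
    from has_ord_mult[OF this] show ?thesis by simp
  next
    case False
    then have "has_ord (\<lambda>w. f w - a) z 0" "has_ord (\<lambda>w. f w - b) z (int j)"
      using j(2) z regular_order[OF z(1), of a] by auto
    from has_ord_mult[OF this] show ?thesis by simp
  qed
  then have o: "has_ord W z (int 2 * (int j - 1) - (int 2 * int j + 0 + 0))"
    unfolding W_def[abs_def]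
    by (intro has_ord_divide has_ord_mult[of "\<lambda>w. ((f w - a) * (f w - b)) ^ 2 * cmp w"]
          has_ord_mult[of "\<lambda>w. ((f w - a) * (f w - b)) ^ 2"] has_ord_power d c order_of_den z)
  show "ord_ge W z (-2)" by (rule ord_ge_mono[OF has_ord_imp_ord_ge[OF o]]) simp
qed

text \<open>
  The principal parts depend on the multiplicity \<open>j\<close> only, so they cancel in differences. If
  \<open>j = 1\<close> and \<open>cmp w = (w - z) * u w\<close>, then \<open>H\<close> equals \<open>-2 / (w - z)\<close> plus the function
  \<open>v' / v - 2 * u' / u\<close>, where \<open>v = u + (w - z) * u'\<close> is the derivative of \<open>cmp\<close>; this
  function vanishes at \<open>z\<close> because \<open>v = u\<close> and \<open>v' = 2 * u'\<close> there.
\<close>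

lemma orders_at_zero:
  assumes z: "f2 z \<noteq> 0" "cmp z = 0" and j: "has_ord (\<lambda>w. f w - f z) z (int j)" "0 < j"
  shows "\<exists>h. h analytic_on {z} \<and> (\<forall>\<^sub>F w in at z. L w = of_nat j / (w - z) + h w)"
    "\<exists>h. h analytic_on {z} \<and> (j = 1 \<longrightarrow> h z = 0) \<and>
        (\<forall>\<^sub>F w in at z. H w = - of_nat (j + 1) / (w - z) + h w)"
    "ord_ge W z (int j - 2)"
proof -
  have fab: "f z \<noteq> a" "f z \<noteq> b" using z(2) pa pb by (auto simp: cmp_def)
  have "order (f z) p = 1" using order_shift[of "f z" 0] z(2) fab by (simp add: cmp_def)
  then have c: "has_ord cmp z (int j)" using poly_comp_zero[OF p_nz z(1) j(1)] by (simp add: cmp_fun)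
  have dc: "has_ord (deriv cmp) z (int j - 1)" using has_ord_deriv[OF c] j(2) by simp
  obtain h1 where h1: "h1 analytic_on {z}" "\<forall>\<^sub>F w in at z. L w = of_nat j / (w - z) + h1 w"
    using has_ord_log_deriv[OF c] unfolding L_def by auto
  then show "\<exists>h. h analytic_on {z} \<and> (\<forall>\<^sub>F w in at z. L w = of_nat j / (w - z) + h w)" by blast
  show "\<exists>h. h analytic_on {z} \<and> (j = 1 \<longrightarrow> h z = 0) \<and>
        (\<forall>\<^sub>F w in at z. H w = - of_nat (j + 1) / (w - z) + h w)"
  proof (cases "j = 1")
    case False
    obtain h2 where h2: "h2 analytic_on {z}"
      "\<forall>\<^sub>F w in at z. deriv (deriv cmp) w / deriv cmp w = of_int (int j - 1) / (w - z) + h2 w"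
      using has_ord_log_deriv[OF dc] by blast
    have "\<forall>\<^sub>F w in at z. H w = - of_nat (j + 1) / (w - z) + (h2 w - 2 * h1 w)"
      using h1(2) h2(2) eventually_ne
    proof eventually_elim
      case (elim w)
      have "(x - 1) / y + s - 2 * (x / y + t) = - (x + 1) / y + (s - 2 * t)" if "y \<noteq> 0" for x y s t :: complex
        using that by (simp add: field_simps)
      from this[of "w - z" "of_nat j" "h2 w" "h1 w"] show ?case
        unfolding H_def elim(1,2) using elim(3) by simp
    qed
    moreover have "(\<lambda>w. h2 w - 2 * h1 w) analytic_on {z}" by (intro analytic_intros h1 h2)
    ultimately show ?thesis using False by (intro exI[of _ "\<lambda>w. h2 w - 2 * h1 w"]) simp
  next
    case True
    obtain u where u: "u analytic_on {z}" "u z \<noteq> 0" "\<forall>\<^sub>F w in at z. cmp w = (w - z) powi (int j) * u w"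
      using c unfolding has_ord_def by blast
    define v where "v = (\<lambda>w. u w + (w - z) * deriv u w)"
    have dv: "\<forall>\<^sub>F w in at z. deriv cmp w = v w"
      using deriv_factored[OF u(1,3)] True by (simp add: v_def)
    have va: "v analytic_on {z}" unfolding v_def by (intro analytic_intros analytic_deriv u)
    have vz: "v z = u z" by (simp add: v_def)
    have "(u has_field_derivative deriv u z) (at z)" "(deriv u has_field_derivative deriv (deriv u) z) (at z)"
      using u(1) analytic_deriv[OF u(1)]
      by (meson DERIV_deriv_iff_field_differentiable analytic_on_imp_differentiable_at insertI1)+
    moreover have "((\<lambda>w. w - z) has_field_derivative 1) (at z)"
      using DERIV_diff[OF DERIV_ident DERIV_const[of z]] by simp
    ultimately have "(v has_field_derivative deriv u z + (1 * deriv u z + deriv (deriv u) z * (z - z))) (at z)"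
      unfolding v_def by (intro DERIV_add DERIV_mult)
    then have dvz: "deriv v z = 2 * deriv u z" by (simp add: DERIV_imp_deriv)
    define h where "h = (\<lambda>w. deriv v w / v w - 2 * (deriv u w / u w))"
    have ne: "\<forall>\<^sub>F w in at z. u w \<noteq> 0" using has_ord_nonzero[OF has_ord_analytic[OF u(1,2)]] .
    have "\<forall>\<^sub>F w in at z. H w = - of_nat (j + 1) / (w - z) + h w"
      using eventually_at_nhds[OF dv] eventually_at_nhds[OF u(3)] dv eventually_ne ne
        analytic_eventually_differentiable[OF u(1)]
    proof eventually_elim
      case (elim w)
      have "deriv (deriv cmp) w = deriv v w" by (rule deriv_cong_ev[OF elim(1) refl])
      moreover have "L w = 1 / (w - z) + deriv u w / u w" unfolding L_def
      proof (rule log_deriv_mult[where E = cmp and F = "\<lambda>w. w - z" and G = u])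
        show "((\<lambda>w. w - z) has_field_derivative 1) (at w)"
          using DERIV_diff[OF DERIV_ident DERIV_const[of z]] by simp
        show "\<forall>\<^sub>F x in nhds w. cmp x = (x - z) * u x" using elim(2) True by simp
      qed (use elim in auto)
      ultimately show ?case unfolding H_def h_def using elim(3) True by (simp add: algebra_simps)
    qed
    moreover have "h analytic_on {z}"
      unfolding h_def using va u vz by (intro analytic_intros analytic_deriv) auto
    moreover have "h z = 0" using dvz vz by (simp add: h_def)
    ultimately show ?thesis by blast
  qed
  have d: "has_ord (deriv f) z (int j - 1)" using deriv_order[OF j(1)] j(2) by simp
  have o: "has_ord W z (int 2 * (int j - 1) - (int 2 * (0 + 0) + int j + 0))"
    unfolding W_def[abs_def]
    by (intro has_ord_divide has_ord_mult has_ord_power d c order_of_den regular_order z fab)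
  show "ord_ge W z (int j - 2)" by (rule ord_ge_mono[OF has_ord_imp_ord_ge[OF o]]) simp
qed

text \<open>
  The three triples belong to points where \<open>f' \<noteq> 0\<close>, zeros of \<open>f'\<close>, and poles.
\<close>

lemma orders_elsewhere:
  assumes "\<not> (f2 z \<noteq> 0 \<and> (f z = a \<or> f z = b))" "\<not> (f2 z \<noteq> 0 \<and> poly p (f z) = 0)"
  shows "\<exists>(h, l, w) \<in> {(0, 0, 0), (-1, 0, 2), (-1, -1, 5)}. ord_ge H z h \<and> ord_ge L z l \<and> ord_ge W z w"
  using orders_at_pole[of z] orders_at_ordinary[of z] assms by (auto simp: cmp_def)

lemma order_bounds: "\<exists>k. ord_ge L z k" "\<exists>k. ord_ge H z k"
proof -
  have "\<exists>j. has_ord cmp z j" unfolding cmp_fun by (rule poly_comp_order_exists[OF p_nz])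
  then obtain j where "has_ord cmp z j" by blast
  from ord_ge_log_deriv[OF this] have L: "ord_ge L z (-1)" unfolding L_def[abs_def] .
  then show "\<exists>k. ord_ge L z k" by blast
  have "\<exists>i. has_ord (deriv cmp) z i"
  proof (cases "f2 z = 0")
    case True
    obtain k where k: "k > 0" "\<And>x. has_ord (\<lambda>w. f w - x) z (- int k)" using pole_order[OF True] by blast
    have "has_ord (deriv cmp) z (- (int (n + m + 1) * int k) - 1)"
      by (rule has_ord_deriv[OF cmp_order_pole[OF k(2)]]) (use k(1) in simp)
    then show ?thesis by blast
  next
    case False
    obtain j where "j > 0" "has_ord (\<lambda>w. f w - f z) z (int j)" using value_order[OF False refl] by blast
    from deriv_cmp_order[OF False this(2,1)] show ?thesis by blast
  qed
  then obtain i where "has_ord (deriv cmp) z i" by blast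
  from ord_ge_H[OF this L] show "\<exists>k. ord_ge H z k" by blast
qed

end

section \<open>Sharing the two sets\<close>

locale shared_sets = F: comp_quotient p a b n m f f1 f2 + G: comp_quotient p a b n m g g1 g2
  for p a b n m f f1 f2 g g1 g2 +
  assumes crit: "f2 z \<noteq> 0 \<and> (f z = a \<or> f z = b) \<longleftrightarrow> g2 z \<noteq> 0 \<and> (g z = a \<or> g z = b)"
    and zero: "f2 z \<noteq> 0 \<and> poly p (f z) = 0 \<longleftrightarrow> g2 z \<noteq> 0 \<and> poly p (g z) = 0"
    and mult: "f2 z \<noteq> 0 \<Longrightarrow> poly p (f z) = 0 \<Longrightarrow> has_ord (\<lambda>w. f w - f z) z k \<Longrightarrow> has_ord (\<lambda>w. g w - g z) z k"
begin

text \<open>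
  The exponents balance the possible poles. Where \<open>f\<close> and \<open>g\<close> take values in \<open>{a, b}\<close> the
  factors contribute at least \<open>-2\<close>, \<open>6\<close>, \<open>-2\<close>, \<open>-2\<close>; at a common simple zero of \<open>p \<circ> f\<close> and
  \<open>p \<circ> g\<close> they contribute at least \<open>2\<close>, \<open>0\<close>, \<open>-1\<close>, \<open>-1\<close>; at a pole of \<open>f\<close> at least \<open>-2\<close>, \<open>-3\<close>,
  \<open>5\<close>, \<open>0\<close>.
\<close>

definition Om :: "complex \<Rightarrow> complex" where
  "Om z = (F.H z - G.H z) ^ 2 * (F.L z - G.L z) ^ 3 * (F.W z * G.W z)"

lemma Om_order_combine:
  assumes "ord_ge (\<lambda>w. F.H w - G.H w) z h" "ord_ge (\<lambda>w. F.L w - G.L w) z l" "ord_ge F.W z v" "ord_ge G.W z w"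
    and "0 \<le> 2 * h + 3 * l + v + w"
  shows "ord_ge Om z 0"
proof (rule ord_ge_mono)
  show "ord_ge Om z (int 2 * h + int 3 * l + (v + w))"
    unfolding Om_def[abs_def] by (intro ord_ge_mult ord_ge_power assms)
qed (use assms in simp)

lemma Om_order: "ord_ge Om z 0"
proof (cases "f2 z \<noteq> 0 \<and> (f z = a \<or> f z = b)")
  case True
  note f = F.orders_at_crit[of z] and g = G.orders_at_crit[of z]
  show ?thesis
    by (rule Om_order_combine[of z "-1" 2 "-2" "-2"]) (use f g True crit in \<open>auto intro: ord_ge_diff\<close>)
next
  case nc: False
  show ?thesis
  proof (cases "f2 z \<noteq> 0 \<and> poly p (f z) = 0")
    case True
    then have fz: "f2 z \<noteq> 0" "F.cmp z = 0" and gz: "g2 z \<noteq> 0" "G.cmp z = 0"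
      using zero by (auto simp: F.cmp_def G.cmp_def)
    obtain j where j: "j > 0" "has_ord (\<lambda>w. f w - f z) z (int j)" using F.value_order[OF fz(1) refl] by blast
    have j': "has_ord (\<lambda>w. g w - g z) z (int j)" using mult j(2) True by blast
    note f = F.orders_at_zero[OF fz j(2,1)] and g = G.orders_at_zero[OF gz j' j(1)]
    have cancel: "ord_ge (\<lambda>w. X w - Y w) z (if h z = k z then 1 else 0)"
      if X: "h analytic_on {z}" "\<forall>\<^sub>F w in at z. X w = c / (w - z) + h w"
        and Y: "k analytic_on {z}" "\<forall>\<^sub>F w in at z. Y w = c / (w - z) + k w" for X Y c h k
    proof (rule ord_ge_cong)
      have a: "(\<lambda>w. h w - k w) analytic_on {z}" by (intro analytic_intros X Y)
      show "ord_ge (\<lambda>w. h w - k w) z (if h z = k z then 1 else 0)"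
        using ord_ge_zero_analytic[OF a] ord_ge_analytic[OF a] by simp
      show "\<forall>\<^sub>F w in at z. h w - k w = X w - Y w"
        using X(2) Y(2) by eventually_elim simp
    qed
    have E: "ord_ge (\<lambda>w. F.L w - G.L w) z 0"
    proof -
      obtain h k where h: "h analytic_on {z}" "\<forall>\<^sub>F w in at z. F.L w = of_nat j / (w - z) + h w"
        and k: "k analytic_on {z}" "\<forall>\<^sub>F w in at z. G.L w = of_nat j / (w - z) + k w"
        using f(1) g(1) by blast
      from cancel[OF h k] show ?thesis by (rule ord_ge_mono) simp
    qed
    have D: "ord_ge (\<lambda>w. F.H w - G.H w) z (if j = 1 then 1 else 0)"
    proof -
      obtain h k where h: "h analytic_on {z}" "\<forall>\<^sub>F w in at z. F.H w = - of_nat (j + 1) / (w - z) + h w" "j = 1 \<longrightarrow> h z = 0"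
        and k: "k analytic_on {z}" "\<forall>\<^sub>F w in at z. G.H w = - of_nat (j + 1) / (w - z) + k w" "j = 1 \<longrightarrow> k z = 0"
        using f(2) g(2) by blast
      from cancel[OF h(1,2) k(1,2)] show ?thesis by (rule ord_ge_mono) (use h k in auto)
    qed
    show ?thesis by (rule Om_order_combine[OF D E f(3) g(3)]) (use j(1) in auto)
  next
    case nz: False
    obtain h l v where f: "(h, l, v) \<in> {(0, 0, 0), (-1, 0, 2), (-1, -1, 5)}" "ord_ge F.H z h" "ord_ge F.L z l" "ord_ge F.W z v"
      using F.orders_elsewhere[OF nc nz] by blast
    obtain h' l' v' where g: "(h', l', v') \<in> {(0, 0, 0), (-1, 0, 2), (-1, -1, 5)}" "ord_ge G.H z h'" "ord_ge G.L z l'" "ord_ge G.W z v'"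
      using G.orders_elsewhere[of z] nc nz crit zero by blast
    show ?thesis
    proof (rule Om_order_combine[OF ord_ge_diff ord_ge_diff f(4) g(4)])
      show "ord_ge F.H z (min h h')" "ord_ge G.H z (min h h')" "ord_ge F.L z (min l l')" "ord_ge G.L z (min l l')"
        using f g by (auto intro: ord_ge_mono)
      show "0 \<le> 2 * min h h' + 3 * min l l' + v + v'" using f(1) g(1) by auto
    qed
  qed
qed

lemma auxiliary_alternative: "(\<forall>\<^sub>\<approx>z. F.L z = G.L z) \<or> (\<forall>\<^sub>\<approx>z. F.H z = G.H z)"
proof (rule ccontr)
  assume neg: "\<not> ?thesis"
  have Fq: "quotient f f1 f2" and Gq: "quotient g g1 g2" by unfold_locales
  have diff: "(\<forall>\<^sub>\<approx>z. X z = Y z) \<or> (\<forall>\<^sub>\<approx>z. X z \<noteq> Y z)" if o: "\<And>z. \<exists>k. ord_ge X z k" "\<And>z. \<exists>k. ord_ge Y z k" for X Y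
  proof -
    have "\<exists>k. ord_ge (\<lambda>w. X w - Y w) z k" for z
    proof -
      obtain j k where "ord_ge X z j" "ord_ge Y z k" using o by blast
      then have "ord_ge X z (min j k)" "ord_ge Y z (min j k)" by (auto intro: ord_ge_mono)
      then show ?thesis using ord_ge_diff by blast
    qed
    from zero_or_ne_cosparse[OF this] show ?thesis by simp
  qed
  have D: "\<forall>\<^sub>\<approx>z. F.H z \<noteq> G.H z" using diff[OF F.order_bounds(2) G.order_bounds(2)] neg by blast
  have E: "\<forall>\<^sub>\<approx>z. F.L z \<noteq> G.L z" using diff[OF F.order_bounds(1) G.order_bounds(1)] neg by blast
  define \<Lambda> where "\<Lambda> = char_fun (\<lambda>z. hmax f1 f2 z * hmax g1 g2 z)"
  have gr: "growth \<Lambda>" and domf: "dominated \<Lambda> f1 f2" and domg: "dominated \<Lambda> g1 g2"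
    unfolding \<Lambda>_def using dominated_pair[OF Fq Gq] dominated_pair2[OF Fq Gq] by auto
  obtain \<psi>f where \<psi>f: "small \<Lambda> \<psi>f" "\<forall>\<^sub>\<approx>z. norm (F.W z) * hmax f1 f2 z ^ (n + m - 4) \<le> norm (\<psi>f z)"
    using F.W_bound[OF gr domf] by blast
  obtain \<psi>g where \<psi>g: "small \<Lambda> \<psi>g" "\<forall>\<^sub>\<approx>z. norm (G.W z) * hmax g1 g2 z ^ (n + m - 4) \<le> norm (\<psi>g z)"
    using G.W_bound[OF gr domg] by blast
  define \<omega> where "\<omega> = (\<lambda>z. (F.H z - G.H z) ^ 2 * (F.L z - G.L z) ^ 3)"
  show False
  proof (rule key_contradiction[OF Fq Gq, of Om "\<lambda>z. \<omega> z * (\<psi>f z * \<psi>g z)" "n + m - 4"])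
    show "ord_ge Om z 0" for z by (rule Om_order)
    have "\<forall>\<^sub>\<approx>z. Om z \<noteq> 0"
      using D E F.regular_cosparse G.regular_cosparse
      by eventually_elim (simp add: Om_def F.W_def G.W_def)
    then show "\<not> (\<forall>\<^sub>\<approx>z. Om z = 0)" using cosparse_contradiction by blast
    have "small \<Lambda> \<omega>" unfolding \<omega>_def
      by (intro small_mult small_power small_diff F.small_H F.small_L G.small_H G.small_L gr domf domg)
    then show "small (char_fun (\<lambda>z. hmax f1 f2 z * hmax g1 g2 z)) (\<lambda>z. \<omega> z * (\<psi>f z * \<psi>g z))"
      unfolding \<Lambda>_def[symmetric] by (intro small_mult gr \<psi>f(1) \<psi>g(1))
    show "1 \<le> n + m - 4" using F.nm by simp
    show "\<forall>\<^sub>\<approx>z. norm (Om z) * (hmax f1 f2 z * hmax g1 g2 z) ^ (n + m - 4) \<le> norm (\<omega> z * (\<psi>f z * \<psi>g z))"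
      using \<psi>f(2) \<psi>g(2)
    proof eventually_elim
      case (elim z)
      have "norm (Om z) * (hmax f1 f2 z * hmax g1 g2 z) ^ (n + m - 4) =
          norm (\<omega> z) * ((norm (F.W z) * hmax f1 f2 z ^ (n + m - 4)) * (norm (G.W z) * hmax g1 g2 z ^ (n + m - 4)))"
        by (simp add: Om_def \<omega>_def norm_mult norm_power power_mult_distrib mult_ac)
      also have "\<dots> \<le> norm (\<omega> z) * (norm (\<psi>f z) * norm (\<psi>g z))"
        using elim G.hmax_pos[of z] by (intro mult_left_mono mult_mono) auto
      finally show ?case by (simp add: norm_mult)
    qed
  qed
qed

end

context comp_quotient
begin

definition U :: "complex \<Rightarrow> complex" where "U z = deriv cmp z / cmp z ^ 2"

lemma inverse_cmp_DERIV:
  assumes "f2 z \<noteq> 0" "cmp z \<noteq> 0"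
  shows "((\<lambda>w. inverse (cmp w)) has_field_derivative - U z) (at z)"
proof -
  have "(cmp has_field_derivative deriv cmp z) (at z)"
    using cmp_analytic[OF assms(1)] by (meson DERIV_deriv_iff_field_differentiable analytic_on_imp_differentiable_at insertI1)
  from DERIV_inverse'[OF this assms(2)] show ?thesis
    by (simp add: U_def divide_inverse power2_eq_square mult_ac)
qed

lemma U_properties:
  assumes "f2 z \<noteq> 0 \<and> f z \<noteq> a \<and> f z \<noteq> b \<and> cmp z \<noteq> 0 \<and> deriv f z \<noteq> 0"
  shows "U analytic_on {z}" "U z \<noteq> 0" "deriv U z / U z = H z"
proof -
  have dn: "deriv cmp z \<noteq> 0" using assms by (simp add: deriv_cmp)
  show an: "U analytic_on {z}" unfolding U_def[abs_def]
    using assms by (intro analytic_intros deriv_cmp_analytic cmp_analytic) auto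
  show U0: "U z \<noteq> 0" using dn assms by (simp add: U_def)
  have D: "(cmp has_field_derivative deriv cmp z) (at z)" "(U has_field_derivative deriv U z) (at z)"
    using cmp_analytic[of z] an assms
    by (meson DERIV_deriv_iff_field_differentiable analytic_on_imp_differentiable_at insertI1)+
  have D2: "((\<lambda>w. cmp w ^ 2) has_field_derivative 2 * cmp z * deriv cmp z) (at z)"
    using DERIV_power[OF D(1), of 2] by (simp add: mult_ac)
  have "isCont cmp z" using cmp_analytic assms by (blast intro: analytic_at_imp_isCont)
  then have "\<forall>\<^sub>F w in nhds z. cmp w \<noteq> 0"
    using assms tendsto_imp_eventually_ne[of cmp "cmp z" "nhds z" 0] by (simp add: isCont_def tendsto_at_iff_tendsto_nhds)
  then have "\<forall>\<^sub>F w in nhds z. deriv cmp w = U w * cmp w ^ 2"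
    by eventually_elim (simp add: U_def)
  from log_deriv_mult[OF D(2) D2 U0 _ this] assms
  have "deriv (deriv cmp) z / deriv cmp z = deriv U z / U z + 2 * cmp z * deriv cmp z / cmp z ^ 2" by simp
  then show "deriv U z / U z = H z" using assms by (simp add: H_def L_def power2_eq_square)
qed

end

context shared_sets
begin

lemma quotients: "quotient f f1 f2" "quotient g g1 g2"
  by unfold_locales

lemma reciprocals_affinely_related:
  "\<exists>A B. A \<noteq> 0 \<and> (\<forall>\<^sub>\<approx>z. inverse (F.cmp z) = A * inverse (G.cmp z) + B)"
  using auxiliary_alternative
proof
  assume e: "\<forall>\<^sub>\<approx>z. F.L z = G.L z"
  have "\<exists>K. K \<noteq> 0 \<and> (\<forall>\<^sub>\<approx>z. F.cmp z = K * G.cmp z)"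
  proof (rule equal_log_deriv_proportional)
    show "\<forall>\<^sub>\<approx>z. F.cmp analytic_on {z} \<and> F.cmp z \<noteq> 0"
      using F.regular_cosparse by eventually_elim (simp add: F.cmp_analytic)
    show "\<forall>\<^sub>\<approx>z. G.cmp analytic_on {z} \<and> G.cmp z \<noteq> 0"
      using G.regular_cosparse by eventually_elim (simp add: G.cmp_analytic)
    show "\<forall>\<^sub>\<approx>z. deriv F.cmp z / F.cmp z = deriv G.cmp z / G.cmp z" using e unfolding F.L_def G.L_def .
  qed
  then obtain K where K: "K \<noteq> 0" "\<forall>\<^sub>\<approx>z. F.cmp z = K * G.cmp z" by blast
  have "\<forall>\<^sub>\<approx>z. inverse (F.cmp z) = inverse K * inverse (G.cmp z) + 0"
    using K(2) by eventually_elim (simp add: mult.commute)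
  then show ?thesis using K(1) by (metis inverse_nonzero_iff_nonzero)
next
  assume e: "\<forall>\<^sub>\<approx>z. F.H z = G.H z"
  have "\<exists>K. K \<noteq> 0 \<and> (\<forall>\<^sub>\<approx>z. F.U z = K * G.U z)"
  proof (rule equal_log_deriv_proportional)
    show "\<forall>\<^sub>\<approx>z. F.U analytic_on {z} \<and> F.U z \<noteq> 0"
      using F.regular_cosparse by eventually_elim (use F.U_properties in blast)
    show "\<forall>\<^sub>\<approx>z. G.U analytic_on {z} \<and> G.U z \<noteq> 0"
      using G.regular_cosparse by eventually_elim (use G.U_properties in blast)
    show "\<forall>\<^sub>\<approx>z. deriv F.U z / F.U z = deriv G.U z / G.U z"
      using e F.regular_cosparse G.regular_cosparse
      by eventually_elim (simp add: F.U_properties(3) G.U_properties(3))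
  qed
  then obtain K where K: "K \<noteq> 0" "\<forall>\<^sub>\<approx>z. F.U z = K * G.U z" by blast
  define R where "R = (\<lambda>w. inverse (F.cmp w) - K * inverse (G.cmp w))"
  have "\<forall>\<^sub>\<approx>z. R analytic_on {z} \<and> deriv R z = 0"
    using K(2) F.regular_cosparse G.regular_cosparse
  proof eventually_elim
    case (elim z)
    have "(R has_field_derivative - F.U z - K * (- G.U z)) (at z)" unfolding R_def
      by (intro DERIV_diff DERIV_cmult F.inverse_cmp_DERIV G.inverse_cmp_DERIV) (use elim in auto)
    then have "deriv R z = 0" using elim(1) by (simp add: DERIV_imp_deriv)
    moreover have "R analytic_on {z}" unfolding R_def
      using elim by (intro analytic_intros F.cmp_analytic G.cmp_analytic) auto
    ultimately show ?case by blast
  qed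
  from deriv_zero_constant[OF this] obtain B where B: "\<forall>\<^sub>\<approx>z. R z = B" by blast
  have "\<forall>\<^sub>\<approx>z. inverse (F.cmp z) = K * inverse (G.cmp z) + B"
    using B by eventually_elim (simp add: R_def algebra_simps)
  then show ?thesis using K(1) by blast
qed

text \<open>
  At a point where \<open>p f = 1 / B\<close> the function \<open>g\<close> has a pole, of order \<open>q\<close> say, and
  \<open>p f - 1 / B\<close> has order \<open>N * q\<close>. Since \<open>g\<close> has no value in \<open>{a, b}\<close> there, neither has \<open>f\<close>;
  so \<open>f\<close> takes a simple root of \<open>p = 1 / B\<close>, with multiplicity \<open>N * q \<ge> 6\<close>.
\<close>

lemma no_offset:
  assumes A: "A \<noteq> 0" and rel: "\<forall>\<^sub>\<approx>z. inverse (F.cmp z) = A * inverse (G.cmp z) + B"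
  shows "B = 0"
proof (rule ccontr)
  assume B: "B \<noteq> 0"
  define v where "v = 1 / B"
  obtain X where X: "card X = 3" "X \<subseteq> {x. poly p x = v}" using F.three_roots by blast
  have cleared: "\<forall>\<^sub>\<approx>z. G.cmp z * (1 - B * F.cmp z) = A * F.cmp z"
    using rel F.cmp_ne_cosparse G.cmp_ne_cosparse by eventually_elim (simp add: field_simps)
  show False
  proof (rule F.totally_ramified_values[OF X(1)])
    fix z assume z: "f2 z \<noteq> 0" "f z \<in> X"
    then have pv: "poly p (f z) = v" using X(2) by auto
    have cz: "F.cmp z = v" "v \<noteq> 0" "1 - B * v = 0" using pv B by (auto simp: F.cmp_def v_def)
    have g2: "g2 z = 0"
    proof (rule ccontr)
      assume g: "g2 z \<noteq> 0"
      have "G.cmp z * (1 - B * F.cmp z) = A * F.cmp z"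
      proof (rule analytic_eq_at[where F = "\<lambda>z. G.cmp z * (1 - B * F.cmp z)" and G = "\<lambda>z. A * F.cmp z"])
        show "(\<lambda>z. G.cmp z * (1 - B * F.cmp z)) analytic_on {z}" "(\<lambda>z. A * F.cmp z) analytic_on {z}"
          by (intro analytic_intros F.cmp_analytic G.cmp_analytic z g)+
        show "\<forall>\<^sub>F w in at z. G.cmp w * (1 - B * F.cmp w) = A * F.cmp w" by (rule cosparse_at[OF cleared])
      qed
      then show False using cz A by simp
    qed
    obtain q where q: "q > 0" "\<And>x. has_ord (\<lambda>w. g w - x) z (- int q)" using G.pole_order[OF g2] by blast
    note gq = G.cmp_order_pole[OF q(2)]
    have fq: "has_ord F.cmp z 0" using cz z by (intro F.order_of_cmp_nonzero) auto
    have "has_ord (\<lambda>w. (- A / B) * (F.cmp w / G.cmp w)) z (0 + (0 - - (int (n + m + 1) * int q)))"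
      using A B by (intro has_ord_mult has_ord_divide has_ord_const fq gq) auto
    then have o: "has_ord (\<lambda>w. poly (p - [:v:]) (f w)) z (0 + (0 - - (int (n + m + 1) * int q)))"
    proof (rule has_ord_cong)
      show "\<forall>\<^sub>F w in at z. - A / B * (F.cmp w / G.cmp w) = poly (p - [:v:]) (f w)"
        using cosparse_at[OF cleared, of z] has_ord_nonzero[OF gq]
      proof eventually_elim
        case (elim w)
        have "A * F.cmp w / G.cmp w = 1 - B * F.cmp w"
          using elim by (simp add: field_simps)
        then have "- (1 / B) * (A * F.cmp w / G.cmp w) = F.cmp w - v"
          using B by (simp add: v_def field_simps)
        then show ?case by (simp add: F.cmp_def)
      qed
    qed
    obtain j where j: "j > 0" "has_ord (\<lambda>w. f w - f z) z (int j)" using F.value_order[OF z(1) refl] by blast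
    have "f z \<noteq> a" "f z \<noteq> b" using crit[of z] g2 z by auto
    then have "order (f z) (p - [:v:]) = 1" using F.order_shift[OF pv] by simp
    then have "has_ord (\<lambda>w. poly (p - [:v:]) (f w)) z (int j)"
      using F.poly_comp_zero[OF F.shift(2) z(1) j(2)] by (metis mult_1 of_nat_1)
    from has_ord_unique[OF this o] have "int j = int (n + m + 1) * int q" by simp
    then have "j = (n + m + 1) * q" by (metis of_nat_eq_iff of_nat_mult)
    moreover have "(n + m + 1) * 1 \<le> (n + m + 1) * q" using q(1) by (intro mult_left_mono) auto
    ultimately have "n + m + 1 \<le> j" by simp
    then have "4 \<le> j" using F.nm by linarith
    then show "\<exists>j\<ge>4. has_ord (\<lambda>w. f w - f z) z (int j)" using j(2) by blast
  qed
qed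

lemma related_some: "\<exists>K. F.related K f g"
proof -
  obtain A B where A: "A \<noteq> 0" "\<forall>\<^sub>\<approx>z. inverse (F.cmp z) = A * inverse (G.cmp z) + B"
    using reciprocals_affinely_related by blast
  have B: "B = 0" by (rule no_offset[OF A])
  have "\<forall>\<^sub>\<approx>z. poly p (f z) = inverse A * poly p (g z)"
    using A(2)
  proof eventually_elim
    case (elim z)
    then have "inverse (inverse (F.cmp z)) = inverse (A * inverse (G.cmp z))" using B by simp
    then show ?case by (simp add: F.cmp_def G.cmp_def mult.commute)
  qed
  then show ?thesis using A(1) unfolding F.related_def by (intro exI[of _ "inverse A"]) simp
qed

text \<open>
  If \<open>K \<noteq> 1\<close>, a value \<open>a\<close> of \<open>g\<close> is accompanied by the value \<open>b\<close> of \<open>f\<close>, whence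
  \<open>p b = K * p a\<close>, and vice versa. Both equations together give \<open>K = -1\<close> and \<open>p a + p b = 0\<close>,
  so \<open>g\<close> omits \<open>a\<close> or \<open>b\<close>.
\<close>

lemma related_factor_one:
  assumes rel: "F.related K f g" and opp: "poly p a + poly p b \<noteq> 0"
  shows "K = 1"
proof (rule ccontr)
  assume K1: "K \<noteq> 1"
  have K0: "K \<noteq> 0" using rel by (simp add: F.related_def)
  have Ka: "K * poly p a \<noteq> poly p a" and Kb: "K * poly p b \<noteq> poly p b" using K1 F.pa F.pb by auto
  interpret S: two_crit p b a m n by (rule F.two_crit_swap)
  have val: "f2 z \<noteq> 0 \<and> (f z = a \<or> f z = b) \<and> poly p (f z) = K * poly p (g z)"
    if "g2 z \<noteq> 0" "g z = a \<or> g z = b" for z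
  proof -
    have "f2 z \<noteq> 0 \<and> (f z = a \<or> f z = b)" using crit that by blast
    then show ?thesis using F.related_value(2)[OF quotients rel] by blast
  qed
  show False
  proof (cases "K * poly p a = poly p b")
    case False
    show False
    proof (rule F.no_relation_omitting[OF quotients rel _ Ka False])
      fix z assume "g2 z \<noteq> 0"
      then show "g z \<noteq> a" using val[of z] Ka False by auto
    qed
  next
    case True
    have Kb': "K * poly p b \<noteq> poly p a"
    proof
      assume "K * poly p b = poly p a"
      then have "K * (K * poly p a) = poly p a" unfolding True .
      then have "(K - 1) * (K + 1) * poly p a = 0" by (simp add: algebra_simps)
      then have "K = - 1" using K1 F.pa by (simp add: eq_neg_iff_add_eq_0)
      then show False using True opp by (simp add: add_eq_0_iff)
    qed
    show False
    proof (rule S.no_relation_omitting[OF quotients rel _ Kb Kb'])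
      fix z assume "g2 z \<noteq> 0"
      then show "g z \<noteq> b" using val[of z] Kb Kb' by auto
    qed
  qed
qed

text \<open>
  Since \<open>p a \<noteq> p b\<close>, the relation \<open>p f = p g\<close> refines the sharing of \<open>{a, b}\<close> to the sharing
  of both values.
\<close>

lemma equal:
  assumes opp: "poly p a + poly p b \<noteq> 0"
  shows "f = g"
proof -
  obtain K where K: "F.related K f g" using related_some by blast
  have rel: "F.related 1 f g" using K related_factor_one[OF K opp] by simp
  have "f z = a \<longleftrightarrow> g z = a" "f z = b \<longleftrightarrow> g z = b" if "f2 z \<noteq> 0" "g2 z \<noteq> 0" for z
  proof -
    have "poly p (f z) = poly p (g z)" using F.related_value(2)[OF quotients rel that(1)] by simp
    then show "f z = a \<longleftrightarrow> g z = a" "f z = b \<longleftrightarrow> g z = b"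
      using crit[of z] that F.crit_values_ne by auto
  qed
  from F.equal_relation[OF quotients rel this] have e: "\<forall>\<^sub>\<approx>z. f z = g z" .
  show ?thesis
  proof
    fix z
    show "f z = g z"
    proof (cases "f2 z = 0")
      case True
      then show ?thesis using F.related_pole[OF quotients rel True] by (simp add: F.feq G.feq)
    next
      case False
      show ?thesis
        by (rule analytic_eq_at[OF F.analytic[OF False] G.analytic[OF F.related_value(1)[OF quotients rel False]] cosparse_at[OF e]])
    qed
  qed
qed

end

section \<open>The polynomial of the theorem\<close>

definition Q_polynomial :: "nat \<Rightarrow> nat \<Rightarrow> complex \<Rightarrow> complex \<Rightarrow> complex poly" where
  "Q_polynomial m n a b =
     (\<Sum>i=0..m. \<Sum>j=0..n. monom (of_nat (m choose i) * of_nat (n choose j) *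
        ((-1) ^ (i + j) / of_nat (n + m + 1 - i - j)) * a ^ j * b ^ i) (n + m + 1 - i - j))"

lemma poly_Q_polynomial: "poly (Q_polynomial m n a b) z = Q_poly m n a b z"
  by (simp add: Q_polynomial_def Q_poly_def poly_sum poly_monom mult_ac)

text \<open>
  Differentiation cancels the denominators, and the double sum factors into two binomial
  expansions.
\<close>

lemma pderiv_Q_polynomial: "pderiv (Q_polynomial m n a b) = [:-a, 1:] ^ n * [:-b, 1:] ^ m"
proof (rule poly_eq_poly_eq_iff[THEN iffD1], rule ext)
  fix z
  have pd: "pderiv (sum F S) = (\<Sum>i\<in>S. pderiv (F i))" for F :: "nat \<Rightarrow> complex poly" and S
    by (induction S rule: infinite_finite_induct) (auto simp: pderiv_add)
  have "poly (pderiv (Q_polynomial m n a b)) z = (\<Sum>i=0..m. \<Sum>j=0..n.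
      (of_nat (m choose i) * (- b) ^ i * z ^ (m - i)) * (of_nat (n choose j) * (- a) ^ j * z ^ (n - j)))"
    unfolding Q_polynomial_def pd pderiv_monom poly_sum poly_monom
  proof (intro sum.cong refl)
    fix i j assume ij: "i \<in> {0..m}" "j \<in> {0..n}"
    define k where "k = n + m + 1 - i - j"
    have k: "complex_of_nat k \<noteq> 0" "z ^ (k - 1) = z ^ (m - i) * z ^ (n - j)"
    proof -
      have "0 < k" and e: "k - 1 = (m - i) + (n - j)" using ij by (auto simp: k_def)
      then show "complex_of_nat k \<noteq> 0" by simp
      show "z ^ (k - 1) = z ^ (m - i) * z ^ (n - j)" unfolding e by (rule power_add)
    qed
    have "of_nat k * (x * y * (s / of_nat k) * u * w) = x * y * s * u * w" for x y s u w :: complex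
      using k(1) by simp
    then show "of_nat (n + m + 1 - i - j) * (of_nat (m choose i) * of_nat (n choose j) *
        ((-1) ^ (i + j) / of_nat (n + m + 1 - i - j)) * a ^ j * b ^ i) * z ^ (n + m + 1 - i - j - 1) =
        of_nat (m choose i) * (- b) ^ i * z ^ (m - i) * (of_nat (n choose j) * (- a) ^ j * z ^ (n - j))"
      unfolding k_def[symmetric] k(2) by (simp add: power_add power_minus[of a j] power_minus[of b i] mult_ac)
  qed
  also have "\<dots> = (- b + z) ^ m * (- a + z) ^ n"
    unfolding binomial_ring sum_product atLeast0AtMost ..
  finally show "poly (pderiv (Q_polynomial m n a b)) z = poly ([:- a, 1:] ^ n * [:- b, 1:] ^ m) z"
    by (simp add: mult.commute)
qed

lemma E_set_iff: "(z, k) \<in> E_set f S \<longleftrightarrow> \<not> is_pole f z \<and> f z \<in> S \<and> k = zorder (\<lambda>w. f w - f z) z"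
  by (auto simp: E_set_def zeros_minus_def)

lemma E_bar_iff: "z \<in> E_bar f S \<longleftrightarrow> \<not> is_pole f z \<and> f z \<in> S"
proof -
  have "z \<in> E_bar f S \<longleftrightarrow> (\<exists>k. (z, k) \<in> E_set f S)" by (force simp: E_bar_def)
  then show ?thesis by (simp add: E_set_iff)
qed

theorem theorem2p4:
  fixes m n :: nat and a b c :: complex and P :: "complex \<Rightarrow> complex"
    and S1 S2 :: "complex set" and f g :: "complex \<Rightarrow> complex"
  assumes mn: "(n \<ge> 3 \<and> m \<ge> 2) \<or> (n \<ge> 2 \<and> m \<ge> 3)"
    and b: "b \<noteq> 0" and ab: "a \<noteq> b"
    and P: "P = (\<lambda>z. Q_poly m n a b z + c)"
    and c: "c \<notin> {0, - Q_poly m n a b a, - Q_poly m n a b b,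
                   - ((Q_poly m n a b a + Q_poly m n a b b) / 2)}"
    and S1: "S1 = {a, b}"
    and S2: "S2 = {z. P z = 0}"
    and f: "f nicely_meromorphic_on UNIV" "\<not> f constant_on UNIV"
    and g: "g nicely_meromorphic_on UNIV" "\<not> g constant_on UNIV"
    and share1: "share_IM f g S1"
    and share2: "share_CM f g S2"
  shows "f = g"
proof -
  define p where "p = Q_polynomial m n a b + [:c:]"
  have poly_p: "poly p z = P z" for z by (simp add: p_def poly_Q_polynomial P)
  obtain f1 f2 where F: "quot_rep f f1 f2" using exists_quot_rep[OF f] by blast
  obtain g1 g2 where G: "quot_rep g g1 g2" using exists_quot_rep[OF g] by blast
  interpret F: quotient f f1 f2 by unfold_locales (fact F)
  interpret G: quotient g g1 g2 by unfold_locales (fact G)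
  interpret two_crit p a b n m
  proof
    show "pderiv p = [:-a, 1:] ^ n * [:-b, 1:] ^ m"
      by (simp add: p_def pderiv_add pderiv_Q_polynomial pderiv_pCons)
  qed (use mn ab in auto)
  have pab: "poly p a \<noteq> 0" "poly p b \<noteq> 0"
    using c by (auto simp: poly_p P eq_neg_iff_add_eq_0 add.commute)
  have sum: "poly p a + poly p b \<noteq> 0"
  proof
    assume "poly p a + poly p b = 0"
    then have "c = - ((Q_poly m n a b a + Q_poly m n a b b) / 2)"
      by (simp add: poly_p P field_simps add_eq_0_iff)
    then show False using c by simp
  qed
  have crit: "f2 z \<noteq> 0 \<and> (f z = a \<or> f z = b) \<longleftrightarrow> g2 z \<noteq> 0 \<and> (g z = a \<or> g z = b)" for z
    using E_bar_iff[of z f S1] E_bar_iff[of z g S1] share1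
    by (simp add: share_IM_def S1 F.pole_iff G.pole_iff)
  have CM: "f2 z \<noteq> 0 \<and> poly p (f z) = 0 \<and> k = zorder (\<lambda>w. f w - f z) z \<longleftrightarrow>
      g2 z \<noteq> 0 \<and> poly p (g z) = 0 \<and> k = zorder (\<lambda>w. g w - g z) z" for z k
    using E_set_iff[of z k f S2] E_set_iff[of z k g S2] share2
    by (simp add: share_CM_def S2 F.pole_iff G.pole_iff poly_p)
  interpret shared_sets p a b n m f f1 f2 g g1 g2
  proof
    show "5 \<le> n + m" using mn by auto
    show "f2 z \<noteq> 0 \<and> poly p (f z) = 0 \<longleftrightarrow> g2 z \<noteq> 0 \<and> poly p (g z) = 0" for z using CM[of z] by blast
    show "has_ord (\<lambda>w. g w - g z) z k" if "f2 z \<noteq> 0" "poly p (f z) = 0" "has_ord (\<lambda>w. f w - f z) z k" for z k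
    proof -
      have z: "g2 z \<noteq> 0" "k = zorder (\<lambda>w. g w - g z) z"
        using CM[of z k] that(1,2) has_ord_zorder[OF that(3)] by auto
      obtain j where j: "has_ord (\<lambda>w. g w - g z) z (int j)" using G.value_order[OF z(1) refl] by blast
      then show ?thesis using has_ord_zorder[OF j] z(2) by simp
    qed
  qed (fact pab crit)+
  show ?thesis by (rule equal[OF sum])
qed

end
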